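(* For every $N\ge 3$, the group $\mathrm{SO}_{2N}(\mathbb C)$ is generically $\mathit{WD}_F$-unacceptable: there exist generic morphisms $\varphi_1,\varphi_2:\mathit{WD}_F\to\mathrm{SO}_{2N}(\mathbb C)$ which are locally conjugate but not conjugate by any element of $\mathrm{SO}_{2N}(\mathbb C)$.
   Context: $F$ is a non-archimedean local field of characteristic $0$ and odd residual characteristic, with Weil group $W_F$ and Weil--Deligne group $\mathit{WD}_F$ $(=W_F\times\mathrm{SL}_2(\mathbb C))$. Morphisms $\varphi:\mathit{WD}_F\to\mathrm{SO}_{2N}(\mathbb C)$ are Langlands parameters for the split group $\mathrm{SO}_{2N}(F)$. Such a morphism is generic if its adjoint $L$-function $L(s,\varphi,\mathrm{Ad})$ is holomorphic at $s=1$. Two morphisms $\varphi,\varphi'$ are locally conjugate if $\varrho\circ\varphi\cong\varrho\circ\varphi'$ for all algebraic representations $\varrho$ of $\mathrm{SO}_{2N}(\mathbb C)$; equivalently, $\varphi(w)$ and $\varphi'(w)$ are conjugate in $\mathrm{SO}_{2N}(\mathbb C)$ for each $w\in\mathit{WD}_F$. They are conjugate if $\varphi'=\mathrm{Ad}(g)\circ\varphi$ for some $g\in\mathrm{SO}_{2N}(\mathbb C)$. A group is generically $\mathit{WD}_F$-acceptable if any two locally conjugate generic morphisms from $\mathit{WD}_F$ to it are conjugate, and generically $\mathit{WD}_F$-unacceptable otherwise. *)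

theory Defs
  imports
    "HOL-Analysis.Analysis"
    "HOL-Algebra.Algebraic_Closure_Type"
    "Jordan_Normal_Form.VS_Connect"
    "Jordan_Normal_Form.Jordan_Normal_Form"
begin

section \<open>Non-archimedean local fields\<close>

text \<open>The field is the type \<^typ>\<open>'a\<close>, given with an absolute value that induces its topology.\<close>

definition valuation_ring :: "('a::field \<Rightarrow> real) \<Rightarrow> 'a set" where
  "valuation_ring v = {x. v x \<le> 1}"

definition residue_classes :: "('a::field \<Rightarrow> real) \<Rightarrow> 'a set set" where
  "residue_classes v =
     valuation_ring v // {(x, y). x \<in> valuation_ring v \<and> y \<in> valuation_ring v \<and> v (x - y) < 1}"

locale nonarch_local_field =
  fixes v :: "'a::field \<Rightarrow> real"
  assumes nonneg: "0 \<le> v x"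
    and eq_0_iff: "v x = 0 \<longleftrightarrow> x = 0"
    and mult: "v (x * y) = v x * v y"
    and ultrametric: "v (x + y) \<le> max (v x) (v y)"
    and discrete: "\<exists>\<pi>. 0 < v \<pi> \<and> v \<pi> < 1 \<and> (\<forall>x. x \<noteq> 0 \<longrightarrow> (\<exists>k::int. v x = v \<pi> powi k))"
    and complete: "(\<forall>e>0. \<exists>M. \<forall>m\<ge>M. \<forall>n\<ge>M. v (s m - s n) < e) \<Longrightarrow>
                     \<exists>l. (\<lambda>n. v (s n - l)) \<longlonglongrightarrow> 0"
    and finite_residue_field: "finite (residue_classes v)"

definition residue_card :: "('a::field \<Rightarrow> real) \<Rightarrow> nat" where
  "residue_card v = card (residue_classes v)"

text \<open>The characteristic of the residue field, i.e. the additive order of 1 in it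
  (positive, as the residue field is finite).\<close>

definition residue_char :: "('a::field \<Rightarrow> real) \<Rightarrow> nat" where
  "residue_char v = (LEAST p. 0 < p \<and> v (of_nat p) < 1)"


section \<open>The Weil group\<close>

text \<open>The field of the Galois group is the algebraic closure, which is a separable closure because
  the characteristic will be 0.\<close>

definition galois_auts :: "('a::field alg_closure \<Rightarrow> 'a alg_closure) set" where
  "galois_auts = {\<sigma>. bij \<sigma> \<and> (\<forall>x y. \<sigma> (x + y) = \<sigma> x + \<sigma> y) \<and> (\<forall>x y. \<sigma> (x * y) = \<sigma> x * \<sigma> y)
                      \<and> (\<forall>a. \<sigma> (to_ac a) = to_ac a)}"

definition integers_ac :: "('a::field \<Rightarrow> real) \<Rightarrow> 'a alg_closure set" where
  "integers_ac v = {x. \<exists>p :: 'a alg_closure poly. Polynomial.lead_coeff p = 1 \<and>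
     (\<forall>i. Polynomial.coeff p i \<in> to_ac ` valuation_ring v) \<and> poly p x = 0}"

text \<open>The maximal ideal of the local ring \<^term>\<open>integers_ac v\<close>: its non-units.\<close>

definition max_ideal_ac :: "('a::field \<Rightarrow> real) \<Rightarrow> 'a alg_closure set" where
  "max_ideal_ac v = {x \<in> integers_ac v. x = 0 \<or> inverse x \<notin> integers_ac v}"

text \<open>\<open>\<sigma>\<close> acts on the residue field of the algebraic closure as the \<open>k\<close>-th power of
  the arithmetic Frobenius \<open>x \<mapsto> x ^ q\<close>.\<close>

definition acts_as_frobenius_power ::
  "('a::field \<Rightarrow> real) \<Rightarrow> ('a alg_closure \<Rightarrow> 'a alg_closure) \<Rightarrow> int \<Rightarrow> bool" where
  "acts_as_frobenius_power v \<sigma> k \<longleftrightarrow> (\<forall>x\<in>integers_ac v.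
     if 0 \<le> k then \<sigma> x - x ^ (residue_card v ^ nat k) \<in> max_ideal_ac v
     else \<sigma> x ^ (residue_card v ^ nat (- k)) - x \<in> max_ideal_ac v)"

definition weil_group :: "('a::field \<Rightarrow> real) \<Rightarrow> ('a alg_closure \<Rightarrow> 'a alg_closure) monoid" where
  "weil_group v = \<lparr> carrier = {\<sigma> \<in> galois_auts. \<exists>k. acts_as_frobenius_power v \<sigma> k},
                    mult = (\<circ>), one = id \<rparr>"

definition inertia_group :: "('a::field \<Rightarrow> real) \<Rightarrow> ('a alg_closure \<Rightarrow> 'a alg_closure) set" where
  "inertia_group v = {\<sigma> \<in> galois_auts. acts_as_frobenius_power v \<sigma> 0}"

text \<open>Inertia is open and carries its profinite topology: a basis of open sets is given by the left
  cosets of the pointwise stabilisers in inertia of finite subsets of the algebraic closure.\<close>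

definition weil_topology ::
  "('a::field \<Rightarrow> real) \<Rightarrow> ('a alg_closure \<Rightarrow> 'a alg_closure) topology" where
  "weil_topology v = topology_generated_by
     {(\<lambda>\<tau>. \<sigma> \<circ> \<tau>) ` {\<tau> \<in> inertia_group v. \<forall>x\<in>S. \<tau> x = x} | \<sigma> S.
        \<sigma> \<in> carrier (weil_group v) \<and> finite S}"


section \<open>Complex linear algebraic groups\<close>

definition GL :: "nat \<Rightarrow> complex mat monoid" where
  "GL n = \<lparr> carrier = {A \<in> carrier_mat n n. invertible_mat A}, mult = (*), one = 1\<^sub>m n \<rparr>"

definition SL :: "nat \<Rightarrow> complex mat monoid" where
  "SL n = \<lparr> carrier = {A \<in> carrier_mat n n. det A = 1}, mult = (*), one = 1\<^sub>m n \<rparr>"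

definition SO :: "nat \<Rightarrow> complex mat monoid" where
  "SO n = \<lparr> carrier = {A \<in> carrier_mat n n. transpose_mat A * A = 1\<^sub>m n \<and> det A = 1},
            mult = (*), one = 1\<^sub>m n \<rparr>"

inductive_set poly_funs :: "nat \<Rightarrow> (complex mat \<Rightarrow> complex) set" for n where
  const: "(\<lambda>A. c) \<in> poly_funs n"
| entry: "i < n \<Longrightarrow> j < n \<Longrightarrow> (\<lambda>A. A $$ (i, j)) \<in> poly_funs n"
| add: "f \<in> poly_funs n \<Longrightarrow> g \<in> poly_funs n \<Longrightarrow> (\<lambda>A. f A + g A) \<in> poly_funs n"
| mult: "f \<in> poly_funs n \<Longrightarrow> g \<in> poly_funs n \<Longrightarrow> (\<lambda>A. f A * g A) \<in> poly_funs n"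

text \<open>Morphisms of varieties from a Zariski-closed set \<open>S\<close> of \<open>n \<times> n\<close> matrices (such as
  \<open>SL\<close> and \<open>SO\<close>) to \<open>m \<times> m\<close> matrices.\<close>

definition regular_map :: "nat \<Rightarrow> complex mat set \<Rightarrow> nat \<Rightarrow> (complex mat \<Rightarrow> complex mat) \<Rightarrow> bool" where
  "regular_map n S m f \<longleftrightarrow>
     (\<forall>i<m. \<forall>j<m. \<exists>p\<in>poly_funs n. \<forall>A\<in>S. f A $$ (i, j) = p A)"

definition algebraic_rep_SO :: "nat \<Rightarrow> nat \<Rightarrow> (complex mat \<Rightarrow> complex mat) \<Rightarrow> bool" where
  "algebraic_rep_SO n m \<rho> \<longleftrightarrow> \<rho> \<in> hom (SO n) (GL m) \<and> regular_map n (carrier (SO n)) m \<rho>"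

definition semisimple_mat :: "complex mat \<Rightarrow> bool" where
  "semisimple_mat A \<longleftrightarrow> (\<exists>D. diagonal_mat D \<and> similar_mat A D)"


section \<open>Morphisms from the Weil--Deligne group\<close>

type_synonym 'a wd = "('a alg_closure \<Rightarrow> 'a alg_closure) \<times> complex mat"

definition weil_deligne_group :: "('a::field \<Rightarrow> real) \<Rightarrow> 'a wd monoid" where
  "weil_deligne_group v = weil_group v \<times>\<times> SL 2"

text \<open>Langlands parameters into \<open>SO n\<close>: continuous homomorphisms that are algebraic on
  \<open>SL 2\<close> and send the Weil group to semisimple elements. As the restriction to \<open>SL 2\<close> is
  algebraic, joint continuity amounts to continuity on the Weil group.\<close>

definition wd_morphism :: "('a::field \<Rightarrow> real) \<Rightarrow> nat \<Rightarrow> ('a wd \<Rightarrow> complex mat) \<Rightarrow> bool" where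
  "wd_morphism v n \<phi> \<longleftrightarrow>
     \<phi> \<in> hom (weil_deligne_group v) (SO n) \<and>
     (\<forall>i<n. \<forall>j<n. continuous_map (weil_topology v) euclidean (\<lambda>\<sigma>. \<phi> (\<sigma>, 1\<^sub>m 2) $$ (i, j))) \<and>
     regular_map 2 (carrier (SL 2)) n (\<lambda>g. \<phi> (id, g)) \<and>
     (\<forall>\<sigma>\<in>carrier (weil_group v). semisimple_mat (\<phi> (\<sigma>, 1\<^sub>m 2)))"

definition locally_conjugate ::
  "('a::field \<Rightarrow> real) \<Rightarrow> nat \<Rightarrow> ('a wd \<Rightarrow> complex mat) \<Rightarrow> ('a wd \<Rightarrow> complex mat) \<Rightarrow> bool" where
  "locally_conjugate v n \<phi> \<phi>' \<longleftrightarrow> (\<forall>m \<rho>. algebraic_rep_SO n m \<rho> \<longrightarrow>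
     (\<exists>P\<in>carrier (GL m). \<forall>w\<in>carrier (weil_deligne_group v). P * \<rho> (\<phi> w) = \<rho> (\<phi>' w) * P))"

definition conjugate_morphisms ::
  "('a::field \<Rightarrow> real) \<Rightarrow> nat \<Rightarrow> ('a wd \<Rightarrow> complex mat) \<Rightarrow> ('a wd \<Rightarrow> complex mat) \<Rightarrow> bool" where
  "conjugate_morphisms v n \<phi> \<phi>' \<longleftrightarrow>
     (\<exists>g\<in>carrier (SO n). \<forall>w\<in>carrier (weil_deligne_group v). \<phi>' w = g * \<phi> w * inv\<^bsub>SO n\<^esub> g)"


section \<open>The adjoint L-function\<close>

text \<open>The determinant of a linear endomorphism \<open>T\<close> of a finite-dimensional complex vector space
  \<open>V\<close>, computed in an arbitrary (ordered) basis.\<close>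

definition coordinate :: "(complex, 'v) module \<Rightarrow> 'v set \<Rightarrow> 'v \<Rightarrow> 'v \<Rightarrow> complex" where
  "coordinate V B x = (SOME a. module.lincomb V a B = x)"

definition det_on :: "(complex, 'v) module \<Rightarrow> ('v \<Rightarrow> 'v) \<Rightarrow> complex" where
  "det_on V T = (let bs = (SOME bs. distinct bs \<and> vectorspace.basis class_ring V (set bs))
     in det (mat (length bs) (length bs) (\<lambda>(i, j). coordinate V (set bs) (T (bs ! j)) (bs ! i))))"

definition so_lie :: "nat \<Rightarrow> (complex, complex mat) module" where
  "so_lie n = (module_mat TYPE(complex) n n)
     \<lparr> carrier := {Y \<in> carrier_mat n n. transpose_mat Y = - Y} \<rparr>"

definition Ad_SO :: "nat \<Rightarrow> complex mat \<Rightarrow> complex mat \<Rightarrow> complex mat" where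
  "Ad_SO n g Y = g * Y * inv\<^bsub>SO n\<^esub> g"

definition upper_unipotent :: "complex \<Rightarrow> complex mat" where
  "upper_unipotent t = mat_of_rows_list 2 [[1, t], [0, 1]]"

text \<open>For a representation \<open>r\<close> of the Weil--Deligne group, with nilpotent operator \<open>N\<close>
  the image of \<open>[[0, 1], [0, 0]]\<close> under the derivative of \<open>r\<close> on \<open>SL 2\<close>, the L-function is
  \<open>L(s, r) = det (1 - q powr (-s) * r (\<Phi>, diag (q powr (-1/2), q powr (1/2))))\<close> to the power \<open>-1\<close>,
  on the inertia invariants of \<open>ker N\<close>; here \<open>\<Phi>\<close> is a geometric Frobenius and \<open>ker N\<close> consists
  of the vectors fixed by the upper unipotent matrices. For \<open>\<rho>\<close> tensor the
  \<open>k\<close>-th symmetric power of the standard representation of \<open>SL 2\<close>, this is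
  \<open>L(s + k/2, \<rho>)\<close>.\<close>

definition adjoint_invariants ::
  "('a::field \<Rightarrow> real) \<Rightarrow> nat \<Rightarrow> ('a wd \<Rightarrow> complex mat) \<Rightarrow> (complex, complex mat) module" where
  "adjoint_invariants v n \<phi> = (so_lie n) \<lparr> carrier := {Y \<in> carrier (so_lie n).
     (\<forall>\<sigma>\<in>inertia_group v. Ad_SO n (\<phi> (\<sigma>, 1\<^sub>m 2)) Y = Y) \<and>
     (\<forall>t. Ad_SO n (\<phi> (id, upper_unipotent t)) Y = Y)} \<rparr>"

definition geometric_frobenius :: "('a::field \<Rightarrow> real) \<Rightarrow> 'a alg_closure \<Rightarrow> 'a alg_closure" where
  "geometric_frobenius v = (SOME \<sigma>. \<sigma> \<in> galois_auts \<and> acts_as_frobenius_power v \<sigma> (-1))"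

definition frobenius_wd :: "('a::field \<Rightarrow> real) \<Rightarrow> 'a wd" where
  "frobenius_wd v = (geometric_frobenius v,
     mat_of_rows_list 2 [[complex_of_real (1 / sqrt (residue_card v)), 0],
                         [0, complex_of_real (sqrt (residue_card v))]])"

definition L_adjoint ::
  "('a::field \<Rightarrow> real) \<Rightarrow> nat \<Rightarrow> ('a wd \<Rightarrow> complex mat) \<Rightarrow> complex \<Rightarrow> complex" where
  "L_adjoint v n \<phi> s = inverse (det_on (adjoint_invariants v n \<phi>)
     (\<lambda>Y. Y - (of_nat (residue_card v) powr (- s)) \<cdot>\<^sub>m Ad_SO n (\<phi> (frobenius_wd v)) Y))"

text \<open>At a zero of the determinant \<^const>\<open>L_adjoint\<close> has the junk value \<open>inverse 0 = 0\<close> but is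
  unbounded nearby, so that being analytic at 1 does express the absence of a pole.\<close>

definition generic_morphism :: "('a::field \<Rightarrow> real) \<Rightarrow> nat \<Rightarrow> ('a wd \<Rightarrow> complex mat) \<Rightarrow> bool" where
  "generic_morphism v n \<phi> \<longleftrightarrow> wd_morphism v n \<phi> \<and> L_adjoint v n \<phi> analytic_on {1}"


section \<open>Acceptability\<close>

definition generically_WD_acceptable :: "('a::field \<Rightarrow> real) \<Rightarrow> nat \<Rightarrow> bool" where
  "generically_WD_acceptable v n \<longleftrightarrow> (\<forall>\<phi> \<phi>'. generic_morphism v n \<phi> \<and> generic_morphism v n \<phi>' \<and>
     locally_conjugate v n \<phi> \<phi>' \<longrightarrow> conjugate_morphisms v n \<phi> \<phi>')"

abbreviation generically_WD_unacceptable :: "('a::field \<Rightarrow> real) \<Rightarrow> nat \<Rightarrow> bool" where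
  "generically_WD_unacceptable v n \<equiv> \<not> generically_WD_acceptable v n"

end

theory Submission
  imports Defs "Jordan_Normal_Form.Schur_Decomposition"
    "HOL-Algebra.Sylow" "HOL-Number_Theory.Residues"
begin

text \<open>Split the \<open>2 N\<close>-dimensional space into \<open>N\<close> planes. Let \<open>\<phi>\<^sub>1\<close> act on two of them through the
  same irreducible dihedral representation, induced from a tame character of the unramified quadratic
  extension, and on the others through rotations by an unramified
  character of order 4; let \<open>\<phi>\<^sub>2\<close> be the conjugate of \<open>\<phi>\<^sub>1\<close> by the reflection \<open>c\<close> in a line of the third
  plane. Each single value of \<open>\<phi>\<^sub>1\<close> commutes either with \<open>c\<close> (Frobenius exponent even) or with a
  reflection of the first plane (exponent odd), so \<open>\<phi>\<^sub>1\<close> and \<open>\<phi>\<^sub>2\<close> are elementwise conjugate, and since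
  their image is finite, characters show that they are locally conjugate. Were they conjugate, an
  orthogonal matrix of determinant \<open>-1\<close> would commute with the image of \<open>\<phi>\<^sub>1\<close>; but the algebra spanned
  by the image contains an orthogonal complex structure, whose centralizer in the orthogonal group is
  a general linear group and lies in \<open>SO\<close>. Frobenius has finite order in the adjoint representation,
  so its eigenvalues have absolute value 1 and the adjoint L-function has no pole at 1.

  The required elements of the Weil group come from an extension theorem for automorphisms (by Zorn's
  lemma) applied to a primitive root of unity \<open>\<zeta>\<close> of order \<open>q ^ 4 - 1\<close> and a root \<open>y\<close> of order
  \<open>q + 1\<close> of a uniformizer: Frobenius is read off from its action on \<open>\<zeta>\<close>, the tame character
  from \<open>\<sigma> y / y\<close>.\<close>


section \<open>Finite groups: equality of characters implies equivalence\<close>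

text \<open>The constants come from the two cases. For an even exponent the unramified rotation must
  be 1 or -1 to commute with \<open>c\<close>, so its order divides 4; with order 2 the whole image
  would commute with \<open>c\<close>. The dihedral representation has determinant
  \<open>(-1) ^ k\<close> and is taken twice to cancel this sign. Frobenius raises roots of unity of
  order prime to \<open>q\<close> to the power \<open>q\<close>, which is -1 modulo
  \<open>q + 1\<close>: so it inverts a tame character of order \<open>q + 1\<close>, and
  \<open>q + 1 > 2\<close> leaves a value whose square is not 1. A root of order
  \<open>q ^ 4 - 1\<close> determines the exponent exactly modulo 4 and has a root of order
  \<open>q + 1\<close> among its powers. The obstacle is the Weil group itself, which is given by
  congruences modulo the non-units of the integral closure of the valuation ring. These can be
  calculated with only once the non-units form an ideal, that is, once the integral closure is known
  to be local, and this rests on completeness. Each unit is then congruent to a root of unity of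
  order prime to \<open>q\<close>, so that automorphisms are recognized and built by their action on
  such roots.\<close>

definition mat_trace :: "'a::comm_ring_1 mat \<Rightarrow> 'a" where
  "mat_trace A = (\<Sum>i<dim_row A. A $$ (i, i))"

definition mat_sum :: "nat \<Rightarrow> nat \<Rightarrow> ('g \<Rightarrow> 'a::comm_ring_1 mat) \<Rightarrow> 'g set \<Rightarrow> 'a mat" where
  "mat_sum n m f S = Matrix.mat n m (\<lambda>(i, j). \<Sum>g\<in>S. f g $$ (i, j))"

lemma mult_index_mat:
  assumes "A \<in> carrier_mat n k" "B \<in> carrier_mat k m" "i < n" "j < m"
  shows "(A * B) $$ (i, j) = (\<Sum>l<k. A $$ (i, l) * B $$ (l, j))"
  using assms by (auto simp: scalar_prod_def lessThan_atLeast0)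

lemma mat_trace_comm:
  assumes A: "A \<in> carrier_mat n m" and B: "B \<in> carrier_mat m n"
  shows "mat_trace (A * B) = mat_trace (B * A)"
proof -
  have "mat_trace (A * B) = (\<Sum>i<n. \<Sum>j<m. A $$ (i, j) * B $$ (j, i))"
    unfolding mat_trace_def using A B by (auto simp: mult_index_mat simp del: index_mult_mat(1) intro!: sum.cong)
  also have "\<dots> = (\<Sum>j<m. \<Sum>i<n. B $$ (j, i) * A $$ (i, j))"
    by (subst sum.swap) (simp add: mult.commute)
  also have "\<dots> = mat_trace (B * A)"
    unfolding mat_trace_def using A B by (auto simp: mult_index_mat simp del: index_mult_mat(1) intro!: sum.cong)
  finally show ?thesis .
qed

lemma mat_trace_conj:
  assumes "A \<in> carrier_mat n n" "P \<in> carrier_mat n n" "Q \<in> carrier_mat n n" "Q * P = 1\<^sub>m n"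
  shows "mat_trace (P * A * Q) = mat_trace A"
proof -
  have "mat_trace (P * A * Q) = mat_trace (Q * (P * A))"
    using assms by (intro mat_trace_comm[of _ n n]) auto
  also have "Q * (P * A) = A"
    using assms by (subst assoc_mult_mat[symmetric, of _ n n _ n _ n]) auto
  finally show ?thesis .
qed

lemma mat_trace_four_block:
  assumes "A \<in> carrier_mat n n" "D \<in> carrier_mat m m"
  shows "mat_trace (four_block_mat A B C D) = mat_trace A + mat_trace D"
proof -
  have "mat_trace (four_block_mat A B C D) =
      (\<Sum>i<n + m. if i < n then A $$ (i, i) else D $$ (i - n, i - n))"
    unfolding mat_trace_def using assms by (auto intro!: sum.cong)
  also have "\<dots> = (\<Sum>i<n. A $$ (i, i)) + (\<Sum>i<m. D $$ (i, i))"
    by (induction m) auto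
  finally show ?thesis using assms by (simp add: mat_trace_def)
qed

lemma mat_sum_carrier [simp]: "mat_sum n m f S \<in> carrier_mat n m"
  by (simp add: mat_sum_def)

lemma mat_sum_index: "i < n \<Longrightarrow> j < m \<Longrightarrow> mat_sum n m f S $$ (i, j) = (\<Sum>g\<in>S. f g $$ (i, j))"
  by (simp add: mat_sum_def)

lemma mult_mat_sum:
  assumes "B \<in> carrier_mat k n" "\<And>g. g \<in> S \<Longrightarrow> f g \<in> carrier_mat n m"
  shows "B * mat_sum n m f S = mat_sum k m (\<lambda>g. B * f g) S"
proof (rule eq_matI)
  fix i j assume "i < dim_row (mat_sum k m (\<lambda>g. B * f g) S)" "j < dim_col (mat_sum k m (\<lambda>g. B * f g) S)"
  hence ij: "i < k" "j < m" by (auto simp: mat_sum_def)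
  have "(B * mat_sum n m f S) $$ (i, j) = (\<Sum>l<n. B $$ (i, l) * (\<Sum>g\<in>S. f g $$ (l, j)))"
    using assms ij by (subst mult_index_mat[of _ k n _ m]) (auto simp: mat_sum_index)
  also have "\<dots> = (\<Sum>g\<in>S. \<Sum>l<n. B $$ (i, l) * f g $$ (l, j))"
    by (subst sum.swap) (simp add: sum_distrib_left)
  also have "\<dots> = (\<Sum>g\<in>S. (B * f g) $$ (i, j))"
    using assms ij by (intro sum.cong refl) (subst mult_index_mat[of _ k n _ m], auto)
  finally show "(B * mat_sum n m f S) $$ (i, j) = mat_sum k m (\<lambda>g. B * f g) S $$ (i, j)"
    using ij by (simp add: mat_sum_index)
qed (use assms in \<open>auto simp: mat_sum_def\<close>)

lemma mat_sum_mult: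
  assumes "B \<in> carrier_mat m k" "\<And>g. g \<in> S \<Longrightarrow> f g \<in> carrier_mat n m"
  shows "mat_sum n m f S * B = mat_sum n k (\<lambda>g. f g * B) S"
proof (rule eq_matI)
  fix i j assume "i < dim_row (mat_sum n k (\<lambda>g. f g * B) S)" "j < dim_col (mat_sum n k (\<lambda>g. f g * B) S)"
  hence ij: "i < n" "j < k" by (auto simp: mat_sum_def)
  have "(mat_sum n m f S * B) $$ (i, j) = (\<Sum>l<m. (\<Sum>g\<in>S. f g $$ (i, l)) * B $$ (l, j))"
    using assms ij by (subst mult_index_mat[of _ n m _ k]) (auto simp: mat_sum_index)
  also have "\<dots> = (\<Sum>g\<in>S. \<Sum>l<m. f g $$ (i, l) * B $$ (l, j))"
    by (subst sum.swap) (simp add: sum_distrib_right)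
  also have "\<dots> = (\<Sum>g\<in>S. (f g * B) $$ (i, j))"
    using assms ij by (intro sum.cong refl) (subst mult_index_mat[of _ n m _ k], auto)
  finally show "(mat_sum n m f S * B) $$ (i, j) = mat_sum n k (\<lambda>g. f g * B) S $$ (i, j)"
    using ij by (simp add: mat_sum_index)
qed (use assms in \<open>auto simp: mat_sum_def\<close>)

lemma mat_sum_cong: "(\<And>g. g \<in> S \<Longrightarrow> f g = h g) \<Longrightarrow> mat_sum n m f S = mat_sum n m h S"
  by (simp add: mat_sum_def)

lemma upper_triangular_pow:
  fixes U :: "'a::comm_ring_1 mat"
  assumes U: "U \<in> carrier_mat n n" "upper_triangular U"
  shows "upper_triangular (U ^\<^sub>m k) \<and> (\<forall>i<n. (U ^\<^sub>m k) $$ (i, i) = (U $$ (i, i)) ^ k)"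
proof (induction k)
  case (Suc k)
  let ?V = "U ^\<^sub>m k"
  have V: "?V \<in> carrier_mat n n" using U by simp
  have *: "(?V * U) $$ (i, j) = (if i = j then ?V $$ (i, i) * U $$ (i, i) else 0)"
    if "j \<le> i" "i < n" for i j
  proof -
    have "(?V * U) $$ (i, j) = (\<Sum>l<n. ?V $$ (i, l) * U $$ (l, j))"
      using V U that by (intro mult_index_mat) auto
    also have "\<dots> = (\<Sum>l<n. if l = i then (if i = j then ?V $$ (i, i) * U $$ (i, i) else 0) else 0)"
    proof (rule sum.cong)
      fix l assume "l \<in> {..<n}"
      show "?V $$ (i, l) * U $$ (l, j) =
        (if l = i then (if i = j then ?V $$ (i, i) * U $$ (i, i) else 0) else 0)"
        using that Suc U V \<open>l \<in> _\<close> by (cases l i rule: linorder_cases) (auto simp: upper_triangular_def)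
    qed auto
    finally show ?thesis using that by simp
  qed
  show ?case using * Suc U V by (auto simp: upper_triangular_def mult.commute)
qed (use U in auto)

text \<open>\<open>A ^\<^sub>m k\<close> is the inverse of \<open>A\<close>. The diagonal of a Schur
  form consists of roots of unity, and these are inverted by complex conjugation.\<close>

lemma mat_trace_inverse_finite_order:
  fixes A :: "complex mat"
  assumes A: "A \<in> carrier_mat n n" and k: "A ^\<^sub>m Suc k = 1\<^sub>m n"
  shows "mat_trace (A ^\<^sub>m k) = cnj (mat_trace A)"
proof -
  from char_poly_factorized[OF A] obtain as where as: "char_poly A = (\<Prod>a\<leftarrow>as. [:- a, 1:])" by auto
  define U where "U = schur_upper_triangular A as"
  have U: "U \<in> carrier_mat n n" "upper_triangular U" "similar_mat A U"
    using schur_upper_triangular[OF A as] by (auto simp: U_def)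
  then obtain P Q where PQ: "similar_mat_wit A U P Q" by (auto simp: similar_mat_def)
  note D = similar_mat_witD2[OF A PQ]
  have pw: "A ^\<^sub>m l = P * U ^\<^sub>m l * Q" for l using similar_mat_wit_pow_id[OF PQ] .
  have "U ^\<^sub>m Suc k = Q * A ^\<^sub>m Suc k * P"
  proof -
    have "similar_mat_wit U A Q P" using PQ by (rule similar_mat_wit_sym)
    from similar_mat_wit_pow_id[OF this] show ?thesis .
  qed
  also have "\<dots> = 1\<^sub>m n" unfolding k using D by simp
  finally have U1: "U ^\<^sub>m Suc k = 1\<^sub>m n" .
  have tr: "mat_trace (A ^\<^sub>m l) = (\<Sum>i<n. (U $$ (i, i)) ^ l)" for l
  proof -
    have "mat_trace (A ^\<^sub>m l) = mat_trace (U ^\<^sub>m l)"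
      unfolding pw using U(1) D by (intro mat_trace_conj[of _ n]) auto
    also have "\<dots> = (\<Sum>i<n. (U $$ (i, i)) ^ l)"
      unfolding mat_trace_def using U upper_triangular_pow[OF U(1,2), of l] by auto
    finally show ?thesis .
  qed
  have "(U $$ (i, i)) ^ k = cnj (U $$ (i, i))" if "i < n" for i
  proof -
    have 1: "(U $$ (i, i)) ^ Suc k = 1"
      using upper_triangular_pow[OF U(1,2), of "Suc k"] that unfolding U1 by auto
    hence "norm (U $$ (i, i)) ^ Suc k = 1" by (metis norm_one norm_power)
    hence "norm (U $$ (i, i)) = 1"
      using power_eq_imp_eq_base[of "norm (U $$ (i, i))" "Suc k" 1] by simp
    hence "U $$ (i, i) * cnj (U $$ (i, i)) = 1" using complex_norm_square[of "U $$ (i, i)"] by simp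
    hence "(U $$ (i, i)) ^ k * (U $$ (i, i) * cnj (U $$ (i, i))) = (U $$ (i, i)) ^ k" by simp
    moreover have "(U $$ (i, i)) ^ k * (U $$ (i, i) * cnj (U $$ (i, i))) = (U $$ (i, i)) ^ Suc k * cnj (U $$ (i, i))"
      by (simp add: mult_ac)
    ultimately show ?thesis unfolding 1 by simp
  qed
  moreover have "mat_trace A = (\<Sum>i<n. U $$ (i, i))"
    using tr[of 1] A by simp
  ultimately show ?thesis by (simp add: tr)
qed

lemma det_nonzero_inverse:
  fixes A :: "'a::field mat"
  assumes "A \<in> carrier_mat n n" "det A \<noteq> 0"
  obtains B where "B \<in> carrier_mat n n" "A * B = 1\<^sub>m n" "B * A = 1\<^sub>m n"
  using det_non_zero_imp_unit[OF assms, of "()"] that by (auto simp: Units_def ring_mat_def)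

lemma det_nonzero_four_block_diag:
  fixes A :: "'a::field mat"
  assumes "A \<in> carrier_mat n n" "D \<in> carrier_mat m m" "det A \<noteq> 0" "det D \<noteq> 0"
  shows "det (four_block_mat A (0\<^sub>m n m) (0\<^sub>m m n) D) \<noteq> 0"
  using assms by (subst det_four_block_mat_upper_right_zero[of _ n _ m]) auto

text \<open>Gaussian elimination: a nonzero entry is moved to the corner, its row and column are
  cleared, and the induction hypothesis treats the remaining block.\<close>

lemma rank_normal_form:
  fixes T :: "'a::field mat"
  assumes "T \<in> carrier_mat n n"
  shows "\<exists>P\<in>carrier_mat n n. \<exists>Q\<in>carrier_mat n n. \<exists>k\<le>n. det P \<noteq> 0 \<and> det Q \<noteq> 0 \<and>
    P * T * Q = four_block_mat (1\<^sub>m k) (0\<^sub>m k (n - k)) (0\<^sub>m (n - k) k) (0\<^sub>m (n - k) (n - k))"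
  using assms
proof (induction n arbitrary: T)
  case 0
  thus ?case by (intro bexI[of _ "1\<^sub>m 0"] exI[of _ 0]) auto
next
  case (Suc n)
  show ?case
  proof (cases "T = 0\<^sub>m (Suc n) (Suc n)")
    case True
    thus ?thesis by (intro bexI[of _ "1\<^sub>m (Suc n)"] exI[of _ 0]) auto
  next
    case False
    then obtain i j where ij: "i < Suc n" "j < Suc n" "T $$ (i, j) \<noteq> 0"
      using Suc.prems by (metis carrier_matD eq_matI index_zero_mat)
    define P1 Q1 where "P1 = (swaprows_mat (Suc n) i 0 :: 'a mat)" and "Q1 = (swaprows_mat (Suc n) j 0 :: 'a mat)"
    have P1: "P1 \<in> carrier_mat (Suc n) (Suc n)" "det P1 \<noteq> 0" and Q1: "Q1 \<in> carrier_mat (Suc n) (Suc n)" "det Q1 \<noteq> 0"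
    proof -
      have *: "swaprows_mat (Suc n) i 0 \<in> carrier_mat (Suc n) (Suc n) \<and> det (swaprows_mat (Suc n) i 0 :: 'a mat) \<noteq> 0"
        if "i < Suc n" for i
      proof -
        have "det (swaprows_mat (Suc n) i 0 * swaprows_mat (Suc n) i 0 :: 'a mat) = 1"
          by (subst swaprows_mat_inv) (use that in auto)
        thus ?thesis by (subst (asm) det_mult[of _ "Suc n"]) auto
      qed
      show "P1 \<in> carrier_mat (Suc n) (Suc n)" "det P1 \<noteq> 0" "Q1 \<in> carrier_mat (Suc n) (Suc n)" "det Q1 \<noteq> 0"
        using * ij by (auto simp: P1_def Q1_def)
    qed
    define T1 where "T1 = P1 * T * Q1"
    have T1: "T1 \<in> carrier_mat (Suc n) (Suc n)" using P1 Q1 Suc.prems by (auto simp: T1_def)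
    have "T1 = swapcols j 0 (swaprows i 0 T)"
      using ij Suc.prems unfolding T1_def P1_def Q1_def
      by (subst swaprows_mat[of _ "Suc n" "Suc n"], simp, simp, simp, subst swapcols_mat[of _ "Suc n" "Suc n"]) auto
    hence a0: "T1 $$ (0, 0) \<noteq> 0" using ij Suc.prems by auto
    obtain A B C D where sp: "split_block T1 1 1 = (A, B, C, D)" by (metis prod_cases4)
    have bl: "A \<in> carrier_mat 1 1" "B \<in> carrier_mat 1 n" "C \<in> carrier_mat n 1" "D \<in> carrier_mat n n"
        "T1 = four_block_mat A B C D"
      using split_block[OF sp, of n n] T1 by auto
    define a where "a = A $$ (0, 0)"
    have a: "a \<noteq> 0" using a0 bl by (auto simp: a_def)
    \<comment> \<open>\<open>L\<close> scales the pivot to 1 and clears the first column,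
      \<open>R\<close> clears the first row; what remains is \<open>E\<close>, the Schur complement
      of the pivot.\<close>
    define L where "L = four_block_mat (inverse a \<cdot>\<^sub>m 1\<^sub>m 1) (0\<^sub>m 1 n) (- inverse a \<cdot>\<^sub>m C) (1\<^sub>m n)"
    define R where "R = four_block_mat (1\<^sub>m 1) (- inverse a \<cdot>\<^sub>m B) (0\<^sub>m n 1) (1\<^sub>m n)"
    have L: "L \<in> carrier_mat (Suc n) (Suc n)" "det L \<noteq> 0"
    proof -
      have "det L = det (inverse a \<cdot>\<^sub>m 1\<^sub>m 1 :: 'a mat) * det (1\<^sub>m n :: 'a mat)"
        unfolding L_def using bl by (intro det_four_block_mat_upper_right_zero) auto
      thus "det L \<noteq> 0" using a by simp
      show "L \<in> carrier_mat (Suc n) (Suc n)"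
        unfolding L_def using four_block_carrier_mat[of "inverse a \<cdot>\<^sub>m 1\<^sub>m 1" 1 1 "1\<^sub>m n" n n] by simp
    qed
    have R: "R \<in> carrier_mat (Suc n) (Suc n)" "det R \<noteq> 0"
    proof -
      have "det R = det (1\<^sub>m 1 :: 'a mat) * det (1\<^sub>m n :: 'a mat)"
        unfolding R_def using bl by (intro det_four_block_mat_lower_left_zero) auto
      thus "det R \<noteq> 0" using a by simp
      show "R \<in> carrier_mat (Suc n) (Suc n)"
        unfolding R_def using four_block_carrier_mat[of "1\<^sub>m 1" 1 1 "1\<^sub>m n" n n] by simp
    qed
    have A: "A = a \<cdot>\<^sub>m 1\<^sub>m 1" using bl by (intro eq_matI) (auto simp: a_def)
    define E where "E = D + (- inverse a) \<cdot>\<^sub>m (C * B)"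
    have E: "E \<in> carrier_mat n n" using bl by (auto simp: E_def)
    have e1: "inverse a \<cdot>\<^sub>m 1\<^sub>m 1 * A + 0\<^sub>m 1 n * C = 1\<^sub>m 1"
      using bl a unfolding A by (intro eq_matI) auto
    have e2: "inverse a \<cdot>\<^sub>m 1\<^sub>m 1 * B + 0\<^sub>m 1 n * D = inverse a \<cdot>\<^sub>m B"
      using bl by (simp add: mult_smult_assoc_mat[of _ 1 1 _ n])
    have e3: "- inverse a \<cdot>\<^sub>m C * A + 1\<^sub>m n * C = 0\<^sub>m n 1"
      using bl a unfolding A by (simp add: mult_smult_assoc_mat[of _ n 1 _ 1] mult_smult_distrib[of _ n 1 _ 1])
        (intro eq_matI, auto)
    have e4: "- inverse a \<cdot>\<^sub>m C * B + 1\<^sub>m n * D = E"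
      using bl unfolding E_def by (simp add: mult_smult_assoc_mat[of _ n 1 _ n] comm_add_mat[of _ n n])
    have LT: "L * T1 = four_block_mat (1\<^sub>m 1) (inverse a \<cdot>\<^sub>m B) (0\<^sub>m n 1) E"
      unfolding L_def bl(5)
      by (subst mult_four_block_mat[of _ 1 1 _ n _ n _ _ 1 _ n]) (use bl in \<open>simp_all only: e1 e2 e3 e4, simp_all\<close>)
    have f1: "1\<^sub>m 1 * (- inverse a \<cdot>\<^sub>m B) + inverse a \<cdot>\<^sub>m B * 1\<^sub>m n = 0\<^sub>m 1 n"
      using bl by (simp add: right_mult_one_mat[of _ 1]) (intro eq_matI, auto)
    have f2: "1\<^sub>m 1 * 1\<^sub>m 1 + inverse a \<cdot>\<^sub>m B * 0\<^sub>m n 1 = 1\<^sub>m 1"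
      using bl by (simp add: right_mult_zero_mat[of _ 1 n])
    have f3: "0\<^sub>m n 1 * 1\<^sub>m 1 + E * 0\<^sub>m n 1 = 0\<^sub>m n 1"
      using E by (simp add: right_mult_zero_mat[of _ n n])
    have f4: "0\<^sub>m n 1 * (- inverse a \<cdot>\<^sub>m B) + E * 1\<^sub>m n = E"
      using E bl by (simp add: left_mult_zero_mat[of _ 1 n])
    have LTR: "L * T1 * R = four_block_mat (1\<^sub>m 1) (0\<^sub>m 1 n) (0\<^sub>m n 1) E"
      unfolding LT R_def
      by (subst mult_four_block_mat[of _ 1 1 _ n _ n _ _ 1 _ n]) (use bl E in \<open>simp_all only: f1 f2 f3 f4, simp_all\<close>)
    from Suc.IH[OF E] obtain P' Q' k where IH: "P' \<in> carrier_mat n n" "Q' \<in> carrier_mat n n" "k \<le> n"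
      "det P' \<noteq> 0" "det Q' \<noteq> 0"
      "P' * E * Q' = four_block_mat (1\<^sub>m k) (0\<^sub>m k (n - k)) (0\<^sub>m (n - k) k) (0\<^sub>m (n - k) (n - k))"
      by blast
    define P2 Q2 where "P2 = four_block_mat (1\<^sub>m 1) (0\<^sub>m 1 n) (0\<^sub>m n 1) P'"
      and "Q2 = four_block_mat (1\<^sub>m 1) (0\<^sub>m 1 n) (0\<^sub>m n 1) Q'"
    have P2: "P2 \<in> carrier_mat (Suc n) (Suc n)" and Q2: "Q2 \<in> carrier_mat (Suc n) (Suc n)"
      using four_block_carrier_mat[of "1\<^sub>m 1" 1 1 P' n n] four_block_carrier_mat[of "1\<^sub>m 1" 1 1 Q' n n] IH
      by (simp_all add: P2_def Q2_def)
    have P2': "det P2 \<noteq> 0" and Q2': "det Q2 \<noteq> 0"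
      unfolding P2_def Q2_def using IH by (intro det_nonzero_four_block_diag; simp)+
    have "P2 * (L * T1 * R) = four_block_mat (1\<^sub>m 1) (0\<^sub>m 1 n) (0\<^sub>m n 1) (P' * E)"
      unfolding P2_def LTR
      by (subst mult_four_block_mat[of _ 1 1 _ n _ n _ _ 1 _ n]) (use IH E in auto)
    hence "P2 * (L * T1 * R) * Q2 = four_block_mat (1\<^sub>m 1) (0\<^sub>m 1 n) (0\<^sub>m n 1) (P' * E * Q')"
      unfolding Q2_def
      apply simp by (subst mult_four_block_mat[of _ 1 1 _ n _ n _ _ 1 _ n]) (use IH E in auto)
    also have "\<dots> = four_block_mat (1\<^sub>m (Suc k)) (0\<^sub>m (Suc k) (Suc n - Suc k)) (0\<^sub>m (Suc n - Suc k) (Suc k)) (0\<^sub>m (Suc n - Suc k) (Suc n - Suc k))"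
      unfolding IH(6) using IH(3) by (intro eq_matI) auto
    also have "P2 * (L * T1 * R) * Q2 = (P2 * L * P1) * T * (Q1 * R * Q2)"
      unfolding T1_def using P1 Q1 P2 Q2 L R Suc.prems
      by (simp add: assoc_mult_mat[of _ "Suc n" "Suc n" _ "Suc n" _ "Suc n"])
    finally have fin: "(P2 * L * P1) * T * (Q1 * R * Q2) = four_block_mat (1\<^sub>m (Suc k)) (0\<^sub>m (Suc k) (Suc n - Suc k)) (0\<^sub>m (Suc n - Suc k) (Suc k)) (0\<^sub>m (Suc n - Suc k) (Suc n - Suc k))" .
    have d: "det (P2 * L * P1) \<noteq> 0" "det (Q1 * R * Q2) \<noteq> 0"
      using P1 Q1 P2 Q2 P2' Q2' L R by (simp_all add: det_mult[of _ "Suc n"] mult_carrier_mat[of _ "Suc n" "Suc n"])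
    show ?thesis
      by (rule bexI[of _ "P2 * L * P1"], rule bexI[of _ "Q1 * R * Q2"], rule exI[of _ "Suc k"])
        (use fin d P1 Q1 P2 Q2 L R IH(3) in auto)
  qed
qed

lemma smult_smult_mat: "a \<cdot>\<^sub>m (b \<cdot>\<^sub>m A) = (a * b :: 'a::semigroup_mult) \<cdot>\<^sub>m A"
  by (rule eq_matI) (auto simp: mult.assoc)

lemma one_smult_mat: "(1::'a::monoid_mult) \<cdot>\<^sub>m A = A"
  by (rule eq_matI) auto

section \<open>Matrix representations of finite groups\<close>

definition matrix_rep :: "('g, 'b) monoid_scheme \<Rightarrow> nat \<Rightarrow> ('g \<Rightarrow> 'a::comm_ring_1 mat) \<Rightarrow> bool" where
  "matrix_rep G m r \<longleftrightarrow> (\<forall>g\<in>carrier G. r g \<in> carrier_mat m m) \<and>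
     (\<forall>g\<in>carrier G. \<forall>h\<in>carrier G. r (g \<otimes>\<^bsub>G\<^esub> h) = r g * r h) \<and> r \<one>\<^bsub>G\<^esub> = 1\<^sub>m m"

lemma matrix_rep_conj:
  fixes G (structure)
  assumes "monoid G" and r: "matrix_rep G m r" and PQ: "P \<in> carrier_mat m m" "Q \<in> carrier_mat m m"
    "P * Q = 1\<^sub>m m" "Q * P = 1\<^sub>m m"
  shows "matrix_rep G m (\<lambda>g. P * r g * Q)"
  unfolding matrix_rep_def
proof (intro conjI ballI)
  interpret monoid G by fact
  fix g h assume gh: "g \<in> carrier G" "h \<in> carrier G"
  have c: "r g \<in> carrier_mat m m" "r h \<in> carrier_mat m m" "r (g \<otimes> h) = r g * r h"
    using r gh by (auto simp: matrix_rep_def)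
  have "P * r g * Q * (P * r h * Q) = P * (r g * ((Q * P) * (r h * Q)))"
    using PQ(1,2) c(1,2) by (simp add: mult_carrier_mat[of _ m m _ m] assoc_mult_mat[of _ m m _ m _ m])
  also have "\<dots> = P * r (g \<otimes> h) * Q"
    unfolding PQ(4) c(3) using PQ(1,2) c(1,2)
    by (simp add: mult_carrier_mat[of _ m m _ m] assoc_mult_mat[of _ m m _ m _ m])
  finally show "P * r (g \<otimes> h) * Q = P * r g * Q * (P * r h * Q)" by simp
qed (use r PQ in \<open>auto simp: matrix_rep_def\<close>)

text \<open>The splitting of a block triangular representation is given by averaging the cocycle
  \<open>g \<mapsto> c g * a (inv g)\<close>.\<close>

lemma block_triangular_split:
  fixes G (structure) and a c d :: "'g \<Rightarrow> complex mat"
  assumes G: "group G" "finite (carrier G)"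
    and a: "matrix_rep G k a" and d: "matrix_rep G l d"
    and c: "\<And>g. g \<in> carrier G \<Longrightarrow> c g \<in> carrier_mat l k"
    and coc: "\<And>g h. g \<in> carrier G \<Longrightarrow> h \<in> carrier G \<Longrightarrow> c (g \<otimes>\<^bsub>G\<^esub> h) = c g * a h + d g * c h"
  obtains Z :: "complex mat" where "Z \<in> carrier_mat l k" "\<And>g. g \<in> carrier G \<Longrightarrow> c g + d g * Z = Z * a g"
proof -
  interpret group G by fact
  define f where "f h = c h * a (inv h)" for h
  define S where "S = mat_sum l k f (carrier G)"
  define Z where "Z = inverse (of_nat (card (carrier G))) \<cdot>\<^sub>m S"
  have S: "S \<in> carrier_mat l k" by (simp add: S_def)
  have ca: "a g \<in> carrier_mat k k" "d g \<in> carrier_mat l l" "c g \<in> carrier_mat l k" "f g \<in> carrier_mat l k"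
    if "g \<in> carrier G" for g
  proof -
    show 1: "a g \<in> carrier_mat k k" "d g \<in> carrier_mat l l" "c g \<in> carrier_mat l k" 
      using that a d c by (auto simp: matrix_rep_def)
    have "a (inv g) \<in> carrier_mat k k" using a that by (auto simp: matrix_rep_def)
    thus "f g \<in> carrier_mat l k" using 1 by (auto simp: f_def)
  qed
  have n0: "of_nat (card (carrier G)) \<noteq> (0::complex)"
    using G(2) carrier_not_empty by simp 
  \<comment> \<open>The cocycle relation is summed over \<open>h\<close>. Translation by
    \<open>g\<close> permutes the group, so \<open>S\<close> reproduces itself while
    \<open>c g\<close> is counted once for each element.\<close>
  have "of_nat (card (carrier G)) \<cdot>\<^sub>m c g + d g * S = S * a g" if g: "g \<in> carrier G" for g
  proof -
    have *: "d g * f h = f (g \<otimes> h) * a g - c g" if h: "h \<in> carrier G" for h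
    proof -
      have "f (g \<otimes> h) * a g = c (g \<otimes> h) * (a (inv (g \<otimes> h)) * a g)"
        using ca g h unfolding f_def by (subst assoc_mult_mat[of _ l k _ k _ k]) auto
      also have "a (inv (g \<otimes> h)) * a g = a (inv (g \<otimes> h) \<otimes> g)"
        using a g h by (auto simp: matrix_rep_def)
      also have "inv (g \<otimes> h) \<otimes> g = inv h" using g h by (simp add: inv_mult_group m_assoc)
      also have "c (g \<otimes> h) * a (inv h) = c g * a h * a (inv h) + d g * c h * a (inv h)"
        unfolding coc[OF g h] using ca g h by (subst add_mult_distrib_mat[of _ l k _ _ k]) (auto intro: mult_carrier_mat)
      also have "c g * a h * a (inv h) = c g * (a h * a (inv h))"
        using ca g h by (intro assoc_mult_mat) auto
      also have "a h * a (inv h) = a (h \<otimes> inv h)" using a h unfolding matrix_rep_def by (metis inv_closed)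
      also have "\<dots> = 1\<^sub>m k" using a h unfolding matrix_rep_def by simp
      also have "c g * 1\<^sub>m k = c g" using ca(3)[OF g] by simp
      also have "d g * c h * a (inv h) = d g * f h"
        unfolding f_def using ca g h by (intro assoc_mult_mat) auto
      finally have "f (g \<otimes> h) * a g = c g + d g * f h" .
      moreover have "d g * f h \<in> carrier_mat l k" using ca[OF g] ca[OF h] by simp
      ultimately show ?thesis using ca[OF g] by (intro eq_matI) auto
    qed
    have "d g * S = mat_sum l k (\<lambda>h. d g * f h) (carrier G)"
      unfolding S_def using ca g by (intro mult_mat_sum) auto
    also have "\<dots> = mat_sum l k (\<lambda>h. f (g \<otimes> h) * a g - c g) (carrier G)"
      by (intro mat_sum_cong) (use * in auto)
    also have "\<dots> = mat_sum l k (\<lambda>h. f (g \<otimes> h) * a g) (carrier G) - of_nat (card (carrier G)) \<cdot>\<^sub>m c g"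
      using ca[OF g] carrier_matD[OF ca(3)[OF g]] by (intro eq_matI) (auto simp: mat_sum_index sum_subtractf carrier_matD[OF mat_sum_carrier] simp del: index_mult_mat(1))
    also have "mat_sum l k (\<lambda>h. f (g \<otimes> h) * a g) (carrier G) = mat_sum l k (\<lambda>h. f (g \<otimes> h)) (carrier G) * a g"
      using ca g by (intro mat_sum_mult[symmetric]) auto
    also have "mat_sum l k (\<lambda>h. f (g \<otimes> h)) (carrier G) = S"
    proof -
      have "bij_betw (\<lambda>h. g \<otimes> h) (carrier G) (carrier G)"
        by (rule bij_betwI[where g = "\<lambda>h. inv g \<otimes> h"]) (use g in \<open>auto simp: m_assoc[symmetric]\<close>)
      thus ?thesis unfolding S_def mat_sum_def
        by (intro arg_cong[where f = "Matrix.mat l k"] ext) (auto intro!: sum.reindex_bij_betw)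
    qed
    finally show ?thesis using S ca[OF g] by (intro eq_matI) auto
  qed
  hence *: "of_nat (card (carrier G)) \<cdot>\<^sub>m (c g + d g * Z) = of_nat (card (carrier G)) \<cdot>\<^sub>m (Z * a g)"
    if "g \<in> carrier G" for g
    using S ca[OF that] n0 that
    by (simp add: Z_def add_smult_distrib_left_mat[of _ l k] mult_smult_distrib[of _ l l _ k] smult_smult_mat one_smult_mat
        mult_smult_assoc_mat[of _ l k _ k])
  show ?thesis
  proof (rule that[of Z])
    fix g assume g: "g \<in> carrier G"
    have "inverse (of_nat (card (carrier G))) \<cdot>\<^sub>m (of_nat (card (carrier G)) \<cdot>\<^sub>m (c g + d g * Z)) =
          inverse (of_nat (card (carrier G))) \<cdot>\<^sub>m (of_nat (card (carrier G)) \<cdot>\<^sub>m (Z * a g))"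
      using *[OF g] by simp
    thus "c g + d g * Z = Z * a g"
      using n0 by (simp add: smult_smult_mat one_smult_mat)
  qed (use S in \<open>simp add: Z_def\<close>)
qed

text \<open>The average of \<open>r' g * E * r (inv g)\<close> over the group intertwines, for every
  \<open>E\<close>. If all averages vanished, taking matrix units for \<open>E\<close> and adding up
  would make the sum of the squared norms of \<open>mat_trace (r g)\<close> zero, although the
  identity contributes \<open>m ^ 2\<close>.\<close>

lemma exists_nonzero_intertwiner:
  fixes G (structure) and r r' :: "'g \<Rightarrow> complex mat"
  assumes G: "group G" "finite (carrier G)"
    and r: "matrix_rep G m r" and r': "matrix_rep G m r'" and "m > 0"
    and tr: "\<And>g. g \<in> carrier G \<Longrightarrow> mat_trace (r g) = mat_trace (r' g)"
  obtains T where "T \<in> carrier_mat m m" "T \<noteq> 0\<^sub>m m m" "\<And>g. g \<in> carrier G \<Longrightarrow> T * r g = r' g * T"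
proof -
  interpret group G by fact
  have ca: "r g \<in> carrier_mat m m" "r' g \<in> carrier_mat m m" if "g \<in> carrier G" for g
    using that r r' by (auto simp: matrix_rep_def)
  define T where "T E = mat_sum m m (\<lambda>g. r' g * E * r (inv g)) (carrier G)" for E
  have Tint: "T E * r g = r' g * T E" if E: "E \<in> carrier_mat m m" and g: "g \<in> carrier G" for E g
  proof -
    have "T E * r g = mat_sum m m (\<lambda>h. r' h * E * r (inv h) * r g) (carrier G)"
      unfolding T_def using E g ca by (intro mat_sum_mult) (auto intro!: mult_carrier_mat[of _ m m _ m])
    also have "\<dots> = mat_sum m m (\<lambda>h. r' (g \<otimes> h) * E * r (inv (g \<otimes> h)) * r g) (carrier G)"
    proof -
      have "bij_betw (\<lambda>h. g \<otimes> h) (carrier G) (carrier G)"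
        by (rule bij_betwI[where g = "\<lambda>h. inv g \<otimes> h"]) (use g in \<open>auto simp: m_assoc[symmetric]\<close>)
      thus ?thesis unfolding mat_sum_def
        by (intro arg_cong[where f = "Matrix.mat m m"] ext) 
          (auto intro!: sum.reindex_bij_betw[symmetric, where h = "\<lambda>h. g \<otimes> h"])
    qed
    also have "\<dots> = mat_sum m m (\<lambda>h. r' g * (r' h * E * r (inv h))) (carrier G)"
    proof (rule mat_sum_cong)
      fix h assume h: "h \<in> carrier G"
      have "r (inv (g \<otimes> h)) * r g = r (inv (g \<otimes> h) \<otimes> g)" using r g h by (auto simp: matrix_rep_def)
      also have "inv (g \<otimes> h) \<otimes> g = inv h" using g h by (simp add: inv_mult_group m_assoc)
      finally have 1: "r (inv (g \<otimes> h)) * r g = r (inv h)" .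
      have 2: "r' (g \<otimes> h) = r' g * r' h" using r' g h by (auto simp: matrix_rep_def)
      show "r' (g \<otimes> h) * E * r (inv (g \<otimes> h)) * r g = r' g * (r' h * E * r (inv h))"
        using ca g h E by (simp add: mult_carrier_mat[of _ m m _ m] assoc_mult_mat[of _ m m _ m _ m] 1 2)
    qed
    also have "\<dots> = r' g * T E"
      unfolding T_def using E g ca by (intro mult_mat_sum[symmetric]) (auto intro!: mult_carrier_mat[of _ m m _ m])
    finally show ?thesis .
  qed
  have "\<exists>E\<in>carrier_mat m m. T E \<noteq> 0\<^sub>m m m"
  proof (rule ccontr)
    assume "\<not> ?thesis"
    hence z: "T E = 0\<^sub>m m m" if "E \<in> carrier_mat m m" for E using that by blast
    have "(\<Sum>g\<in>carrier G. r' g $$ (a, a) * r (inv g) $$ (b, b)) = 0" if ab: "a < m" "b < m" for a b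
    proof -
      define E :: "complex mat" where "E = Matrix.mat m m (\<lambda>(i, j). if i = a \<and> j = b then 1 else 0)"
      have E: "E \<in> carrier_mat m m" by (simp add: E_def)
      have "(r' g * E * r (inv g)) $$ (a, b) = r' g $$ (a, a) * r (inv g) $$ (b, b)" if g: "g \<in> carrier G" for g
      proof -
        have 1: "(r' g * E) $$ (a, l) = (if l = b then r' g $$ (a, a) else 0)" if "l < m" for l
        proof -
          have "(r' g * E) $$ (a, l) = (\<Sum>i<m. r' g $$ (a, i) * E $$ (i, l))"
            using ca(2)[OF g] E ab that by (intro mult_index_mat) auto
          also have "\<dots> = (\<Sum>i<m. if i = a then (if l = b then r' g $$ (a, a) else 0) else 0)"
            using that ab by (intro sum.cong) (auto simp: E_def)
          finally show ?thesis using ab by simp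
        qed
        have "(r' g * E * r (inv g)) $$ (a, b) = (\<Sum>l<m. (r' g * E) $$ (a, l) * r (inv g) $$ (l, b))"
          using ca(2)[OF g] ca(1)[of "inv g"] g E ab by (intro mult_index_mat[of _ m m]) auto
        also have "\<dots> = (\<Sum>l<m. if l = b then r' g $$ (a, a) * r (inv g) $$ (b, b) else 0)"
          by (intro sum.cong) (auto simp: 1)
        finally show ?thesis using ab by simp
      qed
      hence "(\<Sum>g\<in>carrier G. r' g $$ (a, a) * r (inv g) $$ (b, b)) = T E $$ (a, b)"
        unfolding T_def using ab by (simp add: mat_sum_index)
      thus ?thesis using z[OF E] ab by simp
    qed
    hence "(\<Sum>a<m. \<Sum>b<m. \<Sum>g\<in>carrier G. r' g $$ (a, a) * r (inv g) $$ (b, b)) = 0" by simp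
    also have "(\<Sum>a<m. \<Sum>b<m. \<Sum>g\<in>carrier G. r' g $$ (a, a) * r (inv g) $$ (b, b)) =
        (\<Sum>a<m. \<Sum>g\<in>carrier G. \<Sum>b<m. r' g $$ (a, a) * r (inv g) $$ (b, b))"
      by (intro sum.cong refl sum.swap)
    also have "\<dots> = (\<Sum>g\<in>carrier G. \<Sum>a<m. \<Sum>b<m. r' g $$ (a, a) * r (inv g) $$ (b, b))"
      by (rule sum.swap)
    also have "\<dots> = (\<Sum>g\<in>carrier G. mat_trace (r' g) * mat_trace (r (inv g)))"
    proof (intro sum.cong refl)
      fix g assume g: "g \<in> carrier G"
      have "dim_row (r' g) = m" "dim_row (r (inv g)) = m" using ca(2)[OF g] ca(1)[of "inv g"] g by auto
      thus "(\<Sum>a<m. \<Sum>b<m. r' g $$ (a, a) * r (inv g) $$ (b, b)) = mat_trace (r' g) * mat_trace (r (inv g))"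
        unfolding mat_trace_def by (simp add: sum_product)
    qed
    also have "\<dots> = (\<Sum>g\<in>carrier G. of_real ((norm (mat_trace (r g)))\<^sup>2))"
    proof (intro sum.cong refl)
      fix g assume g: "g \<in> carrier G"
      have pw: "r (g [^] l) = r g ^\<^sub>m l" for l :: nat
      proof (induction l)
        case 0
        thus ?case using r ca(1)[OF g] by (auto simp: matrix_rep_def)
      next
        case (Suc l)
        thus ?case using r g by (simp add: matrix_rep_def)
      qed
      define k where "k = order G - 1"
      have k: "order G = Suc k" using order_gt_0_iff_finite G(2) by (simp add: k_def)
      have "g [^] Suc k = \<one>" using pow_order_eq_1[OF g] k by simp
      hence 1: "g [^] k \<otimes> g = \<one>" by simp
      hence "inv g = g [^] k" using g by (metis inv_equality nat_pow_closed)
      hence "mat_trace (r (inv g)) = cnj (mat_trace (r g))"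
        using mat_trace_inverse_finite_order[OF ca(1)[OF g], of k] pw[of k] pw[of "Suc k"] 1 r
        by (simp add: matrix_rep_def)
      thus "mat_trace (r' g) * mat_trace (r (inv g)) = of_real ((norm (mat_trace (r g)))\<^sup>2)"
        using tr[OF g] by (simp only: complex_norm_square)
    qed
    also have "\<dots> = of_real (\<Sum>g\<in>carrier G. (norm (mat_trace (r g)))\<^sup>2)" by simp
    finally have "(\<Sum>g\<in>carrier G. (norm (mat_trace (r g)))\<^sup>2) = 0" using of_real_eq_0_iff by blast
    hence "(norm (mat_trace (r \<one>)))\<^sup>2 = 0"
      using G(2) by (subst (asm) sum_nonneg_eq_0_iff) auto
    moreover have "mat_trace (r \<one>) = of_nat m" using r by (simp add: matrix_rep_def mat_trace_def)
    ultimately show False using \<open>m > 0\<close> by simp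
  qed
  then obtain E where "E \<in> carrier_mat m m" "T E \<noteq> 0\<^sub>m m m" by blast
  thus ?thesis using that[of "T E"] Tint by (auto simp: T_def)
qed

text \<open>Induction on the degree, with a nonzero intertwiner in place of irreducible
  constituents. In bases that bring it to rank normal form \<open>J\<close>, both representations
  are block triangular with a common block \<open>a\<close>; the complementary blocks
  \<open>d\<close> and \<open>d'\<close> are smaller and again have equal traces, and both
  triangular forms split by averaging.\<close>

lemma equal_characters_imp_equivalent:
  fixes G (structure) and r r' :: "'g \<Rightarrow> complex mat"
  assumes G: "group G" "finite (carrier G)"
    and "matrix_rep G m r" and "matrix_rep G m r'"
    and "\<And>g. g \<in> carrier G \<Longrightarrow> mat_trace (r g) = mat_trace (r' g)"
  shows "\<exists>P\<in>carrier_mat m m. det P \<noteq> 0 \<and> (\<forall>g\<in>carrier G. P * r g = r' g * P)"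
  using assms(3-5)
proof (induction m arbitrary: r r' rule: less_induct)
  case (less m)
  interpret group G by fact
  show ?case
  proof (cases "m = 0")
    case True
    have "1\<^sub>m 0 * r g = r' g * 1\<^sub>m 0" if "g \<in> carrier G" for g
      using less.prems(1,2) True that by (intro eq_matI) (auto simp: matrix_rep_def)
    thus ?thesis using True by (intro bexI[of _ "1\<^sub>m 0"]) auto
  next
    case False
    then obtain T where T: "T \<in> carrier_mat m m" "T \<noteq> 0\<^sub>m m m" "\<And>g. g \<in> carrier G \<Longrightarrow> T * r g = r' g * T"
      using exists_nonzero_intertwiner[OF G less.prems(1,2) _ less.prems(3)] by blast
    obtain P Q k where PQ: "P \<in> carrier_mat m m" "Q \<in> carrier_mat m m" "k \<le> m" "det P \<noteq> 0" "det Q \<noteq> 0"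
      "P * T * Q = four_block_mat (1\<^sub>m k) (0\<^sub>m k (m - k)) (0\<^sub>m (m - k) k) (0\<^sub>m (m - k) (m - k))"
      using rank_normal_form[OF T(1)] by blast
    define J where "J = (four_block_mat (1\<^sub>m k) (0\<^sub>m k (m - k)) (0\<^sub>m (m - k) k) (0\<^sub>m (m - k) (m - k)) :: complex mat)"
    obtain P' where P': "P' \<in> carrier_mat m m" "P * P' = 1\<^sub>m m" "P' * P = 1\<^sub>m m"
      using det_nonzero_inverse[OF PQ(1,4)] .
    obtain Q' where Q': "Q' \<in> carrier_mat m m" "Q * Q' = 1\<^sub>m m" "Q' * Q = 1\<^sub>m m"
      using det_nonzero_inverse[OF PQ(2,5)] .
    note as = mult_carrier_mat[of _ m m _ m] assoc_mult_mat[of _ m m _ m _ m]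
    define l where "l = m - k"
    have klm: "k + l = m" using PQ(3) by (simp add: l_def)
    have "k > 0"
    proof (rule ccontr)
      assume "\<not> k > 0"
      hence "P * T * Q = 0\<^sub>m m m" unfolding PQ(6) by (auto intro!: eq_matI)
      hence "P' * (P * T * Q) * Q' = 0\<^sub>m m m" using P' Q' by simp
      also have "P' * (P * T * Q) * Q' = (P' * P) * (T * (Q * Q'))"
        using P'(1) Q'(1) PQ(1,2) T(1) by (simp add: as)
      also have "\<dots> = T" unfolding P'(3) Q'(2) using T(1) by simp
      finally show False using T(2) by simp
    qed
    define s s' where "s g = Q' * r g * Q" and "s' g = P * r' g * P'" for g
    have s: "matrix_rep G m s" and s': "matrix_rep G m s'"
      unfolding s_def s'_def using less.prems PQ P' Q' by (auto intro!: matrix_rep_conj is_monoid)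
    have rc: "r g \<in> carrier_mat m m" "r' g \<in> carrier_mat m m" if "g \<in> carrier G" for g
      using that less.prems by (auto simp: matrix_rep_def)
    have sc: "s g \<in> carrier_mat m m" "s' g \<in> carrier_mat m m" if "g \<in> carrier G" for g
      using that s s' by (auto simp: matrix_rep_def)
    have J: "J * s g = s' g * J" if g: "g \<in> carrier G" for g
    proof -
      have "J * s g = P * (T * (Q * Q')) * r g * Q"
        unfolding J_def PQ(6)[symmetric] s_def using rc[OF g] PQ(1,2) T(1) Q'(1) by (simp add: as)
      also have "\<dots> = P * (T * r g) * Q"
        unfolding Q'(2) using rc[OF g] PQ(1,2) T(1) Q'(1) by (simp add: as)
      also have "\<dots> = P * r' g * ((P' * P) * (T * Q))"
        unfolding T(3)[OF g] P'(3) using rc[OF g] PQ(1,2) T(1) by (simp add: as)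
      also have "\<dots> = s' g * J"
        unfolding J_def PQ(6)[symmetric] s'_def using rc[OF g] PQ(1,2) T(1) P'(1) by (simp add: as)
      finally show ?thesis .
    qed
    have trs: "mat_trace (s g) = mat_trace (s' g)" if g: "g \<in> carrier G" for g
      unfolding s_def s'_def using mat_trace_conj[OF rc(1)[OF g] Q'(1) PQ(2) Q'(2)]
         mat_trace_conj[OF rc(2)[OF g] PQ(1) P'(1) P'(3)] less.prems(3)[OF g] by simp
    define a c d where "a g = Matrix.mat k k (\<lambda>(i, j). s g $$ (i, j))"
      and "c g = Matrix.mat l k (\<lambda>(i, j). s g $$ (i + k, j))"
      and "d g = Matrix.mat l l (\<lambda>(i, j). s g $$ (i + k, j + k))" for g
    define b' d' where "b' g = Matrix.mat k l (\<lambda>(i, j). s' g $$ (i, j + k))"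
      and "d' g = Matrix.mat l l (\<lambda>(i, j). s' g $$ (i + k, j + k))" for g
    have bc: "a g \<in> carrier_mat k k" "c g \<in> carrier_mat l k" "d g \<in> carrier_mat l l" 
       "b' g \<in> carrier_mat k l" "d' g \<in> carrier_mat l l" for g
      by (simp_all add: a_def c_def d_def b'_def d'_def)
    \<comment> \<open>Read block by block, \<open>J * s g = s' g * J\<close> makes the upper right
      block of \<open>s g\<close> and the lower left block of \<open>s' g\<close> zero and the two
      upper left blocks equal.\<close>
    have Jr: "(J * s g) $$ (i, j) = (if i < k then s g $$ (i, j) else 0)"
      "(s' g * J) $$ (i, j) = (if j < k then s' g $$ (i, j) else 0)"
      if g: "g \<in> carrier G" and ij: "i < m" "j < m" for g i j
    proof -
      have Jc: "J \<in> carrier_mat m m"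
        unfolding J_def PQ(6)[symmetric] using PQ(1,2) T(1) by (auto intro!: mult_carrier_mat[of _ m m _ m])
      have Je: "J $$ (i, j) = (if i = j \<and> i < k then 1 else 0)" if "i < m" "j < m" for i j
        using that klm by (auto simp: J_def)
      have "(J * s g) $$ (i, j) = (\<Sum>x<m. J $$ (i, x) * s g $$ (x, j))"
        using Jc sc[OF g] ij by (intro mult_index_mat) auto
      also have "\<dots> = (\<Sum>x<m. if x = i then (if i < k then s g $$ (i, j) else 0) else 0)"
        using ij by (intro sum.cong) (auto simp: Je)
      finally show "(J * s g) $$ (i, j) = (if i < k then s g $$ (i, j) else 0)" using ij by simp
      have "(s' g * J) $$ (i, j) = (\<Sum>x<m. s' g $$ (i, x) * J $$ (x, j))"
        using Jc sc[OF g] ij by (intro mult_index_mat) auto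
      also have "\<dots> = (\<Sum>x<m. if x = j then (if j < k then s' g $$ (i, j) else 0) else 0)"
        using ij by (intro sum.cong) (auto simp: Je)
      finally show "(s' g * J) $$ (i, j) = (if j < k then s' g $$ (i, j) else 0)" using ij by simp
    qed
    have sb: "s g = four_block_mat (a g) (0\<^sub>m k l) (c g) (d g)" if g: "g \<in> carrier G" for g
    proof (rule eq_matI)
      fix i j assume "i < dim_row (four_block_mat (a g) (0\<^sub>m k l) (c g) (d g))"
        "j < dim_col (four_block_mat (a g) (0\<^sub>m k l) (c g) (d g))"
      hence ij: "i < m" "j < m" using bc klm by (auto simp: a_def d_def)
      show "s g $$ (i, j) = four_block_mat (a g) (0\<^sub>m k l) (c g) (d g) $$ (i, j)"
        using ij klm Jr[OF g ij] J[OF g] by (auto simp: a_def c_def d_def)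
    qed (use bc sc[OF g] klm in \<open>auto simp: a_def d_def\<close>)
    have sb': "s' g = four_block_mat (a g) (b' g) (0\<^sub>m l k) (d' g)" if g: "g \<in> carrier G" for g
    proof (rule eq_matI)
      fix i j assume "i < dim_row (four_block_mat (a g) (b' g) (0\<^sub>m l k) (d' g))"
        "j < dim_col (four_block_mat (a g) (b' g) (0\<^sub>m l k) (d' g))"
      hence ij: "i < m" "j < m" using bc klm by (auto simp: a_def d'_def)
      show "s' g $$ (i, j) = four_block_mat (a g) (b' g) (0\<^sub>m l k) (d' g) $$ (i, j)"
        using ij klm Jr[OF g ij] J[OF g] by (auto simp: a_def b'_def d'_def)
    qed (use bc sc[OF g] klm in \<open>auto simp: a_def d'_def\<close>)
    have m1: "four_block_mat (a g) (0\<^sub>m k l) (c g) (d g) * four_block_mat (a h) (0\<^sub>m k l) (c h) (d h) =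
       four_block_mat (a g * a h) (0\<^sub>m k l) (c g * a h + d g * c h) (d g * d h)" for g h
      using bc[of g] bc[of h]
      by (subst mult_four_block_mat[of _ k k _ l _ l _ _ k _ l])
        (auto intro!: cong_four_block_mat simp: right_mult_zero_mat[of _ k k] right_mult_zero_mat[of _ l k] left_mult_zero_mat[of _ l])
    have m2: "four_block_mat (a g) (b' g) (0\<^sub>m l k) (d' g) * four_block_mat (a h) (b' h) (0\<^sub>m l k) (d' h) =
       four_block_mat (a g * a h) (a g * b' h + b' g * d' h) (0\<^sub>m l k) (d' g * d' h)" for g h
      using bc[of g] bc[of h]
      by (subst mult_four_block_mat[of _ k k _ l _ l _ _ k _ l])
        (auto intro!: cong_four_block_mat simp: right_mult_zero_mat[of _ k l] right_mult_zero_mat[of _ l l] left_mult_zero_mat[of _ k])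
    have inj: "A = A2 \<and> B = B2 \<and> C = C2 \<and> D = D2"
      if "four_block_mat A B C D = four_block_mat A2 B2 C2 D2" 
      "A \<in> carrier_mat k k" "B \<in> carrier_mat k l" "C \<in> carrier_mat l k" "D \<in> carrier_mat l l"
      "A2 \<in> carrier_mat k k" "B2 \<in> carrier_mat k l" "C2 \<in> carrier_mat l k" "D2 \<in> carrier_mat l l"
      for A B C D A2 B2 C2 D2 :: "complex mat"
    proof -
      have *: "four_block_mat A B C D $$ (i, j) = four_block_mat A2 B2 C2 D2 $$ (i, j)" for i j
        using that(1) by simp
      have "A $$ (i, j) = A2 $$ (i, j)" if "i < k" "j < k" for i j using *[of i j] that \<open>A \<in> _\<close> \<open>A2 \<in> _\<close> \<open>D \<in> _\<close> \<open>D2 \<in> _\<close> by auto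
      moreover have "B $$ (i, j) = B2 $$ (i, j)" if "i < k" "j < l" for i j using *[of i "j + k"] that \<open>A \<in> _\<close> \<open>A2 \<in> _\<close> \<open>D \<in> _\<close> \<open>D2 \<in> _\<close> by auto
      moreover have "C $$ (i, j) = C2 $$ (i, j)" if "i < l" "j < k" for i j using *[of "i + k" j] that \<open>A \<in> _\<close> \<open>A2 \<in> _\<close> \<open>D \<in> _\<close> \<open>D2 \<in> _\<close> by auto
      moreover have "D $$ (i, j) = D2 $$ (i, j)" if "i < l" "j < l" for i j using *[of "i + k" "j + k"] that \<open>A \<in> _\<close> \<open>A2 \<in> _\<close> \<open>D \<in> _\<close> \<open>D2 \<in> _\<close> by auto
      ultimately show ?thesis using that(2-) by (auto intro!: eq_matI)
    qed
    have h1: "a (g \<otimes> h) = a g * a h" "c (g \<otimes> h) = c g * a h + d g * c h" "d (g \<otimes> h) = d g * d h"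
      if gh: "g \<in> carrier G" "h \<in> carrier G" for g h
    proof -
      have "s (g \<otimes> h) = s g * s h" using s gh by (auto simp: matrix_rep_def)
      hence "four_block_mat (a (g \<otimes> h)) (0\<^sub>m k l) (c (g \<otimes> h)) (d (g \<otimes> h)) =
        four_block_mat (a g * a h) (0\<^sub>m k l) (c g * a h + d g * c h) (d g * d h)"
        using sb gh m1 by simp
      from inj[OF this] show "a (g \<otimes> h) = a g * a h" "c (g \<otimes> h) = c g * a h + d g * c h" "d (g \<otimes> h) = d g * d h"
        using bc by (auto simp: mult_carrier_mat[of _ k k] mult_carrier_mat[of _ l l] mult_carrier_mat[of _ l k])
    qed
    have h2: "b' (g \<otimes> h) = a g * b' h + b' g * d' h" "d' (g \<otimes> h) = d' g * d' h"
      if gh: "g \<in> carrier G" "h \<in> carrier G" for g h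
    proof -
      have "s' (g \<otimes> h) = s' g * s' h" using s' gh by (auto simp: matrix_rep_def)
      hence "four_block_mat (a (g \<otimes> h)) (b' (g \<otimes> h)) (0\<^sub>m l k) (d' (g \<otimes> h)) =
        four_block_mat (a g * a h) (a g * b' h + b' g * d' h) (0\<^sub>m l k) (d' g * d' h)"
        using sb' gh m2 by simp
      from inj[OF this] show "b' (g \<otimes> h) = a g * b' h + b' g * d' h" "d' (g \<otimes> h) = d' g * d' h"
        using bc by (auto simp: mult_carrier_mat[of _ k k] mult_carrier_mat[of _ l l] mult_carrier_mat[of _ k l])
    qed
    have "s \<one> = 1\<^sub>m m" "s' \<one> = 1\<^sub>m m" using s s' by (auto simp: matrix_rep_def)
    hence o: "a \<one> = 1\<^sub>m k" "d \<one> = 1\<^sub>m l" "d' \<one> = 1\<^sub>m l"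
      using klm by (auto simp: a_def d_def d'_def intro!: eq_matI)
    have ra: "matrix_rep G k a" and rd: "matrix_rep G l d" and rd': "matrix_rep G l d'"
      using o h1 h2 bc by (auto simp: matrix_rep_def)
    have "mat_trace (d g) = mat_trace (d' g)" if g: "g \<in> carrier G" for g
      using trs[OF g] unfolding sb[OF g] sb'[OF g] using bc[of g] mat_trace_four_block[of "a g" k "d g" l]
        mat_trace_four_block[of "a g" k "d' g" l] by simp
    moreover have "l < m" using \<open>k > 0\<close> klm by simp
    ultimately obtain S where S: "S \<in> carrier_mat l l" "det S \<noteq> 0" "\<And>g. g \<in> carrier G \<Longrightarrow> S * d g = d' g * S"
      using less.IH[OF _ rd rd'] by blast
    obtain Z where Z: "Z \<in> carrier_mat l k" "\<And>g. g \<in> carrier G \<Longrightarrow> c g + d g * Z = Z * a g"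
      using block_triangular_split[OF G ra rd bc(2) h1(2)] by blast
    \<comment> \<open>For the upper triangular \<open>s'\<close> the diagonal blocks exchange their
      roles: \<open>b'\<close> is a cocycle with \<open>a\<close> acting on the left and
      \<open>d'\<close> on the right.\<close>
    obtain Y where Y: "Y \<in> carrier_mat k l" "\<And>g. g \<in> carrier G \<Longrightarrow> b' g + a g * Y = Y * d' g"
    proof -
      have "b' (g \<otimes> h) = b' g * d' h + a g * b' h" if "g \<in> carrier G" "h \<in> carrier G" for g h
        unfolding h2(1)[OF that] using bc[of g] bc[of h] by (intro comm_add_mat[of _ k l]) (auto intro: mult_carrier_mat)
      from block_triangular_split[OF G rd' ra bc(4) this] that show ?thesis by blast
    qed
    define U where "U = four_block_mat (1\<^sub>m k) (0\<^sub>m k l) (- Z) (1\<^sub>m l)"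
    define W where "W = four_block_mat (1\<^sub>m k) Y (0\<^sub>m l k) (1\<^sub>m l)"
    define E where "E = four_block_mat (1\<^sub>m k) (0\<^sub>m k l) (0\<^sub>m l k) S"
    have UWE: "U \<in> carrier_mat m m" "W \<in> carrier_mat m m" "E \<in> carrier_mat m m"
      using four_block_carrier_mat[of "1\<^sub>m k" k k "1\<^sub>m l" l l] four_block_carrier_mat[of "1\<^sub>m k" k k S l l] S(1) 
      unfolding U_def W_def E_def klm by auto
    have dets: "det U \<noteq> 0" "det W \<noteq> 0" "det E \<noteq> 0"
    proof -
      show "det U \<noteq> 0" unfolding U_def using Z(1) by (subst det_four_block_mat_upper_right_zero[of _ k _ l]) auto
      show "det W \<noteq> 0" unfolding W_def using Y(1) by (subst det_four_block_mat_lower_left_zero[of _ k _ l]) auto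
      show "det E \<noteq> 0" unfolding E_def using S by (intro det_nonzero_four_block_diag) auto
    qed
    have W1: "U * s g = four_block_mat (a g) (0\<^sub>m k l) (0\<^sub>m l k) (d g) * U"
      "W * four_block_mat (a g) (0\<^sub>m k l) (0\<^sub>m l k) (d' g) = s' g * W"
      "E * four_block_mat (a g) (0\<^sub>m k l) (0\<^sub>m l k) (d g) = four_block_mat (a g) (0\<^sub>m k l) (0\<^sub>m l k) (d' g) * E"
      if g: "g \<in> carrier G" for g
    proof -
      note dm = carrier_matD[OF bc(1)[of g]] carrier_matD[OF bc(2)[of g]] carrier_matD[OF bc(3)[of g]]
        carrier_matD[OF bc(4)[of g]] carrier_matD[OF bc(5)[of g]] carrier_matD[OF Z(1)] carrier_matD[OF Y(1)] carrier_matD[OF S(1)]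
      have z: "- Z * a g + c g = d g * - Z"
      proof -
        have "- Z * a g + c g = - (Z * a g) + c g" using dm by simp
        also have "\<dots> = - (d g * Z)" unfolding Z(2)[OF g, symmetric] using dm by (intro eq_matI) auto
        finally show ?thesis using dm by simp
      qed
      have y: "Y * d' g = a g * Y + b' g"
        unfolding Y(2)[OF g, symmetric] using bc[of g] Y(1) by (intro comm_add_mat[of _ k l]) (auto intro: mult_carrier_mat)
      show "U * s g = four_block_mat (a g) (0\<^sub>m k l) (0\<^sub>m l k) (d g) * U"
        unfolding sb[OF g] U_def
        apply (subst mult_four_block_mat[of _ k k _ l _ l _ _ k _ l], use bc Z in auto)
        apply (subst mult_four_block_mat[of _ k k _ l _ l _ _ k _ l], use bc Z in auto)
        apply (rule cong_four_block_mat)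
        using z by (auto simp: dm simp del: index_mult_mat(1) uminus_mult_left_mat uminus_mult_right_mat intro!: eq_matI)
      show "W * four_block_mat (a g) (0\<^sub>m k l) (0\<^sub>m l k) (d' g) = s' g * W"
        unfolding sb'[OF g] W_def
        apply (subst mult_four_block_mat[of _ k k _ l _ l _ _ k _ l], use bc Y in auto)
        apply (subst mult_four_block_mat[of _ k k _ l _ l _ _ k _ l], use bc Y in auto)
        apply (rule cong_four_block_mat)
        using y by (auto simp: dm simp del: index_mult_mat(1) intro!: eq_matI)
      show "E * four_block_mat (a g) (0\<^sub>m k l) (0\<^sub>m l k) (d g) = four_block_mat (a g) (0\<^sub>m k l) (0\<^sub>m l k) (d' g) * E"
        unfolding E_def
        apply (subst mult_four_block_mat[of _ k k _ l _ l _ _ k _ l], use bc S in auto)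
        apply (subst mult_four_block_mat[of _ k k _ l _ l _ _ k _ l], use bc S in auto)
        apply (rule cong_four_block_mat)
        using S(3)[OF g] by (auto simp: dm simp del: index_mult_mat(1) intro!: eq_matI)
    qed
    \<comment> \<open>\<open>U\<close> and \<open>W\<close> remove the off-diagonal blocks of
      \<open>s\<close> and \<open>s'\<close>, \<open>E\<close> matches \<open>d\<close> with
      \<open>d'\<close>, and the outer factors undo the changes of basis.\<close>
    define R where "R = P' * (W * (E * (U * Q')))"
    have "R \<in> carrier_mat m m" using P' Q' UWE by (simp add: R_def as)
    moreover have "det P' \<noteq> 0" "det Q' \<noteq> 0"
      using det_mult[OF PQ(1) P'(1)] det_mult[OF PQ(2) Q'(1)] P'(2) Q'(2) by auto
    hence "det R \<noteq> 0" using P' Q' UWE dets by (simp add: R_def det_mult[of _ m] mult_carrier_mat[of _ m m _ m])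
    moreover have "R * r g = r' g * R" if g: "g \<in> carrier G" for g
    proof -
      let ?D = "four_block_mat (a g) (0\<^sub>m k l) (0\<^sub>m l k) (d g)" and ?D' = "four_block_mat (a g) (0\<^sub>m k l) (0\<^sub>m l k) (d' g)"
      have Dc: "?D \<in> carrier_mat m m" "?D' \<in> carrier_mat m m"
        using four_block_carrier_mat[of "a g" k k "d g" l l] four_block_carrier_mat[of "a g" k k "d' g" l l] bc klm by auto
      have q: "Q' * r g = s g * Q'"
        unfolding s_def using rc[OF g] Q' PQ(2) by (simp add: as)
      have p: "P' * s' g = r' g * P'"
      proof -
        have "P' * s' g = (P' * P) * (r' g * P')" unfolding s'_def using rc[OF g] P'(1) PQ(1) by (simp add: as)
        thus ?thesis unfolding P'(3) using rc[OF g] P'(1) by (simp add: as)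
      qed
      have "R * r g = P' * (W * (E * (U * (Q' * r g))))"
        unfolding R_def using rc[OF g] P'(1) Q'(1) UWE by (simp add: as)
      also have "\<dots> = P' * (W * (E * ((U * s g) * Q')))"
        unfolding q using sc[OF g] P'(1) Q'(1) UWE by (simp add: as)
      also have "\<dots> = P' * (W * ((E * ?D) * (U * Q')))"
        unfolding W1(1)[OF g] using Dc P'(1) Q'(1) UWE by (simp add: as)
      also have "\<dots> = P' * ((W * ?D') * (E * (U * Q')))"
        unfolding W1(3)[OF g] using Dc P'(1) Q'(1) UWE by (simp add: as)
      also have "\<dots> = (P' * s' g) * (W * (E * (U * Q')))"
        unfolding W1(2)[OF g] using sc[OF g] P'(1) Q'(1) UWE by (simp add: as)
      also have "\<dots> = r' g * R"
        unfolding p R_def using rc[OF g] P'(1) Q'(1) UWE by (simp add: as)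
      finally show ?thesis .
    qed
    ultimately show ?thesis by blast
  qed
qed

section \<open>The ring of integers of the algebraic closure\<close>

locale local_field_char_0 = nonarch_local_field v for v :: "'a::field_char_0 \<Rightarrow> real"
begin

abbreviation R :: "'a set" where "R \<equiv> valuation_ring v"

abbreviation Oac :: "'a alg_closure set" where "Oac \<equiv> integers_ac v"

abbreviation Mac :: "'a alg_closure set" where "Mac \<equiv> max_ideal_ac v"

lemma v_0 [simp]: "v 0 = 0"
  by (simp add: eq_0_iff)

lemma v_1 [simp]: "v 1 = 1"
  using mult[of 1 1] eq_0_iff[of 1] by simp

lemma v_uminus [simp]: "v (- x) = v x"
proof -
  have "v (-1) * v (-1) = 1" using mult[of "-1" "-1"] by simp
  hence "v (-1) = 1 \<or> v (-1) = -1" by (simp add: square_eq_1_iff)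
  hence "v (-1) = 1" using nonneg[of "-1"] by linarith
  thus ?thesis using mult[of "-1" x] by simp
qed

lemma v_diff: "v (x - y) \<le> max (v x) (v y)"
  using ultrametric[of x "- y"] by simp

lemma v_power [simp]: "v (x ^ n) = v x ^ n"
  by (induction n) (auto simp: mult)

lemma v_inverse: "v (inverse x) = inverse (v x)"
proof (cases "x = 0")
  case False
  hence "v x * v (inverse x) = 1" using mult[of x "inverse x"] by simp
  thus ?thesis using inverse_unique[of "v x"] by simp
qed auto

lemma v_divide: "v (x / y) = v x / v y"
  by (simp add: divide_inverse mult v_inverse)

lemma R_iff: "x \<in> R \<longleftrightarrow> v x \<le> 1"
  by (simp add: valuation_ring_def)

lemma R_0 [simp]: "0 \<in> R" and R_1 [simp]: "1 \<in> R"
  by (auto simp: R_iff)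

lemma R_uminus: "x \<in> R \<Longrightarrow> - x \<in> R"
  by (simp add: R_iff)

lemma R_add: "x \<in> R \<Longrightarrow> y \<in> R \<Longrightarrow> x + y \<in> R"
  using ultrametric[of x y] by (simp add: R_iff)

lemma R_mult: "x \<in> R \<Longrightarrow> y \<in> R \<Longrightarrow> x * y \<in> R"
  by (simp add: R_iff mult mult_le_one nonneg)

lemma R_power: "x \<in> R \<Longrightarrow> x ^ n \<in> R"
  by (induction n) (auto intro: R_mult)

lemma R_sum: "(\<And>i. i \<in> I \<Longrightarrow> f i \<in> R) \<Longrightarrow> (\<Sum>i\<in>I. f i) \<in> R"
  by (induction I rule: infinite_finite_induct) (auto intro: R_add)

lemma R_of_nat [simp]: "of_nat n \<in> R"
  by (induction n) (auto intro: R_add)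

section \<open>The uniformizer and convergent series in it\<close>

definition unif :: 'a where
  "unif = (SOME \<pi>. 0 < v \<pi> \<and> v \<pi> < 1 \<and> (\<forall>x. x \<noteq> 0 \<longrightarrow> (\<exists>k::int. v x = v \<pi> powi k)))"

lemma unif: "0 < v unif" "v unif < 1" "x \<noteq> 0 \<Longrightarrow> \<exists>k::int. v x = v unif powi k"
  using someI_ex[OF discrete] unfolding unif_def by auto

lemma unif_nonzero [simp]: "unif \<noteq> 0"
  using unif(1) by auto

lemma unif_R [simp]: "unif \<in> R"
  using unif(2) by (simp add: R_iff)

text \<open>The value group is generated by \<open>v unif\<close>, so a value below 1 is at most
  \<open>v unif\<close>.\<close>

lemma v_less_1_imp_div_unif:
  assumes "v x < 1"
  shows "x / unif \<in> R"
proof (cases "x = 0")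
  case False
  then obtain k :: int where k: "v x = v unif powi k" using unif(3) by blast
  have "k \<ge> 1"
  proof (rule ccontr)
    assume "\<not> k \<ge> 1"
    define n where "n = nat (- k)"
    have n: "k = - int n" using \<open>\<not> k \<ge> 1\<close> by (simp add: n_def)
    hence "v x = inverse (v unif ^ n)" using k by (simp add: power_int_minus)
    moreover have "v unif ^ n \<le> 1" "v unif ^ n > 0" using unif by (auto intro: power_le_one)
    ultimately have "v x \<ge> 1" by (simp add: one_le_inverse)
    thus False using assms by simp
  qed
  define n where "n = nat (k - 1)"
  have n: "k = int (Suc n)" using \<open>k \<ge> 1\<close> by (simp add: n_def)
  have "v x = v unif ^ Suc n" unfolding k n by (rule power_int_of_nat)
  moreover have "v unif ^ n \<le> 1" using unif by (auto intro: power_le_one)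
  ultimately have "v (x / unif) \<le> 1"
    using unif(1) by (simp add: v_divide divide_le_eq)
  thus ?thesis by (simp add: R_iff)
qed auto

lemma unif_power_mult_in_R: "\<exists>k. unif ^ k * x \<in> R"
proof -
  have "(\<lambda>k. v unif ^ k * v x) \<longlonglongrightarrow> 0 * v x"
    using unif by (intro tendsto_mult LIMSEQ_realpow_zero tendsto_const) auto
  hence "eventually (\<lambda>k. v unif ^ k * v x < 1) sequentially"
    by (intro order_tendstoD(2)[where a = 1]) auto
  then obtain k where "v unif ^ k * v x < 1" using eventually_happens'[OF sequentially_bot] by blast
  thus ?thesis by (intro exI[of _ k]) (simp add: R_iff mult)
qed

text \<open>Completeness enters here. The sum \<open>c\<close> of the series is described without
  limits: for each \<open>K\<close> it differs from the partial sum by a multiple of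
  \<open>unif ^ K\<close>.\<close>

lemma unif_adic_series:
  assumes a: "\<And>k. a k \<in> R"
  shows "\<exists>c. \<forall>K. \<exists>b\<in>R. c = (\<Sum>k<K. unif ^ k * a k) + unif ^ K * b"
proof -
  define s where "s n = (\<Sum>k<n. unif ^ k * a k)" for n
  have d: "\<exists>b\<in>R. s m = s n + unif ^ n * b" if "n \<le> m" for n m
    using that
  proof (induction m rule: dec_induct)
    case base
    thus ?case by (intro bexI[of _ 0]) auto
  next
    case (step m)
    obtain b where b: "b \<in> R" "s m = s n + unif ^ n * b" using step.IH by auto
    have "unif ^ n * unif ^ (m - n) = unif ^ m" using step(1) by (simp flip: power_add)
    moreover have "s (Suc m) = s m + unif ^ m * a m" by (simp add: s_def)
    ultimately have "s (Suc m) = s n + unif ^ n * (b + unif ^ (m - n) * a m)"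
      unfolding b(2) distrib_left by (simp add: add.assoc flip: mult.assoc)
    thus ?case using b a by (intro bexI[of _ "b + unif ^ (m - n) * a m"] R_add R_mult R_power unif_R)
  qed
  have small: "v (s m - s n) \<le> v unif ^ n" if nm: "n \<le> m" for n m
  proof -
    obtain b where "b \<in> R" "s m = s n + unif ^ n * b" using d[OF nm] by blast
    thus ?thesis using unif by (simp add: mult R_iff mult_left_le)
  qed
  have "\<exists>l. (\<lambda>n. v (s n - l)) \<longlonglongrightarrow> 0"
  proof (rule complete, intro allI impI)
    fix e :: real assume "e > 0"
    have "(\<lambda>k. v unif ^ k) \<longlonglongrightarrow> 0"
      using unif by (intro LIMSEQ_realpow_zero) auto
    hence "eventually (\<lambda>k. v unif ^ k < e) sequentially" using \<open>e > 0\<close> by (rule order_tendstoD(2))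
    then obtain M where M: "\<And>k. k \<ge> M \<Longrightarrow> v unif ^ k < e" by (auto simp: eventually_sequentially)
    have "v (s m - s n) < e" if "m \<ge> M" "n \<ge> M" for m n
    proof (cases "n \<le> m")
      case True
      thus ?thesis using small[OF True] M[OF that(2)] by simp
    next
      case False
      hence "v (s n - s m) < e" using small[of m n] M[OF that(1)] by simp
      thus ?thesis using v_uminus[of "s n - s m"] by simp
    qed
    thus "\<exists>M. \<forall>m\<ge>M. \<forall>n\<ge>M. v (s m - s n) < e" by blast
  qed
  then obtain l where l: "(\<lambda>n. v (s n - l)) \<longlonglongrightarrow> 0" by blast
  have "\<exists>b\<in>R. l = s K + unif ^ K * b" for K
  proof -
    have "eventually (\<lambda>n. v (s n - l) < v unif ^ K \<and> n \<ge> K) sequentially"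
      using unif by (intro eventually_conj order_tendstoD(2)[OF l] eventually_ge_at_top) auto
    then obtain n where n: "v (s n - l) < v unif ^ K" "n \<ge> K" using eventually_happens'[OF sequentially_bot] by blast
    obtain b where b: "b \<in> R" "s n = s K + unif ^ K * b" using d[OF n(2)] by blast
    have "(l - s n) / unif ^ K \<in> R"
      using n(1) v_uminus[of "l - s n"] unif by (simp add: R_iff v_divide divide_le_eq)
    moreover have "l = s K + unif ^ K * (b + (l - s n) / unif ^ K)"
      using b(2) by (simp add: field_simps)
    ultimately show ?thesis using b(1) by (intro bexI[of _ "b + (l - s n) / unif ^ K"]) (auto intro: R_add)
  qed
  thus ?thesis unfolding s_def by blast
qed

end

text \<open>By the Leibniz formula. Applied below to polynomials over the valuation ring, it shows
  that a characteristic polynomial has coefficients there.\<close>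

lemma det_in_subring:
  fixes S :: "'b::comm_ring_1 set"
  assumes "A \<in> carrier_mat n n" "\<And>i j. i < n \<Longrightarrow> j < n \<Longrightarrow> A $$ (i, j) \<in> S"
    and S: "0 \<in> S" "1 \<in> S" "\<And>x y. x \<in> S \<Longrightarrow> y \<in> S \<Longrightarrow> x + y \<in> S" "\<And>x y. x \<in> S \<Longrightarrow> y \<in> S \<Longrightarrow> x * y \<in> S"
      "\<And>x. x \<in> S \<Longrightarrow> - x \<in> S"
  shows "Determinant.det A \<in> S"
proof -
  have sum: "sum f I \<in> S" if "\<And>i. i \<in> I \<Longrightarrow> f i \<in> S" for f :: "(nat \<Rightarrow> nat) \<Rightarrow> 'b" and I
    using that by (induction I rule: infinite_finite_induct) (auto intro: S)
  have prod: "prod f I \<in> S" if "\<And>i. i \<in> I \<Longrightarrow> f i \<in> S" for f :: "nat \<Rightarrow> 'b" and I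
    using that by (induction I rule: infinite_finite_induct) (auto intro: S)
  show ?thesis
    unfolding det_def'[OF assms(1)]
    using assms(2) S(2,5)
    by (intro sum S(4) prod) (auto simp: sign_def permutes_in_image)
qed

section \<open>Finite spans over the valuation ring and integrality\<close>

context local_field_char_0
begin

text \<open>For \<open>w\<close> the powers of an integral element below the degree of its equation,
  this is the ring \<open>R[x]\<close>, a finite module in which approximation can be carried out
  coefficient by coefficient.\<close>

definition Rspan :: "'i set \<Rightarrow> ('i \<Rightarrow> 'a alg_closure) \<Rightarrow> 'a alg_closure set" where
  "Rspan I w = {\<Sum>i\<in>I. to_ac (c i) * w i | c. \<forall>i. c i \<in> R}"

lemma Rspan_0: "0 \<in> Rspan I w"
  unfolding Rspan_def by (auto intro!: exI[of _ "\<lambda>_. 0"])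

lemma Rspan_add:
  assumes "x \<in> Rspan I w" "y \<in> Rspan I w"
  shows "x + y \<in> Rspan I w"
proof -
  from assms obtain c d where "x = (\<Sum>i\<in>I. to_ac (c i) * w i)" "\<forall>i. c i \<in> R"
    "y = (\<Sum>i\<in>I. to_ac (d i) * w i)" "\<forall>i. d i \<in> R" by (auto simp: Rspan_def)
  thus ?thesis unfolding Rspan_def
    by (intro CollectI exI[of _ "\<lambda>i. c i + d i"]) (auto simp: sum.distrib algebra_simps intro: R_add)
qed

lemma Rspan_smult:
  assumes "x \<in> Rspan I w" "a \<in> R"
  shows "to_ac a * x \<in> Rspan I w"
proof -
  from assms obtain c where "x = (\<Sum>i\<in>I. to_ac (c i) * w i)" "\<forall>i. c i \<in> R" by (auto simp: Rspan_def)
  thus ?thesis unfolding Rspan_def using assms(2)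
    by (intro CollectI exI[of _ "\<lambda>i. a * c i"]) (auto simp: sum_distrib_left mult.assoc intro: R_mult)
qed

lemma Rspan_uminus: "x \<in> Rspan I w \<Longrightarrow> - x \<in> Rspan I w"
  using Rspan_smult[of x I w "-1"] by (simp add: R_uminus)

lemma Rspan_diff: "x \<in> Rspan I w \<Longrightarrow> y \<in> Rspan I w \<Longrightarrow> x - y \<in> Rspan I w"
  using Rspan_add[of x I w "- y"] Rspan_uminus[of y I w] by simp

lemma Rspan_sum: "(\<And>j. j \<in> J \<Longrightarrow> f j \<in> Rspan I w) \<Longrightarrow> (\<Sum>j\<in>J. f j) \<in> Rspan I w"
  by (induction J rule: infinite_finite_induct) (auto intro: Rspan_0 Rspan_add)

lemma Rspan_base:
  assumes "finite I" "i \<in> I"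
  shows "w i \<in> Rspan I w"
proof -
  have "w i = (\<Sum>j\<in>I. to_ac (if j = i then 1 else 0) * w j)"
    using assms by (subst sum.remove[of _ i]) (auto intro!: sum.neutral[symmetric])
  thus ?thesis unfolding Rspan_def by (intro CollectI exI[of _ "\<lambda>j. if j = i then 1 else 0"]) auto
qed

lemma mult_Rspan_closed:
  assumes "x \<in> Rspan I w" and "\<And>i. i \<in> I \<Longrightarrow> z * w i \<in> Rspan J u"
  shows "z * x \<in> Rspan J u"
proof -
  from assms obtain c where c: "x = (\<Sum>i\<in>I. to_ac (c i) * w i)" "\<forall>i. c i \<in> R" by (auto simp: Rspan_def)
  have "z * x = (\<Sum>i\<in>I. to_ac (c i) * (z * w i))"
    unfolding c(1) by (simp add: sum_distrib_left mult_ac)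
  also have "\<dots> \<in> Rspan J u" using c(2) assms(2) by (intro Rspan_sum Rspan_smult) auto
  finally show ?thesis .
qed

text \<open>A monic equation solved for its leading term. In this form integrality is a statement
  about finite spans rather than about polynomials.\<close>

lemma integers_ac_iff:
  "x \<in> Oac \<longleftrightarrow> (\<exists>n. x ^ n \<in> Rspan {..<n} (\<lambda>i. x ^ i))"
proof
  assume "x \<in> Oac"
  then obtain p where p: "Polynomial.lead_coeff p = 1" "\<And>i. Polynomial.coeff p i \<in> to_ac ` R" "poly p x = 0"
    by (auto simp: integers_ac_def)
  have "\<forall>i. \<exists>c. c \<in> R \<and> Polynomial.coeff p i = to_ac c" using p(2) by blast
  from choice[OF this] obtain c where c: "\<And>i. c i \<in> R \<and> Polynomial.coeff p i = to_ac (c i)" by blast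
  define n where "n = Polynomial.degree p"
  have "0 = (\<Sum>i\<le>n. Polynomial.coeff p i * x ^ i)" using p(3) by (simp add: poly_altdef n_def)
  also have "{..n} = insert n {..<n}" by auto
  also have "(\<Sum>i\<in>\<dots>. Polynomial.coeff p i * x ^ i) = x ^ n + (\<Sum>i<n. to_ac (c i) * x ^ i)"
    using p(1) c by (subst sum.insert) (auto simp: n_def)
  finally have "x ^ n + (\<Sum>i<n. to_ac (c i) * x ^ i) = 0" by (rule sym)
  hence "x ^ n = - (\<Sum>i<n. to_ac (c i) * x ^ i)" by (simp only: eq_neg_iff_add_eq_0)
  also have "\<dots> \<in> Rspan {..<n} (\<lambda>i. x ^ i)"
    by (rule Rspan_uminus) (use c in \<open>auto simp: Rspan_def\<close>)
  finally show "\<exists>n. x ^ n \<in> Rspan {..<n} (\<lambda>i. x ^ i)" ..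
next
  assume "\<exists>n. x ^ n \<in> Rspan {..<n} (\<lambda>i. x ^ i)"
  then obtain n c where c: "x ^ n = (\<Sum>i<n. to_ac (c i) * x ^ i)" "\<And>i. c i \<in> R" unfolding Rspan_def by blast
  define p where "p = Polynomial.monom (1::'a alg_closure) n - (\<Sum>i<n. Polynomial.monom (to_ac (c i)) i)"
  have co: "Polynomial.coeff p k = (if k = n then 1 else if k < n then - to_ac (c k) else 0)" for k
  proof -
    have "Polynomial.coeff (\<Sum>i<n. Polynomial.monom (to_ac (c i)) i) k = (\<Sum>i<n. if i = k then to_ac (c i) else 0)"
      by (simp add: coeff_sum) 
    thus ?thesis by (auto simp: p_def)
  qed
  have deg: "Polynomial.degree p = n"
  proof (rule antisym)
    show "Polynomial.degree p \<le> n" by (rule degree_le) (simp add: co)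
    show "n \<le> Polynomial.degree p" by (rule le_degree) (simp add: co)
  qed
  have co': "Polynomial.coeff p i \<in> to_ac ` R" for i
    using imageI[OF R_uminus[OF c(2)[of i]], of to_ac] imageI[OF R_1, of to_ac] imageI[OF R_0, of to_ac] by (auto simp: co)
  moreover have "poly p x = 0"
    by (simp add: p_def poly_monom poly_sum c(1))
  moreover have "Polynomial.lead_coeff p = 1" unfolding deg co by simp
  ultimately show "x \<in> Oac"
    unfolding integers_ac_def using co' by blast
qed

text \<open>The determinant trick: multiplication by \<open>z\<close> has a matrix over
  \<open>R\<close>, the nonzero vector \<open>w\<close> is an eigenvector of it for
  \<open>z\<close>, and the characteristic polynomial is monic.\<close>

lemma integral_if_Rspan_stable:
  fixes w :: "'i \<Rightarrow> 'a alg_closure"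
  assumes "finite I" "i0 \<in> I" "w i0 \<noteq> 0" and st: "\<And>i. i \<in> I \<Longrightarrow> z * w i \<in> Rspan I w"
  shows "z \<in> Oac"
proof -
  have "\<forall>i\<in>I. \<exists>c. z * w i = (\<Sum>j\<in>I. to_ac (c j) * w j) \<and> (\<forall>j. c j \<in> R)"
    using st unfolding Rspan_def by blast
  then obtain C where C: "\<And>i. i \<in> I \<Longrightarrow> z * w i = (\<Sum>j\<in>I. to_ac (C i j) * w j)" "\<And>i j. i \<in> I \<Longrightarrow> C i j \<in> R"
    by metis
  define n where "n = card I"
  obtain h where h: "bij_betw h {0..<n} I"
    using ex_bij_betw_nat_finite[OF assms(1)] unfolding n_def by blast
  have hI: "h i \<in> I" if "i < n" for i using h that by (auto simp: bij_betw_def)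
  define A where "A = Matrix.mat n n (\<lambda>(i, j). to_ac (C (h i) (h j)))"
  define u where "u = Matrix.vec n (\<lambda>i. w (h i))"
  have A: "A \<in> carrier_mat n n" by (simp add: A_def)
  have "A *\<^sub>v u = z \<cdot>\<^sub>v u"
  proof (rule eq_vecI)
    fix i assume "i < dim_vec (z \<cdot>\<^sub>v u)"
    hence i: "i < n" by (simp add: u_def)
    have "vec_index (A *\<^sub>v u) i = (\<Sum>j\<in>{0..<n}. to_ac (C (h i) (h j)) * w (h j))"
      using i by (simp add: A_def u_def scalar_prod_def)
    also have "\<dots> = (\<Sum>j\<in>I. to_ac (C (h i) j) * w j)"
      by (rule sum.reindex_bij_betw[OF h])
    also have "\<dots> = z * w (h i)" using C(1)[OF hI[OF i]] by simp
    finally show "vec_index (A *\<^sub>v u) i = vec_index (z \<cdot>\<^sub>v u) i" using i by (simp add: u_def)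
  qed (simp add: A_def u_def)
  moreover obtain k where "k < n" "h k = i0" using h assms(2) by (auto simp: bij_betw_def)
  hence "u \<noteq> 0\<^sub>v n" using assms(3) by (auto simp: u_def vec_eq_iff)
  ultimately have "eigenvector A u z" using A by (auto simp: eigenvector_def u_def)
  hence "poly (char_poly A) z = 0"
    using eigenvalue_root_char_poly[OF A] by (auto simp: eigenvalue_def)
  moreover have "Polynomial.lead_coeff (char_poly A) = 1" using degree_monic_char_poly[OF A] by simp
  moreover have "\<forall>i. Polynomial.coeff (char_poly A) i \<in> to_ac ` R"
  proof -
    define S where "S = {p. \<forall>i. Polynomial.coeff p i \<in> to_ac ` R}"
    have im: "x + y \<in> to_ac ` R" "x * y \<in> to_ac ` R" "- x \<in> to_ac ` R"
      if "x \<in> to_ac ` R" "y \<in> to_ac ` R" for x y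
      using that by (auto simp: image_iff simp flip: to_ac_add to_ac_mult to_ac_minus intro: R_add R_mult R_uminus
          simp del: to_ac_add to_ac_mult to_ac_minus)
    have im0: "0 \<in> to_ac ` R" "1 \<in> to_ac ` R" using image_eqI[of 0 to_ac 0 R] image_eqI[of 1 to_ac 1 R] by auto
    have ims: "sum f K \<in> to_ac ` R" if "\<And>i. i \<in> K \<Longrightarrow> f i \<in> to_ac ` R" for f and K :: "nat set"
      using that by (induction K rule: infinite_finite_induct) (auto intro: im im0)
    have "Determinant.det (char_poly_matrix A) \<in> S"
    proof (rule det_in_subring)
      show "char_poly_matrix A \<in> carrier_mat n n" using A by simp
      show "char_poly_matrix A $$ (i, j) \<in> S" if "i < n" "j < n" for i j
        using that A hI im0 im(3) C(2) unfolding S_def char_poly_matrix_def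
        by (auto simp: A_def coeff_pCons split: nat.splits simp flip: to_ac_minus simp del: to_ac_minus intro!: imageI R_uminus)
      show "0 \<in> S" "1 \<in> S" using im0 by (auto simp: S_def)
      show "x + y \<in> S" if "x \<in> S" "y \<in> S" for x y using that im by (auto simp: S_def)
      show "- x \<in> S" if "x \<in> S" for x using that im(3) unfolding S_def coeff_minus mem_Collect_eq by blast
      show "x * y \<in> S" if "x \<in> S" "y \<in> S" for x y using that im by (auto simp: S_def coeff_mult intro!: ims)
    qed
    thus ?thesis by (simp add: S_def char_poly_def)
  qed
  ultimately show ?thesis unfolding integers_ac_def by blast
qed

lemma power_in_Rspan_step:
  assumes "x ^ n \<in> Rspan {..<n} (\<lambda>i. x ^ i)" "i < n"
  shows "x * x ^ i \<in> Rspan {..<n} (\<lambda>i. x ^ i)"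
proof (cases "Suc i = n")
  case True
  thus ?thesis using assms by auto
next
  case False
  thus ?thesis using Rspan_base[of "{..<n}" "Suc i" "\<lambda>i. x ^ i"] assms by simp
qed

text \<open>The products \<open>x ^ i * y ^ j\<close> span a finite module that is stable under
  \<open>x\<close> and under \<open>y\<close>, hence under their sum and product.\<close>

lemma
  assumes x: "x \<in> Oac" and y: "y \<in> Oac"
  shows Oac_add: "x + y \<in> Oac" and Oac_mult: "x * y \<in> Oac"
proof -
  obtain n where n: "x ^ n \<in> Rspan {..<n} (\<lambda>i. x ^ i)" using x integers_ac_iff by blast
  obtain m where m: "y ^ m \<in> Rspan {..<m} (\<lambda>i. y ^ i)" using y integers_ac_iff by blast
  define I where "I = {..<n} \<times> {..<m}"
  define w where "w = (\<lambda>(i, j). x ^ i * y ^ j)"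
  have fin: "finite I" by (simp add: I_def)
  have "n \<noteq> 0" "m \<noteq> 0" using n m by (auto simp: Rspan_def intro!: Nat.gr0I)
  hence i0: "(0, 0) \<in> I" "w (0, 0) \<noteq> 0" by (auto simp: I_def w_def)
  have xm: "x * w p \<in> Rspan I w" if p: "p \<in> I" for p
  proof -
    obtain i j where ij: "p = (i, j)" "i < n" "j < m" using p by (auto simp: I_def)
    have "y ^ j * (x * x ^ i) \<in> Rspan I w"
    proof (rule mult_Rspan_closed[OF power_in_Rspan_step[OF n ij(2)]])
      show "y ^ j * x ^ k \<in> Rspan I w" if "k \<in> {..<n}" for k
        using Rspan_base[OF fin, of "(k, j)" w] that ij by (simp add: I_def w_def mult.commute)
    qed
    thus ?thesis by (simp add: ij(1) w_def mult_ac)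
  qed
  have ym: "y * w p \<in> Rspan I w" if p: "p \<in> I" for p
  proof -
    obtain i j where ij: "p = (i, j)" "i < n" "j < m" using p by (auto simp: I_def)
    have "x ^ i * (y * y ^ j) \<in> Rspan I w"
    proof (rule mult_Rspan_closed[OF power_in_Rspan_step[OF m ij(3)]])
      show "x ^ i * y ^ k \<in> Rspan I w" if "k \<in> {..<m}" for k
        using Rspan_base[OF fin, of "(i, k)" w] that ij by (simp add: I_def w_def mult.commute)
    qed
    thus ?thesis by (simp add: ij(1) w_def mult_ac)
  qed
  show "x + y \<in> Oac"
    by (rule integral_if_Rspan_stable[where w = w, OF fin i0]) (use xm ym in \<open>auto simp: distrib_right intro: Rspan_add\<close>)
  show "x * y \<in> Oac"
    by (rule integral_if_Rspan_stable[where w = w, OF fin i0]) (simp only: mult.assoc mult_Rspan_closed[OF ym xm])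
qed

lemma Oac_to_ac: "a \<in> R \<Longrightarrow> to_ac a \<in> Oac"
proof (subst integers_ac_iff, intro exI[of _ 1])
  assume "a \<in> R"
  hence "to_ac a * 1 \<in> Rspan {..<1::nat} (\<lambda>i. to_ac a ^ i)"
    using Rspan_base[of "{..<1::nat}" 0 "\<lambda>i. to_ac a ^ i"] by (intro Rspan_smult) auto
  thus "to_ac a ^ 1 \<in> Rspan {..<1} (\<lambda>i. to_ac a ^ i)" by simp
qed

lemma Oac_0 [simp]: "0 \<in> Oac" and Oac_1 [simp]: "1 \<in> Oac"
  using Oac_to_ac[of 0] Oac_to_ac[of 1] by auto

lemma Oac_uminus: "x \<in> Oac \<Longrightarrow> - x \<in> Oac"
  using Oac_mult[of "to_ac (-1)" x] Oac_to_ac[of "-1"] by (simp add: R_uminus)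

lemma Oac_diff: "x \<in> Oac \<Longrightarrow> y \<in> Oac \<Longrightarrow> x - y \<in> Oac"
  using Oac_add[of x "- y"] Oac_uminus[of y] by simp

lemma Oac_power: "x \<in> Oac \<Longrightarrow> x ^ n \<in> Oac"
  by (induction n) (auto intro: Oac_mult)

lemma Oac_sum: "(\<And>i. i \<in> I \<Longrightarrow> f i \<in> Oac) \<Longrightarrow> (\<Sum>i\<in>I. f i) \<in> Oac"
  by (induction I rule: infinite_finite_induct) (auto intro: Oac_add)

lemma Oac_Rspan: "x \<in> Rspan I w \<Longrightarrow> (\<And>i. i \<in> I \<Longrightarrow> w i \<in> Oac) \<Longrightarrow> x \<in> Oac"
  by (auto simp: Rspan_def intro!: Oac_sum Oac_mult Oac_to_ac)

lemma Oac_root: 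
  assumes "x ^ n \<in> Oac" "n > 0"
  shows "x \<in> Oac"
proof -
  obtain m where m: "(x ^ n) ^ m \<in> Rspan {..<m} (\<lambda>i. (x ^ n) ^ i)" using assms integers_ac_iff by blast
  have "Rspan {..<m} (\<lambda>i. (x ^ n) ^ i) \<subseteq> Rspan {..<n * m} (\<lambda>i. x ^ i)"
  proof
    fix z assume "z \<in> Rspan {..<m} (\<lambda>i. (x ^ n) ^ i)"
    then obtain c where "z = (\<Sum>i<m. to_ac (c i) * (x ^ n) ^ i)" "\<forall>i. c i \<in> R" by (auto simp: Rspan_def)
    moreover have "(x ^ n) ^ i \<in> Rspan {..<n * m} (\<lambda>i. x ^ i)" if "i < m" for i
      using Rspan_base[of "{..<n * m}" "n * i" "\<lambda>i. x ^ i"] that assms(2) by (simp add: power_mult)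
    ultimately show "z \<in> Rspan {..<n * m} (\<lambda>i. x ^ i)" by (auto intro!: Rspan_sum Rspan_smult)
  qed
  hence "x ^ (n * m) \<in> Rspan {..<n * m} (\<lambda>i. x ^ i)" using m by (auto simp: power_mult)
  thus ?thesis using integers_ac_iff[of x] by blast
qed

text \<open>The valuation ring is integrally closed: if \<open>v a > 1\<close>, division of the
  equation of \<open>a\<close> by \<open>a ^ (n - 1)\<close> expresses \<open>a\<close> through
  powers of \<open>inverse a\<close>, which lie in \<open>R\<close>.\<close>

lemma Oac_to_ac_iff: "to_ac a \<in> Oac \<longleftrightarrow> a \<in> R"
proof
  assume "to_ac a \<in> Oac"
  then obtain n c where c: "to_ac a ^ n = (\<Sum>i<n. to_ac (c i) * to_ac a ^ i)" "\<And>i. c i \<in> R"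
    by (auto simp: integers_ac_iff Rspan_def)
  have "to_ac (a ^ n) = to_ac (\<Sum>i<n. c i * a ^ i)" unfolding to_ac_sum using c(1) by simp
  hence eq: "a ^ n = (\<Sum>i<n. c i * a ^ i)" by (simp only: to_ac_eq_iff)
  show "a \<in> R"
  proof (rule ccontr)
    assume "a \<notin> R"
    hence va: "v a > 1" by (simp add: R_iff)
    hence a0: "a \<noteq> 0" by auto
    have inv: "inverse a \<in> R" using va by (simp add: R_iff v_inverse inverse_le_1_iff)
    have n: "n > 0" using eq by (auto intro!: Nat.gr0I)
    have "a = inverse a ^ (n - 1) * a ^ n"
      using a0 n by (cases n) (auto simp: field_simps)
    also have "\<dots> = (\<Sum>i<n. c i * inverse a ^ (n - 1 - i))"
      unfolding eq sum_distrib_left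
    proof (intro sum.cong refl)
      fix i assume "i \<in> {..<n}"
      hence "inverse a ^ (n - 1) = inverse a ^ (n - 1 - i) * inverse a ^ i" by (simp flip: power_add)
      thus "inverse a ^ (n - 1) * (c i * a ^ i) = c i * inverse a ^ (n - 1 - i)"
        using a0 by (simp add: field_simps)
    qed
    also have "\<dots> \<in> R" using c(2) inv by (intro R_sum R_mult R_power)
    finally show False using \<open>a \<notin> R\<close> by simp
  qed
qed (rule Oac_to_ac)


section \<open>Divisibility by the uniformizer in the integral closure\<close>

abbreviation pi :: "'a alg_closure" where "pi \<equiv> to_ac unif"

lemma pi_Oac [simp]: "pi \<in> Oac"
  by (rule Oac_to_ac) simp

lemma inverse_in_R: "v a = 1 \<Longrightarrow> inverse a \<in> R"
  by (simp add: R_iff v_inverse)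

text \<open>The equation of \<open>t = pi * z\<close> has all its lower coefficients
  \<open>d i\<close> divisible by \<open>unif\<close>. Evaluated at -1 instead of \<open>t\<close>,
  it gives \<open>a\<close> of absolute value 1. Since \<open>t ^ k - (-1) ^ k\<close> is a multiple
  of \<open>1 + t\<close>, so is \<open>a\<close>, and this inverts \<open>1 + t\<close>.\<close>

lemma one_plus_pi_mult_unit:
  assumes z: "z \<in> Oac"
  shows "1 + pi * z \<noteq> 0" "inverse (1 + pi * z) \<in> Oac"
proof -
  obtain n c where c: "z ^ n = (\<Sum>i<n. to_ac (c i) * z ^ i)" "\<And>i. c i \<in> R"
    using z unfolding integers_ac_iff Rspan_def by blast
  define t where "t = pi * z"
  define w where "w = 1 + t"
  define d where "d i = c i * unif ^ (n - i)" for i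
  have t: "t \<in> Oac" using z by (simp add: t_def Oac_mult)
  have "t ^ n = pi ^ n * (\<Sum>i<n. to_ac (c i) * z ^ i)" by (simp add: t_def power_mult_distrib c(1))
  also have "\<dots> = (\<Sum>i<n. to_ac (d i) * t ^ i)"
    unfolding sum_distrib_left
  proof (intro sum.cong refl)
    fix i assume "i \<in> {..<n}"
    hence "pi ^ n = pi ^ (n - i) * pi ^ i" by (simp flip: power_add)
    thus "pi ^ n * (to_ac (c i) * z ^ i) = to_ac (d i) * t ^ i"
      by (simp only: d_def t_def power_mult_distrib to_ac_mult to_ac_power mult_ac)
  qed
  finally have tn: "t ^ n = (\<Sum>i<n. to_ac (d i) * t ^ i)" .
  define h where "h k = (\<Sum>i<k. (-1) ^ (k - Suc i) * t ^ i)" for k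
  have h: "t ^ k - (-1) ^ k = w * h k" for k
    unfolding h_def w_def using power_diff_sumr2[of t k "-1"] by (simp add: add.commute)
  have hO: "h k \<in> Oac" for k
    unfolding h_def using t by (intro Oac_sum Oac_mult Oac_power Oac_uminus) auto
  define a where "a = (-1) ^ n - (\<Sum>i<n. d i * (-1) ^ i)"
  define H where "H = (\<Sum>i<n. to_ac (d i) * h i) - h n"
  have "to_ac a = (-1) ^ n - (\<Sum>i<n. to_ac (d i) * (-1) ^ i)" by (simp add: a_def to_ac_sum)
  also have "\<dots> = ((-1) ^ n - t ^ n) - (\<Sum>i<n. to_ac (d i) * ((-1) ^ i - t ^ i))"
    using tn by (simp add: sum_subtractf right_diff_distrib)
  also have "\<dots> = (\<Sum>i<n. to_ac (d i) * (t ^ i - (-1) ^ i)) - (t ^ n - (-1) ^ n)"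
    by (simp add: sum_subtractf right_diff_distrib)
  also have "\<dots> = w * H" unfolding h H_def by (simp add: sum_distrib_left right_diff_distrib mult_ac)
  finally have aw: "to_ac a = w * H" .
  have dR: "d i / unif \<in> R" if "i < n" for i
  proof -
    have "d i / unif = c i * unif ^ (n - Suc i)"
      using that by (simp add: d_def Suc_diff_Suc[symmetric] del: diff_Suc_Suc)
    thus ?thesis using c(2) by (simp add: R_mult R_power)
  qed
  have va: "v a = 1"
  proof -
    define b where "b = (\<Sum>i<n. d i / unif * (-1) ^ i)"
    have bR: "b \<in> R" unfolding b_def using dR by (intro R_sum R_mult R_power R_uminus) auto
    have ab: "(-1) ^ n = a + unif * b" by (simp add: a_def b_def sum_distrib_left)
    have ub: "v (unif * b) < 1" using bR unif by (simp add: mult R_iff) (smt (verit) mult_left_le)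
    have "v ((-1) ^ n) = 1" by simp
    hence "1 \<le> max (v a) (v (unif * b))" using ultrametric[of a "unif * b"] ab by simp
    hence "1 \<le> v a" using ub by simp
    moreover have "a = (-1) ^ n - unif * b" using ab by simp
    hence "v a \<le> max 1 (v (unif * b))" using v_diff[of "(-1) ^ n" "unif * b"] by simp
    ultimately show ?thesis using ub by simp
  qed
  hence "a \<noteq> 0" by auto
  hence "w \<noteq> 0" using aw by auto
  thus "1 + pi * z \<noteq> 0" by (simp add: w_def t_def)
  have "w * (H * to_ac (inverse a)) = 1"
    using \<open>a \<noteq> 0\<close> by (simp flip: mult.assoc aw)
  hence "inverse w = H * to_ac (inverse a)" by (rule inverse_unique)
  moreover have "H \<in> Oac"
  proof -
    have "d i \<in> R" for i using c(2) by (simp add: d_def R_mult R_power)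
    thus ?thesis unfolding H_def using hO by (intro Oac_diff Oac_sum Oac_mult Oac_to_ac) auto
  qed
  ultimately have "inverse w \<in> Oac" using Oac_to_ac[OF inverse_in_R[OF va]] by (simp add: Oac_mult)
  thus "inverse (1 + pi * z) \<in> Oac" by (simp add: w_def t_def)
qed

text \<open>Clearing denominators: in the equation of \<open>pi ^ a * z\<close> the coefficient of
  degree \<open>i\<close> gains the factor \<open>unif ^ (a * (n - i))\<close>.\<close>

lemma pi_power_mult_in_Oac: "\<exists>a. pi ^ a * z \<in> Oac"
proof -
  obtain p where p: "p \<noteq> 0" "poly (map_poly to_ac p) z = 0" by (rule alg_closure_algebraic)
  define n where "n = Polynomial.degree p"
  define b where "b i = Polynomial.coeff p i / Polynomial.coeff p n" for i
  have lc: "Polynomial.coeff p n \<noteq> 0" using p(1) by (simp add: n_def)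
  have "\<exists>a. \<forall>i<m. unif ^ a * b i \<in> R" for m
  proof (induction m)
    case (Suc m)
    then obtain a where a: "\<And>i. i < m \<Longrightarrow> unif ^ a * b i \<in> R" by blast
    obtain k where k: "unif ^ k * b m \<in> R" using unif_power_mult_in_R by blast
    have "unif ^ (a + k) * b i \<in> R" if "i < Suc m" for i
    proof (cases "i = m")
      case True
      have "unif ^ (a + k) * b i = unif ^ a * (unif ^ k * b m)" using True by (simp add: power_add)
      thus ?thesis using k by (simp add: R_mult R_power)
    next
      case False
      have eq: "unif ^ (a + k) * b i = unif ^ k * (unif ^ a * b i)" by (simp only: power_add mult_ac)
      show ?thesis unfolding eq by (intro R_mult R_power unif_R a) (use that False in simp)
    qed
    thus ?case by blast
  qed auto
  then obtain a where a: "\<And>i. i < n \<Longrightarrow> unif ^ a * b i \<in> R" by blast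
  define y where "y = pi ^ a * z"
  define c where "c i = (if i < n then - (unif ^ (a * (n - i)) * b i) else 0)" for i
  have cR: "c i \<in> R" for i
  proof (cases "i < n")
    case True
    have "n - i = Suc (n - Suc i)" using True by simp
    hence "unif ^ (a * (n - i)) = unif ^ (a * (n - Suc i)) * unif ^ a"
      by (simp only: mult_Suc_right power_add mult.commute)
    hence "c i = - (unif ^ (a * (n - Suc i)) * (unif ^ a * b i))" using True by (simp add: c_def)
    thus ?thesis using a[OF True] by (simp add: R_mult R_power R_uminus)
  qed (simp add: c_def)
  have "0 = (\<Sum>i\<le>n. to_ac (Polynomial.coeff p i) * z ^ i)"
    using p(2) by (simp add: poly_altdef coeff_map_poly degree_map_poly n_def)
  also have "{..n} = insert n {..<n}" by auto
  also have "(\<Sum>i\<in>\<dots>. to_ac (Polynomial.coeff p i) * z ^ i) =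
      to_ac (Polynomial.coeff p n) * z ^ n + (\<Sum>i<n. to_ac (Polynomial.coeff p i) * z ^ i)" by simp
  finally have "to_ac (Polynomial.coeff p n) * z ^ n + (\<Sum>i<n. to_ac (Polynomial.coeff p i) * z ^ i) = 0" by (rule sym)
  hence e1: "to_ac (Polynomial.coeff p n) * z ^ n = - (\<Sum>i<n. to_ac (Polynomial.coeff p i) * z ^ i)"
    by (simp only: eq_neg_iff_add_eq_0)
  have zn: "z ^ n = - (\<Sum>i<n. to_ac (b i) * z ^ i)"
  proof -
    have "z ^ n = (to_ac (Polynomial.coeff p n) * z ^ n) / to_ac (Polynomial.coeff p n)" using lc by simp
    also have "\<dots> = - (\<Sum>i<n. to_ac (b i) * z ^ i)"
      unfolding e1 by (simp add: b_def sum_divide_distrib)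
    finally show ?thesis .
  qed
  have "y ^ n = pi ^ (a * n) * z ^ n" by (simp add: y_def power_mult_distrib power_mult)
  also have "\<dots> = (\<Sum>i<n. to_ac (c i) * y ^ i)"
    unfolding zn mult_minus_right sum_distrib_left sum_negf[symmetric]
  proof (intro sum.cong refl)
    fix i assume i: "i \<in> {..<n}"
    hence "a * n = a * (n - i) + a * i" by (simp flip: distrib_left)
    hence "pi ^ (a * n) = pi ^ (a * (n - i)) * pi ^ (a * i)" by (simp flip: power_add)
    thus "- (pi ^ (a * n) * (to_ac (b i) * z ^ i)) = to_ac (c i) * y ^ i"
      using i by (simp add: c_def y_def power_mult_distrib power_mult mult_ac)
  qed
  finally have "y ^ n \<in> Rspan {..<n} (\<lambda>i. y ^ i)" using cR unfolding Rspan_def by blast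
  hence "y \<in> Oac" unfolding integers_ac_iff by blast
  thus ?thesis unfolding y_def by blast
qed

lemma pi_not_unit: "inverse pi \<notin> Oac"
proof
  assume "inverse pi \<in> Oac"
  hence "to_ac (inverse unif) \<in> Oac" by simp
  hence "inverse (v unif) \<le> 1" by (simp only: Oac_to_ac_iff R_iff v_inverse)
  thus False using unif(1,2) by (simp add: inverse_le_1_iff)
qed

text \<open>Turns congruences modulo all powers of the uniformizer into equalities. For
  \<open>w \<noteq> 0\<close> some \<open>pi ^ a * inverse w\<close> is integral, and divisibility
  of \<open>w\<close> by \<open>pi ^ Suc a\<close> would make \<open>inverse pi\<close>
  integral.\<close>

lemma Oac_separated:
  assumes "\<And>k. \<exists>z\<in>Oac. w = pi ^ k * z"
  shows "w = 0"
proof (rule ccontr)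
  assume w: "w \<noteq> 0"
  obtain a where a: "pi ^ a * inverse w \<in> Oac" using pi_power_mult_in_Oac by blast
  obtain z where z: "z \<in> Oac" "w = pi ^ Suc a * z" using assms by blast
  have "z \<noteq> 0" using z w by auto
  have "(pi ^ a * inverse w) * z = inverse pi" unfolding z(2) using \<open>z \<noteq> 0\<close> by (simp add: field_simps)
  thus False using pi_not_unit Oac_mult[OF a z(1)] by simp
qed

section \<open>Powers modulo the uniformizer and locality of the integral closure\<close>

lemma residue_classes_eq_imp:
  assumes "a \<in> R" "b \<in> R"
    and "{(x, y). x \<in> R \<and> y \<in> R \<and> v (x - y) < 1} `` {a} = {(x, y). x \<in> R \<and> y \<in> R \<and> v (x - y) < 1} `` {b}"
  shows "v (a - b) < 1"
proof -
  have "b \<in> {(x, y). x \<in> R \<and> y \<in> R \<and> v (x - y) < 1} `` {b}" using assms(2) by simp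
  thus ?thesis unfolding assms(3)[symmetric] by simp
qed

text \<open>The coefficients are read modulo \<open>unif\<close>. There are finitely many tuples of
  residue classes, so two powers of \<open>x\<close> share one.\<close>

lemma power_pigeonhole:
  fixes n :: nat
  assumes "\<And>k. x ^ k \<in> Rspan {..<n} w"
  shows "\<exists>A B. A < B \<and> (\<exists>s\<in>Rspan {..<n} w. x ^ A - x ^ B = pi * s)"
proof -
  have "\<forall>k. \<exists>c. x ^ k = (\<Sum>i<n. to_ac (c i) * w i) \<and> (\<forall>i. c i \<in> R)"
    using assms unfolding Rspan_def by blast
  from choice[OF this] obtain c where c: "\<And>k. x ^ k = (\<Sum>i<n. to_ac (c k i) * w i)" "\<And>k i. c k i \<in> R" by blast
  let ?r = "{(x, y). x \<in> R \<and> y \<in> R \<and> v (x - y) < 1}"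
  define g where "g k = restrict (\<lambda>i. ?r `` {c k i}) {..<n}" for k
  have "g k \<in> {..<n} \<rightarrow>\<^sub>E residue_classes v" for k
  proof (rule PiE_I)
    show "g k i \<in> residue_classes v" if "i \<in> {..<n}" for i
      using that quotientI[OF c(2)[of k i], of ?r] by (simp add: g_def residue_classes_def)
  qed (simp add: g_def)
  hence "range g \<subseteq> {..<n} \<rightarrow>\<^sub>E residue_classes v" by blast
  hence fin: "finite (range g)"
    by (rule finite_subset) (simp add: finite_PiE finite_residue_field)
  have "\<not> inj g"
  proof
    assume "inj g"
    from finite_imageD[OF fin this] show False by simp
  qed
  then obtain A B where AB: "g A = g B" "A \<noteq> B" unfolding inj_def by blast
  have "\<exists>s\<in>Rspan {..<n} w. x ^ A - x ^ B = pi * s" if AB: "g A = g B" for A B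
  proof -
    have d: "(c A i - c B i) / unif \<in> R" if i: "i < n" for i
    proof (rule v_less_1_imp_div_unif, rule residue_classes_eq_imp)
      show "?r `` {c A i} = ?r `` {c B i}" using fun_cong[OF AB, of i] i by (simp add: g_def)
    qed (use c in auto)
    define e where "e i = (if i < n then (c A i - c B i) / unif else 0)" for i
    have "x ^ A - x ^ B = (\<Sum>i<n. to_ac (c A i - c B i) * w i)"
      by (simp add: c(1) sum_subtractf left_diff_distrib)
    also have "\<dots> = pi * (\<Sum>i<n. to_ac (e i) * w i)"
      unfolding sum_distrib_left by (intro sum.cong refl) (simp add: e_def)
    finally have "x ^ A - x ^ B = pi * (\<Sum>i<n. to_ac (e i) * w i)" .
    moreover have "e i \<in> R" for i using d by (simp add: e_def)
    hence "(\<Sum>i<n. to_ac (e i) * w i) \<in> Rspan {..<n} w" unfolding Rspan_def by blast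
    ultimately show ?thesis by blast
  qed
  from this[OF AB(1)] this[OF AB(1)[symmetric]] show ?thesis using AB(2) by (cases A B rule: linorder_cases) blast+
qed

lemma Rspan_powers_mult:
  assumes n: "x ^ n \<in> Rspan {..<n} (\<lambda>i. x ^ i)"
    and ab: "a \<in> Rspan {..<n} (\<lambda>i. x ^ i)" "b \<in> Rspan {..<n} (\<lambda>i. x ^ i)"
  shows "a * b \<in> Rspan {..<n} (\<lambda>i. x ^ i)"
proof -
  have x1: "x * a \<in> Rspan {..<n} (\<lambda>i. x ^ i)" if "a \<in> Rspan {..<n} (\<lambda>i. x ^ i)" for a
    using that by (rule mult_Rspan_closed) (use power_in_Rspan_step[OF n] in auto)
  have "x ^ i * a \<in> Rspan {..<n} (\<lambda>i. x ^ i)" for i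
    by (induction i) (use ab x1 in \<open>auto simp: mult.assoc\<close>)
  hence "a * x ^ i \<in> Rspan {..<n} (\<lambda>i. x ^ i)" for i by (simp add: mult.commute)
  with ab(2) show ?thesis by (intro mult_Rspan_closed[of b]) auto
qed


text \<open>Powers become periodic from the exponent \<open>A\<close> on: the given difference is
  multiplied by \<open>x ^ (j + k * d)\<close>, and the differences telescope.\<close>

lemma ring_power_congruence:
  fixes x u :: "'b::comm_ring_1"
  assumes S: "\<And>a b. a \<in> S \<Longrightarrow> b \<in> S \<Longrightarrow> a + b \<in> S" "\<And>a b. a \<in> S \<Longrightarrow> b \<in> S \<Longrightarrow> a * b \<in> S" "0 \<in> S" "x \<in> S" "1 \<in> S"
    and AB: "x ^ A - x ^ (A + d) = u * s" "s \<in> S"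
  shows "\<exists>s\<in>S. x ^ (A + j) - x ^ (A + j + k * d) = u * s"
proof -
  have xp: "x ^ i \<in> S" for i by (induction i) (use S in auto)
  show ?thesis
  proof (induction k)
    case (Suc k)
    then obtain t where t: "t \<in> S" "x ^ (A + j) - x ^ (A + j + k * d) = u * t" by blast
    have "x ^ (A + j + k * d) - x ^ (A + j + Suc k * d) = x ^ (j + k * d) * (x ^ A - x ^ (A + d))"
      by (simp add: power_add algebra_simps)
    also have "\<dots> = u * (x ^ (j + k * d) * s)" unfolding AB(1) by (simp only: mult_ac)
    finally have e: "x ^ (A + j + k * d) - x ^ (A + j + Suc k * d) = u * (x ^ (j + k * d) * s)" .
    have "x ^ (A + j) - x ^ (A + j + Suc k * d) =
      (x ^ (A + j) - x ^ (A + j + k * d)) + (x ^ (A + j + k * d) - x ^ (A + j + Suc k * d))" by simp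
    also have "\<dots> = u * (t + x ^ (j + k * d) * s)" unfolding t(2) e by (simp only: distrib_left)
    finally show ?case using t(1) AB(2) xp S by blast
  qed (use S in \<open>auto intro!: bexI[of _ 0]\<close>)
qed

text \<open>Idempotents of the finite ring \<open>S / unif S\<close> lift to the complete ring \<open>S = R[x]\<close>, which is a
  domain; so a large power of \<open>x\<close> is congruent to 0 or 1.\<close>

lemma power_congruent_0_or_1:
  assumes x: "x \<in> Oac"
  shows "\<exists>M>0. \<exists>s\<in>Oac. x ^ M = pi * s \<or> x ^ M = 1 + pi * s"
proof -
  obtain n where n: "x ^ n \<in> Rspan {..<n} (\<lambda>i. x ^ i)" using x integers_ac_iff by blast
  define S where "S = Rspan {..<n} (\<lambda>i. x ^ i)"
  have n0: "n > 0" using n by (auto simp: Rspan_def intro!: Nat.gr0I)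
  have S1: "1 \<in> S" using Rspan_base[of "{..<n}" 0 "\<lambda>i. x ^ i"] n0 by (simp add: S_def)
  have Sx: "x \<in> S" using power_in_Rspan_step[OF n n0] by (simp add: S_def)
  have Smult: "a * b \<in> S" if "a \<in> S" "b \<in> S" for a b
    using Rspan_powers_mult[OF n] that by (simp add: S_def)
  have Sadd: "a + b \<in> S" if "a \<in> S" "b \<in> S" for a b using that by (simp add: S_def Rspan_add)
  have Sdiff: "a - b \<in> S" if "a \<in> S" "b \<in> S" for a b using that by (simp add: S_def Rspan_diff)
  have Suminus: "- a \<in> S" if "a \<in> S" for a using that by (simp add: S_def Rspan_uminus)
  have S0: "0 \<in> S" by (simp add: S_def Rspan_0)
  have SO: "a \<in> Oac" if "a \<in> S" for a using Oac_Rspan that x by (auto simp: S_def intro: Oac_power)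
  have Ssm: "to_ac c * a \<in> S" if "a \<in> S" "c \<in> R" for a c using that by (simp add: S_def Rspan_smult)
  have Sp: "a ^ k \<in> S" if "a \<in> S" for a k by (induction k) (use S1 Smult that in auto)
  have Sofnat: "of_nat k \<in> S" for k by (induction k) (use S0 S1 Sadd in auto)
  have Snum: "numeral k \<in> S" for k using Sofnat[of "numeral k"] by simp
  have "x ^ k \<in> Rspan {..<n} (\<lambda>i. x ^ i)" for k using Sp[OF Sx, of k] by (simp add: S_def)
  then obtain A B s0 where AB: "A < B" "s0 \<in> S" "x ^ A - x ^ B = pi * s0"
    using power_pigeonhole[of x n "\<lambda>i. x ^ i"] by (auto simp: S_def)
  define d where "d = B - A"
  have d: "d > 0" "B = A + d" using AB by (auto simp: d_def)
  \<comment> \<open>A multiple of the period \<open>d\<close> that is at least \<open>A\<close>: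
    then \<open>x ^ M\<close> and \<open>x ^ (2 * M)\<close> are congruent, and \<open>e\<close> is
    idempotent modulo the uniformizer.\<close>
  define M where "M = d * (A + 1)"
  have "1 * (A + 1) \<le> d * (A + 1)" using d by (intro mult_le_mono1) simp
  hence "M \<ge> A" "M > 0" using d(1) by (simp_all add: M_def)
  define e where "e = x ^ M"
  have eS: "e \<in> S" using Sx Sp by (simp add: e_def)
  obtain s1 where s1: "s1 \<in> S" "e - e ^ 2 = pi * s1"
  proof -
    have "\<exists>s\<in>S. x ^ (A + (M - A)) - x ^ (A + (M - A) + (A + 1) * d) = pi * s"
      using AB d by (intro ring_power_congruence[where s = s0] Sadd Smult S0 S1 Sx) auto
    moreover have "A + (M - A) = M" using \<open>M \<ge> A\<close> by simp
    moreover have "M + (A + 1) * d = M * 2" by (simp add: M_def mult.commute)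
    ultimately show ?thesis using that unfolding e_def power_mult[symmetric] by metis
  qed
  \<comment> \<open>Newton iteration for idempotents. The new error is the square of the old one
    \<open>y ^ 2 - y\<close> times \<open>4 * (y ^ 2 - y) - 3\<close>, so each step gains at least
    one power of the uniformizer.\<close>
  define E where "E = rec_nat e (\<lambda>_ y. 3 * y ^ 2 - 2 * y ^ 3)"
  have E0: "E 0 = e" and ES: "E (Suc k) = 3 * E k ^ 2 - 2 * E k ^ 3" for k by (simp_all add: E_def)
  have inv: "E k \<in> S \<and> (\<exists>s\<in>S. E k ^ 2 - E k = pi ^ Suc k * s)" for k
  proof (induction k)
    case 0
    have "E 0 ^ 2 - E 0 = pi ^ Suc 0 * (- s1)" using s1(2) by (simp add: E0 algebra_simps)
    thus ?case using eS Suminus[OF s1(1)] unfolding E0 by blast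
  next
    case (Suc k)
    then obtain s where s: "E k \<in> S" "s \<in> S" "E k ^ 2 - E k = pi ^ Suc k * s" by blast
    have "E (Suc k) ^ 2 - E (Suc k) = (E k ^ 2 - E k) ^ 2 * (4 * (E k ^ 2 - E k) - 3)"
      unfolding ES by (simp add: power2_eq_square power3_eq_cube algebra_simps)
    also have "\<dots> = pi ^ Suc (Suc k) * (pi ^ k * s ^ 2 * (4 * (E k ^ 2 - E k) - 3))"
      unfolding s(3) by (simp add: power2_eq_square algebra_simps)
    finally have "E (Suc k) ^ 2 - E (Suc k) = pi ^ Suc (Suc k) * (pi ^ k * s ^ 2 * (4 * (E k ^ 2 - E k) - 3))" .
    moreover have "pi \<in> S" using Ssm[OF S1 unif_R] by simp
    hence "pi ^ k * s ^ 2 * (4 * (E k ^ 2 - E k) - 3) \<in> S"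
      using s by (intro Smult Sdiff Sp Snum)
    moreover have "E (Suc k) \<in> S" unfolding ES using s by (intro Smult Sdiff Sp Snum)
    ultimately show ?case by blast
  qed
  have "\<forall>k. \<exists>a. E (Suc k) - E k = pi ^ Suc k * (\<Sum>i<n. to_ac (a i) * x ^ i) \<and> (\<forall>i. a i \<in> R)"
  proof
    fix k
    obtain s where s: "E k \<in> S" "s \<in> S" "E k ^ 2 - E k = pi ^ Suc k * s" using inv[of k] by blast
    have "E (Suc k) - E k = (E k ^ 2 - E k) * (1 - 2 * E k)" unfolding ES by (simp add: power2_eq_square power3_eq_cube algebra_simps)
    also have "\<dots> = pi ^ Suc k * (s * (1 - 2 * E k))" unfolding s(3) by (simp only: mult.assoc)
    finally have 1: "E (Suc k) - E k = pi ^ Suc k * (s * (1 - 2 * E k))" .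
    have "s * (1 - 2 * E k) \<in> S" using s by (intro Smult Sdiff S1 Snum)
    then obtain a where "s * (1 - 2 * E k) = (\<Sum>i<n. to_ac (a i) * x ^ i)" "\<forall>i. a i \<in> R"
      unfolding S_def Rspan_def by blast
    thus "\<exists>a. E (Suc k) - E k = pi ^ Suc k * (\<Sum>i<n. to_ac (a i) * x ^ i) \<and> (\<forall>i. a i \<in> R)"
      using 1 by auto
  qed
  from choice[OF this] obtain a where a: "\<And>k. E (Suc k) - E k = pi ^ Suc k * (\<Sum>i<n. to_ac (a k i) * x ^ i)"
    "\<And>k i. a k i \<in> R" by blast
  \<comment> \<open>The limit is taken coefficientwise: the increments of the iteration are expanded
    in powers of \<open>x\<close>, and each series of coefficients converges in the base
    field.\<close>
  have "\<forall>i. \<exists>c. \<forall>K. \<exists>b\<in>R. c = (\<Sum>k<K. unif ^ k * (unif * a k i)) + unif ^ K * b"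
    using a(2) by (intro allI unif_adic_series) (auto intro: R_mult)
  from choice[OF this] obtain c where c: "\<And>i K. \<exists>b\<in>R. c i = (\<Sum>k<K. unif ^ k * (unif * a k i)) + unif ^ K * b"
    by blast
  define L where "L = e + (\<Sum>i<n. to_ac (c i) * x ^ i)"
  have LE: "\<exists>s\<in>S. L = E K + pi ^ K * s" for K
  proof -
    have "\<forall>i. \<exists>b. b \<in> R \<and> c i = (\<Sum>k<K. unif ^ k * (unif * a k i)) + unif ^ K * b" using c by blast
    from choice[OF this] obtain b where b: "\<And>i. b i \<in> R"
       "\<And>i. c i = (\<Sum>k<K. unif ^ k * (unif * a k i)) + unif ^ K * b i" by blast
    have "(\<Sum>i<n. to_ac (c i) * x ^ i) = (\<Sum>i<n. \<Sum>k<K. pi ^ Suc k * (to_ac (a k i) * x ^ i)) + (\<Sum>i<n. pi ^ K * (to_ac (b i) * x ^ i))"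
      unfolding sum.distrib[symmetric]
    proof (intro sum.cong refl)
      fix i
      have "to_ac (c i) = (\<Sum>k<K. pi ^ Suc k * to_ac (a k i)) + pi ^ K * to_ac (b i)"
        unfolding b(2) by (simp add: to_ac_sum mult_ac)
      thus "to_ac (c i) * x ^ i = (\<Sum>k<K. pi ^ Suc k * (to_ac (a k i) * x ^ i)) + pi ^ K * (to_ac (b i) * x ^ i)"
        by (simp add: distrib_right sum_distrib_right mult.assoc)
    qed
    also have "(\<Sum>i<n. \<Sum>k<K. pi ^ Suc k * (to_ac (a k i) * x ^ i)) = (\<Sum>k<K. E (Suc k) - E k)"
      by (subst sum.swap) (simp add: a(1) sum_distrib_left)
    also have "\<dots> = E K - e" using sum_lessThan_telescope[of E K] E0 by simp
    also have "(\<Sum>i<n. pi ^ K * (to_ac (b i) * x ^ i)) = pi ^ K * (\<Sum>i<n. to_ac (b i) * x ^ i)"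
      by (simp add: sum_distrib_left)
    finally have "L = E K + pi ^ K * (\<Sum>i<n. to_ac (b i) * x ^ i)" by (simp add: L_def)
    moreover have "(\<Sum>i<n. to_ac (b i) * x ^ i) \<in> S" using b(1) unfolding S_def Rspan_def by blast
    ultimately show ?thesis by blast
  qed
  \<comment> \<open>The limit is idempotent modulo every power of the uniformizer, hence exactly,
    and a field has only the idempotents 0 and 1.\<close>
  have "L ^ 2 - L = 0"
  proof (rule Oac_separated)
    fix K
    obtain t where t: "t \<in> S" "L = E K + pi ^ K * t" using LE by blast
    obtain s where s: "E K \<in> S" "s \<in> S" "E K ^ 2 - E K = pi ^ Suc K * s" using inv[of K] by blast
    have "L ^ 2 - L = (E K ^ 2 - E K) + pi ^ K * (2 * E K * t + pi ^ K * t ^ 2 - t)"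
      unfolding t(2) by (simp add: power2_eq_square algebra_simps)
    also have "\<dots> = pi ^ K * (pi * s + 2 * E K * t + pi ^ K * t ^ 2 - t)"
      unfolding s(3) by (simp add: algebra_simps)
    finally have "L ^ 2 - L = pi ^ K * (pi * s + 2 * E K * t + pi ^ K * t ^ 2 - t)" .
    moreover have "pi \<in> S" using Ssm[OF S1 unif_R] by simp
    hence "pi * s + 2 * E K * t + pi ^ K * t ^ 2 - t \<in> S" using s t by (intro Sadd Sdiff Smult Sp Snum)
    ultimately show "\<exists>z\<in>Oac. L ^ 2 - L = pi ^ K * z" using SO by blast
  qed
  hence "L * (L - 1) = 0" by (simp add: power2_eq_square algebra_simps)
  hence L01: "L = 0 \<or> L = 1" by auto
  obtain t where t: "t \<in> S" "L = E 1 + pi ^ 1 * t" using LE by blast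
  obtain u where u: "u \<in> S" "E 1 - e = pi * u"
  proof -
    have "(\<Sum>i<n. to_ac (a 0 i) * x ^ i) \<in> S" using a(2) unfolding S_def Rspan_def by blast
    thus ?thesis using that a(1)[of 0] E0 by simp
  qed
  have "e = L + pi * (- u - t)" using t(2) u(2) by (simp add: algebra_simps)
  moreover have "- u - t \<in> Oac" using t(1) u(1) by (intro SO Sdiff Suminus)
  ultimately have "x ^ M = pi * (- u - t) \<or> x ^ M = 1 + pi * (- u - t)" "- u - t \<in> Oac"
    using L01 unfolding e_def by auto
  thus ?thesis using \<open>M > 0\<close> by blast
qed

text \<open>Some \<open>x ^ M\<close> is congruent to 0 or 1 modulo the uniformizer. In the second
  case it is a unit divisible by \<open>x\<close>; in the first, \<open>1 - x ^ M\<close> is a unit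
  divisible by \<open>1 - x\<close>.\<close>

theorem Oac_local:
  assumes x: "x \<in> Oac" and "x \<noteq> 0" "x \<noteq> 1"
  shows "inverse x \<in> Oac \<or> inverse (1 - x) \<in> Oac"
proof -
  obtain M s where M: "M > 0" "s \<in> Oac" "x ^ M = pi * s \<or> x ^ M = 1 + pi * s"
    using power_congruent_0_or_1[OF x] by blast
  show ?thesis
  proof (cases "x ^ M = 1 + pi * s")
    case True
    have "x * (x ^ (M - 1) * inverse (x ^ M)) = x ^ M * inverse (x ^ M)"
      using M(1) by (simp only: power_eq_if[of x M] mult.assoc) simp
    also have "\<dots> = 1" using \<open>x \<noteq> 0\<close> by simp
    finally have "x * (x ^ (M - 1) * inverse (x ^ M)) = 1" .
    hence "inverse x = x ^ (M - 1) * inverse (1 + pi * s)" unfolding True by (rule inverse_unique)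
    thus ?thesis using one_plus_pi_mult_unit[OF M(2)] x by (simp add: Oac_mult Oac_power)
  next
    case False
    hence xM: "x ^ M = pi * s" using M by blast
    have u: "1 - x ^ M \<noteq> 0" "inverse (1 - x ^ M) \<in> Oac"
      using one_plus_pi_mult_unit[OF Oac_uminus[OF M(2)]] by (simp_all add: xM)
    have f: "1 - x ^ M = (1 - x) * (\<Sum>i<M. x ^ i)" by (rule one_diff_power_eq)
    have "(1 - x) * ((\<Sum>i<M. x ^ i) * inverse (1 - x ^ M)) = (1 - x ^ M) * inverse (1 - x ^ M)"
      by (simp only: f mult.assoc)
    also have "\<dots> = 1" using u(1) by simp
    finally have "(1 - x) * ((\<Sum>i<M. x ^ i) * inverse (1 - x ^ M)) = 1" .
    hence "inverse (1 - x) = (\<Sum>i<M. x ^ i) * inverse (1 - x ^ M)" by (rule inverse_unique)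
    thus ?thesis using u(2) x by (simp add: Oac_mult Oac_power Oac_sum)
  qed
qed


section \<open>The ideal of non-units\<close>

lemma Mac_iff: "x \<in> Mac \<longleftrightarrow> x \<in> Oac \<and> (x = 0 \<or> inverse x \<notin> Oac)"
  by (auto simp: max_ideal_ac_def)

lemma Mac_0 [simp]: "0 \<in> Mac" and Mac_1 [simp]: "1 \<notin> Mac"
  by (auto simp: Mac_iff)

lemma Mac_Oac: "x \<in> Mac \<Longrightarrow> x \<in> Oac"
  by (simp add: Mac_iff)

lemma Mac_mult:
  assumes "x \<in> Mac" "y \<in> Oac"
  shows "x * y \<in> Mac"
proof (cases "x * y = 0")
  case False
  have "inverse (x * y) \<notin> Oac"
  proof
    assume "inverse (x * y) \<in> Oac"
    hence "y * inverse (x * y) \<in> Oac" using assms(2) by (rule Oac_mult[rotated])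
    moreover have "y * inverse (x * y) = inverse x" using False by simp
    ultimately have "inverse x \<in> Oac" by (simp only:)
    thus False using assms(1) False by (simp add: Mac_iff)
  qed
  thus ?thesis using assms by (simp add: Mac_iff Oac_mult)
next
  case True
  show ?thesis unfolding True by (rule Mac_0)
qed

lemma Mac_mult_left: "x \<in> Oac \<Longrightarrow> y \<in> Mac \<Longrightarrow> x * y \<in> Mac"
  using Mac_mult[of y x] by (simp add: mult.commute)

lemma Mac_prime:
  assumes "x \<in> Oac" "y \<in> Oac" "x * y \<in> Mac"
  shows "x \<in> Mac \<or> y \<in> Mac"
proof (rule ccontr)
  assume "\<not> ?thesis"
  hence "x \<noteq> 0" "y \<noteq> 0" "inverse x \<in> Oac" "inverse y \<in> Oac" using assms by (auto simp: Mac_iff)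
  thus False using assms(3) Oac_mult[of "inverse x" "inverse y"] by (simp add: Mac_iff)
qed

lemma Mac_power: "x \<in> Oac \<Longrightarrow> x ^ n \<in> Mac \<Longrightarrow> x \<in> Mac"
  by (induction n) (use Mac_prime Oac_power in auto)

lemma Mac_uminus: "x \<in> Mac \<Longrightarrow> - x \<in> Mac"
  using Mac_mult[of x "-1"] Oac_uminus[OF Oac_1] by simp

text \<open>If \<open>u = x + y\<close> were a unit, then \<open>x / u\<close> and
  \<open>y / u\<close> would be non-units with sum 1, against \<open>Oac_local\<close>.\<close>

lemma Mac_add:
  assumes "x \<in> Mac" "y \<in> Mac"
  shows "x + y \<in> Mac"
proof (rule ccontr)
  assume n: "x + y \<notin> Mac"
  define u where "u = x + y"
  have u: "u \<noteq> 0" "inverse u \<in> Oac" using n assms by (auto simp: Mac_iff Oac_add u_def)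
  have 1: "x * inverse u \<in> Mac" "y * inverse u \<in> Mac" using assms u(2) by (auto intro: Mac_mult)
  have 2: "y * inverse u = 1 - x * inverse u" using u(1) by (simp add: u_def field_simps)
  have "x * inverse u \<noteq> 0"
  proof
    assume "x * inverse u = 0"
    hence "y * inverse u = 1" using 2 by simp
    thus False using 1(2) by simp
  qed
  moreover have "x * inverse u \<noteq> 1" using 1(1) by auto
  ultimately have "inverse (x * inverse u) \<in> Oac \<or> inverse (1 - x * inverse u) \<in> Oac"
    using 1 Mac_Oac by (intro Oac_local) auto
  moreover have "1 - x * inverse u \<noteq> 0" using 1(1) by auto
  ultimately show False
    using 1 \<open>x * inverse u \<noteq> 0\<close> unfolding 2 Mac_iff by blast
qed

lemma Mac_diff: "x \<in> Mac \<Longrightarrow> y \<in> Mac \<Longrightarrow> x - y \<in> Mac"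
  using Mac_add[of x "- y"] Mac_uminus[of y] by simp

lemma Mac_sum: "(\<And>i. i \<in> I \<Longrightarrow> f i \<in> Mac) \<Longrightarrow> (\<Sum>i\<in>I. f i) \<in> Mac"
  by (induction I rule: infinite_finite_induct) (auto intro: Mac_add)

lemma pi_Mac [simp]: "pi \<in> Mac"
  using pi_not_unit by (simp add: Mac_iff)

lemma Mac_to_ac: "v a < 1 \<Longrightarrow> to_ac a \<in> Mac"
  using Mac_mult[OF pi_Mac Oac_to_ac[OF v_less_1_imp_div_unif, of a]] by simp

lemma prod_mset_Mac:
  assumes "prod_mset (image_mset f A) \<in> Mac" "\<And>a. a \<in># A \<Longrightarrow> f a \<in> Oac"
  shows "\<exists>a\<in>#A. f a \<in> Mac"
  using assms
proof (induction A)
  case (add a A)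
  have "prod_mset (image_mset f A) \<in> Oac"
    using add.prems(2) by (induction A) (auto intro: Oac_mult)
  hence "f a \<in> Mac \<or> prod_mset (image_mset f A) \<in> Mac"
    using add.prems by (intro Mac_prime) auto
  thus ?case using add by auto
qed simp

section \<open>The residue field and its cardinality\<close>

definition rescl :: "'a \<Rightarrow> 'a set" where
  "rescl a = {b \<in> R. v (a - b) < 1}"

text \<open>Chosen representatives replace the residue field by a finite set of elements of
  \<open>R\<close>, over which sums and products can be formed. The choice depends on the class
  only.\<close>

definition rep :: "'a \<Rightarrow> 'a" where
  "rep a = (SOME b. b \<in> rescl a)"

abbreviation q :: nat where "q \<equiv> residue_card v"

lemma v_less_add: "v x < 1 \<Longrightarrow> v y < 1 \<Longrightarrow> v (x + y) < 1"
  using ultrametric[of x y] by simp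

lemma v_less_diff: "v x < 1 \<Longrightarrow> v y < 1 \<Longrightarrow> v (x - y) < 1"
  using v_diff[of x y] by simp

lemma v_less_mult: "x \<in> R \<Longrightarrow> v y < 1 \<Longrightarrow> v (x * y) < 1"
  using nonneg[of y] nonneg[of x] mult_left_le_one_le[of "v y" "v x"] by (simp add: mult R_iff)

lemma rep: "a \<in> R \<Longrightarrow> rep a \<in> R \<and> v (a - rep a) < 1"
  using someI[of "\<lambda>b. b \<in> rescl a" a] by (auto simp: rep_def rescl_def)

lemma rep_cong: "v (a - b) < 1 \<Longrightarrow> rep a = rep b"
proof -
  assume ab: "v (a - b) < 1"
  have "v (a - c) < 1 \<longleftrightarrow> v (b - c) < 1" for c
    using v_less_add[OF ab, of "b - c"] v_less_diff[of "a - c" "a - b"] ab by auto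
  thus ?thesis by (simp add: rep_def rescl_def)
qed

lemma rep_rep: "a \<in> R \<Longrightarrow> rep (rep a) = rep a"
  using rep[of a] by (intro rep_cong[symmetric]) auto

lemma rep_eq_iff: "a \<in> R \<Longrightarrow> b \<in> R \<Longrightarrow> rep a = rep b \<longleftrightarrow> v (a - b) < 1"
proof
  assume ab: "a \<in> R" "b \<in> R" "rep a = rep b"
  have "a - b = (a - rep a) - (b - rep b)" using ab by simp
  thus "v (a - b) < 1" using v_less_diff[of "a - rep a" "b - rep b"] rep ab(1,2) by metis
qed (rule rep_cong)

lemma finite_reps: "finite (rep ` R)" and card_reps: "card (rep ` R) = q"
proof -
  have eq: "residue_classes v = rescl ` R"
    unfolding residue_classes_def rescl_def quotient_def by (auto simp: image_def)
  have "bij_betw (\<lambda>C. SOME b. b \<in> C) (residue_classes v) (rep ` R)"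
    unfolding bij_betw_def
  proof
    show "inj_on (\<lambda>C. SOME b. b \<in> C) (residue_classes v)"
    proof (rule inj_onI)
      fix C D assume C: "C \<in> residue_classes v" and D: "D \<in> residue_classes v"
        and CD: "(SOME b. b \<in> C) = (SOME b. b \<in> D)"
      obtain a where a: "a \<in> R" "C = rescl a" using C unfolding eq by blast
      obtain b where b: "b \<in> R" "D = rescl b" using D unfolding eq by blast
      have "rep a = rep b" using CD by (simp add: a b rep_def)
      hence ab: "v (a - b) < 1" using rep_eq_iff a b by blast
      have "v (a - c) < 1 \<longleftrightarrow> v (b - c) < 1" for c
        using v_less_add[OF ab, of "b - c"] v_less_diff[of "a - c" "a - b"] ab by auto
      thus "C = D" by (simp add: a b rescl_def)
    qed
  qed (auto simp: eq rep_def image_image)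
  from bij_betw_same_card[OF this] bij_betw_finite[OF this] finite_residue_field
  show "finite (rep ` R)" "card (rep ` R) = q" by (simp_all add: residue_card_def)
qed

text \<open>Adding 1 permutes the residue classes. The sum over all classes is therefore unchanged,
  although it grows by \<open>q\<close>.\<close>

lemma v_q: "v (of_nat q) < 1"
proof -
  define T where "T = rep ` R"
  have TR: "t \<in> R" if "t \<in> T" for t using that rep by (auto simp: T_def)
  have rT: "rep t = t" if "t \<in> T" for t using that rep_rep by (auto simp: T_def)
  have fin: "finite T" "card T = q" using finite_reps card_reps by (auto simp: T_def)
  have "inj_on (\<lambda>t. rep (t + 1)) T"
  proof (rule inj_onI)
    fix s t assume st: "s \<in> T" "t \<in> T" "rep (s + 1) = rep (t + 1)"
    hence "v (s - t) < 1" using rep_eq_iff[of "s + 1" "t + 1"] TR by (simp add: R_add)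
    thus "s = t" using rep_cong[of s t] rT st by simp
  qed
  moreover have "(\<lambda>t. rep (t + 1)) ` T \<subseteq> T" using TR by (auto simp: T_def intro!: R_add)
  ultimately have "bij_betw (\<lambda>t. rep (t + 1)) T T"
    using fin(1) by (simp add: bij_betw_def endo_inj_surj)
  hence "(\<Sum>t\<in>T. rep (t + 1)) = (\<Sum>t\<in>T. t)" by (rule sum.reindex_bij_betw)
  hence "(\<Sum>t\<in>T. (t + 1) - rep (t + 1)) = of_nat q" using fin by (simp add: sum_subtractf sum.distrib)
  moreover have r1: "v ((t + 1) - rep (t + 1)) < 1" if "t \<in> T" for t
    using rep[OF R_add[OF TR[OF that] R_1]] by blast
  have "v (\<Sum>t\<in>A. (t + 1) - rep (t + 1)) < 1" if "A \<subseteq> T" "finite A" for A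
    using that(2,1) by induction (auto intro!: v_less_add r1)
  ultimately show ?thesis using fin(1) by (metis order_refl)
qed

text \<open>The argument for Fermat's theorem: multiplication by a unit \<open>a\<close> permutes
  the nonzero classes, and comparing their products gives \<open>a ^ (q - 1)\<close> congruent to
  1.\<close>

lemma power_q_cong:
  assumes a: "a \<in> R"
  shows "v (a ^ q - a) < 1"
proof -
  define T where "T = rep ` R"
  have TR: "t \<in> R" if "t \<in> T" for t using that rep by (auto simp: T_def)
  have rT: "rep t = t" if "t \<in> T" for t using that rep_rep by (auto simp: T_def)
  have fin: "finite T" "card T = q" using finite_reps card_reps by (auto simp: T_def)
  have "rep 0 \<in> T" by (auto simp: T_def)
  hence "card T > 0" using fin(1) card_gt_0_iff by blast
  hence q0: "q > 0" using fin by simp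
  show ?thesis
  proof (cases "v a < 1")
    case True
    have "a ^ q = a ^ (q - 1) * a" using q0 by (simp add: power_eq_if[of a q] mult.commute)
    hence "v (a ^ q) < 1" using v_less_mult[OF R_power[OF a] True] by metis
    thus ?thesis using True v_less_diff by blast
  next
    case False
    hence va: "v a = 1" using a by (simp add: R_iff)
    define U where "U = T - {rep 0}"
    have U: "finite U" "card U = q - 1" using fin \<open>rep 0 \<in> T\<close> by (auto simp: U_def)
    have vU: "v t = 1" if "t \<in> U" for t
    proof (rule ccontr)
      assume "v t \<noteq> 1"
      hence "v (t - 0) < 1" using TR[of t] that by (auto simp: U_def R_iff)
      hence "rep t = rep 0" by (rule rep_cong)
      thus False using that rT by (auto simp: U_def)
    qed
    have "inj_on (\<lambda>t. rep (a * t)) U"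
    proof (rule inj_onI)
      fix s t assume st: "s \<in> U" "t \<in> U" "rep (a * s) = rep (a * t)"
      hence "v (a * s - a * t) < 1" using rep_eq_iff[of "a * s" "a * t"] TR a by (simp add: R_mult U_def)
      hence "v (s - t) < 1" using va by (simp flip: right_diff_distrib add: mult)
      thus "s = t" using rep_cong[of s t] rT st by (simp add: U_def)
    qed
    moreover have "(\<lambda>t. rep (a * t)) ` U \<subseteq> U"
    proof (clarify)
      fix t assume t: "t \<in> U"
      have R: "a * t \<in> R" using t TR a by (simp add: U_def R_mult)
      have "v (a * t) = 1" using va vU[OF t] by (simp add: mult)
      hence "rep (a * t) \<noteq> rep 0" using rep_eq_iff[OF R R_0] by simp
      thus "rep (a * t) \<in> U" using R by (simp add: U_def T_def)
    qed
    ultimately have "bij_betw (\<lambda>t. rep (a * t)) U U"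
      using U(1) by (simp add: bij_betw_def endo_inj_surj)
    hence pr: "(\<Prod>t\<in>U. rep (a * t)) = (\<Prod>t\<in>U. t)" by (rule prod.reindex_bij_betw)
    have c: "v ((\<Prod>t\<in>A. a * t) - (\<Prod>t\<in>A. rep (a * t))) < 1 \<and> (\<Prod>t\<in>A. a * t) \<in> R \<and> (\<Prod>t\<in>A. rep (a * t)) \<in> R"
      if "finite A" "A \<subseteq> U" for A
      using that
    proof induction
      case (insert x A)
      have x: "a * x \<in> R" using insert TR a by (auto simp: U_def intro: R_mult)
      let ?P = "\<Prod>t\<in>A. a * t" and ?Q = "\<Prod>t\<in>A. rep (a * t)"
      have "v (a * x * (?P - ?Q) + ?Q * (a * x - rep (a * x))) < 1"
        using insert x rep by (intro v_less_add v_less_mult) auto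
      also have "a * x * (?P - ?Q) + ?Q * (a * x - rep (a * x)) = a * x * ?P - rep (a * x) * ?Q"
        by (simp add: algebra_simps)
      finally have "v (a * x * ?P - rep (a * x) * ?Q) < 1" .
      moreover have "(\<Prod>t\<in>insert x A. a * t) = a * x * ?P" "(\<Prod>t\<in>insert x A. rep (a * t)) = rep (a * x) * ?Q"
        using insert(1,2) by (rule prod.insert)+
      moreover have "a * x * ?P \<in> R" "rep (a * x) * ?Q \<in> R" using insert x rep[OF x] by (auto intro!: R_mult)
      ultimately show ?case by (simp only:)
    qed auto
    have "(\<Prod>t\<in>U. a * t) - (\<Prod>t\<in>U. rep (a * t)) = (a ^ (q - 1) - 1) * (\<Prod>t\<in>U. t)"
      unfolding pr using U by (simp add: prod.distrib algebra_simps)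
    moreover have "v (\<Prod>t\<in>A. t) = 1" if "finite A" "A \<subseteq> U" for A
      using that by induction (auto simp: mult vU)
    ultimately have "v (a ^ (q - 1) - 1) < 1" using c[OF U(1)] U(1) by (simp add: mult)
    hence "v (a * (a ^ (q - 1) - 1)) < 1" using a by (intro v_less_mult)
    also have "a * (a ^ (q - 1) - 1) = a ^ q - a"
      using q0 by (simp add: right_diff_distrib power_eq_if[of a q])
    finally show ?thesis .
  qed
qed


definition p0 :: nat where "p0 = residue_char v"

lemma q_pos: "q > 0"
proof -
  have "rep 0 \<in> rep ` R" by simp
  thus ?thesis using finite_reps card_reps card_gt_0_iff by (metis empty_iff)
qed

lemma p0: "p0 > 0" "v (of_nat p0) < 1" "\<And>n. 0 < n \<Longrightarrow> v (of_nat n) < 1 \<Longrightarrow> p0 \<le> n"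
proof -
  have ex: "\<exists>n>0. v (of_nat n) < 1" using v_q q_pos by blast
  have "0 < p0 \<and> v (of_nat p0) < 1"
    unfolding p0_def residue_char_def using ex by (rule LeastI_ex)
  thus "p0 > 0" "v (of_nat p0) < 1" by auto
  show "p0 \<le> n" if "0 < n" "v (of_nat n) < 1" for n
    unfolding p0_def residue_char_def using that by (intro Least_le) auto
qed

lemma v_of_nat_less_iff: "v (of_nat n) < 1 \<longleftrightarrow> p0 dvd n"
proof
  assume n: "v (of_nat n) < 1"
  have e: "of_nat n - of_nat (n div p0) * of_nat p0 = (of_nat (n mod p0) :: 'a)"
    using div_mult_mod_eq[of n p0] by (metis add_diff_cancel_left' of_nat_add of_nat_mult)
  have "v (of_nat (n div p0) * of_nat p0) < 1" using p0(2) by (intro v_less_mult) auto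
  hence "v (of_nat (n mod p0)) < 1" unfolding e[symmetric] using n by (intro v_less_diff)
  hence "\<not> n mod p0 > 0" using p0(3)[of "n mod p0"] p0(1) by (meson mod_less_divisor not_le)
  thus "p0 dvd n" by (simp add: mod_eq_0_iff_dvd)
next
  assume "p0 dvd n"
  then obtain k where "n = k * p0" by (metis dvd_def mult.commute)
  thus "v (of_nat n) < 1" using p0(2) v_less_mult[of "of_nat k" "of_nat p0"] by simp
qed

lemma v_of_nat_eq_1: "\<not> p0 dvd n \<Longrightarrow> v (of_nat n) = 1"
  using v_of_nat_less_iff[of n] R_of_nat[of n] by (simp add: R_iff)

lemma prime_p0: "Factorial_Ring.prime p0"
proof (rule prime_natI)
  show "p0 \<ge> 2"
  proof (rule ccontr)
    assume "\<not> ?thesis"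
    hence "p0 = 1" using p0(1) by simp
    thus False using p0(2) by simp
  qed
  fix a b assume ab: "p0 dvd a * b"
  hence "v (of_nat (a * b)) < 1" by (simp only: v_of_nat_less_iff)
  hence "v (of_nat a) * v (of_nat b) < 1" by (simp add: mult)
  hence "v (of_nat a) < 1 \<or> v (of_nat b) < 1"
    using R_of_nat[of a] R_of_nat[of b] by (cases "v (of_nat a) = 1") (auto simp: R_iff)
  thus "p0 dvd a \<or> p0 dvd b" by (simp only: v_of_nat_less_iff)
qed

text \<open>Serves to apply Sylow's theorem to the order \<open>q\<close> of the residue
  field.\<close>

definition residue_add_group :: "'a monoid" where
  "residue_add_group = \<lparr>carrier = rep ` R, mult = (\<lambda>a b. rep (a + b)), one = rep 0\<rparr>"

lemma group_residue_add: "group residue_add_group"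
proof (rule groupI)
  show "\<one>\<^bsub>residue_add_group\<^esub> \<in> carrier residue_add_group" by (simp add: residue_add_group_def)
next
  fix x y assume "x \<in> carrier residue_add_group" "y \<in> carrier residue_add_group"
  thus "x \<otimes>\<^bsub>residue_add_group\<^esub> y \<in> carrier residue_add_group"
    using rep by (auto simp: residue_add_group_def intro!: imageI R_add)
next
  fix x y z assume "x \<in> carrier residue_add_group" "y \<in> carrier residue_add_group" "z \<in> carrier residue_add_group"
  hence R: "x \<in> R" "y \<in> R" "z \<in> R" using rep by (auto simp: residue_add_group_def)
  have "v (rep (x + y) + z - (x + rep (y + z))) < 1"
    using v_less_diff[of "(y + z) - rep (y + z)" "(x + y) - rep (x + y)"] rep[of "x + y"] rep[of "y + z"] R
    by (simp add: R_add algebra_simps)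
  thus "x \<otimes>\<^bsub>residue_add_group\<^esub> y \<otimes>\<^bsub>residue_add_group\<^esub> z = x \<otimes>\<^bsub>residue_add_group\<^esub> (y \<otimes>\<^bsub>residue_add_group\<^esub> z)"
    by (simp add: residue_add_group_def rep_cong)
next
  fix x assume "x \<in> carrier residue_add_group"
  then obtain a where a: "a \<in> R" "x = rep a" by (auto simp: residue_add_group_def)
  have "v (rep 0 + x - x) < 1" using rep[of 0] by simp
  hence "rep (rep 0 + x) = rep x" by (rule rep_cong)
  thus "\<one>\<^bsub>residue_add_group\<^esub> \<otimes>\<^bsub>residue_add_group\<^esub> x = x" using a rep_rep by (simp add: residue_add_group_def)
  have "v (rep (- x) + x - 0) < 1" using rep[of "- x"] rep[of a] a R_uminus[of x] v_uminus[of "- x - rep (- x)"] by simp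
  hence "rep (rep (- x) + x) = rep 0" by (rule rep_cong)
  moreover have "rep (- x) \<in> carrier residue_add_group"
    using rep[of a] a by (simp add: residue_add_group_def R_uminus)
  ultimately show "\<exists>y\<in>carrier residue_add_group. y \<otimes>\<^bsub>residue_add_group\<^esub> x = \<one>\<^bsub>residue_add_group\<^esub>"
    by (intro bexI[of _ "rep (- x)"]) (simp_all add: residue_add_group_def)
qed

lemma residue_add_group_pow:
  assumes "x \<in> R"
  shows "x [^]\<^bsub>residue_add_group\<^esub> n = rep (of_nat n * x)"
proof (induction n)
  case 0
  show ?case by (simp add: residue_add_group_def nat_pow_def)
next
  case (Suc n)
  have R: "of_nat n * x \<in> R" using assms by (simp add: R_mult)
  have "v (rep (of_nat n * x) + x - of_nat (Suc n) * x) < 1"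
    using rep[OF R] v_uminus[of "of_nat n * x - rep (of_nat n * x)"] by (simp add: algebra_simps)
  hence "rep (rep (of_nat n * x) + x) = rep (of_nat (Suc n) * x)" by (rule rep_cong)
  moreover have "x [^]\<^bsub>residue_add_group\<^esub> Suc n = x [^]\<^bsub>residue_add_group\<^esub> n \<otimes>\<^bsub>residue_add_group\<^esub> x"
    by (simp add: nat_pow_def)
  ultimately show ?case unfolding Suc by (simp add: residue_add_group_def)
qed

text \<open>A subgroup of order \<open>l\<close> contains a nonzero class that \<open>l\<close>
  annihilates, whereas a prime other than \<open>p0\<close> is a unit of \<open>R\<close>.\<close>

lemma prime_dvd_q: "Factorial_Ring.prime l \<Longrightarrow> l dvd q \<Longrightarrow> l = p0"
proof (rule ccontr)
  assume l: "Factorial_Ring.prime l" "l dvd q" "l \<noteq> p0"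
  let ?G = residue_add_group
  interpret G: group ?G by (rule group_residue_add)
  have fin: "finite (carrier ?G)" "order ?G = q"
    using finite_reps card_reps by (auto simp: residue_add_group_def order_def)
  obtain m where "q = l * m" using l(2) by (auto simp: dvd_def)
  hence "order ?G = l ^ 1 * m" using fin by simp
  then obtain H where H: "subgroup H ?G" "card H = l ^ 1"
    using sylow_thm[OF l(1) group_residue_add _ fin(1), of 1 m] by blast
  interpret H: group "?G\<lparr>carrier := H\<rparr>" using H(1) by (rule subgroup.subgroup_is_group) (rule group_residue_add)
  have "card H > 1" using H(2) prime_gt_1_nat[OF l(1)] by simp
  have "\<not> H \<subseteq> {\<one>\<^bsub>?G\<^esub>}"
  proof
    assume "H \<subseteq> {\<one>\<^bsub>?G\<^esub>}"
    hence "card H \<le> 1" using card_mono[of "{\<one>\<^bsub>?G\<^esub>}" H] by simp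
    thus False using \<open>card H > 1\<close> by simp
  qed
  then obtain x where x: "x \<in> H" "x \<noteq> \<one>\<^bsub>?G\<^esub>" by blast
  hence xG: "x \<in> carrier ?G" using H(1) subgroup.subset by blast
  then obtain a where a: "a \<in> R" "x = rep a" by (auto simp: residue_add_group_def)
  hence xR: "x \<in> R" using rep by blast
  have "x [^]\<^bsub>?G\<lparr>carrier := H\<rparr>\<^esub> order (?G\<lparr>carrier := H\<rparr>) = \<one>\<^bsub>?G\<lparr>carrier := H\<rparr>\<^esub>"
    using x(1) by (intro H.pow_order_eq_1) simp
  hence "x [^]\<^bsub>?G\<^esub> l = \<one>\<^bsub>?G\<^esub>"
    using G.nat_pow_consistent[of x l H] H(2) by (simp add: order_def)
  hence "rep (of_nat l * x) = rep 0" by (simp add: residue_add_group_pow[OF xR]) (simp add: residue_add_group_def)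
  hence "v (of_nat l * x - 0) < 1" using rep_eq_iff[of "of_nat l * x" 0] xR by (simp add: R_mult)
  moreover have "\<not> p0 dvd l" using l(1,3) prime_p0 primes_dvd_imp_eq by blast
  hence "v (of_nat l) = 1" by (rule v_of_nat_eq_1)
  ultimately have "v (x - 0) < 1" by (simp add: mult)
  hence "rep x = rep 0" by (rule rep_cong)
  hence "x = \<one>\<^bsub>?G\<^esub>" using rep_rep a by (simp add: residue_add_group_def)
  thus False using x by simp
qed

lemma q_gt_1: "q > 1"
proof -
  have "rep 0 \<noteq> rep 1" using rep_eq_iff[of 0 1] by simp
  hence "card {rep 0, rep 1} = 2" by simp
  moreover have "card {rep 0, rep 1} \<le> card (rep ` R)" by (rule card_mono[OF finite_reps]) auto
  ultimately show ?thesis by (simp add: card_reps)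
qed

lemma q_prime_power: "\<exists>f>0. q = p0 ^ f"
proof -
  have "q = p0 ^ multiplicity p0 q"
  proof (rule multiplicity_eq_nat)
    show "multiplicity l q = multiplicity l (p0 ^ multiplicity p0 q)" if "Factorial_Ring.prime l" for l
    proof (cases "l = p0")
      case True
      thus ?thesis using prime_p0 by simp
    next
      case False
      hence "\<not> l dvd q" using prime_dvd_q that by blast
      hence "multiplicity l q = 0" by (rule not_dvd_imp_multiplicity_0)
      moreover have "multiplicity l (p0 ^ multiplicity p0 q) = 0"
        using False that prime_p0 by (simp add: multiplicity_distinct_prime_power)
      ultimately show ?thesis by simp
    qed
  qed (use q_pos p0(1) in auto)
  moreover have "multiplicity p0 q > 0" using calculation q_gt_1 by (intro Nat.gr0I) auto
  ultimately show ?thesis by blast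
qed

end

text \<open>Interpreted twice: with the integral closure and its non-units, and with
  \<open>R[\<zeta>]\<close> for a root of unity \<open>\<zeta>\<close> and the multiples of
  \<open>unif\<close>.\<close>

locale prime_ideal_congruence =
  fixes S I :: "'b::comm_ring_1 set" and p :: nat
  assumes S: "0 \<in> S" "1 \<in> S" "\<And>x y. x \<in> S \<Longrightarrow> y \<in> S \<Longrightarrow> x + y \<in> S" "\<And>x y. x \<in> S \<Longrightarrow> y \<in> S \<Longrightarrow> x * y \<in> S"
    and I: "0 \<in> I" "\<And>x y. x \<in> I \<Longrightarrow> y \<in> I \<Longrightarrow> x + y \<in> I" "\<And>x y. x \<in> S \<Longrightarrow> y \<in> I \<Longrightarrow> x * y \<in> I"
      "\<And>x. x \<in> I \<Longrightarrow> - x \<in> I" "I \<subseteq> S"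
    and p: "Factorial_Ring.prime p" "of_nat p \<in> I"
begin

lemma S_power: "x \<in> S \<Longrightarrow> x ^ n \<in> S"
  by (induction n) (auto intro: S)

lemma S_of_nat: "of_nat n \<in> S"
  by (induction n) (auto intro: S)

lemma S_sum: "(\<And>i. i \<in> A \<Longrightarrow> f i \<in> S) \<Longrightarrow> sum f A \<in> S"
  by (induction A rule: infinite_finite_induct) (auto intro: S)

lemma I_sum: "(\<And>i. i \<in> A \<Longrightarrow> f i \<in> I) \<Longrightarrow> sum f A \<in> I"
  by (induction A rule: infinite_finite_induct) (auto intro: I)

lemma cong_trans: "x - y \<in> I \<Longrightarrow> y - z \<in> I \<Longrightarrow> x - z \<in> I"
  using I(2)[of "x - y" "y - z"] by simp

lemma cong_mult:
  assumes "x - x' \<in> I" "y - y' \<in> I" "x \<in> S" "y' \<in> S"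
  shows "x * y - x' * y' \<in> I"
proof -
  have "x * (y - y') + y' * (x - x') \<in> I" using assms by (intro I)
  thus ?thesis by (simp add: algebra_simps)
qed

lemma cong_power:
  assumes "x - y \<in> I" "x \<in> S" "y \<in> S"
  shows "x ^ n - y ^ n \<in> I"
  by (induction n) (use assms in \<open>auto intro!: cong_mult S_power I\<close>)

lemma add_power_p:
  assumes "x \<in> S" "y \<in> S"
  shows "(x + y) ^ p - (x ^ p + y ^ p) \<in> I"
proof -
  have "p > 0" using p(1) prime_gt_0_nat by blast
  have "(x + y) ^ p = (\<Sum>k\<le>p. of_nat (p choose k) * x ^ k * y ^ (p - k))" by (rule binomial_ring)
  also have "{..p} = insert 0 (insert p {1..<p})" using \<open>p > 0\<close> by auto
  also have "(\<Sum>k\<in>\<dots>. of_nat (p choose k) * x ^ k * y ^ (p - k)) =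
      y ^ p + (x ^ p + (\<Sum>k\<in>{1..<p}. of_nat (p choose k) * x ^ k * y ^ (p - k)))"
    using \<open>p > 0\<close> by (subst sum.insert, simp, simp, subst sum.insert) auto
  finally have "(x + y) ^ p - (x ^ p + y ^ p) = (\<Sum>k\<in>{1..<p}. of_nat (p choose k) * x ^ k * y ^ (p - k))"
    by simp
  also have "\<dots> \<in> I"
  proof (rule I_sum)
    fix k assume k: "k \<in> {1..<p}"
    hence "p dvd p choose k" using p(1) by (intro dvd_choose_prime) auto
    then obtain j where j: "p choose k = j * p" by (metis dvd_def mult.commute)
    have "(of_nat j * x ^ k * y ^ (p - k)) * of_nat p \<in> I"
      using assms p(2) by (intro I(3) S S_power S_of_nat)
    thus "of_nat (p choose k) * x ^ k * y ^ (p - k) \<in> I" unfolding j by (simp add: mult_ac)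
  qed
  finally show ?thesis .
qed

lemma add_power_p_power:
  assumes "x \<in> S" "y \<in> S"
  shows "(x + y) ^ (p ^ f) - (x ^ (p ^ f) + y ^ (p ^ f)) \<in> I"
proof (induction f)
  case (Suc f)
  let ?Q = "p ^ f"
  have "((x + y) ^ ?Q) ^ p - (x ^ ?Q + y ^ ?Q) ^ p \<in> I"
    using assms Suc by (intro cong_power S S_power)
  moreover have "(x ^ ?Q + y ^ ?Q) ^ p - ((x ^ ?Q) ^ p + (y ^ ?Q) ^ p) \<in> I"
    using assms by (intro add_power_p S_power)
  ultimately have "((x + y) ^ ?Q) ^ p - ((x ^ ?Q) ^ p + (y ^ ?Q) ^ p) \<in> I" by (rule cong_trans)
  thus ?case by (simp add: mult.commute flip: power_mult)
qed (use I in auto)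

lemma sum_power_p_power:
  assumes "finite A" "\<And>i. i \<in> A \<Longrightarrow> g i \<in> S"
  shows "(\<Sum>i\<in>A. g i) ^ (p ^ f) - (\<Sum>i\<in>A. g i ^ (p ^ f)) \<in> I"
  using assms
proof induction
  case empty
  have "p ^ f \<noteq> 0" using p(1) prime_gt_0_nat by auto
  hence "(0::'b) ^ (p ^ f) = 0" by (simp only: power_0_left if_False)
  thus ?case using I(1) by simp
next
  case (insert a A)
  have "sum g A \<in> S" using insert by (intro S_sum) auto
  hence "(g a + sum g A) ^ (p ^ f) - (g a ^ (p ^ f) + sum g A ^ (p ^ f)) \<in> I"
    using insert by (intro add_power_p_power) auto
  moreover have "(g a ^ (p ^ f) + sum g A ^ (p ^ f)) - (g a ^ (p ^ f) + (\<Sum>i\<in>A. g i ^ (p ^ f))) \<in> I"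
    using insert by simp
  ultimately have "(g a + sum g A) ^ (p ^ f) - (g a ^ (p ^ f) + (\<Sum>i\<in>A. g i ^ (p ^ f))) \<in> I" by (rule cong_trans)
  thus ?case using insert by simp
qed

end

section \<open>Extending automorphisms and roots of unity\<close>

text \<open>\<open>x ^ n - 1\<close> splits into linear factors, and a multiple root would be a zero
  of the derivative, hence 0, which is not a root.\<close>

lemma card_roots_of_unity:
  assumes "n > 0"
  shows "finite {x :: 'b::{alg_closed_field, field_char_0}. x ^ n = 1}"
    and "card {x :: 'b::{alg_closed_field, field_char_0}. x ^ n = 1} = n"
proof -
  define f where "f = Polynomial.monom (1::'b) n - 1"
  have f: "poly f x = x ^ n - 1" for x by (simp add: f_def poly_monom)
  have deg: "Polynomial.degree f = n" "Polynomial.lead_coeff f = 1"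
  proof -
    have "Polynomial.degree (- 1 ::'b poly) < Polynomial.degree (Polynomial.monom (1::'b) n)"
      using assms by (simp add: degree_monom_eq)
    thus "Polynomial.degree f = n"
      unfolding f_def diff_conv_add_uminus by (subst degree_add_eq_left) (simp_all add: degree_monom_eq)
    thus "Polynomial.lead_coeff f = 1" using assms by (simp add: f_def)
  qed
  have f0: "f \<noteq> 0" using deg(2) by auto
  obtain A where A: "size A = n" "f = (\<Prod>x\<in>#A. [:- x, 1:])"
    using alg_closed_imp_factorization[OF f0] deg by auto
  define l where "l x = [:- x, 1:]" for x :: 'b
  have A2: "f = (\<Prod>x\<in>#A. l x)" using A(2) by (simp add: l_def)
  have l0: "poly (l x) x = 0" for x by (simp add: l_def)
  have root: "poly f x = 0 \<longleftrightarrow> x \<in># A" for x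
    unfolding A(2) by (auto simp: poly_prod_mset prod_mset_zero_iff)
  have "count A a \<le> 1" for a
  proof (rule ccontr)
    assume "\<not> ?thesis"
    hence "{#a, a#} \<subseteq># A" by (intro mset_subset_eqI) auto
    then obtain B where "A = {#a, a#} + B" by (metis mset_subset_eq_exists_conv)
    hence fB: "f = l a * (l a * (\<Prod>x\<in>#B. l x))" unfolding A2 by simp
    have "poly (pderiv f) a = 0" unfolding fB by (simp add: pderiv_mult l0)
    hence "of_nat n * a ^ (n - 1) = 0" by (simp add: f_def pderiv_diff pderiv_monom poly_monom)
    hence "a = 0" using assms by simp
    moreover have "poly f a = 0" unfolding fB by (simp add: l0)
    ultimately show False using assms by (simp add: f power_0_left)
  qed
  hence cA: "count A a = (if a \<in># A then 1 else 0)" for a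
    using count_greater_zero_iff[of A a] le_antisym[of "count A a" 1] by (auto simp: not_in_iff)
  have "A = mset_set (set_mset A)"
    by (rule multiset_eqI) (simp add: cA count_mset_set')
  hence "size A = card (set_mset A)" by (metis size_mset_set)
  moreover have "set_mset A = {x. x ^ n = 1}" using root by (auto simp: f)
  ultimately show "finite {x :: 'b. x ^ n = 1}" "card {x :: 'b. x ^ n = 1} = n"
    using A(1) by (metis finite_set_mset, simp)
qed

lemma power_eq_1_gcd:
  fixes x :: "'b::field"
  assumes "x ^ m = 1" "x ^ n = 1"
  shows "x ^ gcd m n = 1"
proof (cases "m = 0")
  case False
  obtain a b where "m * a = n * b + gcd m n" using bezout_nat[OF False] by blast
  hence "a * m = b * n + gcd m n" by (simp only: mult.commute)
  hence "x ^ (a * m) = x ^ (b * n) * x ^ gcd m n" by (simp add: power_add)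
  moreover have "x ^ (a * m) = 1" "x ^ (b * n) = 1"
    using assms by (simp_all add: power_mult mult.commute[of a] mult.commute[of b])
  ultimately show ?thesis by simp
qed (use assms in simp)

definition primitive_root :: "nat \<Rightarrow> 'b::field \<Rightarrow> bool" where
  "primitive_root n x \<longleftrightarrow> x ^ n = 1 \<and> (\<forall>m. x ^ m = 1 \<longrightarrow> n dvd m)"

text \<open>Counting by exact order: the number of elements of order \<open>d\<close> is forced to be \<open>totient d\<close> for
  every \<open>d\<close>, since the \<open>n\<close>-th roots of unity are \<open>n\<close> in number.\<close>

lemma card_primitive_roots:
  assumes "n > 0"
  shows "card {x :: 'b::{alg_closed_field, field_char_0}. primitive_root n x} = totient n"
  using assms
proof (induction n rule: less_induct)
  case (less n)
  let ?P = "\<lambda>d. {x :: 'b. primitive_root d x}"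
  have key: "x ^ n = 1" if h: "primitive_root d x" "d dvd n" for x :: 'b and d
  proof -
    obtain k where "n = d * k" using h(2) by blast
    thus ?thesis using h(1) by (simp add: primitive_root_def power_mult)
  qed
  have un: "{x :: 'b. x ^ n = 1} = (\<Union>d\<in>{d. d dvd n}. ?P d)"
  proof (intro equalityI subsetI)
    fix x :: 'b assume x: "x \<in> {x. x ^ n = 1}"
    define d where "d = (LEAST d. d > 0 \<and> x ^ d = 1)"
    have d: "d > 0 \<and> x ^ d = 1" 
      using LeastI[of "\<lambda>d. d > 0 \<and> x ^ d = 1" n] x less.prems unfolding d_def by blast
    have dm: "d dvd m" if m: "x ^ m = 1" for m
    proof -
      have "x ^ gcd d m = 1" using d m by (intro power_eq_1_gcd) auto
      moreover have "gcd d m > 0" using d by simp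
      ultimately have "d \<le> gcd d m"
        using Least_le[of "\<lambda>d. d > 0 \<and> x ^ d = 1" "gcd d m", folded d_def] by blast
      moreover have "gcd d m \<le> d" using d by (intro gcd_le1_nat) auto
      ultimately have "gcd d m = d" by (rule le_antisym[rotated])
      thus ?thesis by (metis gcd_dvd2)
    qed
    have "primitive_root d x" using d dm by (simp add: primitive_root_def)
    moreover have "d dvd n" using dm x by simp
    ultimately show "x \<in> (\<Union>d\<in>{d. d dvd n}. ?P d)" by (intro UN_I[of d]) simp_all
  next
    fix x assume "x \<in> (\<Union>d\<in>{d. d dvd n}. ?P d)"
    then obtain d where "d dvd n" "primitive_root d x" by blast
    thus "x \<in> {x. x ^ n = 1}" using key by blast
  qed
  have fD: "finite {d. d dvd n}" using less.prems by (rule finite_divisors_nat)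
  have fD': "finite {d. d dvd n \<and> d \<noteq> n}" by (rule finite_subset[OF _ fD]) blast
  have fin: "finite (?P d)" if "d dvd n" for d
  proof (rule finite_subset[OF _ card_roots_of_unity(1)[OF less.prems]], rule subsetI)
    fix x :: 'b assume "x \<in> ?P d"
    thus "x \<in> {x. x ^ n = 1}" using that key by blast
  qed
  have "n = card (\<Union>d\<in>{d. d dvd n}. ?P d)" 
    by (rule card_roots_of_unity(2)[OF less.prems, where 'b = 'b, unfolded un, symmetric])
  also have "\<dots> = (\<Sum>d\<in>{d. d dvd n}. card (?P d))"
  proof (rule card_UN_disjoint)
    show "finite {d. d dvd n}" by (rule fD)
    show "\<forall>i\<in>{d. d dvd n}. \<forall>j\<in>{d. d dvd n}. i \<noteq> j \<longrightarrow> ?P i \<inter> ?P j = {}"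
    proof (intro ballI impI)
      fix i j :: nat assume "i \<noteq> j"
      have False if "primitive_root i x" "primitive_root j x" for x :: 'b
        using that \<open>i \<noteq> j\<close> dvd_antisym[of i j] by (simp add: primitive_root_def)
      thus "?P i \<inter> ?P j = {}" by blast
    qed
  qed (use fin in auto)
  also have "{d. d dvd n} = insert n {d. d dvd n \<and> d \<noteq> n}" by auto
  also have "(\<Sum>d\<in>\<dots>. card (?P d)) = card (?P n) + (\<Sum>d\<in>{d. d dvd n \<and> d \<noteq> n}. card (?P d))"
    using fD' by (subst sum.insert) simp_all
  also have "(\<Sum>d\<in>{d. d dvd n \<and> d \<noteq> n}. card (?P d)) = (\<Sum>d\<in>{d. d dvd n \<and> d \<noteq> n}. totient d)"
  proof (intro sum.cong refl)
    fix d assume "d \<in> {d. d dvd n \<and> d \<noteq> n}"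
    hence "d dvd n" "d \<noteq> n" by auto
    hence "d < n" "d > 0" using less.prems dvd_imp_le[of d n] dvd_pos_nat[of n d] by auto
    thus "card (?P d) = totient d" by (rule less.IH)
  qed
  finally have 1: "n = card (?P n) + (\<Sum>d\<in>{d. d dvd n \<and> d \<noteq> n}. totient d)" .
  have "n = (\<Sum>d\<in>{d. d dvd n}. totient d)" using totient_divisor_sum[of n] by simp
  also have "{d. d dvd n} = insert n {d. d dvd n \<and> d \<noteq> n}" by auto
  also have "(\<Sum>d\<in>\<dots>. totient d) = totient n + (\<Sum>d\<in>{d. d dvd n \<and> d \<noteq> n}. totient d)"
    using fD' by (subst sum.insert) simp_all
  finally show ?case using 1 by linarith
qed

lemma exists_primitive_root:
  assumes "n > 0"
  obtains x :: "'b::{alg_closed_field, field_char_0}" where "primitive_root n x"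
proof -
  have "card {x :: 'b. primitive_root n x} \<noteq> 0" using card_primitive_roots[OF assms, where 'b = 'b] assms by simp
  hence "{x :: 'b. primitive_root n x} \<noteq> {}" by (metis card.empty)
  thus ?thesis using that by blast
qed

lemma primitive_root_power_eq_iff:
  assumes "primitive_root n (x::'b::field)" "n > 0" "i < n" "j < n"
  shows "x ^ i = x ^ j \<longleftrightarrow> i = j"
proof -
  have x0: "x \<noteq> 0" using assms by (auto simp: primitive_root_def power_0_left)
  have *: "i = j" if "i \<le> j" "j < n" "x ^ i = x ^ j" for i j
  proof -
    have "i + (j - i) = j" using that by simp
    hence "x ^ j = x ^ i * x ^ (j - i)" by (metis power_add)
    hence "x ^ (j - i) = 1" using that x0 by simp
    hence "n dvd j - i" using assms(1) by (auto simp: primitive_root_def)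
    hence "j - i = 0" using that dvd_imp_le[of n "j - i"] by linarith
    thus ?thesis using that by simp
  qed
  show ?thesis using *[of i j] *[of j i] assms by (cases "i \<le> j") auto
qed

lemma primitive_root_generates:
  assumes "primitive_root n (x::'b::{alg_closed_field, field_char_0})" "n > 0" "y ^ n = 1"
  obtains i where "i < n" "y = x ^ i"
proof -
  have "inj_on (\<lambda>i. x ^ i) {..<n}"
    using primitive_root_power_eq_iff[OF assms(1,2)] by (auto intro!: inj_onI)
  hence "card ((\<lambda>i. x ^ i) ` {..<n}) = n" by (simp add: card_image)
  moreover have "(x ^ i) ^ n = 1" for i
    using assms(1) by (metis primitive_root_def mult.commute power_mult power_one)
  hence "(\<lambda>i. x ^ i) ` {..<n} \<subseteq> {y. y ^ n = 1}" by auto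
  ultimately have "(\<lambda>i. x ^ i) ` {..<n} = {y. y ^ n = 1}"
    using card_roots_of_unity[OF assms(2), where 'b = 'b] by (intro card_subset_eq) auto
  thus ?thesis using assms(3) that by blast
qed

text \<open>A homomorphism between subrings is represented by its graph: a subring \<open>G\<close> of the product
  ring in which \<open>(0, y)\<close> occurs only for \<open>y = 0\<close>.\<close>

locale field_hom_graph =
  fixes G :: "('a::field alg_closure \<times> 'a alg_closure) set"
  assumes base: "(to_ac a, to_ac a) \<in> G"
    and add: "(x, y) \<in> G \<Longrightarrow> (x', y') \<in> G \<Longrightarrow> (x + x', y + y') \<in> G"
    and mult: "(x, y) \<in> G \<Longrightarrow> (x', y') \<in> G \<Longrightarrow> (x * x', y * y') \<in> G"
    and zero: "(0, y) \<in> G \<Longrightarrow> y = 0"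

lemma poly_eq_sum_atMost:
  fixes P :: "'b::comm_semiring_1 poly"
  assumes "Polynomial.degree P \<le> n"
  shows "poly P x = (\<Sum>i\<le>n. Polynomial.coeff P i * x ^ i)"
  unfolding poly_altdef using assms by (intro sum.mono_neutral_left) (auto simp: coeff_eq_0)

lemma degree_eqI:
  assumes "Polynomial.coeff P d \<noteq> 0" "\<And>i. i > d \<Longrightarrow> Polynomial.coeff P i = 0"
  shows "Polynomial.degree P = d"
proof (rule antisym)
  show "Polynomial.degree P \<le> d" by (rule degree_le) (use assms(2) in blast)
  show "d \<le> Polynomial.degree P" by (rule le_degree) (rule assms(1))
qed

text \<open>After division by a power of \<open>x\<close>, an algebraic equation has a nonzero
  constant term, and this term is a multiple of \<open>x\<close>. Consequently a subring that
  contains the base field is a field.\<close>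

lemma inverse_as_polynomial:
  fixes x :: "'a::field alg_closure"
  assumes "x \<noteq> 0"
  shows "\<exists>U. inverse x = poly (map_poly to_ac U) x"
proof -
  have "\<exists>U. inverse x = poly (map_poly to_ac U) x" if "p \<noteq> 0" "poly (map_poly to_ac p) x = 0" for p :: "'a poly"
    using that
  proof (induction p rule: pCons_induct)
    case (pCons c p)
    have m: "map_poly to_ac (pCons c p) = pCons (to_ac c) (map_poly to_ac p)"
      by (rule poly_eqI) (simp add: coeff_map_poly coeff_pCons split: nat.split)
    hence 0: "to_ac c + x * poly (map_poly to_ac p) x = 0" using pCons.prems by simp
    show ?case
    proof (cases "c = 0")
      case True
      hence "p \<noteq> 0" using pCons.prems(1) by auto
      moreover have "poly (map_poly to_ac p) x = 0" using 0 True assms by simp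
      ultimately show ?thesis by (rule pCons.IH)
    next
      case False
      define U where "U = Polynomial.smult (- inverse c) p"
      have "map_poly to_ac U = Polynomial.smult (to_ac (- inverse c)) (map_poly to_ac p)"
        by (rule poly_eqI) (simp add: U_def coeff_map_poly)
      hence "x * poly (map_poly to_ac U) x = - inverse (to_ac c) * (x * poly (map_poly to_ac p) x)" by simp
      also have "x * poly (map_poly to_ac p) x = - to_ac c" using 0 by (simp add: eq_neg_iff_add_eq_0 add.commute)
      finally have "x * poly (map_poly to_ac U) x = 1" using False by simp
      thus ?thesis using inverse_unique by blast
    qed
  qed simp
  thus ?thesis using alg_closure_algebraic by blast
qed

section \<open>Extension of field homomorphisms\<close>

context field_hom_graph
begin

lemma zero_one: "(0, 0) \<in> G" "(1, 1) \<in> G"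
  using base[of 0] base[of 1] by simp_all

lemma uminus: "(x, y) \<in> G \<Longrightarrow> (- x, - y) \<in> G"
  using mult[of "-1" "-1" x y] base[of "-1"] by simp

lemma diff: "(x, y) \<in> G \<Longrightarrow> (x', y') \<in> G \<Longrightarrow> (x - x', y - y') \<in> G"
  using add[of x y "- x'" "- y'"] uminus[of x' y'] by simp

lemma sum: "(\<And>i. i \<in> A \<Longrightarrow> (f i, g i) \<in> G) \<Longrightarrow> (sum f A, sum g A) \<in> G"
  by (induction A rule: infinite_finite_induct) (auto intro: zero_one add)

lemma power: "(x, y) \<in> G \<Longrightarrow> (x ^ n, y ^ n) \<in> G"
  by (induction n) (auto intro: zero_one mult)

lemma functional: "(x, y) \<in> G \<Longrightarrow> (x, y') \<in> G \<Longrightarrow> y = y'"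
  using diff[of x y x y'] zero[of "y - y'"] by simp

text \<open>\<open>P'\<close> is the image of \<open>P\<close> when the homomorphism is applied to
  the coefficients.\<close>

definition prel :: "'a alg_closure poly \<Rightarrow> 'a alg_closure poly \<Rightarrow> bool" where
  "prel P P' \<longleftrightarrow> (\<forall>i. (Polynomial.coeff P i, Polynomial.coeff P' i) \<in> G)"

lemma prel_add: "prel P P' \<Longrightarrow> prel Q Q' \<Longrightarrow> prel (P + Q) (P' + Q')"
  by (simp add: prel_def add)

lemma prel_diff: "prel P P' \<Longrightarrow> prel Q Q' \<Longrightarrow> prel (P - Q) (P' - Q')"
  by (simp add: prel_def diff)

lemma prel_mult: "prel P P' \<Longrightarrow> prel Q Q' \<Longrightarrow> prel (P * Q) (P' * Q')"
  unfolding prel_def coeff_mult by (intro allI sum mult) auto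

lemma prel_monom: "(x, y) \<in> G \<Longrightarrow> prel (Polynomial.monom x n) (Polynomial.monom y n)"
  by (simp add: prel_def zero_one)

lemma prel_smult: "(x, y) \<in> G \<Longrightarrow> prel P P' \<Longrightarrow> prel (Polynomial.smult x P) (Polynomial.smult y P')"
  by (simp add: prel_def mult)

lemma prel_base: "prel (map_poly to_ac p) (map_poly to_ac p)"
  by (simp add: prel_def coeff_map_poly base)

lemma prel_0: "prel 0 0"
  by (simp add: prel_def zero_one)

lemma prel_poly:
  assumes "prel P P'" "(x, y) \<in> G"
  shows "(poly P x, poly P' y) \<in> G"
proof -
  define n where "n = max (Polynomial.degree P) (Polynomial.degree P')"
  have "poly P x = (\<Sum>i\<le>n. Polynomial.coeff P i * x ^ i)" "poly P' y = (\<Sum>i\<le>n. Polynomial.coeff P' i * y ^ i)"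
    by (simp_all add: poly_eq_sum_atMost n_def)
  thus ?thesis using assms by (auto simp: prel_def intro!: sum mult power)
qed

lemma inverse:
  assumes "(x, y) \<in> G" "x \<noteq> 0"
  shows "(inverse x, inverse y) \<in> G"
proof -
  obtain U where U: "inverse x = poly (map_poly to_ac U) x" using inverse_as_polynomial[OF assms(2)] by blast
  define u where "u = poly (map_poly to_ac U) y"
  have 1: "(inverse x, u) \<in> G" unfolding U u_def using prel_base assms(1) by (rule prel_poly)
  hence "(x * inverse x, y * u) \<in> G" using assms(1) mult by blast
  hence "(1, y * u) \<in> G" using assms(2) by simp
  hence "y * u = 1" using functional zero_one(2) by blast
  hence "inverse y = u" by (rule inverse_unique)
  thus ?thesis using 1 by simp
qed

text \<open>Long division by a monic polynomial, carried out in source and target at once, so that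
  quotients and remainders correspond too. The bound \<open>n\<close> on the number of coefficients
  drops with each leading term.\<close>

lemma prel_division:
  assumes F: "prel F F'" "Polynomial.coeff F d = 1" "Polynomial.coeff F' d = 1"
    "\<And>i. i > d \<Longrightarrow> Polynomial.coeff F i = 0" "\<And>i. i > d \<Longrightarrow> Polynomial.coeff F' i = 0"
    and "prel P P'" "\<And>i. i \<ge> n \<Longrightarrow> Polynomial.coeff P i = 0 \<and> Polynomial.coeff P' i = 0"
  shows "\<exists>Q Q' T T'. prel Q Q' \<and> prel T T' \<and> P = F * Q + T \<and> P' = F' * Q' + T' \<and>
    (\<forall>i\<ge>d. Polynomial.coeff T i = 0)"
  using assms(6-)
proof (induction n arbitrary: P P')
  case 0
  thus ?case using prel_0 by (intro exI[of _ 0] exI[of _ 0] exI[of _ P] exI[of _ P']) auto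
next
  case (Suc n)
  show ?case
  proof (cases "d \<le> n")
    case False
    thus ?thesis using Suc.prems prel_0 by (intro exI[of _ 0] exI[of _ 0] exI[of _ P] exI[of _ P']) auto
  next
    case True
    define c c' where "c = Polynomial.coeff P n" and "c' = Polynomial.coeff P' n"
    define M M' where "M = Polynomial.monom c (n - d)" and "M' = Polynomial.monom c' (n - d)"
    have cG: "(c, c') \<in> G" using Suc.prems(1) by (simp add: prel_def c_def c'_def)
    have M: "prel M M'" unfolding M_def M'_def using cG by (rule prel_monom)
    have "prel (P - M * F) (P' - M' * F')" using Suc.prems(1) M F(1) by (intro prel_diff prel_mult)
    moreover have "Polynomial.coeff (P - M * F) i = 0 \<and> Polynomial.coeff (P' - M' * F') i = 0" if "i \<ge> n" for i
    proof (cases "i = n")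
      case True
      thus ?thesis using \<open>d \<le> n\<close> F by (simp add: M_def M'_def coeff_monom_mult c_def c'_def)
    next
      case False
      hence "i \<ge> Suc n" "i - (n - d) > d" using that \<open>d \<le> n\<close> by auto
      thus ?thesis using Suc.prems(2)[of i] F by (simp add: M_def M'_def coeff_monom_mult)
    qed
    ultimately obtain Q Q' T T' where QT: "prel Q Q'" "prel T T'" "P - M * F = F * Q + T" "P' - M' * F' = F' * Q' + T'"
      "\<forall>i\<ge>d. Polynomial.coeff T i = 0" using Suc.IH by blast
    have "P = F * (M + Q) + T" "P' = F' * (M' + Q') + T'" using QT(3,4) by (simp_all add: algebra_simps)
    moreover have "prel (M + Q) (M' + Q')" using M QT(1) by (rule prel_add)
    ultimately show ?thesis using QT by blast
  qed
qed

text \<open>\<open>F\<close> is monic of least degree over the domain of the homomorphism, and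
  \<open>F'\<close> is its image. A remainder modulo \<open>F\<close> that vanishes at
  \<open>z\<close> must be zero, and then its image is zero as well, so that divisibility carries
  over to the target.\<close>

lemma minimal_polynomial:
  obtains F F' d where "prel F F'" "d > 0" "Polynomial.degree F = d" "Polynomial.degree F' = d"
    "Polynomial.lead_coeff F = 1" "Polynomial.lead_coeff F' = 1" "poly F z = 0"
    "\<And>P P'. prel P P' \<Longrightarrow> poly P z = 0 \<Longrightarrow> \<exists>Q Q'. prel Q Q' \<and> P = F * Q \<and> P' = F' * Q'"
proof -
  define A where "A d \<longleftrightarrow> (\<exists>F F'. prel F F' \<and> Polynomial.coeff F d = 1 \<and> (\<forall>i>d. Polynomial.coeff F i = 0) \<and> poly F z = 0)" for d
  have A: "A (Polynomial.degree P)" if P: "prel P P'" "P \<noteq> 0" "poly P z = 0" for P P'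
  proof -
    define c where "c = inverse (Polynomial.lead_coeff P)"
    define c' where "c' = inverse (Polynomial.coeff P' (Polynomial.degree P))"
    have lc: "Polynomial.lead_coeff P \<noteq> 0" using P(2) by simp
    have "(c, c') \<in> G" unfolding c_def c'_def using P(1) lc by (intro inverse) (auto simp: prel_def)
    hence "prel (Polynomial.smult c P) (Polynomial.smult c' P')" using P(1) by (rule prel_smult)
    moreover have "Polynomial.coeff (Polynomial.smult c P) (Polynomial.degree P) = 1" using lc by (simp add: c_def)
    moreover have "\<forall>i>Polynomial.degree P. Polynomial.coeff (Polynomial.smult c P) i = 0" by (simp add: coeff_eq_0)
    moreover have "poly (Polynomial.smult c P) z = 0" using P(3) by simp
    ultimately show ?thesis unfolding A_def by blast
  qed
  obtain p :: "'a poly" where p: "p \<noteq> 0" "poly (map_poly to_ac p) z = 0" by (rule alg_closure_algebraic)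
  have "map_poly to_ac p \<noteq> 0" using p(1) by (metis map_poly_0 poly_eqI coeff_map_poly to_ac_0 coeff_0 to_ac_eq_0_iff)
  hence ex: "\<exists>d. A d" using A[OF prel_base] p(2) by blast
  define d where "d = (LEAST d. A d)"
  have "A d" unfolding d_def using ex by (rule LeastI_ex)
  then obtain F F' where F: "prel F F'" "Polynomial.coeff F d = 1" "\<And>i. i > d \<Longrightarrow> Polynomial.coeff F i = 0" "poly F z = 0"
    unfolding A_def by blast
  have F'0: "Polynomial.coeff F' i = 0" if "i > d" for i using F(1) F(3)[OF that] zero unfolding prel_def by metis
  have F'1: "Polynomial.coeff F' d = 1" using F(1,2) functional zero_one(2) unfolding prel_def by metis
  have deg: "Polynomial.degree F = d" "Polynomial.degree F' = d"
    using F(2,3) F'0 F'1 by (simp_all add: degree_eqI)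
  have d0: "d > 0"
  proof (rule ccontr)
    assume "\<not> d > 0"
    hence "Polynomial.degree F = 0" "Polynomial.coeff F 0 = 1" using deg F(2) by auto
    hence "F = [:1:]" by (metis degree_eq_zeroE coeff_pCons_0)
    thus False using F(4) by simp
  qed
  have dv: "\<exists>Q Q'. prel Q Q' \<and> P = F * Q \<and> P' = F' * Q'" if P: "prel P P'" "poly P z = 0" for P P'
  proof -
    define n where "n = Suc (max (Polynomial.degree P) (Polynomial.degree P'))"
    have "Polynomial.coeff P i = 0 \<and> Polynomial.coeff P' i = 0" if "i \<ge> n" for i
      using that by (auto simp: n_def intro!: coeff_eq_0)
    then obtain Q Q' T T' where Q: "prel Q Q'" "prel T T'" "P = F * Q + T" "P' = F' * Q' + T'" "\<forall>i\<ge>d. Polynomial.coeff T i = 0"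
      using prel_division[OF F(1,2) F'1 F(3) F'0 P(1)] by blast
    have "T = 0"
    proof (rule ccontr)
      assume T: "T \<noteq> 0"
      have "poly T z = 0" using P(2) F(4) Q(3) by simp
      hence "A (Polynomial.degree T)" using A Q(2) T by blast
      hence "d \<le> Polynomial.degree T" unfolding d_def by (rule Least_le)
      hence "Polynomial.lead_coeff T = 0" using Q(5) by blast
      thus False using T by simp
    qed
    moreover have "T' = 0"
    proof (rule poly_eqI)
      fix i
      have "(0, Polynomial.coeff T' i) \<in> G" using Q(2) unfolding prel_def \<open>T = 0\<close> by (metis coeff_0)
      thus "Polynomial.coeff T' i = Polynomial.coeff 0 i" using zero by simp
    qed
    ultimately show ?thesis using Q by auto
  qed
  show ?thesis by (rule that[OF F(1) d0 deg _ _ F(4) dv]) (simp_all add: deg F(2) F'1)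
qed

text \<open>\<open>z\<close> may be sent to any root of \<open>F'\<close>: a polynomial that
  vanishes at \<open>z\<close> is a multiple of \<open>F\<close>, so its image is a multiple of
  \<open>F'\<close> and vanishes at \<open>z'\<close>.\<close>

lemma extension_step:
  assumes F: "prel F F'" "poly F z = 0" "poly F' z' = 0"
    "\<And>P P'. prel P P' \<Longrightarrow> poly P z = 0 \<Longrightarrow> \<exists>Q Q'. prel Q Q' \<and> P = F * Q \<and> P' = F' * Q'"
  shows "\<exists>H. field_hom_graph H \<and> G \<subseteq> H \<and> (z, z') \<in> H"
proof -
  define H where "H = {(poly P z, poly P' z') | P P'. prel P P'}"
  have GH: "G \<subseteq> H"
  proof (clarify)
    fix x y assume "(x, y) \<in> G"
    hence "prel [:x:] [:y:]" using prel_monom[of x y 0] by (simp add: monom_0)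
    hence "(poly [:x:] z, poly [:y:] z') \<in> H" unfolding H_def by blast
    thus "(x, y) \<in> H" by simp
  qed
  have "(z, z') \<in> H"
  proof -
    have "prel [:0, 1:] [:0, 1:]" using prel_monom[OF zero_one(2), of 1] by (simp add: monom_altdef)
    hence "(poly [:0, 1:] z, poly [:0, 1:] z') \<in> H" unfolding H_def by blast
    thus ?thesis by simp
  qed
  moreover have "field_hom_graph H"
  proof
    show "(to_ac a, to_ac a) \<in> H" for a using GH base by blast
    show "(x + x', y + y') \<in> H" if xy: "(x, y) \<in> H" "(x', y') \<in> H" for x y x' y'
    proof -
      obtain P P' Q Q' where "x = poly P z" "y = poly P' z'" "x' = poly Q z" "y' = poly Q' z'" "prel P P'" "prel Q Q'"
        using xy unfolding H_def by blast
      hence "x + x' = poly (P + Q) z" "y + y' = poly (P' + Q') z'" "prel (P + Q) (P' + Q')" by (simp_all add: prel_add)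
      thus ?thesis unfolding H_def by blast
    qed
    show "(x * x', y * y') \<in> H" if xy: "(x, y) \<in> H" "(x', y') \<in> H" for x y x' y'
    proof -
      obtain P P' Q Q' where "x = poly P z" "y = poly P' z'" "x' = poly Q z" "y' = poly Q' z'" "prel P P'" "prel Q Q'"
        using xy unfolding H_def by blast
      hence "x * x' = poly (P * Q) z" "y * y' = poly (P' * Q') z'" "prel (P * Q) (P' * Q')" by (simp_all add: prel_mult)
      thus ?thesis unfolding H_def by blast
    qed
    show "y = 0" if y: "(0, y) \<in> H" for y
    proof -
      obtain P P' where P: "poly P z = 0" "y = poly P' z'" "prel P P'" using y unfolding H_def by force
      then obtain Q' where "P' = F' * Q'" using F(4) by blast
      thus ?thesis using P F(3) by simp
    qed
  qed
  ultimately show ?thesis using GH by blast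
qed

theorem extends_to_galois_aut: "\<exists>\<sigma>\<in>galois_auts. \<forall>(x, y)\<in>G. \<sigma> x = y"
proof -
  define A where "A = {H. field_hom_graph H \<and> G \<subseteq> H}"
  have GA: "G \<in> A" using field_hom_graph_axioms by (simp add: A_def)
  have "\<exists>M\<in>A. \<forall>V\<in>A. M \<subseteq> V \<longrightarrow> V = M"
  proof (rule subset_Zorn_nonempty)
    fix C assume False: "C \<noteq> {}" and C: "subset.chain A C"
    show "\<Union>C \<in> A"
    proof -
      have CA: "field_hom_graph V" "G \<subseteq> V" if "V \<in> C" for V using C that by (auto simp: subset.chain_def A_def)
      have two: "\<exists>Z\<in>C. V \<subseteq> Z \<and> Y \<subseteq> Z" if "V \<in> C" "Y \<in> C" for V Y
      proof -
        have "V \<subseteq> Y \<or> Y \<subseteq> V" using C that by (auto simp: subset.chain_def)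
        thus ?thesis using that by blast
      qed
      have "field_hom_graph (\<Union>C)"
      proof
        show "(to_ac a, to_ac a) \<in> \<Union>C" for a using False CA base by blast
        show "(x + x', y + y') \<in> \<Union>C" if xy: "(x, y) \<in> \<Union>C" "(x', y') \<in> \<Union>C" for x y x' y'
        proof -
          obtain V Y where XY: "V \<in> C" "(x, y) \<in> V" "Y \<in> C" "(x', y') \<in> Y" using xy by blast
          obtain Z where Z: "Z \<in> C" "V \<subseteq> Z" "Y \<subseteq> Z" using two[OF XY(1,3)] by blast
          have "(x + x', y + y') \<in> Z" using XY Z by (intro field_hom_graph.add CA) auto
          thus ?thesis using Z by blast
        qed
        show "(x * x', y * y') \<in> \<Union>C" if xy: "(x, y) \<in> \<Union>C" "(x', y') \<in> \<Union>C" for x y x' y'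
        proof -
          obtain V Y where XY: "V \<in> C" "(x, y) \<in> V" "Y \<in> C" "(x', y') \<in> Y" using xy by blast
          obtain Z where Z: "Z \<in> C" "V \<subseteq> Z" "Y \<subseteq> Z" using two[OF XY(1,3)] by blast
          have "(x * x', y * y') \<in> Z" using XY Z by (intro field_hom_graph.mult CA) auto
          thus ?thesis using Z by blast
        qed
        show "y = 0" if "(0, y) \<in> \<Union>C" for y using that field_hom_graph.zero CA(1) by blast
      qed
      moreover have "G \<subseteq> \<Union>C" using False CA by blast
      ultimately show ?thesis by (simp add: A_def)
    qed
  qed (use GA in blast)
  then obtain M where M0: "M \<in> A" "\<forall>V\<in>A. M \<subseteq> V \<longrightarrow> V = M" by blast
  have M: "field_hom_graph M" "G \<subseteq> M" using M0(1) by (simp_all add: A_def)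
  have max: "V = M" if "field_hom_graph V" "M \<subseteq> V" for V
  proof -
    have "V \<in> A" using that M(2) by (simp add: A_def)
    thus ?thesis using M0(2) that(2) by blast
  qed
  interpret M: field_hom_graph M by (rule M(1))
  \<comment> \<open>A maximal graph is defined everywhere, because an extension step at
    \<open>z\<close> cannot enlarge it.\<close>
  have total: "\<exists>y. (z, y) \<in> M" for z
  proof -
    obtain F F' d where F: "M.prel F F'" "d > 0" "Polynomial.degree F = d" "Polynomial.degree F' = d"
      "Polynomial.lead_coeff F = 1" "Polynomial.lead_coeff F' = 1" "poly F z = 0"
      "\<And>P P'. M.prel P P' \<Longrightarrow> poly P z = 0 \<Longrightarrow> \<exists>Q Q'. M.prel Q Q' \<and> P = F * Q \<and> P' = F' * Q'"
      by (rule M.minimal_polynomial[of z]) blast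
    obtain z' where z': "poly F' z' = 0" using alg_closed_imp_poly_has_root[of F'] F by auto
    obtain H where H: "field_hom_graph H" "M \<subseteq> H" "(z, z') \<in> H"
      using M.extension_step[OF F(1,7) z' F(8)] by blast
    hence "H = M" by (intro max)
    thus ?thesis using H by blast
  qed
  define \<sigma> where "\<sigma> z = (SOME y. (z, y) \<in> M)" for z
  have \<sigma>M: "(z, \<sigma> z) \<in> M" for z unfolding \<sigma>_def using total by (rule someI_ex)
  have \<sigma>I: "\<sigma> x = y" if "(x, y) \<in> M" for x y using M.functional[OF \<sigma>M that] .
  have \<sigma>_add: "\<sigma> (x + y) = \<sigma> x + \<sigma> y" for x y by (intro \<sigma>I M.add \<sigma>M)
  have \<sigma>_mult: "\<sigma> (x * y) = \<sigma> x * \<sigma> y" for x y by (intro \<sigma>I M.mult \<sigma>M)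
  have \<sigma>_base: "\<sigma> (to_ac a) = to_ac a" for a by (intro \<sigma>I M.base)
  have \<sigma>0: "\<sigma> 0 = 0" and \<sigma>1: "\<sigma> 1 = 1" using \<sigma>_base[of 0] \<sigma>_base[of 1] by simp_all
  have inj: "inj \<sigma>"
  proof (rule injI)
    fix x y assume xy: "\<sigma> x = \<sigma> y"
    have "\<sigma> (x - y) = 0" using \<sigma>_add[of "x - y" y] xy by simp
    hence "\<sigma> ((x - y) * inverse (x - y)) = 0" by (simp add: \<sigma>_mult)
    thus "x = y" using \<sigma>1 by (cases "x = y") auto
  qed
  have \<sigma>_poly: "\<sigma> (poly (map_poly to_ac p) x) = poly (map_poly to_ac p) (\<sigma> x)" for p x
  proof (intro \<sigma>I M.prel_poly M.prel_base \<sigma>M)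
  qed
  \<comment> \<open>The map sends the finite set of roots of a polynomial over the base field
    injectively to itself, hence onto itself, and every element is such a root.\<close>
  have "surj \<sigma>"
    unfolding surj_def
  proof
    fix y :: "'a alg_closure"
    obtain p :: "'a poly" where p: "p \<noteq> 0" "poly (map_poly to_ac p) y = 0" by (rule alg_closure_algebraic)
    define Z where "Z = {x. poly (map_poly to_ac p) x = 0}"
    have "map_poly to_ac p \<noteq> 0" using p(1) by (metis poly_eqI coeff_map_poly to_ac_0 coeff_0 to_ac_eq_0_iff)
    hence fin: "finite Z" unfolding Z_def by (rule poly_roots_finite)
    have "\<sigma> ` Z \<subseteq> Z" using \<sigma>_poly \<sigma>0 by (auto simp: Z_def) (metis \<sigma>0)
    hence "\<sigma> ` Z = Z" using fin inj by (intro endo_inj_surj) (auto intro: inj_on_subset)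
    moreover have "y \<in> Z" using p by (simp add: Z_def)
    ultimately show "\<exists>x. y = \<sigma> x" by blast
  qed
  hence "\<sigma> \<in> galois_auts" using inj \<sigma>_add \<sigma>_mult \<sigma>_base by (simp add: galois_auts_def bij_def)
  moreover have "\<forall>(x, y)\<in>G. \<sigma> x = y" using M(2) \<sigma>I by blast
  ultimately show ?thesis by blast
qed

end

section \<open>Galois automorphisms\<close>

lemma galois_auts_hom:
  fixes \<sigma> :: "'a::field alg_closure \<Rightarrow> 'a alg_closure"
  assumes "\<sigma> \<in> galois_auts"
  shows "\<sigma> (x + y) = \<sigma> x + \<sigma> y" "\<sigma> (x * y) = \<sigma> x * \<sigma> y" "\<sigma> (to_ac a) = to_ac a" "bij \<sigma>"
    "\<sigma> 0 = 0" "\<sigma> 1 = 1" "\<sigma> (x ^ n) = \<sigma> x ^ n" "\<sigma> (x - y) = \<sigma> x - \<sigma> y" "\<sigma> (inverse x) = inverse (\<sigma> x)"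
    "\<sigma> (\<Sum>i\<in>A. f i) = (\<Sum>i\<in>A. \<sigma> (f i))"
proof -
  show add: "\<sigma> (x + y) = \<sigma> x + \<sigma> y" for x y using assms by (simp add: galois_auts_def)
  show mult: "\<sigma> (x * y) = \<sigma> x * \<sigma> y" for x y using assms by (simp add: galois_auts_def)
  show base: "\<sigma> (to_ac a) = to_ac a" for a using assms by (simp add: galois_auts_def)
  show "bij \<sigma>" using assms by (simp add: galois_auts_def)
  show 0: "\<sigma> 0 = 0" using base[of 0] by simp
  show 1: "\<sigma> 1 = 1" using base[of 1] by simp
  show "\<sigma> (x ^ n) = \<sigma> x ^ n" by (induction n) (simp_all add: 1 mult)
  show "\<sigma> (x - y) = \<sigma> x - \<sigma> y" using add[of "x - y" y] by simp
  show "\<sigma> (inverse x) = inverse (\<sigma> x)"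
  proof (cases "x = 0")
    case False
    hence "\<sigma> x * \<sigma> (inverse x) = 1" using mult[of x "inverse x"] 1 by simp
    thus ?thesis using inverse_unique[of "\<sigma> x"] by simp
  qed (simp add: 0)
  show "\<sigma> (\<Sum>i\<in>A. f i) = (\<Sum>i\<in>A. \<sigma> (f i))"
    by (induction A rule: infinite_finite_induct) (simp_all add: 0 add)
qed

lemma galois_auts_id: "id \<in> galois_auts"
  by (simp add: galois_auts_def)

lemma galois_auts_comp: "\<sigma> \<in> galois_auts \<Longrightarrow> \<tau> \<in> galois_auts \<Longrightarrow> \<sigma> \<circ> \<tau> \<in> galois_auts"
  by (simp add: galois_auts_def bij_comp)

lemma galois_auts_inv:
  fixes \<sigma> :: "'a::field alg_closure \<Rightarrow> 'a alg_closure"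
  assumes s: "\<sigma> \<in> galois_auts"
  shows "inv_into UNIV \<sigma> \<in> galois_auts"
proof -
  note h = galois_auts_hom[OF s]
  have sv: "\<sigma> (inv_into UNIV \<sigma> x) = x" for x using h(4) by (simp add: bij_def surj_f_inv_f)
  have vs: "inv_into UNIV \<sigma> (\<sigma> x) = x" for x using h(4) by (simp add: bij_def)
  have "inv_into UNIV \<sigma> (x + y) = inv_into UNIV \<sigma> x + inv_into UNIV \<sigma> y" for x y
    using vs[of "inv_into UNIV \<sigma> x + inv_into UNIV \<sigma> y"] by (simp add: h(1) sv)
  moreover have "inv_into UNIV \<sigma> (x * y) = inv_into UNIV \<sigma> x * inv_into UNIV \<sigma> y" for x y
    using vs[of "inv_into UNIV \<sigma> x * inv_into UNIV \<sigma> y"] by (simp add: h(2) sv)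
  moreover have "inv_into UNIV \<sigma> (to_ac a) = to_ac a" for a using vs[of "to_ac a"] by (simp add: h(3))
  ultimately show ?thesis using bij_imp_bij_inv[OF h(4)] by (simp add: galois_auts_def)
qed

text \<open>If \<open>u\<close> were the only root of \<open>F\<close>, it would be a multiple root
  of \<open>F\<close> and so of \<open>g\<close>, and the derivative of \<open>g\<close> would
  vanish there.\<close>

lemma second_root:
  fixes F g :: "'b::alg_closed_field poly"
  assumes "poly F u = 0" "Polynomial.degree F > 1" "F dvd g" "poly (pderiv g) u \<noteq> 0"
  shows "\<exists>z. z \<noteq> u \<and> poly F z = 0"
proof -
  define l where "l = [:- u, 1:]"
  have l: "poly l u = 0" "Polynomial.degree l = 1" "l \<noteq> 0" by (simp_all add: l_def)
  obtain H where H: "F = l * H" using assms(1) unfolding l_def poly_eq_0_iff_dvd by (auto elim: dvdE)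
  have "H \<noteq> 0" using H assms(2) by auto
  hence "Polynomial.degree F = 1 + Polynomial.degree H" unfolding H using l by (simp add: degree_mult_eq)
  hence "Polynomial.degree H > 0" using assms(2) by simp
  then obtain z where z: "poly H z = 0" using alg_closed_imp_poly_has_root by blast
  have "z \<noteq> u"
  proof
    assume zu: "z = u"
    obtain E where E: "g = F * E" using assms(3) by (rule dvdE)
    have "poly (pderiv g) u = 0" unfolding E H using z zu l by (simp add: pderiv_mult)
    thus False using assms(4) by simp
  qed
  moreover have "poly F z = 0" unfolding H using z by simp
  ultimately show ?thesis by blast
qed

section \<open>Roots of unity of order prime to the residue characteristic\<close>

context local_field_char_0
begin

lemma galois_Oac:
  assumes s: "\<sigma> \<in> galois_auts" and x: "x \<in> Oac"
  shows "\<sigma> x \<in> Oac"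
proof -
  note h = galois_auts_hom[OF s]
  obtain n c where c: "x ^ n = (\<Sum>i<n. to_ac (c i) * x ^ i)" "\<forall>i. c i \<in> R"
    using x unfolding integers_ac_iff Rspan_def by blast
  have "\<sigma> x ^ n = \<sigma> (\<Sum>i<n. to_ac (c i) * x ^ i)" unfolding c(1)[symmetric] by (simp add: h)
  also have "\<dots> = (\<Sum>i<n. to_ac (c i) * \<sigma> x ^ i)" by (simp add: h)
  finally show ?thesis using c(2) unfolding integers_ac_iff Rspan_def by blast
qed

lemma galois_Mac:
  assumes s: "\<sigma> \<in> galois_auts" and x: "x \<in> Mac"
  shows "\<sigma> x \<in> Mac"
proof (rule ccontr)
  note h = galois_auts_hom[OF s]
  assume "\<sigma> x \<notin> Mac"
  hence 0: "\<sigma> x \<noteq> 0" "inverse (\<sigma> x) \<in> Oac" using galois_Oac[OF s Mac_Oac[OF x]] by (auto simp: Mac_iff)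
  have x0: "x \<noteq> 0"
  proof
    assume "x = 0"
    hence "\<sigma> x = 0" by (simp only: h(5))
    thus False using 0(1) by contradiction
  qed
  have 1: "\<sigma> (inverse x) \<in> Oac" unfolding h(9) by (rule 0(2))
  have "inv_into UNIV \<sigma> (\<sigma> (inverse x)) \<in> Oac" by (rule galois_Oac[OF galois_auts_inv[OF s] 1])
  hence "inverse x \<in> Oac" using h(4) by (simp add: bij_def)
  thus False using x x0 by (simp add: Mac_iff)
qed

lemma root_of_unity_Oac:
  assumes "\<eta> ^ n = 1" "n > 0"
  shows "\<eta> \<in> Oac" "\<eta> \<notin> Mac"
proof -
  show O: "\<eta> \<in> Oac" by (rule Oac_root[of _ n]) (simp_all add: assms)
  show "\<eta> \<notin> Mac"
  proof
    assume "\<eta> \<in> Mac"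
    hence "\<eta> * \<eta> ^ (n - 1) \<in> Mac" using O by (intro Mac_mult Oac_power)
    moreover have "\<eta> * \<eta> ^ (n - 1) = \<eta> ^ n" using assms(2) by (cases n) simp_all
    ultimately show False using assms(1) by simp
  qed
qed

text \<open>\<open>1 - \<eta>\<close> divides each \<open>1 - \<eta> ^ i\<close>, and these add up to \<open>n\<close>, which is a unit.\<close>

lemma one_minus_root_of_unity_unit:
  assumes "\<eta> ^ n = 1" "n > 0" "v (of_nat n) = 1" "\<eta> \<noteq> 1"
  shows "1 - \<eta> \<notin> Mac"
proof
  assume M: "1 - \<eta> \<in> Mac"
  note O = root_of_unity_Oac[OF assms(1,2)]
  have "(1 - \<eta>) * (\<Sum>i<n. \<eta> ^ i) = 0" using one_diff_power_eq[of \<eta> n] assms(1) by simp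
  hence "(\<Sum>i<n. \<eta> ^ i) = 0" using assms(4) by simp
  hence "of_nat n = (\<Sum>i<n. 1 - \<eta> ^ i)" by (simp add: sum_subtractf)
  also have "\<dots> \<in> Mac"
  proof (rule Mac_sum)
    fix i
    have "1 - \<eta> ^ i = (1 - \<eta>) * (\<Sum>j<i. \<eta> ^ j)" by (rule one_diff_power_eq)
    thus "1 - \<eta> ^ i \<in> Mac" using Mac_mult[OF M Oac_sum[of "{..<i}" "\<lambda>j. \<eta> ^ j"]] O(1) by (simp add: Oac_power)
  qed
  finally have n: "of_nat n \<in> Mac" .
  have "to_ac (inverse (of_nat n)) \<in> Oac" by (rule Oac_to_ac[OF inverse_in_R[OF assms(3)]])
  with n have "of_nat n * to_ac (inverse (of_nat n)) \<in> Mac" by (rule Mac_mult)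
  thus False using assms(2) by simp
qed

text \<open>The quotient \<open>\<eta>\<close> of two different roots makes
  \<open>1 - \<eta>\<close> a unit, whereas it inherits membership in the maximal ideal from their
  difference. This is how equalities are read off from the congruences that define the Weil
  group.\<close>

lemma roots_of_unity_eq_if_congruent:
  assumes "\<zeta> ^ n = 1" "\<xi> ^ n = 1" "n > 0" "v (of_nat n) = 1" "\<zeta> - \<xi> \<in> Mac"
  shows "\<zeta> = \<xi>"
proof (rule ccontr)
  assume ne: "\<zeta> \<noteq> \<xi>"
  have x0: "\<zeta> \<noteq> 0" using assms(1,3) by (auto simp: power_0_left)
  define \<eta> where "\<eta> = \<xi> * inverse \<zeta>"
  have "\<eta> ^ n = 1" using assms(1,2) by (simp add: \<eta>_def power_mult_distrib power_inverse)
  moreover have "\<eta> \<noteq> 1"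
  proof
    assume "\<eta> = 1"
    hence "(\<xi> * inverse \<zeta>) * \<zeta> = 1 * \<zeta>" by (simp only: \<eta>_def)
    hence "\<xi> = \<zeta>" using x0 by (simp add: mult.assoc)
    thus False using ne by simp
  qed
  ultimately have "1 - \<eta> \<notin> Mac" using one_minus_root_of_unity_unit assms by blast
  moreover have "1 - \<eta> = (\<zeta> - \<xi>) * inverse \<zeta>" using x0 by (simp add: \<eta>_def left_diff_distrib)
  moreover have "inverse \<zeta> ^ n = 1" using assms(1) by (simp add: power_inverse)
  hence "inverse \<zeta> \<in> Oac" using root_of_unity_Oac assms(3) by blast
  ultimately show False using Mac_mult[OF assms(5)] by simp
qed

lemma Mac_congruence: "prime_ideal_congruence Oac Mac p0"
proof
  show "of_nat p0 \<in> Mac" using Mac_to_ac[OF p0(2)] by simp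
  show "x + y \<in> Oac" if "x \<in> Oac" "y \<in> Oac" for x y using that by (rule Oac_add)
  show "x * y \<in> Oac" if "x \<in> Oac" "y \<in> Oac" for x y using that by (rule Oac_mult)
  show "x + y \<in> Mac" if "x \<in> Mac" "y \<in> Mac" for x y using that by (rule Mac_add)
  show "x * y \<in> Mac" if "x \<in> Oac" "y \<in> Mac" for x y using that by (rule Mac_mult_left)
  show "- x \<in> Mac" if "x \<in> Mac" for x using that by (rule Mac_uminus)
  show "Mac \<subseteq> Oac" using Mac_Oac by blast
qed (simp_all add: prime_p0)

lemma power_congruent:
  assumes "x - y \<in> Mac" "x \<in> Oac" "y \<in> Oac"
  shows "x ^ n - y ^ n \<in> Mac"
  using prime_ideal_congruence.cong_power[OF Mac_congruence assms] .

text \<open>Some power of \<open>x\<close> is congruent to 1. The least such exponent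
  \<open>n\<close> is prime to \<open>p0\<close>, because \<open>x ^ (p0 * m) - 1\<close> is
  congruent to \<open>(x ^ m - 1) ^ p0\<close>. As \<open>x ^ n - 1\<close> is the product of the
  differences of \<open>x\<close> from the \<open>n\<close>-th roots of unity, one of these
  differences is a non-unit.\<close>

lemma teichmueller:
  assumes x: "x \<in> Oac" "x \<notin> Mac"
  obtains \<zeta> n where "n > 0" "v (of_nat n) = 1" "\<zeta> ^ n = 1" "x - \<zeta> \<in> Mac"
proof -
  interpret C: prime_ideal_congruence Oac Mac p0 by (rule Mac_congruence)
  obtain M s where M: "M > 0" "s \<in> Oac" "x ^ M = pi * s \<or> x ^ M = 1 + pi * s"
    using power_congruent_0_or_1[OF x(1)] by blast
  have "x ^ M \<noteq> pi * s"
  proof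
    assume "x ^ M = pi * s"
    hence "x ^ M \<in> Mac" using Mac_mult[OF pi_Mac M(2)] by simp
    thus False using Mac_power[OF x(1)] x(2) by blast
  qed
  hence "x ^ M - 1 = pi * s" using M(3) by simp
  hence 1: "x ^ M - 1 \<in> Mac" using Mac_mult[OF pi_Mac M(2)] by simp
  define n where "n = (LEAST n. n > 0 \<and> x ^ n - 1 \<in> Mac)"
  have n: "n > 0 \<and> x ^ n - 1 \<in> Mac"
    using LeastI[of "\<lambda>n. n > 0 \<and> x ^ n - 1 \<in> Mac" M] 1 M(1) unfolding n_def by blast
  have "\<not> p0 dvd n"
  proof
    assume "p0 dvd n"
    then obtain m where m: "n = p0 * m" by (rule dvdE)
    have O: "x ^ m - 1 \<in> Oac" using x(1) by (intro Oac_diff Oac_power) auto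
    have "((x ^ m - 1) + 1) ^ p0 - ((x ^ m - 1) ^ p0 + 1 ^ p0) \<in> Mac"
      using O by (intro C.add_power_p) auto
    moreover have "((x ^ m - 1) + 1) ^ p0 = x ^ n" by (simp add: m mult.commute power_mult)
    ultimately have "(x ^ n - 1) - (x ^ m - 1) ^ p0 \<in> Mac" by (simp add: algebra_simps)
    with conjunct2[OF n] have "(x ^ n - 1) - ((x ^ n - 1) - (x ^ m - 1) ^ p0) \<in> Mac" by (rule Mac_diff)
    hence "(x ^ m - 1) ^ p0 \<in> Mac" by simp
    hence "x ^ m - 1 \<in> Mac" using O Mac_power by blast
    moreover have "m > 0" using n m by (intro Nat.gr0I) auto
    ultimately have "n \<le> m" unfolding n_def by (intro Least_le) blast
    moreover have "p0 > 1" using prime_p0 prime_gt_1_nat by blast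
    ultimately show False using \<open>m > 0\<close> m by simp
  qed
  hence vn: "v (of_nat n) = 1" by (rule v_of_nat_eq_1)
  define g where "g = Polynomial.monom (1::'a alg_closure) n - 1"
  have gp: "poly g z = z ^ n - 1" for z by (simp add: g_def poly_monom)
  have gn: "Polynomial.coeff g n = 1" using n by (simp add: g_def)
  have "Polynomial.degree g = n" by (rule degree_eqI) (use n in \<open>auto simp: g_def\<close>)
  hence lc: "Polynomial.lead_coeff g = 1" "g \<noteq> 0" using gn by auto
  obtain A where A: "g = (\<Prod>a\<in>#A. [:- a, 1:])"
    using alg_closed_imp_factorization[OF lc(2)] lc(1) by auto
  have "prod_mset (image_mset (\<lambda>a. x - a) A) \<in> Mac"
  proof -
    have "poly g x = prod_mset (image_mset (\<lambda>a. x - a) A)" unfolding A by (simp add: poly_prod_mset)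
    thus ?thesis using n gp by simp
  qed
  moreover have root: "a ^ n = 1" if "a \<in># A" for a
  proof -
    have "poly g a = 0" unfolding A using that by (auto simp: poly_prod_mset prod_mset_zero_iff)
    thus ?thesis by (simp add: gp)
  qed
  have "x - a \<in> Oac" if "a \<in># A" for a
    using x(1) root_of_unity_Oac[OF root[OF that]] n by (intro Oac_diff) auto
  ultimately obtain a where "a \<in># A" "x - a \<in> Mac" using prod_mset_Mac[of "\<lambda>a. x - a" A] by blast
  thus ?thesis using that n vn root by blast
qed

section \<open>The action of Frobenius on roots of unity\<close>

definition kpoly :: "'a alg_closure poly \<Rightarrow> bool" where
  "kpoly P \<longleftrightarrow> (\<forall>i. Polynomial.coeff P i \<in> range to_ac)"

lemma base_graph: "field_hom_graph (Id_on (range (to_ac :: 'a \<Rightarrow> _)))"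
proof
  show "(x + x', y + y') \<in> Id_on (range to_ac)" if "(x, y) \<in> Id_on (range (to_ac :: 'a \<Rightarrow> _))" "(x', y') \<in> Id_on (range to_ac)" for x y x' y'
    using that by (auto simp: Id_on_iff simp flip: to_ac_add)
  show "(x * x', y * y') \<in> Id_on (range to_ac)" if "(x, y) \<in> Id_on (range (to_ac :: 'a \<Rightarrow> _))" "(x', y') \<in> Id_on (range to_ac)" for x y x' y'
    using that by (auto simp: Id_on_iff simp flip: to_ac_mult)
qed auto

text \<open>The identity of the base field is itself a homomorphism graph, so the closure properties
  of \<open>kpoly\<close> are instances of those of \<open>prel\<close>.\<close>

lemma kpoly_prel: "field_hom_graph.prel (Id_on (range to_ac)) P Q \<longleftrightarrow> kpoly P \<and> P = Q"
  unfolding field_hom_graph.prel_def[OF base_graph] kpoly_def by (auto simp: Id_on_iff poly_eq_iff)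

lemma kpoly_add: "kpoly P \<Longrightarrow> kpoly Q \<Longrightarrow> kpoly (P + Q)"
  using field_hom_graph.prel_add[OF base_graph, of P P Q Q] by (simp add: kpoly_prel)

lemma kpoly_mult: "kpoly P \<Longrightarrow> kpoly Q \<Longrightarrow> kpoly (P * Q)"
  using field_hom_graph.prel_mult[OF base_graph, of P P Q Q] by (simp add: kpoly_prel)

lemma kpoly_monom: "kpoly (Polynomial.monom (to_ac a) n)"
  using field_hom_graph.prel_monom[OF base_graph, of "to_ac a" "to_ac a" n] by (simp add: kpoly_prel Id_on_iff)

lemma kpoly_pcompose:
  assumes "kpoly P" "kpoly Q"
  shows "kpoly (pcompose P Q)"
  using assms(1)
proof (induction P)
  case (pCons a P)
  have "kpoly P" using pCons.prems unfolding kpoly_def by (metis coeff_pCons_Suc)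
  hence 1: "kpoly (Q * pcompose P Q)" using pCons.IH assms(2) by (simp add: kpoly_mult)
  have "a \<in> range to_ac" using pCons.prems unfolding kpoly_def by (metis coeff_pCons_0)
  then obtain b where "a = to_ac b" by blast
  hence "kpoly [:a:]" using kpoly_monom[of b 0] by (simp add: monom_0)
  hence "kpoly ([:a:] + Q * pcompose P Q)" using 1 by (rule kpoly_add)
  thus ?case by (simp add: pcompose_pCons)
next
  case 0
  show ?case using kpoly_monom[of 0 0] by simp
qed

lemma coeff_prod_linear_Oac:
  assumes "\<And>a. a \<in># A \<Longrightarrow> a \<in> Oac"
  shows "Polynomial.coeff (\<Prod>a\<in>#A. [:- a, 1:]) i \<in> Oac"
  using assms
proof (induction A arbitrary: i)
  case (add a A)
  let ?P = "\<Prod>a\<in>#A. [:- a, 1:]"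
  have "Polynomial.coeff ([:- a, 1:] * ?P) i = - a * Polynomial.coeff ?P i + Polynomial.coeff (pCons 0 ?P) i"
    by (simp add: mult_pCons_left)
  moreover have "Polynomial.coeff (pCons 0 ?P) i \<in> Oac"
    using add by (auto simp: coeff_pCons split: nat.split)
  ultimately show ?case using add by (simp add: Oac_add Oac_mult Oac_uminus Oac_diff)
qed (simp add: Polynomial.coeff_1)

text \<open>Let \<open>F\<close> be the minimal polynomial of \<open>\<zeta>\<close>. The
  \<open>q\<close>-th power of \<open>F(\<zeta>) = 0\<close> shows that
  \<open>F(\<zeta> ^ q)\<close> is a non-unit, so \<open>\<zeta> ^ q\<close> is congruent to a root
  of \<open>F\<close>. Both are \<open>n\<close>-th roots of unity, and congruent ones are
  equal.\<close>

lemma frobenius_on_roots_of_unity: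
  assumes n: "n > 0" "v (of_nat n) = 1" "\<zeta> ^ n = 1" and P: "kpoly P" "poly P \<zeta> = 0"
  shows "poly P (\<zeta> ^ q) = 0"
proof -
  interpret D: field_hom_graph "Id_on (range (to_ac :: 'a \<Rightarrow> _))" by (rule base_graph)
  interpret C: prime_ideal_congruence Oac Mac p0 by (rule Mac_congruence)
  obtain F F' d where F: "D.prel F F'" "d > 0" "Polynomial.degree F = d" "Polynomial.degree F' = d"
    "Polynomial.lead_coeff F = 1" "Polynomial.lead_coeff F' = 1" "poly F \<zeta> = 0"
    "\<And>P P'. D.prel P P' \<Longrightarrow> poly P \<zeta> = 0 \<Longrightarrow> \<exists>Q Q'. D.prel Q Q' \<and> P = F * Q \<and> P' = F' * Q'"
    by (rule D.minimal_polynomial[of \<zeta>]) blast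
  have kF: "kpoly F" using F(1) unfolding kpoly_prel by blast
  define g where "g = Polynomial.monom (1::'a alg_closure) n + Polynomial.monom (- 1) 0"
  have gp: "poly g z = z ^ n - 1" for z by (simp add: g_def poly_monom)
  have "kpoly g" unfolding g_def using kpoly_monom[of 1 n] kpoly_monom[of "- 1" 0] by (intro kpoly_add) simp_all
  hence "D.prel g g" by (simp add: kpoly_prel)
  moreover have "poly g \<zeta> = 0" using n by (simp add: gp)
  ultimately obtain E where E: "g = F * E" using F(8) by blast
  have "F \<noteq> 0" using F(5) by auto
  then obtain A where A: "F = (\<Prod>a\<in>#A. [:- a, 1:])"
    using alg_closed_imp_factorization[of F] F(5) by auto
  have root: "a ^ n = 1" if "a \<in># A" for a
  proof -
    have "poly F a = 0" unfolding A using that by (auto simp: poly_prod_mset prod_mset_zero_iff)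
    hence "poly g a = 0" unfolding E by simp
    thus ?thesis by (simp add: gp)
  qed
  have rO: "a \<in> Oac" if "a \<in># A" for a using root_of_unity_Oac[OF root[OF that] n(1)] by simp
  have zO: "\<zeta> \<in> Oac" using root_of_unity_Oac[OF n(3,1)] by simp
  have "\<forall>i. \<exists>a. Polynomial.coeff F i = to_ac a" using kF unfolding kpoly_def by blast
  from choice[OF this] obtain c where c: "\<And>i. Polynomial.coeff F i = to_ac (c i)" by blast
  have cR: "c i \<in> R" for i
  proof -
    have "Polynomial.coeff F i \<in> Oac" unfolding A using rO by (rule coeff_prod_linear_Oac)
    thus ?thesis by (simp add: c Oac_to_ac_iff)
  qed
  obtain f where f: "f > 0" "q = p0 ^ f" using q_prime_power by blast
  have "poly F (\<zeta> ^ q) \<in> Mac"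
  proof -
    have "(\<Sum>i\<le>d. to_ac (c i) * \<zeta> ^ i) ^ q - (\<Sum>i\<le>d. (to_ac (c i) * \<zeta> ^ i) ^ q) \<in> Mac"
      unfolding f(2) using cR zO by (intro C.sum_power_p_power) (auto intro: Oac_mult Oac_power Oac_to_ac)
    moreover have "(\<Sum>i\<le>d. to_ac (c i) * \<zeta> ^ i) = 0" using F(7) by (simp add: poly_altdef F(3) c)
    hence "(\<Sum>i\<le>d. to_ac (c i) * \<zeta> ^ i) ^ q = 0" using q_pos by (simp add: power_0_left)
    ultimately have 1: "- (\<Sum>i\<le>d. (to_ac (c i) * \<zeta> ^ i) ^ q) \<in> Mac" by simp
    have "(\<Sum>i\<le>d. to_ac (c i ^ q - c i) * (\<zeta> ^ q) ^ i) \<in> Mac"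
    proof (rule Mac_sum)
      fix i
      show "to_ac (c i ^ q - c i) * (\<zeta> ^ q) ^ i \<in> Mac"
        using power_q_cong[OF cR[of i]] zO by (intro Mac_mult Mac_to_ac Oac_power)
    qed
    also have "(\<Sum>i\<le>d. to_ac (c i ^ q - c i) * (\<zeta> ^ q) ^ i) =
        (\<Sum>i\<le>d. (to_ac (c i) * \<zeta> ^ i) ^ q) - (\<Sum>i\<le>d. to_ac (c i) * (\<zeta> ^ q) ^ i)"
      unfolding sum_subtractf[symmetric]
    proof (intro sum.cong refl)
      fix i
      have "(\<zeta> ^ q) ^ i = (\<zeta> ^ i) ^ q" by (simp only: power_mult[symmetric] mult.commute)
      thus "to_ac (c i ^ q - c i) * (\<zeta> ^ q) ^ i = (to_ac (c i) * \<zeta> ^ i) ^ q - to_ac (c i) * (\<zeta> ^ q) ^ i"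
        by (simp add: left_diff_distrib power_mult_distrib)
    qed
    also have "(\<Sum>i\<le>d. to_ac (c i) * (\<zeta> ^ q) ^ i) = poly F (\<zeta> ^ q)" by (simp add: poly_altdef F(3) c)
    finally have "(\<Sum>i\<le>d. (to_ac (c i) * \<zeta> ^ i) ^ q) - poly F (\<zeta> ^ q) \<in> Mac" .
    with 1 have "- (\<Sum>i\<le>d. (to_ac (c i) * \<zeta> ^ i) ^ q) + ((\<Sum>i\<le>d. (to_ac (c i) * \<zeta> ^ i) ^ q) - poly F (\<zeta> ^ q)) \<in> Mac"
      by (rule Mac_add)
    hence "- poly F (\<zeta> ^ q) \<in> Mac" by simp
    thus ?thesis using Mac_uminus[of "- poly F (\<zeta> ^ q)"] by simp
  qed
  moreover have pF: "poly F (\<zeta> ^ q) = prod_mset (image_mset (\<lambda>a. \<zeta> ^ q - a) A)"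
    unfolding A by (simp add: poly_prod_mset)
  ultimately obtain a where a: "a \<in># A" "\<zeta> ^ q - a \<in> Mac"
    using prod_mset_Mac[of "\<lambda>a. \<zeta> ^ q - a" A] rO zO by (auto intro: Oac_diff Oac_power)
  have "(\<zeta> ^ q) ^ n = 1" using n(3) by (metis mult.commute power_mult power_one)
  hence "\<zeta> ^ q = a" using roots_of_unity_eq_if_congruent[OF _ root[OF a(1)] n(1,2) a(2)] by blast
  hence "poly F (\<zeta> ^ q) = 0" unfolding pF using a(1) by (auto simp: prod_mset_zero_iff)
  moreover obtain Q where "P = F * Q" using F(8)[of P P] P by (auto simp: kpoly_prel)
  ultimately show ?thesis by simp
qed


text \<open>By \<open>teichmueller\<close> these roots of unity represent the nonzero classes of the
  residue field of the algebraic closure, so they detect Frobenius and inertia.\<close>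

definition mu' :: "'a alg_closure set" where
  "mu' = {\<zeta>. \<exists>n>0. v (of_nat n) = 1 \<and> \<zeta> ^ n = 1}"

text \<open>Rewrites polynomial expressions in two roots of unity as expressions in a single one, so
  that the fields built from \<open>mu'\<close> are closed under sums and products.\<close>

lemma mu'_common_root:
  assumes "\<zeta> \<in> mu'" "\<xi> \<in> mu'"
  obtains \<omega> n a b where "n > 0" "v (of_nat n) = 1" "\<omega> ^ n = 1" "\<zeta> = \<omega> ^ a" "\<xi> = \<omega> ^ b"
proof -
  obtain n where n: "n > 0" "v (of_nat n) = 1" "\<zeta> ^ n = 1" using assms(1) unfolding mu'_def by blast
  obtain m where m: "m > 0" "v (of_nat m) = 1" "\<xi> ^ m = 1" using assms(2) unfolding mu'_def by blast
  have nm: "n * m > 0" "v (of_nat (n * m)) = 1" using n m by (simp_all add: mult)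
  obtain \<omega> :: "'a alg_closure" where \<omega>: "primitive_root (n * m) \<omega>" using exists_primitive_root[OF nm(1)] .
  have "\<zeta> ^ (n * m) = 1" using n(3) by (simp add: power_mult)
  then obtain a where a: "\<zeta> = \<omega> ^ a" using primitive_root_generates[OF \<omega> nm(1)] by blast
  have "\<xi> ^ (m * n) = 1" using m(3) by (simp add: power_mult)
  hence "\<xi> ^ (n * m) = 1" by (simp only: mult.commute)
  then obtain b where b: "\<xi> = \<omega> ^ b" using primitive_root_generates[OF \<omega> nm(1)] by blast
  show ?thesis using that[OF nm _ a b] \<omega> by (simp add: primitive_root_def)
qed

lemma mu'_Oac: "\<zeta> \<in> mu' \<Longrightarrow> \<zeta> \<in> Oac"
  using root_of_unity_Oac unfolding mu'_def by blast

lemma kpoly_power_arg: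
  assumes "kpoly P"
  shows "\<exists>Q. kpoly Q \<and> (\<forall>x. poly Q x = poly P (x ^ a))"
proof -
  have "kpoly (pcompose P (Polynomial.monom 1 a))" using kpoly_pcompose[OF assms kpoly_monom[of 1 a]] by simp
  moreover have "poly (pcompose P (Polynomial.monom 1 a)) x = poly P (x ^ a)" for x by (simp add: poly_pcompose poly_monom)
  ultimately show ?thesis by blast
qed

text \<open>The graph \<open>G\<close> sends a polynomial expression in \<open>\<zeta>\<close> to
  the same expression in \<open>\<zeta> ^ q\<close>. That it is single-valued is exactly
  \<open>frobenius_on_roots_of_unity\<close>.\<close>

lemma exists_frobenius:
  obtains \<sigma> where "\<sigma> \<in> galois_auts" "\<And>\<zeta>. \<zeta> \<in> mu' \<Longrightarrow> \<sigma> \<zeta> = \<zeta> ^ q"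
proof -
  define G where "G = {(poly P \<zeta>, poly P (\<zeta> ^ q)) | P \<zeta>. kpoly P \<and> \<zeta> \<in> mu'}"
  have two: "\<exists>\<omega>\<in>mu'. \<exists>P Q. kpoly P \<and> kpoly Q \<and> x = poly P \<omega> \<and> y = poly P (\<omega> ^ q) \<and> x' = poly Q \<omega> \<and> y' = poly Q (\<omega> ^ q)"
    if xy: "(x, y) \<in> G" "(x', y') \<in> G" for x y x' y'
  proof -
    obtain P \<zeta> where P: "kpoly P" "\<zeta> \<in> mu'" "x = poly P \<zeta>" "y = poly P (\<zeta> ^ q)" using xy(1) unfolding G_def by blast
    obtain Q \<xi> where Q: "kpoly Q" "\<xi> \<in> mu'" "x' = poly Q \<xi>" "y' = poly Q (\<xi> ^ q)" using xy(2) unfolding G_def by blast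
    obtain \<omega> n a b where \<omega>: "n > 0" "v (of_nat n) = 1" "\<omega> ^ n = 1" "\<zeta> = \<omega> ^ a" "\<xi> = \<omega> ^ b"
      using mu'_common_root[OF P(2) Q(2)] .
    have \<omega>m: "\<omega> \<in> mu'" using \<omega> unfolding mu'_def by blast
    obtain P' where P': "kpoly P'" "\<And>x. poly P' x = poly P (x ^ a)" using kpoly_power_arg[OF P(1)] by blast
    obtain Q' where Q': "kpoly Q'" "\<And>x. poly Q' x = poly Q (x ^ b)" using kpoly_power_arg[OF Q(1)] by blast
    have "(\<omega> ^ a) ^ q = (\<omega> ^ q) ^ a" "(\<omega> ^ b) ^ q = (\<omega> ^ q) ^ b" by (simp_all add: mult.commute flip: power_mult)
    hence "x = poly P' \<omega>" "y = poly P' (\<omega> ^ q)" "x' = poly Q' \<omega>" "y' = poly Q' (\<omega> ^ q)"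
      using P(3,4) Q(3,4) by (simp_all add: P'(2) Q'(2) \<omega>(4,5))
    thus ?thesis using \<omega>m P'(1) Q'(1) by blast
  qed
  have "field_hom_graph G"
  proof
    have one: "1 \<in> mu'" unfolding mu'_def by (intro CollectI exI[of _ 1]) simp
    show "(to_ac a, to_ac a) \<in> G" for a
    proof -
      have "(poly (Polynomial.monom (to_ac a) 0) 1, poly (Polynomial.monom (to_ac a) 0) (1 ^ q)) \<in> G"
        unfolding G_def using kpoly_monom[of a 0] one by blast
      thus ?thesis by (simp add: poly_monom)
    qed
    show "(x + x', y + y') \<in> G" if xy: "(x, y) \<in> G" "(x', y') \<in> G" for x y x' y'
    proof -
      obtain \<omega> P Q where h: "\<omega> \<in> mu'" "kpoly P" "kpoly Q" "x = poly P \<omega>" "y = poly P (\<omega> ^ q)" "x' = poly Q \<omega>" "y' = poly Q (\<omega> ^ q)"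
        using two[OF xy] by blast
      hence "(poly (P + Q) \<omega>, poly (P + Q) (\<omega> ^ q)) \<in> G" unfolding G_def using kpoly_add by blast
      thus ?thesis by (simp add: h)
    qed
    show "(x * x', y * y') \<in> G" if xy: "(x, y) \<in> G" "(x', y') \<in> G" for x y x' y'
    proof -
      obtain \<omega> P Q where h: "\<omega> \<in> mu'" "kpoly P" "kpoly Q" "x = poly P \<omega>" "y = poly P (\<omega> ^ q)" "x' = poly Q \<omega>" "y' = poly Q (\<omega> ^ q)"
        using two[OF xy] by blast
      hence "(poly (P * Q) \<omega>, poly (P * Q) (\<omega> ^ q)) \<in> G" unfolding G_def using kpoly_mult by blast
      thus ?thesis by (simp add: h)
    qed
    show "y = 0" if y: "(0, y) \<in> G" for y
    proof -
      obtain P \<zeta> where h: "kpoly P" "\<zeta> \<in> mu'" "poly P \<zeta> = 0" "y = poly P (\<zeta> ^ q)" using y unfolding G_def by force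
      obtain n where n: "n > 0" "v (of_nat n) = 1" "\<zeta> ^ n = 1" using h(2) unfolding mu'_def by blast
      show ?thesis unfolding h(4) using frobenius_on_roots_of_unity[OF n h(1,3)] .
    qed
  qed
  then obtain \<sigma> where \<sigma>: "\<sigma> \<in> galois_auts" "\<forall>(x, y)\<in>G. \<sigma> x = y"
    using field_hom_graph.extends_to_galois_aut by blast
  have "\<sigma> \<zeta> = \<zeta> ^ q" if "\<zeta> \<in> mu'" for \<zeta>
  proof -
    have "(poly (Polynomial.monom (to_ac 1) 1) \<zeta>, poly (Polynomial.monom (to_ac 1) 1) (\<zeta> ^ q)) \<in> G"
      unfolding G_def using that kpoly_monom[of 1 1] by blast
    hence "(\<zeta>, \<zeta> ^ q) \<in> G" by (simp add: poly_monom)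
    from bspec[OF \<sigma>(2) this] show ?thesis by simp
  qed
  thus ?thesis using that \<sigma>(1) by blast
qed

text \<open>Non-units stay non-units under both maps. Every other integral element is congruent to
  an element of \<open>mu'\<close>, where the two maps agree.\<close>

lemma acts_as_frobenius_powerI:
  assumes s: "\<sigma> \<in> galois_auts" and m: "\<And>\<zeta>. \<zeta> \<in> mu' \<Longrightarrow> \<sigma> \<zeta> = \<zeta> ^ (q ^ k)"
  shows "acts_as_frobenius_power v \<sigma> (int k)"
  unfolding acts_as_frobenius_power_def
proof
  note h = galois_auts_hom[OF s]
  fix x assume x: "x \<in> Oac"
  have "\<sigma> x - x ^ (q ^ k) \<in> Mac"
  proof (cases "x \<in> Mac")
    case True
    have "q ^ k > 0" using q_pos by simp
    hence "x ^ (q ^ k) = x * x ^ (q ^ k - 1)" by (metis power_eq_if not_gr_zero)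
    moreover have "x * x ^ (q ^ k - 1) \<in> Mac" using True x by (intro Mac_mult Oac_power)
    ultimately show ?thesis using galois_Mac[OF s True] by (intro Mac_diff) simp_all
  next
    case False
    obtain \<zeta> n where z: "n > 0" "v (of_nat n) = 1" "\<zeta> ^ n = 1" "x - \<zeta> \<in> Mac" using teichmueller[OF x False] .
    have zm: "\<zeta> \<in> mu'" using z unfolding mu'_def by blast
    have 1: "\<sigma> x - \<sigma> \<zeta> \<in> Mac" using galois_Mac[OF s z(4)] by (simp add: h(8))
    have 2: "x ^ (q ^ k) - \<zeta> ^ (q ^ k) \<in> Mac" using power_congruent[OF z(4) x mu'_Oac[OF zm]] .
    have "(\<sigma> x - \<sigma> \<zeta>) - (x ^ (q ^ k) - \<zeta> ^ (q ^ k)) \<in> Mac" using 1 2 by (rule Mac_diff)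
    thus ?thesis by (simp add: m[OF zm])
  qed
  thus "if 0 \<le> int k then \<sigma> x - x ^ q ^ nat (int k) \<in> Mac else \<sigma> x ^ q ^ nat (- int k) - x \<in> Mac" by simp
qed

lemma exists_geometric_frobenius:
  obtains \<sigma> where "\<sigma> \<in> galois_auts" "acts_as_frobenius_power v \<sigma> (- 1)"
proof -
  obtain \<sigma> where s: "\<sigma> \<in> galois_auts" "\<And>\<zeta>. \<zeta> \<in> mu' \<Longrightarrow> \<sigma> \<zeta> = \<zeta> ^ q"
    by (rule exists_frobenius) blast
  have f: "acts_as_frobenius_power v \<sigma> (int 1)" using s by (intro acts_as_frobenius_powerI) simp_all
  have sv: "\<sigma> (inv_into UNIV \<sigma> x) = x" for x using galois_auts_hom(4)[OF s(1)] by (simp add: bij_def surj_f_inv_f)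
  have i: "inv_into UNIV \<sigma> \<in> galois_auts" using s(1) by (rule galois_auts_inv)
  have "inv_into UNIV \<sigma> x ^ q - x \<in> Mac" if x: "x \<in> Oac" for x
  proof -
    have "\<sigma> (inv_into UNIV \<sigma> x) - inv_into UNIV \<sigma> x ^ q \<in> Mac"
      using f galois_Oac[OF i x] unfolding acts_as_frobenius_power_def by simp
    hence "- (x - inv_into UNIV \<sigma> x ^ q) \<in> Mac" unfolding sv by (rule Mac_uminus)
    thus ?thesis by simp
  qed
  hence "acts_as_frobenius_power v (inv_into UNIV \<sigma>) (- 1)" unfolding acts_as_frobenius_power_def by simp
  thus ?thesis using that i by blast
qed

section \<open>The maximal unramified extension and inertia\<close>

definition unram :: "'a alg_closure set" where
  "unram = {poly P \<zeta> | P \<zeta>. kpoly P \<and> \<zeta> \<in> mu'}"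

text \<open>Starting from the identity graph, the extension theorem yields automorphisms that fix
  the unramified extension.\<close>

lemma unram_graph: "field_hom_graph (Id_on unram)"
proof
  have one: "1 \<in> mu'" unfolding mu'_def by (intro CollectI exI[of _ 1]) simp
  show "(to_ac a, to_ac a) \<in> Id_on unram" for a
  proof -
    have "poly (Polynomial.monom (to_ac a) 0) 1 \<in> unram" unfolding unram_def using kpoly_monom[of a 0] one by blast
    thus ?thesis by (simp add: poly_monom Id_on_iff)
  qed
  have two: "\<exists>\<omega>\<in>mu'. \<exists>P Q. kpoly P \<and> kpoly Q \<and> x = poly P \<omega> \<and> x' = poly Q \<omega>"
    if xy: "x \<in> unram" "x' \<in> unram" for x x'
  proof -
    obtain P \<zeta> where P: "kpoly P" "\<zeta> \<in> mu'" "x = poly P \<zeta>" using xy(1) unfolding unram_def by blast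
    obtain Q \<xi> where Q: "kpoly Q" "\<xi> \<in> mu'" "x' = poly Q \<xi>" using xy(2) unfolding unram_def by blast
    obtain \<omega> n a b where \<omega>: "n > 0" "v (of_nat n) = 1" "\<omega> ^ n = 1" "\<zeta> = \<omega> ^ a" "\<xi> = \<omega> ^ b"
      using mu'_common_root[OF P(2) Q(2)] .
    have \<omega>m: "\<omega> \<in> mu'" using \<omega> unfolding mu'_def by blast
    obtain P' where P': "kpoly P'" "\<And>x. poly P' x = poly P (x ^ a)" using kpoly_power_arg[OF P(1)] by blast
    obtain Q' where Q': "kpoly Q'" "\<And>x. poly Q' x = poly Q (x ^ b)" using kpoly_power_arg[OF Q(1)] by blast
    have "x = poly P' \<omega>" "x' = poly Q' \<omega>" using P(3) Q(3) by (simp_all add: P'(2) Q'(2) \<omega>(4,5))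
    thus ?thesis using \<omega>m P'(1) Q'(1) by blast
  qed
  show "(x + x', y + y') \<in> Id_on unram" if xy: "(x, y) \<in> Id_on unram" "(x', y') \<in> Id_on unram" for x y x' y'
  proof -
    have e: "x \<in> unram" "x' \<in> unram" "y = x" "y' = x'" using xy by (auto simp: Id_on_iff)
    obtain \<omega> P Q where h: "\<omega> \<in> mu'" "kpoly P" "kpoly Q" "x = poly P \<omega>" "x' = poly Q \<omega>" using two[OF e(1,2)] by blast
    hence "poly (P + Q) \<omega> \<in> unram" unfolding unram_def using kpoly_add by blast
    thus ?thesis by (simp add: h e Id_on_iff)
  qed
  show "(x * x', y * y') \<in> Id_on unram" if xy: "(x, y) \<in> Id_on unram" "(x', y') \<in> Id_on unram" for x y x' y'
  proof -
    have e: "x \<in> unram" "x' \<in> unram" "y = x" "y' = x'" using xy by (auto simp: Id_on_iff)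
    obtain \<omega> P Q where h: "\<omega> \<in> mu'" "kpoly P" "kpoly Q" "x = poly P \<omega>" "x' = poly Q \<omega>" using two[OF e(1,2)] by blast
    hence "poly (P * Q) \<omega> \<in> unram" unfolding unram_def using kpoly_mult by blast
    thus ?thesis by (simp add: h e Id_on_iff)
  qed
qed (simp add: Id_on_iff)

lemma power_q_power_cong:
  assumes a: "a \<in> R"
  shows "v (a ^ (q ^ r) - a) < 1"
proof (induction r)
  case (Suc r)
  have "v ((a ^ (q ^ r)) ^ q - a ^ (q ^ r)) < 1" using a by (intro power_q_cong R_power)
  hence "v (((a ^ (q ^ r)) ^ q - a ^ (q ^ r)) + (a ^ (q ^ r) - a)) < 1" using Suc by (rule v_less_add)
  thus ?case by (simp add: mult.commute flip: power_mult)
qed simp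

lemma Rspan_root_of_unity:
  assumes n: "n > 0" "\<zeta> ^ n = 1"
  defines "S \<equiv> Rspan {..<n} (\<lambda>i. \<zeta> ^ i)"
  shows "a \<in> S \<Longrightarrow> b \<in> S \<Longrightarrow> a * b \<in> S" "\<zeta> ^ k \<in> S" "S \<subseteq> Oac" "a \<in> S \<Longrightarrow> a ^ k \<in> S" "1 \<in> S"
proof -
  have "(\<lambda>i. \<zeta> ^ i) 0 \<in> Rspan {..<n} (\<lambda>i. \<zeta> ^ i)" by (rule Rspan_base) (use n in simp_all)
  thus 1: "1 \<in> S" by (simp add: S_def)
  hence zn: "\<zeta> ^ n \<in> Rspan {..<n} (\<lambda>i. \<zeta> ^ i)" using n(2) by (simp add: S_def)
  show m: "a * b \<in> S" if "a \<in> S" "b \<in> S" for a b using Rspan_powers_mult[OF zn] that by (simp add: S_def)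
  show p: "a ^ k \<in> S" if "a \<in> S" for a k by (induction k) (use 1 m that in auto)
  have "\<zeta> * \<zeta> ^ 0 \<in> S" unfolding S_def by (rule power_in_Rspan_step[OF zn n(1)])
  thus "\<zeta> ^ k \<in> S" using p by simp
  show "S \<subseteq> Oac" unfolding S_def
    by (intro subsetI, erule Oac_Rspan, rule Oac_power, rule root_of_unity_Oac(1)[OF n(2,1)])
qed

text \<open>\<open>unif\<close> stays prime in \<open>S = R[\<zeta>]\<close>: the \<open>q ^ r\<close>-th power is the identity of \<open>S / unif S\<close> for a
  suitable \<open>r\<close>, so an element of \<open>S\<close> in the maximal ideal is divisible by \<open>unif\<close>.\<close>

lemma Rspan_root_of_unity_Mac:
  assumes n: "n > 0" "v (of_nat n) = 1" "\<zeta> ^ n = 1"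
    and z: "z \<in> Rspan {..<n} (\<lambda>i. \<zeta> ^ i)" "z \<in> Mac"
  shows "\<exists>s\<in>Rspan {..<n} (\<lambda>i. \<zeta> ^ i). z = pi * s"
proof -
  define S where "S = Rspan {..<n} (\<lambda>i. \<zeta> ^ i)"
  note RS = Rspan_root_of_unity[OF n(1,3), folded S_def]
  have Sadd: "a + b \<in> S" if "a \<in> S" "b \<in> S" for a b using that by (simp add: S_def Rspan_add)
  have Sdiff: "a - b \<in> S" if "a \<in> S" "b \<in> S" for a b using that by (simp add: S_def Rspan_diff)
  have Suminus: "- a \<in> S" if "a \<in> S" for a using that by (simp add: S_def Rspan_uminus)
  have S0: "0 \<in> S" by (simp add: S_def Rspan_0)
  have Sto: "to_ac c \<in> S" if "c \<in> R" for c using Rspan_smult[of 1 "{..<n}" "\<lambda>i. \<zeta> ^ i" c] RS(5) that by (simp add: S_def)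
  have zS: "z \<in> S" using z(1) by (simp add: S_def)
  define I where "I = {pi * s | s. s \<in> S}"
  interpret C: prime_ideal_congruence S I p0
  proof
    show "0 \<in> S" by (rule S0)
    show "1 \<in> S" by (rule RS(5))
    show "x + y \<in> S" if "x \<in> S" "y \<in> S" for x y using that by (rule Sadd)
    show "x * y \<in> S" if "x \<in> S" "y \<in> S" for x y using that by (rule RS(1))
    show "0 \<in> I" unfolding I_def using S0 by (intro CollectI exI[of _ 0]) simp
    show "x + y \<in> I" if xy: "x \<in> I" "y \<in> I" for x y
    proof -
      obtain s t where "s \<in> S" "t \<in> S" "x = pi * s" "y = pi * t" using xy unfolding I_def by blast
      thus ?thesis unfolding I_def by (intro CollectI exI[of _ "s + t"]) (simp add: distrib_left Sadd)
    qed
    show "x * y \<in> I" if xy: "x \<in> S" "y \<in> I" for x y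
    proof -
      obtain t where "t \<in> S" "y = pi * t" using xy unfolding I_def by blast
      thus ?thesis unfolding I_def using xy(1) by (intro CollectI exI[of _ "x * t"]) (simp add: RS(1))
    qed
    show "- x \<in> I" if x: "x \<in> I" for x
    proof -
      obtain t where "t \<in> S" "x = pi * t" using x unfolding I_def by blast
      thus ?thesis unfolding I_def by (intro CollectI exI[of _ "- t"]) (simp add: Suminus)
    qed
    show "I \<subseteq> S" unfolding I_def using RS(1)[OF Sto[OF unif_R]] by blast
    show "Factorial_Ring.prime p0" by (rule prime_p0)
    have "of_nat p0 = pi * to_ac (of_nat p0 / unif)" by simp
    moreover have "to_ac (of_nat p0 / unif) \<in> S" by (rule Sto[OF v_less_1_imp_div_unif[OF p0(2)]])
    ultimately show "of_nat p0 \<in> I" unfolding I_def by blast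
  qed
  obtain f where f: "f > 0" "q = p0 ^ f" using q_prime_power by blast
  have "\<not> p0 dvd n" using n(2) v_of_nat_less_iff[of n] by simp
  hence "coprime p0 n" using prime_p0 prime_imp_coprime by blast
  hence cop: "coprime q n" unfolding f(2) by simp
  \<comment> \<open>By Euler's theorem \<open>n\<close> divides \<open>q ^ r - 1\<close>, so the
    power \<open>Q = q ^ r\<close> fixes \<open>\<zeta>\<close>, and it fixes elements of
    \<open>R\<close> modulo \<open>unif\<close>.\<close>
  define r where "r = totient n"
  have "r > 0" using n(1) by (simp add: r_def)
  define Q where "Q = q ^ r"
  have "[Q = 1] (mod n)" unfolding Q_def r_def using cop by (rule euler_theorem)
  have "Q > 1" unfolding Q_def using q_gt_1 \<open>r > 0\<close> by (rule one_less_power)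
  have "n dvd Q - 1" using \<open>[Q = 1] (mod n)\<close> by (rule cong_to_1_nat)
  then obtain k where k: "Q - 1 = n * k" by (rule dvdE)
  have "Q = Suc (n * k)" using k \<open>Q > 1\<close> by simp
  hence zQ: "\<zeta> ^ Q = \<zeta>" using n(3) by (simp add: power_mult)
  have QP: "Q = p0 ^ (f * r)" by (simp add: Q_def f(2) power_mult)
  obtain c where c: "z = (\<Sum>i<n. to_ac (c i) * \<zeta> ^ i)" "\<forall>i. c i \<in> R" using z(1) unfolding Rspan_def by blast
  have 1: "z ^ Q - (\<Sum>i<n. (to_ac (c i) * \<zeta> ^ i) ^ Q) \<in> I"
    unfolding c(1) QP using c(2) RS Sto by (intro C.sum_power_p_power) auto
  have "(\<Sum>i<n. to_ac (c i ^ Q - c i) * \<zeta> ^ i) \<in> I"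
  proof (rule C.I_sum)
    fix i
    have "v (c i ^ Q - c i) < 1" unfolding Q_def using c(2) by (intro power_q_power_cong) simp
    hence "to_ac ((c i ^ Q - c i) / unif) \<in> S" by (intro Sto v_less_1_imp_div_unif)
    hence "to_ac ((c i ^ Q - c i) / unif) * \<zeta> ^ i \<in> S" using RS by blast
    hence "pi * (to_ac ((c i ^ Q - c i) / unif) * \<zeta> ^ i) \<in> I" unfolding I_def by blast
    thus "to_ac (c i ^ Q - c i) * \<zeta> ^ i \<in> I" by simp
  qed
  also have "(\<Sum>i<n. to_ac (c i ^ Q - c i) * \<zeta> ^ i) = (\<Sum>i<n. (to_ac (c i) * \<zeta> ^ i) ^ Q) - z"
    unfolding c(1) sum_subtractf[symmetric]
  proof (intro sum.cong refl)
    fix i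
    have "(\<zeta> ^ i) ^ Q = \<zeta> ^ i" by (metis zQ mult.commute power_mult)
    thus "to_ac (c i ^ Q - c i) * \<zeta> ^ i = (to_ac (c i) * \<zeta> ^ i) ^ Q - to_ac (c i) * \<zeta> ^ i"
      by (simp add: left_diff_distrib power_mult_distrib)
  qed
  finally have "z ^ Q - z \<in> I" using C.cong_trans[OF 1] by blast
  then obtain s where s: "s \<in> S" "z ^ Q - z = pi * s" unfolding I_def by blast
  \<comment> \<open>\<open>z ^ Q - z\<close> is \<open>z\<close> times \<open>t - 1\<close>. As a
    positive power of \<open>z\<close>, \<open>t\<close> is a non-unit, so \<open>1 - t\<close> is a
    unit and \<open>z\<close> itself inherits divisibility by \<open>unif\<close>.\<close>
  define t where "t = z ^ (Q - 1)"
  have "z ^ Q = z * t" using \<open>Q > 1\<close> unfolding t_def by (cases Q) simp_all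
  hence "z * (1 - t) = - (z ^ Q - z)" by (simp add: right_diff_distrib)
  hence e: "z * (1 - t) = pi * (- s)" unfolding s(2) by simp
  have "Q - 1 = Suc (Q - 2)" using \<open>Q > 1\<close> by simp
  hence "t = z * z ^ (Q - 2)" unfolding t_def by simp
  hence tM: "t \<in> Mac" using z(2) Mac_Oac[OF z(2)] by (simp add: Mac_mult Oac_power)
  have tS: "t \<in> S" unfolding t_def using zS by (rule RS(4))
  define u where "u = 1 - t"
  have uO: "u \<in> Oac" using tM by (simp add: u_def Oac_diff Mac_Oac)
  have uM: "u \<notin> Mac"
  proof
    assume "u \<in> Mac"
    hence "u + t \<in> Mac" using tM by (rule Mac_add)
    thus False by (simp add: u_def)
  qed
  hence iu: "u \<noteq> 0" "inverse u \<in> Oac" using uO by (auto simp: Mac_iff)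
  have uS: "u \<in> S" unfolding u_def using RS(5) tS by (rule Sdiff)
  \<comment> \<open>An integral equation of \<open>inverse u\<close>, multiplied by
    \<open>u ^ (m - 1)\<close>, writes \<open>inverse u\<close> as a polynomial in \<open>u\<close>
    over \<open>R\<close>.\<close>
  have "inverse u \<in> S"
  proof -
    obtain m d where d: "inverse u ^ m = (\<Sum>i<m. to_ac (d i) * inverse u ^ i)" "\<forall>i. d i \<in> R"
      using iu(2) unfolding integers_ac_iff Rspan_def by blast
    have "m \<noteq> 0"
    proof
      assume "m = 0"
      thus False using d(1) by simp
    qed
    hence "inverse u = u ^ (m - 1) * inverse u ^ m"
      using iu(1) by (cases m) (simp_all add: power_inverse)
    also have "\<dots> = (\<Sum>i<m. to_ac (d i) * u ^ (m - 1 - i))"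
      unfolding d(1) sum_distrib_left
    proof (intro sum.cong refl)
      fix i assume "i \<in> {..<m}"
      hence "m - 1 = (m - 1 - i) + i" by simp
      hence "u ^ (m - 1) = u ^ (m - 1 - i) * u ^ i" by (metis power_add)
      moreover have "u ^ i * inverse u ^ i = 1" using iu(1) by (simp add: power_inverse)
      ultimately show "u ^ (m - 1) * (to_ac (d i) * inverse u ^ i) = to_ac (d i) * u ^ (m - 1 - i)"
        by (simp add: mult.commute mult.left_commute)
    qed
    also have "\<dots> \<in> S" using d(2) uS by (intro C.S_sum RS(1) Sto RS(4)) simp_all
    finally show ?thesis .
  qed
  hence "- s * inverse u \<in> S" using s(1) by (intro RS(1) Suminus)
  moreover have "z = pi * (- s * inverse u)"
  proof -
    have "z = (z * (1 - t)) * inverse u" using iu(1) by (simp add: u_def mult.assoc)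
    thus ?thesis unfolding e by (simp only: mult.assoc)
  qed
  ultimately show ?thesis unfolding S_def by blast
qed


text \<open>The unramified extension has integral valuations. With denominators cleared the element
  lies in \<open>R[\<zeta>]\<close>, and a factor \<open>pi\<close> splits off as long as a non-unit
  is left; by separatedness this ends.\<close>

lemma unram_factorization:
  assumes z: "z \<in> unram" "z \<noteq> 0"
  obtains a b \<epsilon> where "pi ^ a * z = pi ^ b * \<epsilon>" "\<epsilon> \<in> Oac" "\<epsilon> \<notin> Mac"
proof -
  obtain P \<zeta> where P: "kpoly P" "\<zeta> \<in> mu'" "z = poly P \<zeta>" using z(1) unfolding unram_def by blast
  obtain n where n: "n > 0" "v (of_nat n) = 1" "\<zeta> ^ n = 1" using P(2) unfolding mu'_def by blast
  define S where "S = Rspan {..<n} (\<lambda>i. \<zeta> ^ i)"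
  note RS = Rspan_root_of_unity[OF n(1,3), folded S_def]
  have "\<forall>i. \<exists>c. Polynomial.coeff P i = to_ac c" using P(1) unfolding kpoly_def by blast
  from choice[OF this] obtain c where c: "\<And>i. Polynomial.coeff P i = to_ac (c i)" by blast
  define d where "d = Polynomial.degree P"
  have "\<exists>a. \<forall>i<m. unif ^ a * c i \<in> R" for m
  proof (induction m)
    case (Suc m)
    then obtain a where a: "\<And>i. i < m \<Longrightarrow> unif ^ a * c i \<in> R" by blast
    obtain k where k: "unif ^ k * c m \<in> R" using unif_power_mult_in_R by blast
    have "unif ^ (a + k) * c i \<in> R" if "i < Suc m" for i
    proof (cases "i = m")
      case True
      have "unif ^ (a + k) * c i = unif ^ a * (unif ^ k * c m)" using True by (simp add: power_add)
      thus ?thesis using k by (simp add: R_mult R_power)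
    next
      case False
      have eq: "unif ^ (a + k) * c i = unif ^ k * (unif ^ a * c i)" by (simp only: power_add mult_ac)
      show ?thesis unfolding eq by (intro R_mult R_power unif_R a) (use that False in simp)
    qed
    thus ?case by blast
  qed auto
  then obtain a where a: "\<And>i. i < Suc d \<Longrightarrow> unif ^ a * c i \<in> R" by blast
  define w where "w = pi ^ a * z"
  have "w = (\<Sum>i\<le>d. to_ac (unif ^ a * c i) * \<zeta> ^ i)"
    unfolding w_def P(3) by (simp add: poly_altdef d_def c sum_distrib_left mult.assoc)
  also have "\<dots> \<in> S"
    unfolding S_def by (intro Rspan_sum Rspan_smult RS(2)[unfolded S_def] a) simp
  finally have wS: "w \<in> S" .
  have "\<exists>b s. s \<in> S \<and> w = pi ^ b * s \<and> s \<notin> Mac"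
  proof (rule ccontr)
    assume nex: "\<not> ?thesis"
    have "\<exists>s\<in>S. w = pi ^ k * s" for k
    proof (induction k)
      case (Suc k)
      then obtain s where s: "s \<in> S" "w = pi ^ k * s" by blast
      hence "s \<in> Mac" using nex by blast
      then obtain t where "t \<in> S" "s = pi * t"
        using Rspan_root_of_unity_Mac[OF n] s(1) unfolding S_def by blast
      thus ?case using s(2) by (intro bexI[of _ t]) (simp_all add: mult_ac)
    qed (use wS in auto)
    hence "\<exists>s\<in>Oac. w = pi ^ k * s" for k using RS(3) by blast
    hence "w = 0" by (rule Oac_separated)
    thus False using z(2) by (simp add: w_def)
  qed
  then obtain b s where "s \<in> S" "w = pi ^ b * s" "s \<notin> Mac" by blast
  thus ?thesis using that[of a b s] RS(3) unfolding w_def by blast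
qed

lemma pi_power_ne_unit: "k > 0 \<Longrightarrow> pi ^ k * \<epsilon> \<noteq> \<delta>" if "\<epsilon> \<in> Oac" "\<delta> \<notin> Mac"
proof
  assume "k > 0" "pi ^ k * \<epsilon> = \<delta>"
  moreover have "pi ^ k * \<epsilon> = pi * (pi ^ (k - 1) * \<epsilon>)" using \<open>k > 0\<close> by (cases k) simp_all
  moreover have "pi * (pi ^ (k - 1) * \<epsilon>) \<in> Mac" using that(1) by (intro Mac_mult[OF pi_Mac] Oac_mult Oac_power) simp_all
  ultimately show False using that(2) by simp
qed

text \<open>In the unramified extension \<open>u\<close> would have the integral valuation
  \<open>b - a\<close>, and \<open>m * (b - a) = 2\<close> has no solution for
  \<open>m > 2\<close>.\<close>

lemma ramified_root_notin_unram:
  assumes u: "u ^ m = pi ^ 2" "m > 2"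
  shows "u \<notin> unram"
proof
  assume "u \<in> unram"
  moreover have "u \<noteq> 0"
  proof
    assume "u = 0"
    hence "pi ^ 2 = 0" using u by (simp add: power_0_left)
    thus False by simp
  qed
  ultimately obtain a b \<epsilon> where e: "pi ^ a * u = pi ^ b * \<epsilon>" "\<epsilon> \<in> Oac" "\<epsilon> \<notin> Mac" by (rule unram_factorization)
  have eO: "\<epsilon> ^ m \<in> Oac" "\<epsilon> ^ m \<notin> Mac" using e Mac_power by (auto intro: Oac_power)
  have "(pi ^ a * u) ^ m = pi ^ (a * m) * pi ^ 2" by (simp add: power_mult_distrib u(1) power_mult)
  also have "\<dots> = pi ^ (a * m + 2)" by (rule power_add[symmetric])
  finally have 1: "pi ^ (a * m + 2) = pi ^ (b * m) * \<epsilon> ^ m" unfolding e(1) by (simp add: power_mult_distrib power_mult)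
  consider "a * m + 2 = b * m" | "a * m + 2 < b * m" | "b * m < a * m + 2" by linarith
  thus False
  proof cases
    case 1
    hence "m dvd 2" by (metis dvd_add_right_iff dvd_triv_right)
    thus False using u(2) by (auto dest: dvd_imp_le)
  next
    case 2
    have "b * m = (a * m + 2) + (b * m - (a * m + 2))" using 2 by simp
    hence "pi ^ (b * m) = pi ^ (a * m + 2) * pi ^ (b * m - (a * m + 2))" by (metis power_add)
    hence "pi ^ (a * m + 2) * 1 = pi ^ (a * m + 2) * (pi ^ (b * m - (a * m + 2)) * \<epsilon> ^ m)" using 1 by (simp add: mult.assoc)
    hence "1 = pi ^ (b * m - (a * m + 2)) * \<epsilon> ^ m" by (subst (asm) mult_cancel_left) auto
    thus False using pi_power_ne_unit[OF eO(1) Mac_1, of "b * m - (a * m + 2)"] 2 by simp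
  next
    case 3
    have "a * m + 2 = b * m + (a * m + 2 - b * m)" using 3 by simp
    hence "pi ^ (a * m + 2) = pi ^ (b * m) * pi ^ (a * m + 2 - b * m)" by (metis power_add)
    hence "pi ^ (b * m) * (pi ^ (a * m + 2 - b * m) * 1) = pi ^ (b * m) * \<epsilon> ^ m" using 1 by simp
    hence "pi ^ (a * m + 2 - b * m) * 1 = \<epsilon> ^ m" by (subst (asm) mult_cancel_left) auto
    thus False using pi_power_ne_unit[OF Oac_1 eO(2), of "a * m + 2 - b * m"] 3 by simp
  qed
qed

text \<open>Outside the unramified extension, the minimal polynomial of \<open>u\<close> over it has
  degree above 1. It divides the separable polynomial \<open>X ^ m - pi ^ 2\<close>, hence has a
  second root to which \<open>u\<close> can be moved.\<close>

lemma exists_inertia_moving: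
  assumes u: "u ^ m = pi ^ 2" "m > 2"
  obtains \<tau> where "\<tau> \<in> galois_auts" "\<And>\<zeta>. \<zeta> \<in> mu' \<Longrightarrow> \<tau> \<zeta> = \<zeta>" "\<tau> u \<noteq> u"
proof -
  interpret U: field_hom_graph "Id_on unram" by (rule unram_graph)
  have un: "u \<notin> unram" using assms by (rule ramified_root_notin_unram)
  obtain F F' d where F: "U.prel F F'" "d > 0" "Polynomial.degree F = d" "Polynomial.degree F' = d"
    "Polynomial.lead_coeff F = 1" "Polynomial.lead_coeff F' = 1" "poly F u = 0"
    "\<And>P P'. U.prel P P' \<Longrightarrow> poly P u = 0 \<Longrightarrow> \<exists>Q Q'. U.prel Q Q' \<and> P = F * Q \<and> P' = F' * Q'"
    by (rule U.minimal_polynomial[of u]) blast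
  have "F' = F" using F(1) unfolding U.prel_def by (intro poly_eqI) (auto simp: Id_on_iff)
  have "d \<noteq> 1"
  proof
    assume "d = 1"
    hence Fe: "F = [:Polynomial.coeff F 0, 1:]"
      using F(3,5) by (intro poly_eqI) (auto simp: coeff_pCons coeff_eq_0 split: nat.split)
    have "poly F u = Polynomial.coeff F 0 + u" by (subst Fe) simp
    hence "u = - Polynomial.coeff F 0" using F(7) by (simp add: eq_neg_iff_add_eq_0 add.commute)
    moreover have "(Polynomial.coeff F 0, Polynomial.coeff F' 0) \<in> Id_on unram" using F(1) unfolding U.prel_def by blast
    ultimately have "(u, - Polynomial.coeff F' 0) \<in> Id_on unram" using U.uminus by simp
    thus False using un by (simp add: Id_on_iff)
  qed
  define g where "g = Polynomial.monom 1 m - Polynomial.monom (pi ^ 2) 0"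
  have gg: "U.prel g g" unfolding g_def
    using U.base[of 1] U.base[of "unif ^ 2"] by (intro U.prel_diff U.prel_monom) simp_all
  have gu: "poly g u = 0" by (simp add: g_def poly_monom u(1))
  obtain Q where "g = F * Q" using F(8)[OF gg gu] by blast
  hence "F dvd g" by (rule dvdI)
  moreover have "u \<noteq> 0"
  proof
    assume "u = 0"
    hence "pi ^ 2 = 0" using u by (simp add: power_0_left)
    thus False by simp
  qed
  hence "poly (pderiv g) u \<noteq> 0" using u(2) by (simp add: g_def pderiv_diff pderiv_monom poly_monom)
  moreover have "Polynomial.degree F > 1" using F(2,3) \<open>d \<noteq> 1\<close> by simp
  ultimately obtain z where z: "z \<noteq> u" "poly F z = 0" using second_root[OF F(7)] by blast
  obtain H where H: "field_hom_graph H" "Id_on unram \<subseteq> H" "(u, z) \<in> H"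
    using U.extension_step[OF F(1,7) _ F(8), of z] z(2) \<open>F' = F\<close> by blast
  obtain \<tau> where t: "\<tau> \<in> galois_auts" "\<forall>(x, y)\<in>H. \<tau> x = y"
    using field_hom_graph.extends_to_galois_aut[OF H(1)] by blast
  have "\<tau> \<zeta> = \<zeta>" if "\<zeta> \<in> mu'" for \<zeta>
  proof -
    have "poly (Polynomial.monom (to_ac 1) 1) \<zeta> \<in> unram" unfolding unram_def using that kpoly_monom[of 1 1] by blast
    hence "\<zeta> \<in> unram" by (simp add: poly_monom)
    hence "(\<zeta>, \<zeta>) \<in> H" using H(2) by blast
    from bspec[OF t(2) this] show ?thesis by simp
  qed
  moreover have "\<tau> u \<noteq> u" using bspec[OF t(2) H(3)] z(1) by simp
  ultimately show ?thesis using that t(1) by blast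
qed

end

text \<open>Modulo \<open>n + 1\<close> the number \<open>n\<close> is -1, so \<open>n ^ d\<close>
  is the sign \<open>(-1) ^ d\<close>.\<close>

lemma power_of_minus_one_residue:
  fixes x :: "'b::field"
  assumes "x ^ (n + 1) = 1"
  shows "x ^ (n ^ d) = (if even d then x else inverse x)"
proof (induction d)
  case (Suc d)
  have x0: "x \<noteq> 0" using assms by (auto simp: power_0_left)
  have "x * x ^ n = 1" using assms by simp
  hence xn: "x ^ n = inverse x" using inverse_unique by metis
  have "n ^ Suc d = n ^ d * n" by simp
  hence "x ^ (n ^ Suc d) = (x ^ (n ^ d)) ^ n" by (simp only: power_mult)
  also have "\<dots> = (if even (Suc d) then x else inverse x)"
    unfolding Suc using x0 by (simp add: xn power_inverse)
  finally show ?case .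
qed simp

section \<open>The Frobenius exponent modulo 4 and the tame character\<close>

context local_field_char_0
begin

definition Mq :: nat where "Mq = q ^ 4 - 1"

lemma Mq: "Mq > 0" "v (of_nat Mq) = 1" "q + 1 dvd Mq"
proof -
  have q4: "q ^ 4 > 1" using q_gt_1 by (intro one_less_power) auto
  thus "Mq > 0" by (simp add: Mq_def)
  have q4': "q ^ 4 = Mq + 1" using q4 by (simp add: Mq_def)
  have "\<not> p0 dvd Mq"
  proof
    assume d: "p0 dvd Mq"
    obtain f where "f > 0" "q = p0 ^ f" using q_prime_power by blast
    hence "p0 dvd q ^ 4" by (simp add: dvd_power power_mult[symmetric])
    hence "p0 dvd Mq + 1" unfolding q4' .
    hence "p0 dvd 1" using d dvd_add_right_iff[of p0 Mq 1] by blast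
    thus False using prime_p0 not_prime_unit by blast
  qed
  thus "v (of_nat Mq) = 1" by (rule v_of_nat_eq_1)
  have "int Mq = int (q + 1) * ((int q - 1) * (int q ^ 2 + 1))"
  proof -
    have "int (q ^ 4) = int Mq + 1" unfolding q4' by simp
    hence "int Mq = int q ^ 4 - 1" by simp
    thus ?thesis by (simp add: power2_eq_square power4_eq_xxxx algebra_simps)
  qed
  hence "int (q + 1) dvd int Mq" by (metis dvd_triv_left)
  thus "q + 1 dvd Mq" by (simp only: of_nat_dvd_iff)
qed

definition zeta :: "'a alg_closure" where
  "zeta = (SOME x. primitive_root Mq x)"

lemma zeta: "primitive_root Mq zeta"
proof -
  obtain x :: "'a alg_closure" where "primitive_root Mq x" using exists_primitive_root[OF Mq(1)] .
  thus ?thesis unfolding zeta_def by (rule someI)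
qed

lemma zeta_pow: "zeta ^ Mq = 1"
  using zeta by (simp add: primitive_root_def)

lemma zeta_mu': "zeta \<in> mu'"
  using zeta_pow Mq unfolding mu'_def by blast

lemma zeta_q4: "zeta ^ (q ^ (4 * k)) = zeta"
proof (induction k)
  case (Suc k)
  have "q ^ 4 = Suc Mq" using Mq(1) by (simp add: Mq_def)
  hence "zeta ^ (q ^ 4) = zeta * zeta ^ Mq" by (simp only: power_Suc)
  hence "zeta ^ (q ^ 4) = zeta" unfolding zeta_pow by simp
  moreover have "4 * Suc k = 4 * k + 4" by simp
  hence "q ^ (4 * Suc k) = q ^ (4 * k) * q ^ 4" by (simp only: power_add)
  hence "zeta ^ (q ^ (4 * Suc k)) = (zeta ^ (q ^ (4 * k))) ^ (q ^ 4)" by (simp only: power_mult)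
  ultimately show ?case using Suc by simp
qed simp

lemma zeta_mod4: "zeta ^ (q ^ k) = zeta ^ (q ^ (k mod 4))"
proof -
  have "q ^ k = q ^ (4 * (k div 4)) * q ^ (k mod 4)" by (metis power_add mult_div_mod_eq)
  hence "zeta ^ (q ^ k) = (zeta ^ (q ^ (4 * (k div 4)))) ^ (q ^ (k mod 4))" by (simp only: power_mult[of zeta])
  thus ?thesis unfolding zeta_q4 .
qed

text \<open>The exponents \<open>q ^ d\<close> with \<open>d < 4\<close> lie below the order
  \<open>q ^ 4 - 1\<close> of \<open>zeta\<close>.\<close>

lemma zeta_deg_unique:
  assumes "zeta ^ (q ^ d) = zeta ^ (q ^ e)" "d < 4" "e < 4"
  shows "d = e"
proof -
  have lt: "q ^ d < Mq" if "d < 4" for d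
  proof -
    have "q ^ d \<le> q ^ 3" using that q_pos by (intro power_increasing) auto
    moreover have "2 * q ^ 3 \<le> q * q ^ 3" using q_gt_1 by (intro mult_le_mono1) simp
    moreover have "q ^ 3 > 1" using q_gt_1 by (intro one_less_power) auto
    moreover have "q ^ 4 = q * q ^ 3" by (simp add: power_numeral_reduce)
    moreover have "Mq + 1 = q ^ 4" using Mq(1) by (simp add: Mq_def)
    ultimately show ?thesis by linarith
  qed
  have "q ^ d = q ^ e" using primitive_root_power_eq_iff[OF zeta Mq(1) lt[OF assms(2)] lt[OF assms(3)]] assms(1) by simp
  thus ?thesis using q_gt_1 by (simp add: power_inject_exp)
qed

lemma weil_group_galois: "\<sigma> \<in> carrier (weil_group v) \<Longrightarrow> \<sigma> \<in> galois_auts"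
  by (simp add: weil_group_def)

lemma weil_zeta:
  assumes "\<sigma> \<in> carrier (weil_group v)"
  shows "\<exists>d<4. \<sigma> zeta = zeta ^ (q ^ d)"
proof -
  have s: "\<sigma> \<in> galois_auts" using assms by (rule weil_group_galois)
  note h = galois_auts_hom[OF s]
  obtain k where k: "acts_as_frobenius_power v \<sigma> k" using assms by (auto simp: weil_group_def)
  have zO: "zeta \<in> Oac" using mu'_Oac[OF zeta_mu'] .
  have sz: "\<sigma> zeta ^ Mq = 1" using arg_cong[OF zeta_pow, of \<sigma>] by (simp only: h(6,7))
  have "\<exists>e. \<sigma> zeta = zeta ^ (q ^ e)"
  proof (cases "k \<ge> 0")
    case True
    have "\<sigma> zeta - zeta ^ (q ^ nat k) \<in> Mac" using bspec[OF k[unfolded acts_as_frobenius_power_def] zO] True by simp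
    moreover have "(zeta ^ (q ^ nat k)) ^ Mq = 1" using zeta_pow by (metis mult.commute power_mult power_one)
    ultimately have "\<sigma> zeta = zeta ^ (q ^ nat k)" using roots_of_unity_eq_if_congruent[OF sz _ Mq(1,2)] by blast
    thus ?thesis by blast
  next
    case False
    define j where "j = nat (- k)"
    have "\<sigma> zeta ^ (q ^ j) - zeta \<in> Mac" using bspec[OF k[unfolded acts_as_frobenius_power_def] zO] False by (simp add: j_def)
    moreover have "(\<sigma> zeta ^ (q ^ j)) ^ Mq = 1" using sz by (metis mult.commute power_mult power_one)
    ultimately have e: "\<sigma> zeta ^ (q ^ j) = zeta" using roots_of_unity_eq_if_congruent[OF _ zeta_pow Mq(1,2)] by blast
    \<comment> \<open>A negative exponent \<open>- j\<close> is replaced by \<open>3 * j\<close>,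
      which agrees with it modulo 4.\<close>
    have "\<sigma> zeta = \<sigma> (zeta ^ (q ^ (4 * j)))" by (simp only: zeta_q4)
    also have "\<dots> = \<sigma> zeta ^ (q ^ j * q ^ (3 * j))" by (simp add: h(7) flip: power_add)
    also have "\<dots> = (\<sigma> zeta ^ (q ^ j)) ^ (q ^ (3 * j))" by (rule power_mult)
    also have "\<dots> = zeta ^ (q ^ (3 * j))" unfolding e ..
    finally show ?thesis by blast
  qed
  then obtain e where "\<sigma> zeta = zeta ^ (q ^ (e mod 4))" using zeta_mod4 by metis
  thus ?thesis by (intro exI[of _ "e mod 4"]) simp
qed

text \<open>The Frobenius exponent modulo 4. Since it is read off from the image of
  \<open>zeta\<close> alone, it is locally constant.\<close>

definition deg4 :: "('a alg_closure \<Rightarrow> 'a alg_closure) \<Rightarrow> nat" where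
  "deg4 \<sigma> = (THE d. d < 4 \<and> \<sigma> zeta = zeta ^ (q ^ d))"

lemma deg4_eqI: "d < 4 \<Longrightarrow> \<sigma> zeta = zeta ^ (q ^ d) \<Longrightarrow> deg4 \<sigma> = d"
  unfolding deg4_def by (rule the_equality) (auto intro: zeta_deg_unique)

lemma deg4: "\<sigma> \<in> carrier (weil_group v) \<Longrightarrow> deg4 \<sigma> < 4 \<and> \<sigma> zeta = zeta ^ (q ^ deg4 \<sigma>)"
  using weil_zeta[of \<sigma>] deg4_eqI[of _ \<sigma>] by auto

lemma deg4_comp:
  assumes "\<sigma> \<in> carrier (weil_group v)" "\<tau> \<in> carrier (weil_group v)"
  shows "deg4 (\<sigma> \<circ> \<tau>) = (deg4 \<sigma> + deg4 \<tau>) mod 4"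
proof (rule deg4_eqI)
  note h = galois_auts_hom[OF weil_group_galois[OF assms(1)]]
  have "(\<sigma> \<circ> \<tau>) zeta = (\<sigma> zeta) ^ (q ^ deg4 \<tau>)" using deg4[OF assms(2)] by (simp add: h(7))
  also have "\<dots> = zeta ^ (q ^ deg4 \<sigma> * q ^ deg4 \<tau>)" using deg4[OF assms(1)] by (simp add: power_mult)
  also have "\<dots> = zeta ^ (q ^ ((deg4 \<sigma> + deg4 \<tau>) mod 4))" by (subst zeta_mod4[symmetric]) (simp add: power_add)
  finally show "(\<sigma> \<circ> \<tau>) zeta = zeta ^ (q ^ ((deg4 \<sigma> + deg4 \<tau>) mod 4))" .
qed simp

definition xi :: "'a alg_closure" where
  "xi = zeta ^ (Mq div (q + 1))"

lemma xi: "primitive_root (q + 1) xi"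
  unfolding primitive_root_def
proof (intro conjI allI impI)
  define k where "k = Mq div (q + 1)"
  have k: "k * (q + 1) = Mq" unfolding k_def by (rule dvd_div_mult_self[OF Mq(3)])
  hence k0: "k > 0" using Mq(1) by (intro Nat.gr0I) auto
  show "xi ^ (q + 1) = 1" unfolding xi_def k_def[symmetric] power_mult[symmetric] k by (rule zeta_pow)
  fix m assume "xi ^ m = 1"
  hence "zeta ^ (k * m) = 1" unfolding xi_def k_def[symmetric] power_mult[symmetric] .
  hence "Mq dvd k * m" using zeta unfolding primitive_root_def by blast
  hence "k * (q + 1) dvd k * m" unfolding k .
  thus "q + 1 dvd m" using k0 by (simp only: nat_mult_dvd_cancel1)
qed

definition yy :: "'a alg_closure" where
  "yy = (SOME y. y ^ (q + 1) = pi)"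

lemma yy: "yy ^ (q + 1) = pi"
proof -
  define g where "g = Polynomial.monom (1 :: 'a alg_closure) (q + 1) - Polynomial.monom pi 0"
  have "Polynomial.degree g = q + 1" by (rule degree_eqI) (auto simp: g_def)
  then obtain y where "poly g y = 0" using alg_closed_imp_poly_has_root[of g] by auto
  hence "y ^ (q + 1) = pi" by (simp add: g_def poly_monom)
  thus ?thesis unfolding yy_def by (rule someI)
qed

lemma yy_nonzero: "yy \<noteq> 0"
proof
  assume "yy = 0"
  hence "pi = 0" using yy by simp
  thus False by simp
qed

lemma weil_yy:
  assumes "\<sigma> \<in> galois_auts"
  shows "\<exists>j. \<sigma> yy = xi ^ j * yy"
proof -
  note h = galois_auts_hom[OF assms]
  define c where "c = \<sigma> yy * inverse yy"
  have "\<sigma> yy ^ (q + 1) = pi" using arg_cong[OF yy, of \<sigma>] by (simp only: h(3,7))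
  hence "\<sigma> yy ^ (q + 1) = yy ^ (q + 1)" by (simp only: yy)
  hence "c ^ (q + 1) = yy ^ (q + 1) * inverse yy ^ (q + 1)" by (simp only: c_def power_mult_distrib)
  also have "\<dots> = 1" by (simp only: power_mult_distrib[symmetric] right_inverse[OF yy_nonzero] power_one)
  finally obtain j where "c = xi ^ j" using primitive_root_generates[OF xi] by auto
  hence "\<sigma> yy = xi ^ j * yy" using yy_nonzero by (simp add: c_def field_simps)
  thus ?thesis by blast
qed

definition omega :: complex where
  "omega = (SOME x. primitive_root (q + 1) x)"

lemma omega: "primitive_root (q + 1) omega"
proof -
  obtain x :: complex where "primitive_root (q + 1) x" using exists_primitive_root[of "q + 1"] by auto
  thus ?thesis unfolding omega_def by (rule someI)
qed

text \<open>The Kummer cocycle \<open>\<sigma> yy / yy\<close>, carried over to complex roots of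
  unity by \<open>xi \<mapsto> omega\<close>. It is a character on the elements of even degree and a
  crossed homomorphism on the whole Weil group.\<close>

definition tame_char :: "('a alg_closure \<Rightarrow> 'a alg_closure) \<Rightarrow> complex" where
  "tame_char \<sigma> = omega ^ (SOME j. \<sigma> yy = xi ^ j * yy)"

lemma primitive_root_transfer:
  assumes "primitive_root n (x::'b::field)" "primitive_root n (z::'c::field)" "n > 0" "x ^ i = x ^ j"
  shows "z ^ i = z ^ j"
proof -
  have *: "z ^ i = z ^ j" if ij: "i \<le> j" "x ^ i = x ^ j" for i j
  proof -
    have x0: "x \<noteq> 0" using assms(1,3) by (auto simp: primitive_root_def power_0_left)
    have ji: "j = i + (j - i)" using ij by simp
    hence "x ^ i * x ^ (j - i) = x ^ j" by (metis power_add)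
    hence "x ^ j * x ^ (j - i) = x ^ j * 1" unfolding ij(2) by simp
    hence "x ^ (j - i) = 1" by (subst (asm) mult_cancel_left) (simp add: x0)
    hence "n dvd j - i" using assms(1) unfolding primitive_root_def by blast
    then obtain k where "j - i = n * k" by (rule dvdE)
    hence "z ^ (j - i) = 1" using assms(2) by (simp add: primitive_root_def power_mult)
    moreover have "z ^ i * z ^ (j - i) = z ^ j" using ji by (metis power_add)
    ultimately show ?thesis by (simp only: mult_1_right)
  qed
  show ?thesis
  proof (cases "i \<le> j")
    case True
    thus ?thesis using assms(4) by (rule *)
  next
    case False
    hence "j \<le> i" by simp
    from *[OF this assms(4)[symmetric]] show ?thesis by (rule sym)
  qed
qed

lemma tame_char_eqI:
  assumes "\<sigma> yy = xi ^ j * yy"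
  shows "tame_char \<sigma> = omega ^ j"
proof -
  have "\<exists>j. \<sigma> yy = xi ^ j * yy" using assms by blast
  define J where "J = (SOME j. \<sigma> yy = xi ^ j * yy)"
  have "\<sigma> yy = xi ^ J * yy" unfolding J_def using \<open>\<exists>j. \<sigma> yy = xi ^ j * yy\<close> by (rule someI_ex)
  hence "xi ^ J * yy = xi ^ j * yy" using assms by (rule trans[OF sym])
  hence "xi ^ J = xi ^ j" by (simp only: mult_cancel_right yy_nonzero simp_thms)
  from primitive_root_transfer[OF xi omega _ this] show ?thesis unfolding tame_char_def J_def by simp
qed

lemma tame_char_pow: "\<sigma> \<in> galois_auts \<Longrightarrow> tame_char \<sigma> ^ (q + 1) = 1"
proof -
  assume "\<sigma> \<in> galois_auts"
  then obtain j where "\<sigma> yy = xi ^ j * yy" using weil_yy by blast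
  hence "tame_char \<sigma> = omega ^ j" by (rule tame_char_eqI)
  moreover have "(omega ^ j) ^ (q + 1) = (omega ^ (q + 1)) ^ j" by (simp only: power_mult[symmetric] mult.commute)
  moreover have "omega ^ (q + 1) = 1" using omega unfolding primitive_root_def by blast
  ultimately show ?thesis by simp
qed

text \<open>\<open>\<sigma>\<close> raises \<open>xi\<close> to the power
  \<open>q ^ deg4 \<sigma>\<close>, and \<open>q\<close> is -1 modulo the order of
  \<open>xi\<close>.\<close>

lemma tame_char_comp:
  assumes "\<sigma> \<in> carrier (weil_group v)" "\<tau> \<in> carrier (weil_group v)"
  shows "tame_char (\<sigma> \<circ> \<tau>) = tame_char \<sigma> * (if even (deg4 \<sigma>) then tame_char \<tau> else inverse (tame_char \<tau>))"
proof -
  note h = galois_auts_hom[OF weil_group_galois[OF assms(1)]]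
  obtain i where i: "\<sigma> yy = xi ^ i * yy" using weil_yy weil_group_galois assms(1) by blast
  obtain j where j: "\<tau> yy = xi ^ j * yy" using weil_yy weil_group_galois assms(2) by blast
  have sx: "\<sigma> xi = xi ^ (q ^ deg4 \<sigma>)"
  proof -
    have "\<sigma> xi = (zeta ^ (q ^ deg4 \<sigma>)) ^ (Mq div (q + 1))" using deg4[OF assms(1)] by (simp add: xi_def h(7))
    thus ?thesis unfolding xi_def by (simp only: power_mult[symmetric] mult.commute)
  qed
  have "(\<sigma> \<circ> \<tau>) yy = (xi ^ (q ^ deg4 \<sigma>)) ^ j * (xi ^ i * yy)" by (simp add: j h(2,7) sx i)
  also have "\<dots> = xi ^ (i + j * q ^ deg4 \<sigma>) * yy"
    by (simp add: power_add mult_ac flip: power_mult)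
  finally have "tame_char (\<sigma> \<circ> \<tau>) = omega ^ (i + j * q ^ deg4 \<sigma>)" by (rule tame_char_eqI)
  also have "\<dots> = omega ^ i * (omega ^ j) ^ (q ^ deg4 \<sigma>)" by (simp only: power_add power_mult)
  also have "omega ^ i = tame_char \<sigma>" using tame_char_eqI[where \<sigma> = \<sigma>, OF i] by simp
  also have "omega ^ j = tame_char \<tau>" using tame_char_eqI[where \<sigma> = \<tau>, OF j] by simp
  also have "tame_char \<tau> ^ (q ^ deg4 \<sigma>) = (if even (deg4 \<sigma>) then tame_char \<tau> else inverse (tame_char \<tau>))"
    using tame_char_pow[OF weil_group_galois[OF assms(2)]] by (rule power_of_minus_one_residue)
  finally show ?thesis .
qed

lemma inertia_in_weil: "\<sigma> \<in> inertia_group v \<Longrightarrow> \<sigma> \<in> carrier (weil_group v)"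
  by (auto simp: inertia_group_def weil_group_def)

lemma deg4_local: "\<tau> zeta = zeta \<Longrightarrow> deg4 (\<sigma> \<circ> \<tau>) = deg4 \<sigma>"
  and tame_char_local: "\<tau> yy = yy \<Longrightarrow> tame_char (\<sigma> \<circ> \<tau>) = tame_char \<sigma>"
  by (simp_all add: deg4_def tame_char_def)

lemma deg4_id: "deg4 id = 0" and tame_char_id: "tame_char id = 1"
  using deg4_eqI[of 0 id] tame_char_eqI[of id 0] by simp_all

text \<open>Inertia is made to move \<open>yy ^ 2\<close> rather than \<open>yy\<close>: this gives
  a tame value whose square is not 1, so that the corresponding rotation is not a symmetric
  matrix.\<close>

lemma exists_inertia_tame_char:
  obtains \<tau> where "\<tau> \<in> inertia_group v" "deg4 \<tau> = 0" "tame_char \<tau> ^ 2 \<noteq> 1"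
proof -
  have u: "(yy ^ 2) ^ (q + 1) = pi ^ 2" using yy by (metis mult.commute power_mult)
  have q2: "q + 1 > 2" using q_gt_1 by simp
  obtain \<tau> where t: "\<tau> \<in> galois_auts" "\<And>\<zeta>. \<zeta> \<in> mu' \<Longrightarrow> \<tau> \<zeta> = \<zeta>" "\<tau> (yy ^ 2) \<noteq> yy ^ 2"
    by (rule exists_inertia_moving[OF u q2]) blast
  note h = galois_auts_hom[OF t(1)]
  have "acts_as_frobenius_power v \<tau> (int 0)" using t(1,2) by (intro acts_as_frobenius_powerI) simp_all
  hence "\<tau> \<in> inertia_group v" using t(1) by (simp add: inertia_group_def)
  moreover have "deg4 \<tau> = 0" using t(2)[OF zeta_mu'] by (intro deg4_eqI) simp_all
  moreover have "tame_char \<tau> ^ 2 \<noteq> 1"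
  proof
    assume 1: "tame_char \<tau> ^ 2 = 1"
    obtain j where j: "\<tau> yy = xi ^ j * yy" using weil_yy[OF t(1)] by blast
    have e: "tame_char \<tau> = omega ^ j" by (rule tame_char_eqI) (rule j)
    have "omega ^ (j * 2) = (omega ^ j) ^ 2" by (rule power_mult)
    hence "omega ^ (j * 2) = omega ^ 0" by (simp only: 1[unfolded e] power_0)
    from primitive_root_transfer[OF omega xi _ this] have x0: "xi ^ (j * 2) = 1" by simp
    have "\<tau> (yy ^ 2) = (xi ^ j * yy) ^ 2" by (simp only: h(7) j)
    also have "\<dots> = xi ^ (j * 2) * yy ^ 2" by (simp only: power_mult_distrib power_mult)
    finally have "\<tau> (yy ^ 2) = yy ^ 2" unfolding x0 by simp
    thus False using t(3) by simp
  qed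
  ultimately show ?thesis using that by blast
qed

lemma exists_weil_deg_1:
  obtains \<sigma> where "\<sigma> \<in> carrier (weil_group v)" "deg4 \<sigma> = 1"
proof -
  obtain \<sigma> where s: "\<sigma> \<in> galois_auts" "\<And>\<zeta>. \<zeta> \<in> mu' \<Longrightarrow> \<sigma> \<zeta> = \<zeta> ^ q"
    by (rule exists_frobenius) blast
  have "acts_as_frobenius_power v \<sigma> (int 1)" using s by (intro acts_as_frobenius_powerI) simp_all
  hence "\<sigma> \<in> carrier (weil_group v)" using s(1) by (auto simp: weil_group_def)
  moreover have "deg4 \<sigma> = 1" using s(2)[OF zeta_mu'] by (intro deg4_eqI) simp_all
  ultimately show ?thesis using that by blast
qed

lemma geometric_frobenius: "geometric_frobenius v \<in> galois_auts" "acts_as_frobenius_power v (geometric_frobenius v) (- 1)"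
proof -
  have "\<exists>\<sigma>. \<sigma> \<in> galois_auts \<and> acts_as_frobenius_power v \<sigma> (- 1)" by (rule exists_geometric_frobenius) blast
  from someI_ex[OF this] show "geometric_frobenius v \<in> galois_auts" "acts_as_frobenius_power v (geometric_frobenius v) (- 1)"
    unfolding geometric_frobenius_def by blast+
qed

lemma comp_inertia_in_weil:
  assumes "\<sigma> \<in> carrier (weil_group v)" "\<tau> \<in> inertia_group v"
  shows "\<sigma> \<circ> \<tau> \<in> carrier (weil_group v)"
proof -
  have s: "\<sigma> \<in> galois_auts" using assms(1) by (rule weil_group_galois)
  have t: "\<tau> \<in> galois_auts" "acts_as_frobenius_power v \<tau> 0" using assms(2) by (auto simp: inertia_group_def)
  note h = galois_auts_hom[OF s]
  obtain k where k: "acts_as_frobenius_power v \<sigma> k" using assms(1) by (auto simp: weil_group_def)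
  have d: "\<sigma> (\<tau> x) - \<sigma> x \<in> Mac" "\<sigma> x \<in> Oac" "\<sigma> (\<tau> x) \<in> Oac" if x: "x \<in> Oac" for x
  proof -
    have "\<tau> x - x \<in> Mac" using bspec[OF t(2)[unfolded acts_as_frobenius_power_def] x] by simp
    from galois_Mac[OF s this] show "\<sigma> (\<tau> x) - \<sigma> x \<in> Mac" by (simp add: h(8))
    show "\<sigma> x \<in> Oac" "\<sigma> (\<tau> x) \<in> Oac" using galois_Oac[OF s] galois_Oac[OF t(1)] x by blast+
  qed
  have "acts_as_frobenius_power v (\<sigma> \<circ> \<tau>) k"
    unfolding acts_as_frobenius_power_def
  proof
    fix x assume x: "x \<in> Oac"
    note kx = bspec[OF k[unfolded acts_as_frobenius_power_def] x]
    show "if 0 \<le> k then (\<sigma> \<circ> \<tau>) x - x ^ q ^ nat k \<in> Mac else (\<sigma> \<circ> \<tau>) x ^ q ^ nat (- k) - x \<in> Mac"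
    proof (cases "k \<ge> 0")
      case True
      hence "\<sigma> x - x ^ q ^ nat k \<in> Mac" using kx by simp
      from Mac_add[OF d(1)[OF x] this] show ?thesis using True by simp
    next
      case False
      hence "\<sigma> x ^ q ^ nat (- k) - x \<in> Mac" using kx by simp
      moreover have "\<sigma> (\<tau> x) ^ q ^ nat (- k) - \<sigma> x ^ q ^ nat (- k) \<in> Mac"
        using x by (intro power_congruent d)
      ultimately have "(\<sigma> (\<tau> x) ^ q ^ nat (- k) - \<sigma> x ^ q ^ nat (- k)) + (\<sigma> x ^ q ^ nat (- k) - x) \<in> Mac"
        by (intro Mac_add)
      thus ?thesis using False by simp
    qed
  qed
  thus ?thesis using galois_auts_comp[OF s t(1)] by (auto simp: weil_group_def)
qed

end

section \<open>Determinants on subspaces and the adjoint L-function\<close>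

text \<open>Independent sets in \<open>W\<close> are independent in \<open>V\<close>, so their sizes
  are bounded by the dimension of \<open>V\<close>, and a maximal one is a basis.\<close>

lemma (in vectorspace) subspace_finite_basis:
  assumes fd: "fin_dim" and W: "subspace K W V"
  obtains B where "finite B" "vectorspace.basis K (vs W) B"
proof -
  interpret W: vectorspace K "vs W" by (rule subspace_is_vs[OF W])
  have sub: "submodule K W V" using W by simp
  have WV: "W \<subseteq> carrier V" using sub by (simp add: submodule_def)
  have small: "finite S \<and> card S \<le> dim" if S: "S \<subseteq> W" "W.lin_indpt S" for S
  proof -
    have "lin_indpt S" using S span_li_not_depend(2)[OF S(1) sub] by simp
    thus ?thesis using li_le_dim[OF fd, of S] S(1) WV by blast
  qed
  have "\<exists>A. finite A \<and> maximal A (\<lambda>S. S \<subseteq> carrier (vs W) \<and> W.lin_indpt S)"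
  proof (rule maximal_exists[where N = dim and B = "{}"])
    show "\<And>A. A \<subseteq> carrier (vs W) \<and> W.lin_indpt A \<Longrightarrow> finite A \<and> card A \<le> dim"
      using small by simp
    show "{} \<subseteq> carrier (vs W) \<and> W.lin_indpt {}"
      by (auto simp: W.lin_dep_def)
  qed
  thus ?thesis using that W.max_li_is_basis by blast
qed

text \<open>The matrices are the image of the vectors of length \<open>n * n\<close> under row-major
  reshaping.\<close>

lemma matrix_fin_dim: "vectorspace.fin_dim class_ring (module_mat TYPE('a::field) n n)"
proof -
  interpret vec: vec_space "TYPE('a)" "n * n" .
  interpret matv: vectorspace class_ring "module_mat TYPE('a) n n" by (rule matrix_vs)
  define T :: "'a Matrix.vec \<Rightarrow> 'a mat" where
    "T = (\<lambda>x. Matrix.mat n n (\<lambda>(i, j). vec_index x (i * n + j)))"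
  have idx: "i * n + j < n * n" if "i < n" "j < n" for i j :: nat
  proof -
    have "i * n + j < Suc i * n" using that by simp
    also have "\<dots> \<le> n * n" using that by (intro mult_right_mono) auto
    finally show ?thesis .
  qed
  interpret lm: linear_map class_ring "module_vec TYPE('a) (n * n)" "module_mat TYPE('a) n n" T
  proof unfold_locales
    show "T \<in> module_hom class_ring (module_vec TYPE('a) (n * n)) (module_mat TYPE('a) n n)"
      unfolding module_hom_def T_def
      by (auto simp: module_mat_simps module_vec_simps class_ring_simps idx intro!: eq_matI)
  qed
  have "T ` carrier (module_vec TYPE('a) (n * n)) = carrier (module_mat TYPE('a) n n)"
  proof (intro equalityI subsetI)
    fix Y assume "Y \<in> carrier (module_mat TYPE('a) n n)"
    hence Y: "Y \<in> carrier_mat n n" by (simp add: module_mat_simps)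
    have "Y = T (Matrix.vec (n * n) (\<lambda>k. Y $$ (k div n, k mod n)))"
      unfolding T_def using Y idx by (intro eq_matI) auto
    thus "Y \<in> T ` carrier (module_vec TYPE('a) (n * n))"
      by (auto simp: module_vec_simps)
  qed (auto simp: T_def module_mat_simps)
  from lm.surj_fin_dim[OF vec.fin_dim this] show ?thesis .
qed

context
  fixes V :: "(complex, 'v) module" (structure) and B
  assumes V: "vectorspace class_ring V" and finB: "finite B"
    and basB: "vectorspace.basis class_ring V B"
begin

interpretation V: vectorspace class_ring V by (rule V)

lemma basis_sub: "B \<subseteq> carrier V" using basB by (simp add: V.basis_def)

lemma coordinate_lincomb:
  assumes "y \<in> carrier V"
  shows "V.lincomb (coordinate V B y) B = y"
proof -
  have "\<exists>!a. a \<in> B \<rightarrow>\<^sub>E carrier class_ring \<and> V.lincomb a B = y"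
    using V.basis_criterion[OF finB basis_sub] basB assms by blast
  hence "\<exists>a. V.lincomb a B = y" by blast
  thus ?thesis unfolding coordinate_def by (rule someI_ex)
qed

text \<open>The criterion for a basis speaks of functions that are undefined off \<open>B\<close>,
  while \<open>coordinate\<close> chooses an arbitrary total function; restricting to
  \<open>B\<close> reconciles the two.\<close>

lemma lincomb_unique:
  assumes "V.lincomb a B = V.lincomb b B" "u \<in> B"
  shows "a u = b u"
proof -
  have r: "V.lincomb (restrict c B) B = V.lincomb c B" for c
    using basis_sub by (intro V.lincomb_cong) (auto simp: class_ring_simps)
  have "V.lincomb a B \<in> carrier V"
    using basis_sub finB by (intro V.lincomb_closed) (auto simp: class_ring_simps)
  hence "\<exists>!c. c \<in> B \<rightarrow>\<^sub>E carrier class_ring \<and> V.lincomb c B = V.lincomb a B"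
    using V.basis_criterion[OF finB basis_sub] basB by blast
  moreover have "restrict a B \<in> B \<rightarrow>\<^sub>E carrier class_ring" "restrict b B \<in> B \<rightarrow>\<^sub>E carrier class_ring"
    by (auto simp: class_ring_simps)
  ultimately have "restrict a B = restrict b B" using r assms(1) by metis
  thus ?thesis using assms(2) by (metis restrict_apply')
qed

lemma coordinate_unique:
  assumes "u \<in> B"
  shows "coordinate V B (V.lincomb a B) u = a u"
proof -
  have "V.lincomb a B \<in> carrier V"
    using basis_sub finB by (intro V.lincomb_closed) (auto simp: class_ring_simps)
  from lincomb_unique[OF coordinate_lincomb[OF this] assms] show ?thesis .
qed

lemma lincomb_plus:
  "V.lincomb a B \<oplus> c \<odot> V.lincomb b B = V.lincomb (\<lambda>u. a u + c * b u) B"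
proof -
  have "c \<odot> V.lincomb b B = V.lincomb (\<lambda>u. c * b u) B"
    using V.lincomb_smult[OF basis_sub, of b c] by (simp add: class_ring_simps)
  moreover have "V.lincomb a B \<oplus> V.lincomb (\<lambda>u. c * b u) B = V.lincomb (\<lambda>u. a u + c * b u) B"
    using V.lincomb_sum[OF finB basis_sub, of a "\<lambda>u. c * b u"] by (simp add: class_ring_simps)
  ultimately show ?thesis by simp
qed

lemma coordinate_plus:
  assumes "x \<in> carrier V" "y \<in> carrier V" "u \<in> B"
  shows "coordinate V B (x \<oplus> c \<odot> y) u = coordinate V B x u + c * coordinate V B y u"
  using coordinate_unique[OF assms(3), of "\<lambda>u. coordinate V B x u + c * coordinate V B y u"]
  by (simp add: lincomb_plus[symmetric] coordinate_lincomb assms)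

lemma coordinate_basis:
  assumes "u \<in> B" "w \<in> B"
  shows "coordinate V B w u = (if u = w then 1 else 0)"
proof -
  have "V.lincomb (\<lambda>u. if u = w then 1 else 0) B = (if w = w then 1 else 0) \<odot> w \<oplus>
      V.lincomb (\<lambda>u. if u = w then 1 else 0) (B - {w})"
    using V.lincomb_del2[OF finB basis_sub _ assms(2), of "\<lambda>u. if u = w then 1 else 0"]
    by (simp add: class_ring_simps)
  also have "V.lincomb (\<lambda>u. if u = w then 1 else 0) (B - {w}) = V.lincomb (\<lambda>u. 0) (B - {w})"
    using basis_sub by (intro V.lincomb_cong) (auto simp: class_ring_simps)
  also have "\<dots> = \<zero>"
    using V.lincomb_zero[of "B - {w}" "\<lambda>u. 0"] basis_sub by (auto simp: class_ring_simps)
  finally have "V.lincomb (\<lambda>u. if u = w then 1 else 0) B = w"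
    using basis_sub assms(2) V.smult_one[of w] by (auto simp: class_ring_simps)
  with coordinate_unique[OF assms(1), of "\<lambda>u. if u = w then 1 else 0"] show ?thesis by simp
qed

lemma coordinate_linear:
  fixes T :: "'v \<Rightarrow> 'v"
  assumes T: "\<And>x. x \<in> carrier V \<Longrightarrow> T x \<in> carrier V"
    and lin: "\<And>x y c. x \<in> carrier V \<Longrightarrow> y \<in> carrier V \<Longrightarrow> T (x \<oplus> c \<odot> y) = T x \<oplus> c \<odot> T y"
    and u: "u \<in> B"
  shows "coordinate V B (T (V.lincomb a B)) u = (\<Sum>b\<in>B. a b * coordinate V B (T b) u)"
proof -
  have T0: "T \<zero> = \<zero>"
  proof -
    have z: "\<zero> \<oplus> 1 \<odot> \<zero> = \<zero>" using V.smult_one[of "\<zero>"] by (simp add: class_ring_simps)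
    have "T \<zero> = T \<zero> \<oplus> T \<zero>" using lin[of "\<zero>" "\<zero>" 1] T[of "\<zero>"] V.smult_one[of "T \<zero>"]
      unfolding z by (simp add: class_ring_simps)
    thus ?thesis using T[of "\<zero>"] V.M.add.l_cancel_one[of "T \<zero>" "T \<zero>"] by simp
  qed
  have "finite S \<Longrightarrow> S \<subseteq> B \<Longrightarrow>
      coordinate V B (T (V.lincomb a S)) u = (\<Sum>b\<in>S. a b * coordinate V B (T b) u)" for S
  proof (induction rule: finite_induct)
    case empty
    have "V.lincomb (\<lambda>_. 0) B = \<zero>"
      using V.lincomb_zero[of B "\<lambda>u. 0"] basis_sub by (auto simp: class_ring_simps)
    thus ?case using coordinate_unique[OF u, of "\<lambda>_. 0"] T0 by (simp add: V.lincomb_def)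
  next
    case (insert b S)
    have sub: "S \<subseteq> carrier V" "b \<in> carrier V" using insert basis_sub by auto
    have cl: "V.lincomb a S \<in> carrier V"
      using sub insert by (intro V.lincomb_closed) (auto simp: class_ring_simps)
    have "V.lincomb a (insert b S) = a b \<odot> b \<oplus> V.lincomb a S"
      using V.lincomb_insert2[of S a b] sub insert by (simp add: class_ring_simps)
    also have "\<dots> = V.lincomb a S \<oplus> a b \<odot> b"
      using cl sub by (intro V.M.a_comm V.smult_closed) (auto simp: class_ring_simps)
    finally show ?case
      using insert cl sub by (simp add: lin coordinate_plus T u)
  qed
  from this[OF finB] show ?thesis by simp
qed

end

text \<open>With \<open>S z\<close> standing for \<open>1 - z * T\<close>, one matrix
  \<open>M\<close> serves all \<open>z\<close>. This makes the determinant a polynomial in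
  \<open>z\<close>, and a zero of it yields a vector that \<open>S z\<close> annihilates.\<close>

lemma det_on_one_minus:
  fixes V :: "(complex, 'v) module" (structure) and T :: "'v \<Rightarrow> 'v" and S :: "complex \<Rightarrow> 'v \<Rightarrow> 'v"
  assumes V: "vectorspace class_ring V"
    and fb: "finite B" "vectorspace.basis class_ring V B"
    and T: "\<And>x. x \<in> carrier V \<Longrightarrow> T x \<in> carrier V"
    and lin: "\<And>x y c. x \<in> carrier V \<Longrightarrow> y \<in> carrier V \<Longrightarrow> T (x \<oplus> c \<odot> y) = T x \<oplus> c \<odot> T y"
    and S: "\<And>z x. x \<in> carrier V \<Longrightarrow> S z x = x \<oplus> (- z) \<odot> T x"
  obtains l M where "M \<in> carrier_mat l l"
    "\<And>z. det_on V (S z) = det (Matrix.mat l l (\<lambda>(i, j). (if i = j then 1 else 0) - z * M $$ (i, j)))"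
    "\<And>z. det_on V (S z) = 0 \<Longrightarrow> \<exists>y\<in>carrier V. y \<noteq> \<zero> \<and> S z y = \<zero>"
proof -
  interpret V: vectorspace class_ring V by (rule V)
  \<comment> \<open>The same choice that \<open>det_on\<close> makes. It depends on \<open>V\<close>
    only and hence not on \<open>z\<close>.\<close>
  define bs where "bs = (SOME bs. distinct bs \<and> V.basis (set bs))"
  have "\<exists>bs. distinct bs \<and> V.basis (set bs)" using finite_distinct_list[OF fb(1)] fb(2) by blast
  hence bs: "distinct bs" "V.basis (set bs)" unfolding bs_def by (metis (mono_tags, lifting) someI_ex)+
  note bas = V _ bs(2)
  have fin: "finite (set bs)" by simp
  note sub = basis_sub[OF V fin bs(2)]
  define l where "l = length bs"
  define M where "M = Matrix.mat l l (\<lambda>(i, j). coordinate V (set bs) (T (bs ! j)) (bs ! i))"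
  have in_bs: "bs ! i \<in> set bs" "bs ! i \<in> carrier V" if "i < l" for i using that sub by (auto simp: l_def)
  define D where "D z = Matrix.mat l l (\<lambda>(i, j). (if i = j then 1 else 0) - z * M $$ (i, j))" for z
  have Dz: "coordinate V (set bs) (S z (bs ! j)) (bs ! i) = D z $$ (i, j)" if "i < l" "j < l" for i j z
    using that in_bs bs(1)
    by (auto simp: D_def M_def S coordinate_plus[OF V fin bs(2)] T coordinate_basis[OF V fin bs(2)]
        nth_eq_iff_index_eq l_def)
  have dims: "dim_row (D z) = l" "dim_col (D z) = l" for z by (simp_all add: D_def)
  have det: "det_on V (S z) = det (D z)" for z
  proof -
    have "Matrix.mat l l (\<lambda>(i, j). coordinate V (set bs) (S z (bs ! j)) (bs ! i)) = D z"
      by (rule eq_matI) (simp_all add: Dz dims)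
    thus ?thesis unfolding det_on_def Let_def bs_def[symmetric] l_def by simp
  qed
  show ?thesis
  proof (rule that[of M l])
    show "M \<in> carrier_mat l l" by (simp add: M_def)
    show "det_on V (S z) = det (Matrix.mat l l (\<lambda>(i, j). (if i = j then 1 else 0) - z * M $$ (i, j)))" for z
      using det[of z] unfolding D_def .
    fix z assume "det_on V (S z) = 0"
    hence "det (D z) = 0" using det by simp
    moreover have Dc: "D z \<in> carrier_mat l l" by (simp add: D_def)
    ultimately obtain x where x: "x \<in> carrier_vec l" "x \<noteq> 0\<^sub>v l" "D z *\<^sub>v x = 0\<^sub>v l"
      using det_0_iff_vec_prod_zero by blast
    \<comment> \<open>The kernel vector \<open>x\<close> is indexed by list positions;
      \<open>a\<close> is the same data as a coefficient function on the basis.\<close>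
    define a where "a u = (\<Sum>j<l. if bs ! j = u then vec_index x j else 0)" for u
    have a: "a (bs ! i) = vec_index x i" if "i < l" for i
    proof -
      have "a (bs ! i) = (\<Sum>j<l. if j = i then vec_index x j else 0)"
        unfolding a_def using that bs(1) by (intro sum.cong) (auto simp: nth_eq_iff_index_eq l_def)
      thus ?thesis using that by simp
    qed
    define y where "y = V.lincomb a (set bs)"
    have y: "y \<in> carrier V" unfolding y_def using sub by (intro V.lincomb_closed) (auto simp: class_ring_simps)
    have Scl: "S z w \<in> carrier V" if "w \<in> carrier V" for w
      using that T S V.smult_closed by (auto simp: class_ring_simps)
    have Slin: "S z (w \<oplus> c \<odot> w') = S z w \<oplus> c \<odot> S z w'" if w: "w \<in> carrier V" "w' \<in> carrier V" for w w' c
    proof -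
      have cl: "c \<odot> w \<in> carrier V" if "w \<in> carrier V" for c w
        using that V.smult_closed by (auto simp: class_ring_simps)
      have "S z (w \<oplus> c \<odot> w') = (w \<oplus> c \<odot> w') \<oplus> (- z) \<odot> (T w \<oplus> c \<odot> T w')"
        using w by (simp add: S cl lin)
      also have "(- z) \<odot> (T w \<oplus> c \<odot> T w') = (- z) \<odot> T w \<oplus> c \<odot> ((- z) \<odot> T w')"
        using w T cl V.smult_r_distr[of "- z" "T w" "c \<odot> T w'"]
          V.smult_assoc1[of "- z" c "T w'"] V.smult_assoc1[of c "- z" "T w'"]
        by (simp add: class_ring_simps mult.commute)
      also have "(w \<oplus> c \<odot> w') \<oplus> ((- z) \<odot> T w \<oplus> c \<odot> ((- z) \<odot> T w')) =
          (w \<oplus> (- z) \<odot> T w) \<oplus> (c \<odot> w' \<oplus> c \<odot> ((- z) \<odot> T w'))"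
        using w T cl by (simp add: V.M.a_ac)
      also have "c \<odot> w' \<oplus> c \<odot> ((- z) \<odot> T w') = c \<odot> (w' \<oplus> (- z) \<odot> T w')"
        using w T cl V.smult_r_distr[of c w' "(- z) \<odot> T w'"] by (simp add: class_ring_simps)
      finally show ?thesis using w by (simp add: S)
    qed
    have "coordinate V (set bs) (S z y) (bs ! i) = 0" if i: "i < l" for i
    proof -
      have "coordinate V (set bs) (S z y) (bs ! i) =
          (\<Sum>b\<in>set bs. a b * coordinate V (set bs) (S z b) (bs ! i))"
        unfolding y_def by (rule coordinate_linear[OF V fin bs(2) Scl Slin in_bs(1)[OF i]])
      also have "\<dots> = (\<Sum>j<l. a (bs ! j) * coordinate V (set bs) (S z (bs ! j)) (bs ! i))"
        by (rule sum.reindex_bij_betw[symmetric]) (use bs(1) in \<open>auto simp: l_def bij_betw_def set_conv_nth inj_on_def nth_eq_iff_index_eq\<close>)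
      also have "\<dots> = vec_index (D z *\<^sub>v x) i"
        using i Dc x(1) by (auto simp: a Dz scalar_prod_def lessThan_atLeast0 mult.commute intro!: sum.cong)
      finally show ?thesis using x(3) i by simp
    qed
    hence c0: "\<forall>u\<in>set bs. coordinate V (set bs) (S z y) u = 0"
      by (auto simp: in_set_conv_nth l_def)
    have "S z y = V.lincomb (coordinate V (set bs) (S z y)) (set bs)"
      using coordinate_lincomb[OF V fin bs(2) Scl[OF y]] by simp
    also have "\<dots> = \<zero>"
      using V.lincomb_zero[of "set bs" "coordinate V (set bs) (S z y)"] sub c0 by (auto simp: class_ring_simps)
    finally have Sy: "S z y = \<zero>" .
    have "y \<noteq> \<zero>"
    proof
      assume "y = \<zero>"
      also have "\<zero> = V.lincomb (\<lambda>_. 0) (set bs)"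
        using V.lincomb_zero[of "set bs" "\<lambda>u. 0"] sub by (auto simp: class_ring_simps)
      finally have eq: "V.lincomb a (set bs) = V.lincomb (\<lambda>_. 0) (set bs)" unfolding y_def .
      have "vec_index x i = 0" if "i < l" for i
        using lincomb_unique[OF V fin bs(2) eq in_bs(1)[OF that]] a[OF that] by simp
      hence "x = 0\<^sub>v l" using x(1) by (intro eq_vecI) auto
      thus False using x(2) by simp
    qed
    thus "\<exists>y\<in>carrier V. y \<noteq> \<zero> \<and> S z y = \<zero>" using y Sy by blast
  qed
qed

section \<open>The special orthogonal group and its adjoint action\<close>

lemma SO_iff: "g \<in> carrier (SO n) \<longleftrightarrow> g \<in> carrier_mat n n \<and> transpose_mat g * g = 1\<^sub>m n \<and> det g = 1"
  by (auto simp: SO_def)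

lemma SO_carrier_mat: "g \<in> carrier (SO n) \<Longrightarrow> g \<in> carrier_mat n n"
  by (simp add: SO_iff)

lemma SO_simps [simp]: "mult (SO n) = (*)" "one (SO n) = 1\<^sub>m n"
  by (simp_all add: SO_def)

lemma SO_mult_transpose: "g \<in> carrier (SO n) \<Longrightarrow> g * transpose_mat g = 1\<^sub>m n"
  using mat_mult_left_right_inverse[of "transpose_mat g" n g] by (auto simp: SO_iff)

lemma SO_mult:
  assumes "g \<in> carrier (SO n)" "h \<in> carrier (SO n)"
  shows "g * h \<in> carrier (SO n)"
proof -
  have c: "g \<in> carrier_mat n n" "h \<in> carrier_mat n n" using assms by (auto simp: SO_iff)
  have "transpose_mat (g * h) * (g * h) = transpose_mat h * ((transpose_mat g * g) * h)"
    using c by (simp add: transpose_mult[of _ n n _ n] mult_carrier_mat[of _ n n _ n] assoc_mult_mat[of _ n n _ n _ n])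
  also have "\<dots> = 1\<^sub>m n" using assms c by (simp add: SO_iff)
  finally show ?thesis using assms c by (auto simp: SO_iff det_mult)
qed

lemma SO_transpose: "g \<in> carrier (SO n) \<Longrightarrow> transpose_mat g \<in> carrier (SO n)"
  using SO_mult_transpose[of g n] by (auto simp: SO_iff det_transpose)

lemma SO_one: "1\<^sub>m n \<in> carrier (SO n)"
  by (auto simp: SO_iff)

lemma SO_group: "group (SO n)"
proof (rule groupI)
  fix x y z assume "x \<in> carrier (SO n)" "y \<in> carrier (SO n)" "z \<in> carrier (SO n)"
  thus "x \<otimes>\<^bsub>SO n\<^esub> y \<otimes>\<^bsub>SO n\<^esub> z = x \<otimes>\<^bsub>SO n\<^esub> (y \<otimes>\<^bsub>SO n\<^esub> z)"
    by (auto simp: SO_iff assoc_mult_mat[of _ n n _ n _ n])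
next
  fix x assume "x \<in> carrier (SO n)"
  thus "\<exists>y\<in>carrier (SO n). y \<otimes>\<^bsub>SO n\<^esub> x = \<one>\<^bsub>SO n\<^esub>"
    using SO_transpose by (auto simp: SO_iff)
qed (auto simp: SO_mult SO_one dest: SO_carrier_mat)

lemma SO_inv: "g \<in> carrier (SO n) \<Longrightarrow> inv\<^bsub>SO n\<^esub> g = transpose_mat g"
  by (intro group.inv_equality[OF SO_group]) (simp_all add: SO_transpose, simp add: SO_iff)

lemma Ad_SO_eq: "g \<in> carrier (SO n) \<Longrightarrow> Ad_SO n g Y = g * Y * transpose_mat g"
  by (simp add: Ad_SO_def SO_inv)

lemma Ad_SO_carrier: "g \<in> carrier (SO n) \<Longrightarrow> Y \<in> carrier_mat n n \<Longrightarrow> Ad_SO n g Y \<in> carrier_mat n n"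
  using SO_carrier_mat[of g n] by (simp add: Ad_SO_eq mult_carrier_mat[of _ n n _ n])

lemma Ad_SO_one: "Y \<in> carrier_mat n n \<Longrightarrow> Ad_SO n (1\<^sub>m n) Y = Y"
  by (simp add: Ad_SO_eq SO_one)

lemma Ad_SO_mult:
  assumes "g \<in> carrier (SO n)" "h \<in> carrier (SO n)" "Y \<in> carrier_mat n n"
  shows "Ad_SO n (g * h) Y = Ad_SO n g (Ad_SO n h Y)"
  using SO_carrier_mat[OF assms(1)] SO_carrier_mat[OF assms(2)] assms
  by (simp add: Ad_SO_eq SO_mult transpose_mult[of _ n n _ n] mult_carrier_mat[of _ n n _ n]
      assoc_mult_mat[of _ n n _ n _ n])

lemma Ad_SO_linear:
  assumes "g \<in> carrier (SO n)" "Y \<in> carrier_mat n n" "Z \<in> carrier_mat n n"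
  shows "Ad_SO n g (Y + c \<cdot>\<^sub>m Z) = Ad_SO n g Y + c \<cdot>\<^sub>m Ad_SO n g Z"
proof -
  have g: "g \<in> carrier_mat n n" "transpose_mat g \<in> carrier_mat n n" using assms by (auto simp: SO_iff)
  have "g * (Y + c \<cdot>\<^sub>m Z) = g * Y + c \<cdot>\<^sub>m (g * Z)"
    using g assms by (simp add: mult_add_distrib_mat[of _ n n _ n] mult_smult_distrib[of _ n n _ n])
  also have "\<dots> * transpose_mat g = g * Y * transpose_mat g + c \<cdot>\<^sub>m (g * Z) * transpose_mat g"
    using g assms by (intro add_mult_distrib_mat[of _ n n]) auto
  also have "c \<cdot>\<^sub>m (g * Z) * transpose_mat g = c \<cdot>\<^sub>m (g * Z * transpose_mat g)"
    using g assms by (intro mult_smult_assoc_mat[of _ n n _ n]) auto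
  finally show ?thesis using assms by (simp add: Ad_SO_eq)
qed

lemma Ad_SO_skew:
  assumes "g \<in> carrier (SO n)" "Y \<in> carrier_mat n n" "transpose_mat Y = - Y"
  shows "transpose_mat (Ad_SO n g Y) = - Ad_SO n g Y"
proof -
  have g: "g \<in> carrier_mat n n" "transpose_mat g \<in> carrier_mat n n" using assms by (auto simp: SO_iff)
  have "transpose_mat (g * Y * transpose_mat g) = g * (transpose_mat Y * transpose_mat g)"
    using g assms(2) by (simp add: transpose_mult[of _ n n _ n] mult_carrier_mat[of _ n n _ n])
  also have "\<dots> = - (g * Y * transpose_mat g)"
    using g assms(2,3) by (simp add: mult_carrier_mat[of _ n n _ n] assoc_mult_mat[of _ n n _ n _ n]
        uminus_mult_left_mat uminus_mult_right_mat)
  finally show ?thesis using assms by (simp add: Ad_SO_eq)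
qed

lemma SO_pow_mat: "g \<in> carrier (SO n) \<Longrightarrow> g ^\<^sub>m k \<in> carrier (SO n)"
  by (induction k) (auto simp: SO_one SO_mult dest: SO_carrier_mat)

lemma Ad_SO_eigen_power:
  assumes g: "g \<in> carrier (SO n)" and Y: "Y \<in> carrier_mat n n" and eig: "Y = z \<cdot>\<^sub>m Ad_SO n g Y"
  shows "Y = z ^ k \<cdot>\<^sub>m Ad_SO n (g ^\<^sub>m k) Y"
proof (induction k)
  case 0
  have "dim_row g = n" using SO_carrier_mat[OF g] by simp
  thus ?case using Y by (simp add: Ad_SO_one one_smult_mat)
next
  case (Suc k)
  have sm: "Ad_SO n h (c \<cdot>\<^sub>m Z) = c \<cdot>\<^sub>m Ad_SO n h Z"
    if "h \<in> carrier (SO n)" "Z \<in> carrier_mat n n" for h Z c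
    using that SO_carrier_mat[OF that(1)]
    by (simp add: Ad_SO_eq mult_carrier_mat[of _ n n _ n] mult_smult_distrib[of _ n n _ n] mult_smult_assoc_mat[of _ n n _ n])
  have gk: "g ^\<^sub>m k \<in> carrier (SO n)" using g by (rule SO_pow_mat)
  have "z ^ Suc k \<cdot>\<^sub>m Ad_SO n (g ^\<^sub>m Suc k) Y = z ^ k \<cdot>\<^sub>m (z \<cdot>\<^sub>m Ad_SO n (g ^\<^sub>m k) (Ad_SO n g Y))"
    using g gk Y by (simp add: Ad_SO_mult smult_smult_mat mult.commute)
  also have "z \<cdot>\<^sub>m Ad_SO n (g ^\<^sub>m k) (Ad_SO n g Y) = Ad_SO n (g ^\<^sub>m k) (z \<cdot>\<^sub>m Ad_SO n g Y)"
    using sm[OF gk Ad_SO_carrier[OF g Y]] by simp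
  also have "\<dots> = Ad_SO n (g ^\<^sub>m k) Y" using eig by metis
  finally show ?case using Suc.IH by metis
qed

lemma analytic_on_det_mat:
  assumes "\<And>i j. i < l \<Longrightarrow> j < l \<Longrightarrow> f i j analytic_on A"
  shows "(\<lambda>s. det (Matrix.mat l l (\<lambda>(i, j). f i j s))) analytic_on A"
proof -
  have "(\<lambda>s. \<Sum>p\<in>{p. p permutes {0..<l}}. signof p * (\<Prod>i = 0..<l. f i (p i) s)) analytic_on A"
    using assms permutes_in_image
    by (intro analytic_on_sum analytic_on_mult analytic_on_const analytic_on_prod) fastforce
  also have "(\<lambda>s. \<Sum>p\<in>{p. p permutes {0..<l}}. signof p * (\<Prod>i = 0..<l. f i (p i) s)) =
      (\<lambda>s. det (Matrix.mat l l (\<lambda>(i, j). f i j s)))"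
  proof
    fix s
    have "p i < l" if "p permutes {0..<l}" "i < l" for p i
      using permutes_in_image[OF that(1), of i] that(2) by simp
    thus "(\<Sum>p\<in>{p. p permutes {0..<l}}. signof p * (\<Prod>i = 0..<l. f i (p i) s)) =
        det (Matrix.mat l l (\<lambda>(i, j). f i j s))"
      by (subst det_def') (auto intro!: sum.cong prod.cong)
  qed
  finally show ?thesis .
qed

lemma inverse_det_on_Ad_analytic:
  assumes W: "subspace class_ring W (module_mat TYPE(complex) n n)"
    and g: "g \<in> carrier (SO n)" "g ^\<^sub>m r = 1\<^sub>m n" "r > 0"
    and stable: "\<And>Y. Y \<in> W \<Longrightarrow> Ad_SO n g Y \<in> W"
    and q: "q > 1"
  shows "(\<lambda>s. inverse (det_on ((module_mat TYPE(complex) n n) \<lparr> carrier := W \<rparr>)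
    (\<lambda>Y. Y - (of_nat q powr (- s)) \<cdot>\<^sub>m Ad_SO n g Y))) analytic_on {1}"
proof -
  let ?V = "(module_mat TYPE(complex) n n) \<lparr> carrier := W \<rparr>"
  interpret M: vectorspace class_ring "module_mat TYPE(complex) n n" by (rule matrix_vs)
  have V: "vectorspace class_ring ?V" by (rule M.subspace_is_vs[OF W])
  obtain B where B: "finite B" "vectorspace.basis class_ring ?V B"
    using M.subspace_finite_basis[OF matrix_fin_dim W] .
  have Wc: "Y \<in> carrier_mat n n" if "Y \<in> W" for Y
    using W that M.is_module[of W] by (auto simp: submodule_def module_mat_simps)
  obtain l M where M: "M \<in> carrier_mat l l"
    "\<And>z. det_on ?V (\<lambda>Y. Y - z \<cdot>\<^sub>m Ad_SO n g Y) =
        det (Matrix.mat l l (\<lambda>(i, j). (if i = j then 1 else 0) - z * M $$ (i, j)))"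
    "\<And>z. det_on ?V (\<lambda>Y. Y - z \<cdot>\<^sub>m Ad_SO n g Y) = 0 \<Longrightarrow>
        \<exists>y\<in>W. y \<noteq> 0\<^sub>m n n \<and> y - z \<cdot>\<^sub>m Ad_SO n g y = 0\<^sub>m n n"
  proof (rule det_on_one_minus[OF V B, of "Ad_SO n g" "\<lambda>z Y. Y - z \<cdot>\<^sub>m Ad_SO n g Y"])
    fix x y :: "complex mat" and c :: complex
    assume "x \<in> carrier ?V" "y \<in> carrier ?V"
    thus "Ad_SO n g (x \<oplus>\<^bsub>?V\<^esub> c \<odot>\<^bsub>?V\<^esub> y) = Ad_SO n g x \<oplus>\<^bsub>?V\<^esub> c \<odot>\<^bsub>?V\<^esub> Ad_SO n g y"
      by (simp add: module_mat_simps Ad_SO_linear[OF g(1)] Wc)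
  next
    fix z x assume "x \<in> carrier ?V"
    hence c: "x \<in> carrier_mat n n" "Ad_SO n g x \<in> carrier_mat n n"
      using Wc stable by auto
    show "x - z \<cdot>\<^sub>m Ad_SO n g x = x \<oplus>\<^bsub>?V\<^esub> (- z) \<odot>\<^bsub>?V\<^esub> Ad_SO n g x"
      using c by (auto simp: module_mat_simps intro!: eq_matI)
  qed (auto simp: stable module_mat_simps)
  have qc: "complex_of_nat q \<notin> \<real>\<^sub>\<le>\<^sub>0" using q by (simp add: complex_nonpos_Reals_iff)
  have "(\<lambda>s. det (Matrix.mat l l (\<lambda>(i, j). (if i = j then 1 else 0) - (of_nat q powr (- s)) * M $$ (i, j))))
      analytic_on {1}"
    using qc by (intro analytic_on_det_mat analytic_intros) auto
  moreover have "det_on ?V (\<lambda>Y. Y - (of_nat q powr (- 1)) \<cdot>\<^sub>m Ad_SO n g Y) \<noteq> 0"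
  proof
    define z where "z = complex_of_nat q powr (- 1)"
    assume "det_on ?V (\<lambda>Y. Y - (of_nat q powr (- 1)) \<cdot>\<^sub>m Ad_SO n g Y) = 0"
    from M(3)[OF this] obtain y where y: "y \<in> W" "y \<noteq> 0\<^sub>m n n" "y - z \<cdot>\<^sub>m Ad_SO n g y = 0\<^sub>m n n"
      unfolding z_def by blast
    have yc: "y \<in> carrier_mat n n" "Ad_SO n g y \<in> carrier_mat n n"
      using y(1) Wc stable by auto
    have "y = z \<cdot>\<^sub>m Ad_SO n g y"
    proof (rule eq_matI)
      fix i j assume ij: "i < dim_row (z \<cdot>\<^sub>m Ad_SO n g y)" "j < dim_col (z \<cdot>\<^sub>m Ad_SO n g y)"
      have "(y - z \<cdot>\<^sub>m Ad_SO n g y) $$ (i, j) = 0" using y(3) ij yc by simp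
      thus "y $$ (i, j) = (z \<cdot>\<^sub>m Ad_SO n g y) $$ (i, j)" using ij yc by simp
    qed (use yc in auto)
    from Ad_SO_eigen_power[OF g(1) yc(1) this, of r]
    have yr: "y = z ^ r \<cdot>\<^sub>m y" using yc g(2) by (simp add: Ad_SO_one)
    obtain i j where ij: "i < n" "j < n" "y $$ (i, j) \<noteq> 0"
      using y(2) yc(1) by (metis eq_matI carrier_matD index_zero_mat)
    have "y $$ (i, j) = z ^ r * y $$ (i, j)"
      by (subst (1) yr) (use ij yc in simp)
    hence "z ^ r = 1" using ij(3) by simp
    moreover have "norm z = inverse (real q)" unfolding z_def using q by (simp add: powr_minus norm_inverse)
    ultimately have "inverse (real q) ^ r = 1" by (metis norm_one norm_power)
    moreover have "inverse (real q) ^ r < 1"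
      using q g(3) by (simp add: power_less_one_iff inverse_less_1_iff)
    ultimately show False by simp
  qed
  ultimately show ?thesis
    unfolding M(2) by (intro analytic_on_inverse) auto
qed

lemma skew_mat_iff:
  assumes "Y \<in> carrier_mat n n"
  shows "transpose_mat Y = - Y \<longleftrightarrow> (\<forall>i<n. \<forall>j<n. Y $$ (j, i) = - Y $$ (i, j))"
proof
  assume t: "transpose_mat Y = - Y"
  show "\<forall>i<n. \<forall>j<n. Y $$ (j, i) = - Y $$ (i, j)"
  proof (intro allI impI)
    fix i j assume "i < n" "j < n"
    hence "transpose_mat Y $$ (i, j) = Y $$ (j, i)" "(- Y) $$ (i, j) = - Y $$ (i, j)"
      using assms by auto
    thus "Y $$ (j, i) = - Y $$ (i, j)" using t by simp
  qed
next
  assume h: "\<forall>i<n. \<forall>j<n. Y $$ (j, i) = - Y $$ (i, j)"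
  show "transpose_mat Y = - Y"
  proof (rule eq_matI)
    fix i j assume "i < dim_row (- Y)" "j < dim_col (- Y)"
    hence ij: "i < n" "j < n" using assms by auto
    hence "transpose_mat Y $$ (i, j) = Y $$ (j, i)" "(- Y) $$ (i, j) = - Y $$ (i, j)"
      using assms by auto
    thus "transpose_mat Y $$ (i, j) = (- Y) $$ (i, j)" using h ij by metis
  qed (use assms in auto)
qed

section \<open>Topology of the Weil group and genericity\<close>

context local_field_char_0
begin

text \<open>Inertia is normal, which will make the space of its invariants stable under
  Frobenius.\<close>

lemma inertia_conjugate:
  assumes s: "\<sigma> \<in> inertia_group v" and f: "\<phi> \<in> galois_auts"
  shows "inv_into UNIV \<phi> \<circ> \<sigma> \<circ> \<phi> \<in> inertia_group v"
    "\<phi> \<circ> (inv_into UNIV \<phi> \<circ> \<sigma> \<circ> \<phi>) = \<sigma> \<circ> \<phi>"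
proof -
  have bij: "bij \<phi>" using galois_auts_hom[OF f] by blast
  have i: "inv_into UNIV \<phi> \<in> galois_auts" using f by (rule galois_auts_inv)
  have s': "\<sigma> \<in> galois_auts" "\<And>x. x \<in> Oac \<Longrightarrow> \<sigma> x - x \<in> Mac"
    using s by (auto simp: inertia_group_def acts_as_frobenius_power_def)
  show "\<phi> \<circ> (inv_into UNIV \<phi> \<circ> \<sigma> \<circ> \<phi>) = \<sigma> \<circ> \<phi>"
    using bij by (simp add: fun_eq_iff bij_is_surj surj_f_inv_f)
  have "inv_into UNIV \<phi> (\<sigma> (\<phi> x)) - x \<in> Mac" if x: "x \<in> Oac" for x
  proof -
    have "inv_into UNIV \<phi> (\<sigma> (\<phi> x) - \<phi> x) \<in> Mac"
      by (rule galois_Mac[OF i s'(2)[OF galois_Oac[OF f x]]])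
    thus ?thesis using galois_auts_hom(8)[OF i] bij by (simp add: bij_is_inj)
  qed
  thus "inv_into UNIV \<phi> \<circ> \<sigma> \<circ> \<phi> \<in> inertia_group v"
    using galois_auts_comp[OF galois_auts_comp[OF i s'(1)] f]
    by (simp add: inertia_group_def acts_as_frobenius_power_def)
qed

lemma weil_topology_open_iff_local:
  assumes "U \<subseteq> carrier (weil_group v)"
    and "\<And>\<sigma>. \<sigma> \<in> U \<Longrightarrow> \<exists>S. finite S \<and> (\<forall>\<tau>\<in>inertia_group v. (\<forall>x\<in>S. \<tau> x = x) \<longrightarrow> \<sigma> \<circ> \<tau> \<in> U)"
  shows "openin (weil_topology v) U"
proof (subst openin_subopen, intro ballI)
  fix \<sigma> assume s: "\<sigma> \<in> U"
  obtain S where S: "finite S" "\<And>\<tau>. \<tau> \<in> inertia_group v \<Longrightarrow> \<forall>x\<in>S. \<tau> x = x \<Longrightarrow> \<sigma> \<circ> \<tau> \<in> U"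
    using assms(2)[OF s] by blast
  let ?T = "(\<lambda>\<tau>. \<sigma> \<circ> \<tau>) ` {\<tau> \<in> inertia_group v. \<forall>x\<in>S. \<tau> x = x}"
  have "openin (weil_topology v) ?T"
    unfolding weil_topology_def using S(1) s assms(1)
    by (intro topology_generated_by_Basis) blast
  moreover have "id \<in> inertia_group v"
    using galois_auts_id by (simp add: inertia_group_def acts_as_frobenius_power_def)
  hence "\<sigma> \<circ> id \<in> ?T" by - (rule imageI, rule CollectI, rule conjI, assumption, simp)
  hence "\<sigma> \<in> ?T" by (simp only: comp_id)
  ultimately show "\<exists>T. openin (weil_topology v) T \<and> \<sigma> \<in> T \<and> T \<subseteq> U" using S(2) by blast
qed

lemma topspace_weil: "topspace (weil_topology v) = carrier (weil_group v)"
proof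
  show "topspace (weil_topology v) \<subseteq> carrier (weil_group v)"
    unfolding weil_topology_def topology_generated_by_topspace
    using comp_inertia_in_weil by auto
  have "openin (weil_topology v) (carrier (weil_group v))"
    by (rule weil_topology_open_iff_local) (auto intro: comp_inertia_in_weil)
  thus "carrier (weil_group v) \<subseteq> topspace (weil_topology v)" by (rule openin_subset)
qed

lemma locally_constant_continuous:
  fixes h :: "('a alg_closure \<Rightarrow> 'a alg_closure) \<Rightarrow> complex"
  assumes "finite S"
    and "\<And>\<sigma> \<tau>. \<sigma> \<in> carrier (weil_group v) \<Longrightarrow> \<forall>x\<in>S. \<tau> x = x \<Longrightarrow> h (\<sigma> \<circ> \<tau>) = h \<sigma>"
  shows "continuous_map (weil_topology v) euclidean h"
  unfolding continuous_map_def topspace_weil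
proof (intro conjI allI impI)
  fix U assume "openin (euclidean :: complex topology) U"
  show "openin (weil_topology v) {x \<in> carrier (weil_group v). h x \<in> U}"
  proof (rule weil_topology_open_iff_local)
    fix \<sigma> assume s: "\<sigma> \<in> {x \<in> carrier (weil_group v). h x \<in> U}"
    show "\<exists>S. finite S \<and> (\<forall>\<tau>\<in>inertia_group v. (\<forall>x\<in>S. \<tau> x = x) \<longrightarrow>
        \<sigma> \<circ> \<tau> \<in> {x \<in> carrier (weil_group v). h x \<in> U})"
      using s assms comp_inertia_in_weil by (intro exI[of _ S]) auto
  qed auto
qed auto

text \<open>The morphism is trivial on \<open>SL 2\<close>, so its nilpotent operator is zero and
  the adjoint L-function is computed on the inertia invariants \<open>C\<close>. Frobenius preserves
  \<open>C\<close> and acts on it with finite order.\<close>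

lemma generic_of_finite_order:
  fixes f :: "('a alg_closure \<Rightarrow> 'a alg_closure) \<Rightarrow> complex mat"
  assumes f: "\<And>\<sigma>. \<sigma> \<in> carrier (weil_group v) \<Longrightarrow> f \<sigma> \<in> carrier (SO n)"
    and mult: "\<And>\<sigma> \<tau>. \<sigma> \<in> carrier (weil_group v) \<Longrightarrow> \<tau> \<in> carrier (weil_group v) \<Longrightarrow>
        f (\<sigma> \<circ> \<tau>) = f \<sigma> * f \<tau>"
    and one: "f id = 1\<^sub>m n"
    and semisimple: "\<And>\<sigma>. \<sigma> \<in> carrier (weil_group v) \<Longrightarrow> semisimple_mat (f \<sigma>)"
    and S: "finite S" "\<And>\<sigma> \<tau>. \<sigma> \<in> carrier (weil_group v) \<Longrightarrow> \<forall>x\<in>S. \<tau> x = x \<Longrightarrow> f (\<sigma> \<circ> \<tau>) = f \<sigma>"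
    and order: "f (geometric_frobenius v) ^\<^sub>m r = 1\<^sub>m n" "r > 0"
  shows "generic_morphism v n (\<lambda>(\<sigma>, g). f \<sigma>)"
  unfolding generic_morphism_def
proof
  let ?W = "weil_group v" and ?\<Phi> = "geometric_frobenius v"
  let ?\<phi> = "\<lambda>(\<sigma>, g :: complex mat). f \<sigma>"
  have W: "mult ?W = (\<circ>)" by (simp add: weil_group_def)
  show "wd_morphism v n ?\<phi>"
    unfolding wd_morphism_def
  proof (intro conjI allI impI ballI)
    show "?\<phi> \<in> hom (weil_deligne_group v) (SO n)"
      by (auto simp: hom_def weil_deligne_group_def DirProd_def W f mult)
    show "continuous_map (weil_topology v) euclidean (\<lambda>\<sigma>. ?\<phi> (\<sigma>, 1\<^sub>m 2) $$ (i, j))" for i j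
      using S by (intro locally_constant_continuous[of S]) auto
    show "regular_map 2 (carrier (SL 2)) n (\<lambda>g. ?\<phi> (id, g))"
      unfolding regular_map_def by (auto intro: poly_funs.const)
    show "semisimple_mat (?\<phi> (\<sigma>, 1\<^sub>m 2))" if "\<sigma> \<in> carrier ?W" for \<sigma>
      using semisimple[OF that] by simp
  qed
  have \<Phi>: "?\<Phi> \<in> galois_auts" "?\<Phi> \<in> carrier ?W"
    using geometric_frobenius by (auto simp: weil_group_def)
  have fI: "f \<sigma> \<in> carrier (SO n)" if "\<sigma> \<in> inertia_group v" for \<sigma>
    using f inertia_in_weil that by blast
  let ?M = "module_mat TYPE(complex) n n"
  interpret M: vectorspace class_ring ?M by (rule matrix_vs)
  define C where "C = {Y \<in> carrier_mat n n. transpose_mat Y = - Y \<and>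
    (\<forall>\<sigma>\<in>inertia_group v. Ad_SO n (f \<sigma>) Y = Y)}"
  have inv: "adjoint_invariants v n ?\<phi> = ?M \<lparr> carrier := C \<rparr>"
    unfolding adjoint_invariants_def so_lie_def C_def using one
    by (auto simp: Ad_SO_one intro!: arg_cong[where f = "\<lambda>K. ?M \<lparr> carrier := K \<rparr>"])
  have add_smult: "Y + c \<cdot>\<^sub>m Z \<in> C" if "Y \<in> C" "Z \<in> C" for Y Z c
  proof -
    have c: "Y \<in> carrier_mat n n" "Z \<in> carrier_mat n n"
      "transpose_mat Y = - Y" "transpose_mat Z = - Z"
      using that by (auto simp: C_def)
    have YZ: "(Y + c \<cdot>\<^sub>m Z) $$ (j, i) = - (Y + c \<cdot>\<^sub>m Z) $$ (i, j)" if "i < n" "j < n" for i j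
    proof -
      have "Y $$ (j, i) = - Y $$ (i, j)" "Z $$ (j, i) = - Z $$ (i, j)"
        using c that skew_mat_iff by blast+
      moreover have "(Y + c \<cdot>\<^sub>m Z) $$ (j, i) = Y $$ (j, i) + c * Z $$ (j, i)"
        "(Y + c \<cdot>\<^sub>m Z) $$ (i, j) = Y $$ (i, j) + c * Z $$ (i, j)" using c(1,2) that by auto
      ultimately show ?thesis by simp
    qed
    have "transpose_mat (Y + c \<cdot>\<^sub>m Z) = - (Y + c \<cdot>\<^sub>m Z)"
      using c(1,2) YZ by (subst skew_mat_iff[of _ n]) (simp, blast)
    thus ?thesis using that fI by (auto simp: C_def Ad_SO_linear)
  qed
  have zero: "0\<^sub>m n n \<in> C"
    using fI SO_carrier_mat by (force simp: C_def Ad_SO_eq intro!: eq_matI)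
  have sub: "submodule class_ring C ?M"
  proof (unfold_locales)
    show "C \<subseteq> carrier ?M" by (auto simp: C_def module_mat_simps)
    fix Y Z assume "Y \<in> C" "Z \<in> C"
    moreover have "Z \<in> carrier_mat n n" using \<open>Z \<in> C\<close> by (simp add: C_def)
    ultimately show "Y \<oplus>\<^bsub>?M\<^esub> Z \<in> C"
      using add_smult[of Y Z 1] by (simp add: module_mat_simps one_smult_mat)
  next
    fix c :: complex and Y assume "c \<in> carrier class_ring" "Y \<in> C"
    moreover have "Y \<in> carrier_mat n n" using \<open>Y \<in> C\<close> by (simp add: C_def)
    ultimately show "c \<odot>\<^bsub>?M\<^esub> Y \<in> C"
      using add_smult[OF zero, of Y c] by (simp add: module_mat_simps)
  qed (use zero in \<open>simp add: module_mat_simps\<close>)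
  have "subspace class_ring C ?M"
    using sub M.vectorspace_axioms by (simp add: subspace_def)
  moreover have "Ad_SO n (f ?\<Phi>) Y \<in> C" if Y: "Y \<in> C" for Y
  proof -
    have Yc: "Y \<in> carrier_mat n n" using Y by (simp add: C_def)
    have "Ad_SO n (f \<sigma>) (Ad_SO n (f ?\<Phi>) Y) = Ad_SO n (f ?\<Phi>) Y" if s: "\<sigma> \<in> inertia_group v" for \<sigma>
    proof -
      note s' = inertia_conjugate[OF s \<Phi>(1)]
      have "Ad_SO n (f \<sigma>) (Ad_SO n (f ?\<Phi>) Y) = Ad_SO n (f \<sigma> * f ?\<Phi>) Y"
        using Ad_SO_mult[OF fI[OF s] f[OF \<Phi>(2)] Yc] by simp
      also have "f \<sigma> * f ?\<Phi> = f (?\<Phi> \<circ> (inv_into UNIV ?\<Phi> \<circ> \<sigma> \<circ> ?\<Phi>))"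
        unfolding s'(2) by (rule mult[OF inertia_in_weil[OF s] \<Phi>(2), symmetric])
      also have "\<dots> = f ?\<Phi> * f (inv_into UNIV ?\<Phi> \<circ> \<sigma> \<circ> ?\<Phi>)"
        by (rule mult[OF \<Phi>(2) inertia_in_weil[OF s'(1)]])
      also have "Ad_SO n \<dots> Y = Ad_SO n (f ?\<Phi>) (Ad_SO n (f (inv_into UNIV ?\<Phi> \<circ> \<sigma> \<circ> ?\<Phi>)) Y)"
        by (rule Ad_SO_mult[OF f[OF \<Phi>(2)] fI[OF s'(1)] Yc])
      also have "Ad_SO n (f (inv_into UNIV ?\<Phi> \<circ> \<sigma> \<circ> ?\<Phi>)) Y = Y"
        using Y s'(1) by (simp add: C_def)
      finally show ?thesis .
    qed
    thus ?thesis
      using Y Yc f[OF \<Phi>(2)] by (simp add: C_def Ad_SO_carrier Ad_SO_skew)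
  qed
  ultimately have "(\<lambda>s. inverse (det_on (?M \<lparr> carrier := C \<rparr>)
      (\<lambda>Y. Y - (of_nat q powr (- s)) \<cdot>\<^sub>m Ad_SO n (f ?\<Phi>) Y))) analytic_on {1}"
    using f[OF \<Phi>(2)] order q_gt_1 by (intro inverse_det_on_Ad_analytic)
  thus "L_adjoint v n ?\<phi> analytic_on {1}"
    by (simp add: L_adjoint_def[abs_def] inv frobenius_wd_def)
qed

end

section \<open>The parameters\<close>

text \<open>In each plane spanned by the coordinates \<open>i\<close> and \<open>N + i\<close> this
  is the matrix \<open>[[a i, b i], [c i, d i]]\<close>. Products, transposes and determinants thus
  reduce to calculations with 2 x 2 matrices.\<close>

definition blk :: "nat \<Rightarrow> (nat \<Rightarrow> complex) \<Rightarrow> (nat \<Rightarrow> complex) \<Rightarrow> (nat \<Rightarrow> complex) \<Rightarrow> (nat \<Rightarrow> complex)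
    \<Rightarrow> complex mat" where
  "blk N a b c d = four_block_mat (mat_diag N a) (mat_diag N b) (mat_diag N c) (mat_diag N d)"

lemma mat_diag_cong: "(\<And>i. i < N \<Longrightarrow> f i = g i) \<Longrightarrow> mat_diag N f = mat_diag N g"
  unfolding mat_diag_def by (intro eq_matI) auto

lemma mat_diag_add: "mat_diag N f + mat_diag N g = mat_diag N (\<lambda>i. f i + g i :: 'a::monoid_add)"
  unfolding mat_diag_def by (intro eq_matI) auto

lemma mat_diag_transpose: "transpose_mat (mat_diag N f) = mat_diag N f"
  unfolding mat_diag_def by (intro eq_matI) auto

lemma mat_diag_zero: "mat_diag N (\<lambda>_. 0) = 0\<^sub>m N N"
  unfolding mat_diag_def by (intro eq_matI) auto

lemma det_mat_diag: "det (mat_diag N f :: 'a::idom mat) = (\<Prod>i<N. f i)"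
proof -
  have "det (mat_diag N f) = prod_list (diag_mat (mat_diag N f))"
    by (rule det_upper_triangular[of _ N]) (auto simp: mat_diag_def)
  also have "\<dots> = (\<Prod>i<N. f i)"
    by (simp add: diag_mat_def mat_diag_def prod.list_conv_set_nth lessThan_atLeast0)
  finally show ?thesis .
qed

lemma blk_carrier [simp]: "blk N a b c d \<in> carrier_mat (2 * N) (2 * N)"
  unfolding blk_def mult_2 by (intro four_block_carrier_mat) auto

lemma blk_cong:
  assumes "\<And>i. i < N \<Longrightarrow> a i = a' i \<and> b i = b' i \<and> c i = c' i \<and> d i = d' i"
  shows "blk N a b c d = blk N a' b' c' d'"
  unfolding blk_def using assms by (auto cong: mat_diag_cong)

lemma blk_mult: "blk N a b c d * blk N a' b' c' d' =
    blk N (\<lambda>i. a i * a' i + b i * c' i) (\<lambda>i. a i * b' i + b i * d' i)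
          (\<lambda>i. c i * a' i + d i * c' i) (\<lambda>i. c i * b' i + d i * d' i)"
  unfolding blk_def by (subst mult_four_block_mat[of _ N N _ N _ N _ _ N _ N]) (auto simp: mat_diag_add)

lemma blk_transpose: "transpose_mat (blk N a b c d) = blk N a c b d"
  unfolding blk_def by (subst transpose_four_block_mat[of _ N N _ N _ N]) (auto simp: mat_diag_transpose)

lemma blk_one: "1\<^sub>m (2 * N) = blk N (\<lambda>_. 1) (\<lambda>_. 0) (\<lambda>_. 0) (\<lambda>_. 1)"
  by (simp add: blk_def mat_diag_zero mult_2)

lemma det_blk: "det (blk N a b c d) = (\<Prod>i<N. a i * d i - b i * c i)"
proof -
  have "mat_diag N a * mat_diag N d - mat_diag N b * mat_diag N c =
      mat_diag N (\<lambda>i. a i * d i - b i * c i)"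
    by (simp, unfold mat_diag_def, intro eq_matI) auto
  thus ?thesis
    unfolding blk_def by (subst det_four_block_mat[of _ N]) (auto simp: mult.commute det_mat_diag)
qed

lemma blk_add_smult: "blk N a b c d + x \<cdot>\<^sub>m blk N a' b' c' d' =
    blk N (\<lambda>i. a i + x * a' i) (\<lambda>i. b i + x * b' i) (\<lambda>i. c i + x * c' i) (\<lambda>i. d i + x * d' i)"
  unfolding blk_def mat_diag_def by (intro eq_matI) auto

lemma blk_SO:
  assumes "\<And>i. i < N \<Longrightarrow> a i ^ 2 + c i ^ 2 = 1 \<and> b i ^ 2 + d i ^ 2 = 1 \<and> a i * b i + c i * d i = 0"
    and "(\<Prod>i<N. a i * d i - b i * c i) = 1"
  shows "blk N a b c d \<in> carrier (SO (2 * N))"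
  unfolding SO_iff blk_transpose blk_mult blk_one det_blk
  using assms by (intro conjI blk_carrier blk_cong) (simp_all add: power2_eq_square mult.commute)

lemma inverse_2x2:
  fixes w :: "'a::field"
  assumes "a * d - b * c = w" "w \<noteq> 0"
  shows "a * (d / w) + b * (- c / w) = 1" "a * (- b / w) + b * (a / w) = 0"
    "c * (d / w) + d * (- c / w) = 0" "c * (- b / w) + d * (a / w) = 1"
proof -
  have "a * (d / w) + b * (- c / w) = (a * d - b * c) / w"
    "c * (- b / w) + d * (a / w) = (a * d - b * c) / w"
    by (simp_all add: diff_divide_distrib mult.commute)
  thus "a * (d / w) + b * (- c / w) = 1" "c * (- b / w) + d * (a / w) = 1"
    unfolding assms(1) using assms(2) by simp_all
qed (simp_all add: mult.commute)

text \<open>In the plane \<open>i\<close> the vectors \<open>(p1 i, p3 i)\<close> and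
  \<open>(p2 i, p4 i)\<close> are independent eigenvectors for \<open>x i\<close> and
  \<open>y i\<close>.\<close>

lemma blk_semisimple:
  assumes p: "\<And>i. i < N \<Longrightarrow> p1 i * p4 i - p2 i * p3 i \<noteq> 0"
    and "\<And>i. i < N \<Longrightarrow> a i * p1 i + b i * p3 i = p1 i * x i \<and> c i * p1 i + d i * p3 i = p3 i * x i"
    and "\<And>i. i < N \<Longrightarrow> a i * p2 i + b i * p4 i = p2 i * y i \<and> c i * p2 i + d i * p4 i = p4 i * y i"
  shows "semisimple_mat (blk N a b c d)"
proof -
  let ?w = "\<lambda>i. p1 i * p4 i - p2 i * p3 i"
  define P where "P = blk N p1 p2 p3 p4"
  define Q where "Q = blk N (\<lambda>i. p4 i / ?w i) (\<lambda>i. - p2 i / ?w i) (\<lambda>i. - p3 i / ?w i) (\<lambda>i. p1 i / ?w i)"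
  define D where "D = blk N x (\<lambda>_. 0) (\<lambda>_. 0) y"
  have c: "P \<in> carrier_mat (2 * N) (2 * N)" "Q \<in> carrier_mat (2 * N) (2 * N)" "D \<in> carrier_mat (2 * N) (2 * N)"
    by (simp_all add: P_def Q_def D_def)
  have PQ: "P * Q = 1\<^sub>m (2 * N)"
    unfolding P_def Q_def blk_mult blk_one
  proof (rule blk_cong)
    fix i assume "i < N"
    note inverse_2x2[OF refl p[OF this]]
    thus "p1 i * (p4 i / ?w i) + p2 i * (- p3 i / ?w i) = 1 \<and>
        p1 i * (- p2 i / ?w i) + p2 i * (p1 i / ?w i) = 0 \<and>
        p3 i * (p4 i / ?w i) + p4 i * (- p3 i / ?w i) = 0 \<and>
        p3 i * (- p2 i / ?w i) + p4 i * (p1 i / ?w i) = 1"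
      by blast
  qed
  have QP: "Q * P = 1\<^sub>m (2 * N)" using PQ c mat_mult_left_right_inverse by blast
  have "blk N a b c d * P = P * D"
    unfolding P_def D_def blk_mult
  proof (rule blk_cong)
    fix i assume "i < N"
    from assms(2,3)[OF this] show "a i * p1 i + b i * p3 i = p1 i * x i + p2 i * 0 \<and>
        a i * p2 i + b i * p4 i = p1 i * 0 + p2 i * y i \<and>
        c i * p1 i + d i * p3 i = p3 i * x i + p4 i * 0 \<and>
        c i * p2 i + d i * p4 i = p3 i * 0 + p4 i * y i" by simp
  qed
  hence "blk N a b c d * (P * Q) = P * D * Q"
    using assoc_mult_mat[OF blk_carrier c(1,2), of a b c d] by simp
  hence "blk N a b c d = P * D * Q"
    using c right_mult_one_mat[OF blk_carrier[of N a b c d]] by (simp add: PQ)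
  from similar_mat_witI[OF PQ QP this blk_carrier c(3,1,2)]
  have "similar_mat (blk N a b c d) D"
    unfolding similar_mat_def by (intro exI)
  moreover have "diagonal_mat D"
    unfolding diagonal_mat_def D_def blk_def mat_diag_def by auto
  ultimately show ?thesis unfolding semisimple_mat_def by blast
qed

section \<open>Orthogonal matrices that commute with a complex structure\<close>

lemma commute_add_smult:
  fixes h :: "'a::comm_ring_1 mat"
  assumes "h \<in> carrier_mat n n" "A \<in> carrier_mat n n" "B \<in> carrier_mat n n"
    and "h * A = A * h" "h * B = B * h"
  shows "h * (A + x \<cdot>\<^sub>m B) = (A + x \<cdot>\<^sub>m B) * h"
  using assms by (simp add: mult_add_distrib_mat[of _ n n _ n] add_mult_distrib_mat[of _ n n _ _ n]
      mult_smult_distrib[of _ n n _ n] mult_smult_assoc_mat[of _ n n _ n])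

text \<open>Such a matrix comes from \<open>GL N\<close>: it is \<open>[[A, B], [- B, A]]\<close>, and orthogonality says that
  \<open>A + \<i> B\<close> and \<open>A - \<i> B\<close> are inverse transposes of each other.\<close>

lemma det_orthogonal_commuting_with_J:
  assumes h: "h \<in> carrier_mat (2 * N) (2 * N)" "transpose_mat h * h = 1\<^sub>m (2 * N)"
    and J: "h * blk N (\<lambda>_. 0) (\<lambda>_. - 1) (\<lambda>_. 1) (\<lambda>_. 0) = blk N (\<lambda>_. 0) (\<lambda>_. - 1) (\<lambda>_. 1) (\<lambda>_. 0) * h"
  shows "det h = 1"
proof -
  have h1: "h $$ (i, N + j) = - h $$ (N + i, j)" "h $$ (N + i, N + j) = h $$ (i, j)"
    if ij: "i < N" "j < N" for i j
  proof -
    let ?J = "blk N (\<lambda>_. 0) (\<lambda>_. - 1) (\<lambda>_. 1) (\<lambda>_. 0)"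
    have J1: "?J $$ (k, l) = (if k < N then (if l = k + N then -1 else 0) else (if k = l + N then 1 else 0))"
      if "k < 2 * N" "l < 2 * N" for k l
      using that by (auto simp: blk_def mat_diag_def)
    have hJ: "(h * ?J) $$ (k, l) = (if l < N then h $$ (k, l + N) else - h $$ (k, l - N))"
      if kl: "k < 2 * N" "l < 2 * N" for k l
    proof (cases "l < N")
      case True
      have "(h * ?J) $$ (k, l) = (\<Sum>r<2 * N. h $$ (k, r) * ?J $$ (r, l))"
        by (rule mult_index_mat) (use h kl in auto)
      also have "\<dots> = (\<Sum>r<2 * N. if r = l + N then h $$ (k, l + N) else 0)"
        using kl True by (intro sum.cong) (auto simp: J1)
      finally show ?thesis using True kl by simp
    next
      case False
      have "(h * ?J) $$ (k, l) = (\<Sum>r<2 * N. h $$ (k, r) * ?J $$ (r, l))"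
        by (rule mult_index_mat) (use h kl in auto)
      also have "\<dots> = (\<Sum>r<2 * N. if r = l - N then - h $$ (k, l - N) else 0)"
        using kl False by (intro sum.cong) (auto simp: J1)
      finally show ?thesis using False kl by simp
    qed
    have Jh: "(?J * h) $$ (k, l) = (if k < N then - h $$ (k + N, l) else h $$ (k - N, l))"
      if kl: "k < 2 * N" "l < 2 * N" for k l
    proof (cases "k < N")
      case True
      have "(?J * h) $$ (k, l) = (\<Sum>r<2 * N. ?J $$ (k, r) * h $$ (r, l))"
        by (rule mult_index_mat) (use h kl in auto)
      also have "\<dots> = (\<Sum>r<2 * N. if r = k + N then - h $$ (k + N, l) else 0)"
        using kl True by (intro sum.cong) (auto simp: J1)
      finally show ?thesis using True kl by simp
    next
      case False
      have "(?J * h) $$ (k, l) = (\<Sum>r<2 * N. ?J $$ (k, r) * h $$ (r, l))"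
        by (rule mult_index_mat) (use h kl in auto)
      also have "\<dots> = (\<Sum>r<2 * N. if r = k - N then h $$ (k - N, l) else 0)"
        using kl False by (intro sum.cong) (auto simp: J1)
      finally show ?thesis using False kl by simp
    qed
    show "h $$ (i, N + j) = - h $$ (N + i, j)"
      using hJ[of i j] Jh[of i j] ij J by (simp add: add.commute)
    show "h $$ (N + i, N + j) = h $$ (i, j)"
      using hJ[of "N + i" j] Jh[of "N + i" j] ij J by (simp add: add.commute)
  qed
  define A where "A = Matrix.mat N N (\<lambda>(i, j). h $$ (i, j))"
  define B where "B = Matrix.mat N N (\<lambda>(i, j). h $$ (i, N + j))"
  have c: "A \<in> carrier_mat N N" "B \<in> carrier_mat N N" by (simp_all add: A_def B_def)
  have hAB: "h = four_block_mat A B (- B) A"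
  proof (rule eq_matI)
    fix k l assume kl: "k < dim_row (four_block_mat A B (- B) A)" "l < dim_col (four_block_mat A B (- B) A)"
    hence kl': "k < N + N" "l < N + N" using c by auto
    show "h $$ (k, l) = four_block_mat A B (- B) A $$ (k, l)"
      using kl' h1[of "k - N" "l - N"] h1[of "k - N" l]
      by (cases "k < N"; cases "l < N") (auto simp: A_def B_def)
  qed (use c h in auto)
  let ?I = "1\<^sub>m N :: complex mat" and ?O = "0\<^sub>m N N :: complex mat"
  \<comment> \<open>These two unipotent factors leave the determinant unchanged and bring
    \<open>h\<close> to block triangular form with \<open>A - \<i> B\<close> and
    \<open>A + \<i> B\<close> on the diagonal.\<close>
  let ?E = "four_block_mat ?I (\<i> \<cdot>\<^sub>m ?I) ?O ?I" and ?F = "four_block_mat ?I (- \<i> \<cdot>\<^sub>m ?I) ?O ?I"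
  let ?P = "A + \<i> \<cdot>\<^sub>m B" and ?M = "A + (- \<i>) \<cdot>\<^sub>m B"
  have 1: "?E * h = four_block_mat ?M (B + \<i> \<cdot>\<^sub>m A) (- B) A"
    unfolding hAB using c by (subst mult_four_block_mat[of _ N N _ N _ N _ _ N _ N])
      (auto intro!: arg_cong2[where f = "\<lambda>x y. four_block_mat x y (- B) A"] eq_matI simp: mult_smult_assoc_mat[of _ N N _ N])
  have 2: "four_block_mat ?M (B + \<i> \<cdot>\<^sub>m A) (- B) A * ?F = four_block_mat ?M ?O (- B) ?P"
  proof -
    have "?M * (- \<i> \<cdot>\<^sub>m ?I) + (B + \<i> \<cdot>\<^sub>m A) * ?I = ?O"
      "- B * (- \<i> \<cdot>\<^sub>m ?I) + A * ?I = ?P"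
      using c by (auto simp: mult_smult_distrib[of _ N N _ N] algebra_simps intro!: eq_matI)
    thus ?thesis using c by (subst mult_four_block_mat[of _ N N _ N _ N _ _ N _ N]) auto
  qed
  have dE: "det ?E = 1" "det ?F = 1" by (subst det_four_block_mat_lower_left_zero[of _ N _ N]; simp)+
  have ec: "?E \<in> carrier_mat (2 * N) (2 * N)" "?F \<in> carrier_mat (2 * N) (2 * N)"
    unfolding mult_2 by (intro four_block_carrier_mat; simp)+
  have "det h = det (?E * h * ?F)"
    using ec h(1) dE by (simp add: det_mult[of _ "2 * N"] mult_carrier_mat[of _ "2 * N" "2 * N" _ "2 * N"])
  also have "\<dots> = det ?M * det ?P"
    unfolding 1 2 using c by (intro det_four_block_mat_upper_right_zero[of _ N _ N]) auto
  finally have dh: "det h = det ?M * det ?P" .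
  let ?T = transpose_mat
  have "?T h * h = four_block_mat (?T A * A + (- ?T B) * (- B)) (?T A * B + (- ?T B) * A)
      (?T B * A + ?T A * (- B)) (?T B * B + ?T A * A)"
  proof -
    have "?T (- B) = - ?T B" using c by (intro eq_matI) auto
    thus ?thesis unfolding hAB using c
      by (subst transpose_four_block_mat[of _ N N _ N _ N], auto)
        (subst mult_four_block_mat[of _ N N _ N _ N _ _ N _ N], auto)
  qed
  hence eq: "four_block_mat (?T A * A + (- ?T B) * (- B)) (?T A * B + (- ?T B) * A)
      (?T B * A + ?T A * (- B)) (?T B * B + ?T A * A) = four_block_mat ?I ?O ?O ?I"
    using h(2) by (simp add: mult_2)
  have ul: "(?T B * B + ?T A * A) $$ (i, j) = ?I $$ (i, j)" and
    ur: "(?T B * A + ?T A * (- B)) $$ (i, j) = 0" if "i < N" "j < N" for i j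
    using arg_cong[OF eq, of "\<lambda>m. m $$ (N + i, N + j)"] arg_cong[OF eq, of "\<lambda>m. m $$ (N + i, j)"] that c
    by (simp_all del: index_mult_mat(1) index_add_mat(1) uminus_mult_right_mat)
  have "?T ?P * ?M = ?I"
  proof (rule eq_matI)
    fix i j assume "i < dim_row ?I" "j < dim_col ?I"
    hence ij: "i < N" "j < N" by auto
    have tc: "?T A \<in> carrier_mat N N" "?T B \<in> carrier_mat N N" using c by auto
    have e: "(?T C * D) $$ (i, j) = (\<Sum>l<N. C $$ (l, i) * D $$ (l, j))"
      if "C \<in> carrier_mat N N" "D \<in> carrier_mat N N" for C D :: "complex mat"
      using that ij mult_index_mat[of "?T C" N N D N i j] by auto
    have "(?T ?P * ?M) $$ (i, j) = (\<Sum>l<N. (A $$ (l, i) + \<i> * B $$ (l, i)) * (A $$ (l, j) - \<i> * B $$ (l, j)))"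
      using c ij by (subst e) (auto intro!: sum.cong)
    also have "\<dots> = (\<Sum>l<N. B $$ (l, i) * B $$ (l, j) + A $$ (l, i) * A $$ (l, j)
        + \<i> * (B $$ (l, i) * A $$ (l, j) - A $$ (l, i) * B $$ (l, j)))"
      by (rule sum.cong) (auto simp: algebra_simps)
    also have "\<dots> = (?T B * B + ?T A * A) $$ (i, j) + \<i> * (?T B * A + ?T A * (- B)) $$ (i, j)"
    proof -
      have "(?T B * B + ?T A * A) $$ (i, j) = (?T B * B) $$ (i, j) + (?T A * A) $$ (i, j)"
        "(?T B * A + ?T A * (- B)) $$ (i, j) = (?T B * A) $$ (i, j) - (?T A * B) $$ (i, j)"
        using c ij by (auto simp del: index_mult_mat(1))
      thus ?thesis using c by (simp add: e sum.distrib sum_subtractf sum_distrib_left[symmetric])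
    qed
    also have "\<dots> = ?I $$ (i, j)" using ul[OF ij] ur[OF ij] by simp
    finally show "(?T ?P * ?M) $$ (i, j) = ?I $$ (i, j)" .
  qed (use c in auto)
  hence "det (?T ?P * ?M) = 1" by simp
  moreover have "det (?T ?P * ?M) = det (?T ?P) * det ?M"
    by (rule det_mult[of _ N]) (use c in auto)
  moreover have "det (?T ?P) = det ?P"
    by (rule det_transpose[of _ N]) (use c in auto)
  ultimately show ?thesis using dh by (simp add: mult.commute)
qed

text \<open>Cosine and sine of the complex angle \<open>t\<close> with
  \<open>x = exp (\<i> * t)\<close>: the rotation
  \<open>[[rcos x, - rsin x], [rsin x, rcos x]]\<close> has the eigenvalues \<open>x\<close> and
  \<open>inverse x\<close>.\<close>

definition rcos :: "complex \<Rightarrow> complex" where "rcos x = (x + inverse x) / 2"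
definition rsin :: "complex \<Rightarrow> complex" where "rsin x = (x - inverse x) / (2 * \<i>)"

lemma rcos_inverse: "rcos (inverse x) = rcos x" and rsin_inverse: "rsin (inverse x) = - rsin x"
  by (simp_all add: rcos_def rsin_def add.commute divide_simps algebra_simps)

lemma rcos_plus_rsin: "rcos x + \<i> * rsin x = x" and rcos_minus_rsin: "rcos x - \<i> * rsin x = inverse x"
  by (simp_all add: rcos_def rsin_def field_simps)

lemma rcos_rsin_square:
  assumes "x \<noteq> 0"
  shows "rcos x * rcos x + rsin x * rsin x = 1"
proof -
  have "rcos x * rcos x + rsin x * rsin x = (rcos x + \<i> * rsin x) * (rcos x - \<i> * rsin x)"
    by (simp add: algebra_simps)
  thus ?thesis using assms by (simp only: rcos_plus_rsin rcos_minus_rsin) simp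
qed

lemma rcos_mult: "rcos (x * y) = rcos x * rcos y - rsin x * rsin y"
  and rsin_mult: "rsin (x * y) = rsin x * rcos y + rcos x * rsin y"
proof -
  have x: "x = rcos x + \<i> * rsin x" "inverse x = rcos x - \<i> * rsin x" for x
    by (simp_all add: rcos_plus_rsin rcos_minus_rsin)
  have 1: "x * y = (rcos x + \<i> * rsin x) * (rcos y + \<i> * rsin y)"
    using x by metis
  have 2: "inverse (x * y) = (rcos x - \<i> * rsin x) * (rcos y - \<i> * rsin y)"
    using x by (metis inverse_mult_distrib)
  have "2 * rcos (x * y) = x * y + inverse (x * y)" by (simp add: rcos_def)
  also have "\<dots> = 2 * (rcos x * rcos y - rsin x * rsin y)"
    by (subst 1, subst 2) (simp add: algebra_simps)
  finally show "rcos (x * y) = rcos x * rcos y - rsin x * rsin y"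
    by (metis mult_cancel_left zero_neq_numeral)
  have "2 * \<i> * rsin (x * y) = x * y - inverse (x * y)" by (simp add: rsin_def)
  also have "\<dots> = 2 * \<i> * (rsin x * rcos y + rcos x * rsin y)"
    by (subst 1, subst 2) (simp add: algebra_simps)
  finally show "rsin (x * y) = rsin x * rcos y + rcos x * rsin y"
    by (metis mult_cancel_left mult_eq_0_iff complex_i_not_zero zero_neq_numeral)
qed

lemma rcos_1 [simp]: "rcos 1 = 1" and rsin_1 [simp]: "rsin 1 = 0"
  by (simp_all add: rcos_def rsin_def)

lemma rcos_i [simp]: "rcos \<i> = 0" and rsin_i [simp]: "rsin \<i> = 1"
  by (simp_all add: rcos_def rsin_def)

lemma rsin_i_power_even: "even k \<Longrightarrow> rsin (\<i> ^ k) = 0"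
proof (elim evenE)
  fix j assume "k = 2 * j"
  hence "inverse (\<i> ^ k) = \<i> ^ k" by (simp add: power_mult power_inverse[symmetric])
  thus "rsin (\<i> ^ k) = 0" by (simp add: rsin_def)
qed

section \<open>The matrices of the two parameters\<close>

definition pm :: "nat \<Rightarrow> complex" where "pm k = (if even k then 1 else -1)"

lemma pm_square [simp]: "pm k * pm k = 1" and pm_add: "pm (k + l) = pm k * pm l"
  by (auto simp: pm_def)

text \<open>The image of an element of the Weil group on which the unramified character of order 4 takes
  the value \<open>\<i> ^ k\<close> and the tame character the value \<open>e\<close>. A pair \<open>(i, N + i)\<close> of coordinates
  spans a plane; for \<open>i < 2\<close> it carries the dihedral representation, where odd \<open>k\<close> act by
  reflections, and for the other \<open>i\<close> a rotation by \<open>k\<close> right angles. The sign \<open>s\<close> reverses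
  the rotation in the plane \<open>i = 2\<close>.\<close>

definition param_mat :: "complex \<Rightarrow> nat \<Rightarrow> nat \<Rightarrow> complex \<Rightarrow> complex mat" where
  "param_mat s N k e = blk N
     (\<lambda>i. if i < 2 then rcos e else rcos (\<i> ^ k))
     (\<lambda>i. if i < 2 then - pm k * rsin e else - (if i = 2 then s else 1) * rsin (\<i> ^ k))
     (\<lambda>i. if i < 2 then rsin e else (if i = 2 then s else 1) * rsin (\<i> ^ k))
     (\<lambda>i. if i < 2 then pm k * rcos e else rcos (\<i> ^ k))"

lemma prod_first_two:
  fixes N :: nat
  assumes "N \<ge> 2" "\<And>i. i < N \<Longrightarrow> f i = (if i < 2 then x else (1::'a::comm_monoid_mult))"
  shows "(\<Prod>i<N. f i) = x * x"
proof -
  have "(\<Prod>i<N. f i) = (\<Prod>i\<in>{..<2::nat}. x)"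
    by (rule prod.mono_neutral_cong_right) (use assms in auto)
  thus ?thesis by (simp add: numeral_2_eq_2)
qed

lemma param_mat_SO:
  assumes N: "N \<ge> 2" and s: "s * s = 1" and e: "e \<noteq> 0"
  shows "param_mat s N k e \<in> carrier (SO (2 * N))"
  unfolding param_mat_def
proof (rule blk_SO)
  have e1: "rcos e * rcos e + rsin e * rsin e = 1" and
    k1: "rcos (\<i> ^ k) * rcos (\<i> ^ k) + rsin (\<i> ^ k) * rsin (\<i> ^ k) = 1"
    using e by (intro rcos_rsin_square; simp)+
  define t where "t i = (if i = 2 then s else 1)" for i :: nat
  have t: "t i * t i = 1" for i using s by (simp add: t_def)
  have sq: "(x * y) * (x * y) = (x * x) * (y * y)" for x y :: complex by (simp add: algebra_simps)
  have n: "pm k * x * (pm k * x) = x * x" "t i * x * (t i * x) = x * x" for i x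
    unfolding sq[of "pm k"] sq[of "t i"] t pm_square by simp_all
  fix i :: nat
  show "(if i < 2 then rcos e else rcos (\<i> ^ k))\<^sup>2 +
      (if i < 2 then rsin e else (if i = 2 then s else 1) * rsin (\<i> ^ k))\<^sup>2 = 1 \<and>
      (if i < 2 then - pm k * rsin e else - (if i = 2 then s else 1) * rsin (\<i> ^ k))\<^sup>2 +
      (if i < 2 then pm k * rcos e else rcos (\<i> ^ k))\<^sup>2 = 1 \<and>
      (if i < 2 then rcos e else rcos (\<i> ^ k)) *
      (if i < 2 then - pm k * rsin e else - (if i = 2 then s else 1) * rsin (\<i> ^ k)) +
      (if i < 2 then rsin e else (if i = 2 then s else 1) * rsin (\<i> ^ k)) *
      (if i < 2 then pm k * rcos e else rcos (\<i> ^ k)) = 0"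
    unfolding t_def[symmetric] using e1 k1
    by (cases "i < 2") (simp_all add: power2_eq_square add.commute n)
next
  have e1: "rcos e * rcos e + rsin e * rsin e = 1" and
    k1: "rcos (\<i> ^ k) * rcos (\<i> ^ k) + rsin (\<i> ^ k) * rsin (\<i> ^ k) = 1"
    using e by (intro rcos_rsin_square; simp)+
  define t where "t i = (if i = 2 then s else 1)" for i :: nat
  have t: "t i * x * (t i * x) = x * x" for i x
    using s by (simp add: t_def algebra_simps)
  have "(\<Prod>i<N. (if i < 2 then rcos e else rcos (\<i> ^ k)) * (if i < 2 then pm k * rcos e else rcos (\<i> ^ k)) -
      (if i < 2 then - pm k * rsin e else - t i * rsin (\<i> ^ k)) *
      (if i < 2 then rsin e else t i * rsin (\<i> ^ k))) = pm k * pm k"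
  proof (rule prod_first_two[OF N])
    fix i :: nat
    have "rcos e * (pm k * rcos e) + pm k * rsin e * rsin e = pm k * (rcos e * rcos e + rsin e * rsin e)"
      by (simp add: algebra_simps)
    thus "(if i < 2 then rcos e else rcos (\<i> ^ k)) * (if i < 2 then pm k * rcos e else rcos (\<i> ^ k)) -
      (if i < 2 then - pm k * rsin e else - t i * rsin (\<i> ^ k)) *
      (if i < 2 then rsin e else t i * rsin (\<i> ^ k)) = (if i < 2 then pm k else 1)"
      using e1 k1 by (cases "i < 2") (simp_all add: t)
  qed
  thus "(\<Prod>i<N. (if i < 2 then rcos e else rcos (\<i> ^ k)) * (if i < 2 then pm k * rcos e else rcos (\<i> ^ k)) -
      (if i < 2 then - pm k * rsin e else - (if i = 2 then s else 1) * rsin (\<i> ^ k)) *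
      (if i < 2 then rsin e else (if i = 2 then s else 1) * rsin (\<i> ^ k))) = 1"
    unfolding t_def[symmetric] by simp
qed

text \<open>A reflection carries a rotation to its inverse, hence the case distinction. It is the
  one in \<open>tame_char_comp\<close>, which makes the parameters multiplicative.\<close>

lemma param_mat_mult:
  assumes s: "s * s = 1"
  shows "param_mat s N k e * param_mat s N l e' =
    param_mat s N (k + l) (e * (if even k then e' else inverse e'))"
proof -
  define t where "t i = (if i = 2 then s else 1)" for i :: nat
  have t: "t i * (t i * x) = x" for i x using s by (simp add: t_def mult.assoc[symmetric])
  have pp: "pm k * (pm k * x) = x" for k x by (simp add: mult.assoc[symmetric])
  define u where "u = (if even k then e' else inverse e')"
  have u: "rcos u = rcos e'" "rsin u = pm k * rsin e'"
    by (auto simp: u_def pm_def rcos_inverse rsin_inverse)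
  show ?thesis
    unfolding param_mat_def blk_mult t_def[symmetric] u_def[symmetric]
    by (rule blk_cong) (auto simp: power_add rcos_mult rsin_mult u pm_add t pp algebra_simps)
qed

lemma param_mat_one: "param_mat s N 0 1 = 1\<^sub>m (2 * N)"
  unfolding param_mat_def blk_one by (rule blk_cong) (auto simp: pm_def)

lemma param_mat_mod4: "param_mat s N (k mod 4) e = param_mat s N k e"
proof -
  have "\<i> ^ k = \<i> ^ (4 * (k div 4) + k mod 4)" by simp
  also have "\<dots> = \<i> ^ (k mod 4)" unfolding power_add power_mult by simp
  finally have "\<i> ^ (k mod 4) = \<i> ^ k" by simp
  moreover have "even (k mod 4) = even k" by presburger
  hence "pm (k mod 4) = pm k" by (simp only: pm_def)
  ultimately show ?thesis by (simp only: param_mat_def)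
qed

lemma param_mat_carrier: "param_mat s N k e \<in> carrier_mat (2 * N) (2 * N)"
  by (simp add: param_mat_def)

text \<open>In the dihedral planes an odd \<open>k\<close> gives reflections, whose square is 1, and
  an even \<open>k\<close> gives rotations.\<close>

lemma param_mat_square:
  assumes s: "s * s = 1" and e: "e \<noteq> 0"
  shows "param_mat s N k e ^\<^sub>m (2 * n) = param_mat s N (2 * k * n) ((if even k then e\<^sup>2 else 1) ^ n)"
proof (induction n)
  case 0
  have "dim_row (param_mat s N k e) = 2 * N" using param_mat_carrier[of s N k e] by simp
  thus ?case by (simp add: param_mat_one)
next
  case (Suc n)
  have "param_mat s N k e ^\<^sub>m (2 * Suc n) =
      param_mat s N k e ^\<^sub>m (2 * n) * param_mat s N k e * param_mat s N k e" by simp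
  also have "\<dots> = param_mat s N (2 * k * n + k + k) ((if even k then e\<^sup>2 else 1) ^ n * e *
      (if even (2 * k * n + k) then e else inverse e))"
    unfolding Suc.IH by (simp add: param_mat_mult[OF s])
  also have "2 * k * n + k + k = 2 * k * Suc n" by simp
  also have "(if even k then e\<^sup>2 else 1) ^ n * e * (if even (2 * k * n + k) then e else inverse e) =
      (if even k then e\<^sup>2 else 1) ^ Suc n"
    using e by (simp add: power2_eq_square mult.assoc)
  finally show ?case .
qed

text \<open>The factor \<open>n\<close> kills the tame part and the factor 4 the quarter
  turns.\<close>

lemma param_mat_finite_order:
  assumes s: "s * s = 1" and e: "e ^ n = 1" "n > 0"
  shows "param_mat s N k e ^\<^sub>m (2 * (2 * n)) = 1\<^sub>m (2 * N)"
proof -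
  have e0: "e \<noteq> 0" using e by (auto simp: power_0_left)
  have "e\<^sup>2 ^ (2 * n) = (e ^ n) ^ 4" by (simp only: power_mult[symmetric]) (simp add: mult.commute)
  hence "(if even k then e\<^sup>2 else 1) ^ (2 * n) = (1::complex)"
    using e(1) by simp
  moreover have "2 * k * (2 * n) = 4 * (k * n)" by simp
  hence "(2 * k * (2 * n)) mod 4 = 0" by (simp only: mod_mult_self1_is_0)
  ultimately show ?thesis
    using param_mat_square[OF s e0, of N k "2 * n"] param_mat_mod4[of s N "2 * k * (2 * n)" 1]
    by (simp add: param_mat_one)
qed

text \<open>Rotations have the eigenvectors \<open>(1, - \<i>)\<close> and \<open>(1, \<i>)\<close>,
  where the sign \<open>t i\<close> exchanges the two in a plane of reversed sense. The reflections
  in the dihedral planes have an axis and a line orthogonal to it.\<close>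

lemma param_mat_semisimple:
  assumes s: "s * s = 1" and e: "e \<noteq> 0"
  shows "semisimple_mat (param_mat s N k e)"
proof -
  define t where "t i = (if i = 2 then s else 1)" for i :: nat
  have t: "t i * t i = 1" for i using s by (simp add: t_def)
  have rot: "rcos x * 1 + - y * rsin x * (- \<i> * y) = 1 * x \<and> y * rsin x * 1 + rcos x * (- \<i> * y) = (- \<i> * y) * x
      \<and> rcos x * 1 + - y * rsin x * (\<i> * y) = 1 * inverse x \<and>
        y * rsin x * 1 + rcos x * (\<i> * y) = (\<i> * y) * inverse x"
    if "y * y = 1" for x y :: complex
  proof -
    have z: "y * (y * z) = z" for z using that by (simp add: mult.assoc[symmetric])
    have "- \<i> * y * (rcos x + \<i> * rsin x) = y * rsin x * 1 + rcos x * (- \<i> * y)"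
      "\<i> * y * (rcos x - \<i> * rsin x) = y * rsin x * 1 + rcos x * (\<i> * y)"
      "rcos x * 1 + - y * rsin x * (- \<i> * y) = rcos x + \<i> * (y * (y * rsin x))"
      "rcos x * 1 + - y * rsin x * (\<i> * y) = rcos x - \<i> * (y * (y * rsin x))"
      by (simp_all add: algebra_simps)
    thus ?thesis unfolding z rcos_plus_rsin rcos_minus_rsin by simp
  qed
  show ?thesis
  proof (cases "even k")
    case True
    show ?thesis unfolding param_mat_def t_def[symmetric]
    proof (rule blk_semisimple[where ?p1.0 = "\<lambda>_. 1" and ?p2.0 = "\<lambda>_. 1"
          and ?p3.0 = "\<lambda>i. - \<i> * (if i < 2 then 1 else t i)" and ?p4.0 = "\<lambda>i. \<i> * (if i < 2 then 1 else t i)"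
          and x = "\<lambda>i. if i < 2 then e else \<i> ^ k" and y = "\<lambda>i. inverse (if i < 2 then e else \<i> ^ k)"])
      fix i :: nat
      have "t i \<noteq> 0" using t[of i] by auto
      thus "1 * (\<i> * (if i < 2 then 1 else t i)) - 1 * (- \<i> * (if i < 2 then 1 else t i)) \<noteq> 0" by simp
    qed (use True rot[of 1 e] rot[OF t] in \<open>auto simp: pm_def\<close>)
  next
    case False
    \<comment> \<open>Half the angle of \<open>e\<close>: the reflection
      \<open>[[rcos e, rsin e], [rsin e, - rcos e]]\<close> has the axis
      \<open>(rcos b, rsin b)\<close>.\<close>
    define b where "b = csqrt e"
    have b: "e = b * b" "b \<noteq> 0" using e by (auto simp: b_def power2_eq_square[symmetric])
    have b1: "rcos b * rcos b + rsin b * rsin b = 1" using b(2) by (rule rcos_rsin_square)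
    hence b2: "rcos b * rcos b = 1 - rsin b * rsin b" by (simp add: eq_diff_eq)
    have refl1: "rcos e * rcos b + rsin e * rsin b = rcos b" "rsin e * rcos b - rcos e * rsin b = rsin b"
    proof -
      have "rcos e * rcos b + rsin e * rsin b = rcos (e * inverse b)"
        "rsin e * rcos b - rcos e * rsin b = rsin (e * inverse b)"
        by (simp_all add: rcos_mult rsin_mult rcos_inverse rsin_inverse)
      thus "rcos e * rcos b + rsin e * rsin b = rcos b" "rsin e * rcos b - rcos e * rsin b = rsin b"
        using b by (simp_all add: mult.assoc)
    qed
    show ?thesis unfolding param_mat_def t_def[symmetric]
    proof (rule blk_semisimple[where ?p1.0 = "\<lambda>i. if i < 2 then rcos b else 1"
          and ?p2.0 = "\<lambda>i. if i < 2 then - rsin b else 1"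
          and ?p3.0 = "\<lambda>i. if i < 2 then rsin b else - \<i> * t i"
          and ?p4.0 = "\<lambda>i. if i < 2 then rcos b else \<i> * t i"
          and x = "\<lambda>i. if i < 2 then 1 else \<i> ^ k" and y = "\<lambda>i. if i < 2 then -1 else inverse (\<i> ^ k)"])
      fix i :: nat
      have "t i \<noteq> 0" using t[of i] by auto
      thus "(if i < 2 then rcos b else 1) * (if i < 2 then rcos b else \<i> * t i) -
         (if i < 2 then - rsin b else 1) * (if i < 2 then rsin b else - \<i> * t i) \<noteq> 0"
        using b1 by (cases "i < 2") simp_all
    next
      fix i :: nat
      show "(if i < 2 then rcos e else rcos (\<i> ^ k)) * (if i < 2 then rcos b else 1) +
         (if i < 2 then - pm k * rsin e else - t i * rsin (\<i> ^ k)) * (if i < 2 then rsin b else - \<i> * t i) =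
         (if i < 2 then rcos b else 1) * (if i < 2 then 1 else \<i> ^ k) \<and>
         (if i < 2 then rsin e else t i * rsin (\<i> ^ k)) * (if i < 2 then rcos b else 1) +
         (if i < 2 then pm k * rcos e else rcos (\<i> ^ k)) * (if i < 2 then rsin b else - \<i> * t i) =
         (if i < 2 then rsin b else - \<i> * t i) * (if i < 2 then 1 else \<i> ^ k)"
        using rot[OF t, of "\<i> ^ k" i] refl1 False by (cases "i < 2") (simp_all add: pm_def)
      show "(if i < 2 then rcos e else rcos (\<i> ^ k)) * (if i < 2 then - rsin b else 1) +
         (if i < 2 then - pm k * rsin e else - t i * rsin (\<i> ^ k)) * (if i < 2 then rcos b else \<i> * t i) =
         (if i < 2 then - rsin b else 1) * (if i < 2 then - 1 else inverse (\<i> ^ k)) \<and>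
         (if i < 2 then rsin e else t i * rsin (\<i> ^ k)) * (if i < 2 then - rsin b else 1) +
         (if i < 2 then pm k * rcos e else rcos (\<i> ^ k)) * (if i < 2 then rcos b else \<i> * t i) =
         (if i < 2 then rcos b else \<i> * t i) * (if i < 2 then - 1 else inverse (\<i> ^ k))"
      proof (cases "i < 2")
        case True
        have "- (rcos e * rsin b) + rsin e * rcos b = rsin b" "- (rsin e * rsin b) - rcos e * rcos b = - rcos b"
          using refl1 by (simp_all add: algebra_simps)
        thus ?thesis using True False by (simp add: pm_def)
      qed (use rot[OF t, of "\<i> ^ k" i] in simp)
    qed
  qed
qed

section \<open>The reflection, conjugacy of single values and its failure for the whole
  image\<close>

definition reflect :: "nat \<Rightarrow> complex mat" where
  "reflect N = blk N (\<lambda>_. 1) (\<lambda>_. 0) (\<lambda>_. 0) (\<lambda>i. if i = 2 then -1 else 1)"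

lemma reflect_carrier: "reflect N \<in> carrier_mat (2 * N) (2 * N)"
  by (simp add: reflect_def)

lemma reflect_square: "reflect N * reflect N = 1\<^sub>m (2 * N)"
  unfolding reflect_def blk_mult blk_one by (rule blk_cong) simp

lemma reflect_transpose: "transpose_mat (reflect N) = reflect N"
  by (simp add: reflect_def blk_transpose)

lemma det_reflect:
  assumes "N \<ge> 3"
  shows "det (reflect N) = -1"
proof -
  have "det (reflect N) = (\<Prod>i<N. if i = 2 then -1 else 1)"
    unfolding reflect_def det_blk by (rule prod.cong) auto
  thus ?thesis using assms by simp
qed

lemma reflect_param_mat: "reflect N * param_mat 1 N k e * reflect N = param_mat (-1) N k e"
  unfolding reflect_def param_mat_def blk_mult by (rule blk_cong) auto

lemma reflect_conj_SO:
  assumes "N \<ge> 3" and g: "g \<in> carrier (SO (2 * N))"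
  shows "reflect N * g * reflect N \<in> carrier (SO (2 * N))"
proof -
  let ?n = "2 * N"
  note c = reflect_carrier[of N] SO_carrier_mat[OF g]
  have "reflect N * (reflect N * Z) = Z" if "Z \<in> carrier_mat ?n ?n" for Z
    using assoc_mult_mat[OF c(1) c(1) that] that by (simp add: reflect_square)
  moreover have "transpose_mat g * (g * Z) = Z" if "Z \<in> carrier_mat ?n ?n" for Z
  proof -
    have t: "transpose_mat g \<in> carrier_mat ?n ?n" "transpose_mat g * g = 1\<^sub>m ?n"
      using g by (auto simp: SO_iff)
    show ?thesis using assoc_mult_mat[OF t(1) c(2) that] that by (simp add: t(2))
  qed
  ultimately have "transpose_mat (reflect N * g * reflect N) * (reflect N * g * reflect N) = 1\<^sub>m ?n"
    using c by (simp add: transpose_mult[of _ ?n ?n _ ?n] mult_carrier_mat[of _ ?n ?n _ ?n]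
        assoc_mult_mat[of _ ?n ?n _ ?n _ ?n] reflect_transpose reflect_square)
  moreover have "det (reflect N * g * reflect N) = 1"
    using c g assms(1) by (simp add: det_mult[of _ ?n] mult_carrier_mat[of _ ?n ?n _ ?n] det_reflect SO_iff)
  ultimately show ?thesis using c by (auto simp: SO_iff)
qed

text \<open>For odd \<open>k\<close> the reflection by which the matrix acts in the plane \<open>i = 0\<close> commutes with it
  and corrects the determinant of \<^const>\<open>reflect\<close>.\<close>

lemma param_mat_elementwise_conjugate:
  assumes N: "N \<ge> 3" and e: "e \<noteq> 0"
  obtains g where "g \<in> carrier (SO (2 * N))" "g * param_mat 1 N k e = param_mat (-1) N k e * g"
proof (cases "even k")
  case True
  \<comment> \<open>An even number of quarter turns is 1 or -1, for which the sense of rotation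
    makes no difference.\<close>
  have "param_mat 1 N k e = param_mat (-1) N k e"
    unfolding param_mat_def by (rule blk_cong) (simp add: rsin_i_power_even[OF True])
  thus ?thesis
    using that[OF SO_one] left_mult_one_mat[OF param_mat_carrier[of 1 N k e]]
      right_mult_one_mat[OF param_mat_carrier[of 1 N k e]] by simp
next
  case False
  have e1: "rcos e * rcos e + rsin e * rsin e = 1" using e by (rule rcos_rsin_square)
  define g where "g = blk N (\<lambda>i. if i = 0 then rcos e else 1) (\<lambda>i. if i = 0 then rsin e else 0)
    (\<lambda>i. if i = 0 then rsin e else 0) (\<lambda>i. if i = 0 then - rcos e else if i = 2 then -1 else 1)"
  have "g \<in> carrier (SO (2 * N))"
    unfolding g_def
  proof (rule blk_SO)
    fix i :: nat
    show "(if i = 0 then rcos e else 1)\<^sup>2 + (if i = 0 then rsin e else 0)\<^sup>2 = 1 \<and>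
        (if i = 0 then rsin e else 0)\<^sup>2 + (if i = 0 then - rcos e else if i = 2 then -1 else 1)\<^sup>2 = 1 \<and>
        (if i = 0 then rcos e else 1) * (if i = 0 then rsin e else 0) +
        (if i = 0 then rsin e else 0) * (if i = 0 then - rcos e else if i = 2 then -1 else 1) = 0"
      using e1 by (simp add: power2_eq_square add.commute)
  next
    have r: "- (rcos e * rcos e) - rsin e * rsin e = - 1"
      using e1 by (metis minus_add_distrib diff_conv_add_uminus)
    have "(\<Prod>i<N. (if i = 0 then rcos e else 1) * (if i = 0 then - rcos e else if i = 2 then -1 else 1) -
        (if i = 0 then rsin e else 0) * (if i = 0 then rsin e else 0)) =
        (\<Prod>i<N. (if i = 0 then -1 else 1) * (if i = 2 then -1 else 1))"
      using r by (intro prod.cong) auto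
    thus "(\<Prod>i<N. (if i = 0 then rcos e else 1) * (if i = 0 then - rcos e else if i = 2 then -1 else 1) -
        (if i = 0 then rsin e else 0) * (if i = 0 then rsin e else 0)) = 1"
      using N by (simp add: prod.distrib)
  qed
  moreover have "g * param_mat 1 N k e = param_mat (-1) N k e * g"
    unfolding g_def param_mat_def blk_mult using False by (intro blk_cong) (simp add: pm_def)
  ultimately show ?thesis by (rule that)
qed

text \<open>\<open>h = reflect N * g\<close> has determinant -1 and commutes with two values of the
  first parameter, hence, as these are orthogonal, also with their transposes. A complex structure
  is a linear combination of the four, which forces \<open>det h = 1\<close>.\<close>

lemma param_mat_not_conjugate:
  assumes N: "N \<ge> 3" and g: "g \<in> carrier (SO (2 * N))"
    and e1: "e1 \<noteq> 0" "e1\<^sup>2 \<noteq> 1" and e2: "e2 \<noteq> 0"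
    and conj: "g * param_mat 1 N 0 e1 = param_mat (-1) N 0 e1 * g"
      "g * param_mat 1 N 1 e2 = param_mat (-1) N 1 e2 * g"
  shows False
proof -
  let ?n = "2 * N"
  define h where "h = reflect N * g"
  have gc: "g \<in> carrier_mat ?n ?n" using SO_carrier_mat[OF g] .
  have hc: "h \<in> carrier_mat ?n ?n"
    unfolding h_def using reflect_carrier gc by (rule mult_carrier_mat)
  have "transpose_mat h * h = transpose_mat g * ((reflect N * reflect N) * g)"
    unfolding h_def using reflect_carrier[of N] gc
    by (simp add: transpose_mult[of _ ?n ?n _ ?n] mult_carrier_mat[of _ ?n ?n _ ?n]
        assoc_mult_mat[of _ ?n ?n _ ?n _ ?n] reflect_transpose)
  also have "\<dots> = 1\<^sub>m ?n" using g gc by (simp add: reflect_square SO_iff)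
  finally have orth: "transpose_mat h * h = 1\<^sub>m ?n" .
  have deth: "det h = -1"
    unfolding h_def using det_mult[OF reflect_carrier gc] g N by (simp add: det_reflect SO_iff)
  have comm: "h * param_mat 1 N k e = param_mat 1 N k e * h"
    if "g * param_mat 1 N k e = param_mat (-1) N k e * g" for k e
  proof -
    let ?c = "reflect N" and ?M = "param_mat 1 N k e"
    note cs = reflect_carrier[of N] gc param_mat_carrier[of 1 N k e]
    have "h * ?M = ?c * (g * ?M)"
      unfolding h_def by (rule assoc_mult_mat[OF cs])
    also have "\<dots> = ?c * (?c * ?M * ?c * g)" by (simp only: that reflect_param_mat)
    also have "\<dots> = (?c * ?c) * (?M * (?c * g))"
      using cs by (simp add: mult_carrier_mat[of _ ?n ?n _ ?n] assoc_mult_mat[of _ ?n ?n _ ?n _ ?n])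
    also have "\<dots> = ?M * h"
      unfolding h_def reflect_square using cs
      by (intro left_mult_one_mat[of _ ?n ?n]) (simp add: mult_carrier_mat[of _ ?n ?n _ ?n])
    finally show ?thesis .
  qed
  have comm': "h * transpose_mat (param_mat 1 N k e) = transpose_mat (param_mat 1 N k e) * h"
    if "g * param_mat 1 N k e = param_mat (-1) N k e * g" and e: "e \<noteq> 0" for k e
  proof -
    let ?M = "param_mat 1 N k e" and ?T = "transpose_mat (param_mat 1 N k e)"
    have M: "?M \<in> carrier (SO ?n)" using N e by (intro param_mat_SO) auto
    have cs: "?M \<in> carrier_mat ?n ?n" "?T \<in> carrier_mat ?n ?n"
      using SO_carrier_mat[OF M] by auto
    have "h * ?T = (?T * ?M) * (h * ?T)"
      using M hc cs by (simp add: SO_iff)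
    also have "\<dots> = ?T * ((?M * h) * ?T)"
      using hc cs by (simp add: mult_carrier_mat[of _ ?n ?n _ ?n] assoc_mult_mat[of _ ?n ?n _ ?n _ ?n])
    also have "\<dots> = ?T * ((h * ?M) * ?T)" using comm[OF that(1)] by simp
    also have "\<dots> = (?T * h) * (?M * ?T)"
      using hc cs by (simp add: mult_carrier_mat[of _ ?n ?n _ ?n] assoc_mult_mat[of _ ?n ?n _ ?n _ ?n])
    also have "\<dots> = ?T * h"
      using SO_mult_transpose[OF M] hc cs by (simp add: mult_carrier_mat[of _ ?n ?n _ ?n])
    finally show ?thesis .
  qed
  have "e1 \<noteq> inverse e1"
  proof
    assume "e1 = inverse e1"
    hence "e1 * e1 = e1 * inverse e1" by simp
    thus False using e1 by (simp add: power2_eq_square)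
  qed
  hence r: "rsin e1 \<noteq> 0" by (simp add: rsin_def)
  let ?t = "param_mat 1 N 0 e1" and ?s = "param_mat 1 N 1 e2"
  \<comment> \<open>In \<open>?t\<close> only the dihedral planes are rotated, so \<open>?t\<close>
    minus its transpose is \<open>2 * rsin e1\<close> times the complex structure there and 0
    elsewhere. In \<open>?s\<close> the dihedral planes carry symmetric reflections and the others
    quarter turns, so \<open>?s\<close> minus its transpose is twice the complex structure in the
    remaining planes.\<close>
  let ?a = "1 / (2 * rsin e1)" and ?b = "1 / 2 :: complex"
  let ?z = "blk N (\<lambda>_. 0) (\<lambda>_. 0) (\<lambda>_. 0) (\<lambda>_. 0)"
  have z0: "?z = 0\<^sub>m ?n ?n" unfolding blk_def mat_diag_def by (intro eq_matI) auto
  have z: "h * ?z = ?z * h" unfolding z0 using hc by simp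
  have "?z + ?a \<cdot>\<^sub>m ?t + (- ?a) \<cdot>\<^sub>m transpose_mat ?t + ?b \<cdot>\<^sub>m ?s + (- ?b) \<cdot>\<^sub>m transpose_mat ?s =
      blk N (\<lambda>_. 0) (\<lambda>_. - 1) (\<lambda>_. 1) (\<lambda>_. 0)"
    unfolding param_mat_def blk_transpose blk_add_smult
    using r by (intro blk_cong) (auto simp: pm_def)
  moreover have "h * (?z + ?a \<cdot>\<^sub>m ?t + (- ?a) \<cdot>\<^sub>m transpose_mat ?t + ?b \<cdot>\<^sub>m ?s + (- ?b) \<cdot>\<^sub>m transpose_mat ?s) =
      (?z + ?a \<cdot>\<^sub>m ?t + (- ?a) \<cdot>\<^sub>m transpose_mat ?t + ?b \<cdot>\<^sub>m ?s + (- ?b) \<cdot>\<^sub>m transpose_mat ?s) * h"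
    by (intro commute_add_smult[OF hc] comm comm' conj z e1(1) e2)
      (simp_all add: param_mat_carrier z0)
  ultimately have "det h = 1" using det_orthogonal_commuting_with_J[OF hc orth] by simp
  thus False using deth by simp
qed

text \<open>A finite group that contains the image of the first parameter. As a group of matrices it
  lets the second parameter appear as the map
  \<open>g \<mapsto> reflect N * g * reflect N\<close>.\<close>

definition param_group :: "nat \<Rightarrow> nat \<Rightarrow> complex mat monoid" where
  "param_group N n = \<lparr> carrier = (\<lambda>(k, e). param_mat 1 N k e) ` ({..<4} \<times> {e. e ^ n = 1}),
     mult = (*), one = 1\<^sub>m (2 * N) \<rparr>"

lemma param_mat_in_group: "e ^ n = 1 \<Longrightarrow> param_mat 1 N k e \<in> carrier (param_group N n)"
  unfolding param_group_def using param_mat_mod4[of 1 N k e]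
  by (auto intro!: image_eqI[where x = "(k mod 4, e)"])

lemma param_group_group:
  assumes "n > 0"
  shows "group (param_group N n)"
proof (rule groupI)
  have ex: "\<exists>k e. x = param_mat 1 N k e \<and> e ^ n = 1" if "x \<in> carrier (param_group N n)" for x
    using that by (auto simp: param_group_def)
  have s: "mult (param_group N n) = (*)" "one (param_group N n) = 1\<^sub>m (2 * N)"
    by (simp_all add: param_group_def)
  show "\<one>\<^bsub>param_group N n\<^esub> \<in> carrier (param_group N n)"
    using param_mat_in_group[of 1 n N 0] by (simp add: s param_mat_one)
  fix x assume x: "x \<in> carrier (param_group N n)"
  obtain k e where ke: "x = param_mat 1 N k e" "e ^ n = 1" using ex[OF x] by blast
  have e0: "e \<noteq> 0" using ke(2) assms by (auto simp: power_0_left)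
  show "\<one>\<^bsub>param_group N n\<^esub> \<otimes>\<^bsub>param_group N n\<^esub> x = x"
    using left_mult_one_mat[OF param_mat_carrier[of 1 N k e]] by (simp add: s ke(1))
  show "\<exists>y\<in>carrier (param_group N n). y \<otimes>\<^bsub>param_group N n\<^esub> x = \<one>\<^bsub>param_group N n\<^esub>"
  proof
    let ?u = "if even k then inverse e else e"
    show "param_mat 1 N (3 * k) ?u \<in> carrier (param_group N n)"
      using ke(2) by (intro param_mat_in_group) (simp add: power_inverse)
    have "param_mat 1 N (3 * k) ?u * param_mat 1 N k e = param_mat 1 N (4 * k) 1"
      using e0 by (simp add: param_mat_mult)
    also have "\<dots> = 1\<^sub>m (2 * N)" using param_mat_mod4[of 1 N "4 * k" 1] by (simp add: param_mat_one)
    finally show "param_mat 1 N (3 * k) ?u \<otimes>\<^bsub>param_group N n\<^esub> x = \<one>\<^bsub>param_group N n\<^esub>"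
      by (simp add: s ke(1))
  qed
  fix y assume y: "y \<in> carrier (param_group N n)"
  obtain l e' where le: "y = param_mat 1 N l e'" "e' ^ n = 1" using ex[OF y] by blast
  show "x \<otimes>\<^bsub>param_group N n\<^esub> y \<in> carrier (param_group N n)"
    unfolding s ke(1) le(1) param_mat_mult[OF mult_1]
    by (rule param_mat_in_group) (simp add: power_mult_distrib ke(2) le(2) power_inverse)
  fix z assume z: "z \<in> carrier (param_group N n)"
  obtain j e'' where je: "z = param_mat 1 N j e''" using ex[OF z] by blast
  show "x \<otimes>\<^bsub>param_group N n\<^esub> y \<otimes>\<^bsub>param_group N n\<^esub> z = x \<otimes>\<^bsub>param_group N n\<^esub> (y \<otimes>\<^bsub>param_group N n\<^esub> z)"
    unfolding s ke(1) le(1) je by (rule assoc_mult_mat[OF param_mat_carrier param_mat_carrier param_mat_carrier])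
qed

lemma algebraic_rep_mult:
  assumes "algebraic_rep_SO n m \<rho>"
  shows "g \<in> carrier (SO n) \<Longrightarrow> \<rho> g \<in> carrier_mat m m"
    "g \<in> carrier (SO n) \<Longrightarrow> h \<in> carrier (SO n) \<Longrightarrow> \<rho> (g * h) = \<rho> g * \<rho> h"
  using assms by (auto simp: algebraic_rep_SO_def hom_def GL_def)

lemma invertible_mat_iff_det:
  fixes A :: "'a::field mat"
  assumes A: "A \<in> carrier_mat m m"
  shows "invertible_mat A \<longleftrightarrow> det A \<noteq> 0"
proof
  assume "invertible_mat A"
  then obtain B where B: "A * B = 1\<^sub>m m" "B * A = 1\<^sub>m (dim_row B)"
    using A by (auto simp: invertible_mat_def inverts_mat_def)
  have "dim_col (A * B) = m" "dim_col (B * A) = dim_row B" by (simp_all only: B) auto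
  hence "B \<in> carrier_mat m m" using A by auto
  from det_mult[OF A this] have "det A * det B = 1" using B(1) by simp
  thus "det A \<noteq> 0" by auto
next
  assume "det A \<noteq> 0"
  then obtain B where "B \<in> carrier_mat m m" "A * B = 1\<^sub>m m" "B * A = 1\<^sub>m m"
    using det_nonzero_inverse[OF A] by blast
  thus "invertible_mat A"
    using A unfolding invertible_mat_def inverts_mat_def by (auto intro!: exI[of _ B])
qed

lemma algebraic_rep_one:
  assumes r: "algebraic_rep_SO n m \<rho>"
  shows "\<rho> (1\<^sub>m n) = 1\<^sub>m m"
proof -
  have c: "\<rho> (1\<^sub>m n) \<in> carrier_mat m m" "invertible_mat (\<rho> (1\<^sub>m n))"
    using r SO_one[of n] by (auto simp: algebraic_rep_SO_def hom_def GL_def Pi_def)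
  have "det (\<rho> (1\<^sub>m n)) \<noteq> 0"
    using c invertible_mat_iff_det by blast
  from det_nonzero_inverse[OF c(1) this] obtain B
    where B: "B \<in> carrier_mat m m" "\<rho> (1\<^sub>m n) * B = 1\<^sub>m m" .
  have "\<rho> (1\<^sub>m n) = \<rho> (1\<^sub>m n) * \<rho> (1\<^sub>m n)"
    using algebraic_rep_mult(2)[OF r SO_one SO_one] by simp
  hence "\<rho> (1\<^sub>m n) * B = \<rho> (1\<^sub>m n) * (\<rho> (1\<^sub>m n) * B)"
    using assoc_mult_mat[OF c(1) c(1) B(1)] by metis
  thus ?thesis unfolding B(2) using right_mult_one_mat[OF c(1)] by metis
qed

text \<open>\<open>reflect N\<close> has determinant -1 and lies outside the domain of the
  representation \<open>\<rho>\<close>, so its image cannot serve as \<open>P\<close>. For each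
  single \<open>g\<close>, however, some element of \<open>SO\<close> also conjugates
  \<open>g\<close> to \<open>reflect N * g * reflect N\<close>; this gives equal traces, and
  \<open>P\<close> comes from the characters.\<close>

lemma param_mat_locally_conjugate:
  assumes N: "N \<ge> 3" and n: "n > 0" and \<rho>: "algebraic_rep_SO (2 * N) m \<rho>"
  shows "\<exists>P\<in>carrier (GL m). \<forall>k e. e ^ n = 1 \<longrightarrow>
    P * \<rho> (param_mat 1 N k e) = \<rho> (param_mat (-1) N k e) * P"
proof -
  let ?G = "param_group N n" and ?c = "reflect N" and ?n = "2 * N"
  let ?r = "\<lambda>g. \<rho> (?c * g * ?c)"
  note rep = algebraic_rep_mult[OF \<rho>]
  have fin: "finite (carrier ?G)"
    unfolding param_group_def using n by (auto intro!: finite_imageI finite_cartesian_product finite_roots_unity)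
  have nz: "e \<noteq> 0" if "e ^ n = 1" for e :: complex using that n by (auto simp: power_0_left)
  have GSO: "g \<in> carrier (SO ?n)" if "g \<in> carrier ?G" for g
    using that N nz by (auto simp: param_group_def intro!: param_mat_SO)
  have conj1: "?c * (g * h) * ?c = (?c * g * ?c) * (?c * h * ?c)"
    if "g \<in> carrier_mat ?n ?n" "h \<in> carrier_mat ?n ?n" for g h
  proof -
    note cs = reflect_carrier[of N] that
    have "(?c * g * ?c) * (?c * h * ?c) = ?c * (g * ((?c * ?c) * (h * ?c)))"
      using cs by (simp add: mult_carrier_mat[of _ ?n ?n _ ?n] assoc_mult_mat[of _ ?n ?n _ ?n _ ?n])
    also have "\<dots> = ?c * (g * (h * ?c))"
      unfolding reflect_square using cs by (simp add: mult_carrier_mat[of _ ?n ?n _ ?n])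
    finally show ?thesis
      using cs by (simp add: mult_carrier_mat[of _ ?n ?n _ ?n] assoc_mult_mat[of _ ?n ?n _ ?n _ ?n])
  qed
  have "matrix_rep ?G m \<rho>"
    using GSO rep algebraic_rep_one[OF \<rho>] by (auto simp: matrix_rep_def param_group_def)
  moreover have "matrix_rep ?G m ?r"
    unfolding matrix_rep_def
  proof (intro conjI ballI)
    show "?r g \<in> carrier_mat m m" if "g \<in> carrier ?G" for g
      using rep(1)[OF reflect_conj_SO[OF N GSO[OF that]]] .
    show "?r (g \<otimes>\<^bsub>?G\<^esub> h) = ?r g * ?r h" if "g \<in> carrier ?G" "h \<in> carrier ?G" for g h
    proof -
      have "g \<otimes>\<^bsub>?G\<^esub> h = g * h" by (simp add: param_group_def)
      thus ?thesis
        using conj1[OF SO_carrier_mat[OF GSO[OF that(1)]] SO_carrier_mat[OF GSO[OF that(2)]]]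
          rep(2)[OF reflect_conj_SO[OF N GSO[OF that(1)]] reflect_conj_SO[OF N GSO[OF that(2)]]] by simp
    qed
    show "?r \<one>\<^bsub>?G\<^esub> = 1\<^sub>m m"
      using reflect_carrier[of N] algebraic_rep_one[OF \<rho>]
      by (simp add: param_group_def reflect_square)
  qed
  moreover have "mat_trace (\<rho> g) = mat_trace (?r g)" if g: "g \<in> carrier ?G" for g
  proof -
    obtain k e where ke: "g = param_mat 1 N k e" "e ^ n = 1"
      using g by (auto simp: param_group_def)
    obtain x where x: "x \<in> carrier (SO ?n)" "x * g = param_mat (-1) N k e * x"
      using param_mat_elementwise_conjugate[OF N nz[OF ke(2)]] ke(1) by metis
    have M: "param_mat (-1) N k e \<in> carrier (SO ?n)"
      using N nz[OF ke(2)] by (intro param_mat_SO) auto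
    note xt = SO_transpose[OF x(1)]
    have "\<rho> x * \<rho> g * \<rho> (transpose_mat x) = \<rho> (x * g) * \<rho> (transpose_mat x)"
      using rep(2)[OF x(1) GSO[OF g]] by simp
    also have "\<dots> = \<rho> (param_mat (-1) N k e) * (\<rho> x * \<rho> (transpose_mat x))"
      unfolding x(2) rep(2)[OF M x(1)] by (rule assoc_mult_mat[OF rep(1)[OF M] rep(1)[OF x(1)] rep(1)[OF xt]])
    also have "\<rho> x * \<rho> (transpose_mat x) = 1\<^sub>m m"
      using rep(2)[OF x(1) xt] SO_mult_transpose[OF x(1)] algebraic_rep_one[OF \<rho>] by simp
    also have "\<rho> (param_mat (-1) N k e) * 1\<^sub>m m = ?r g"
      using right_mult_one_mat[OF rep(1)[OF M]] by (simp add: ke(1) reflect_param_mat)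
    finally have "\<rho> x * \<rho> g * \<rho> (transpose_mat x) = ?r g" .
    moreover have "\<rho> (transpose_mat x) * \<rho> x = 1\<^sub>m m"
      using rep(2)[OF xt x(1)] x(1) algebraic_rep_one[OF \<rho>] by (simp add: SO_iff)
    ultimately show ?thesis
      using mat_trace_conj[OF rep(1)[OF GSO[OF g]] rep(1)[OF x(1)] rep(1)[OF xt]] by metis
  qed
  ultimately obtain P where P: "P \<in> carrier_mat m m" "det P \<noteq> 0" "\<forall>g\<in>carrier ?G. P * \<rho> g = ?r g * P"
    using equal_characters_imp_equivalent[OF param_group_group[OF n] fin, of m \<rho> ?r] by blast
  have "P \<in> carrier (GL m)"
    using P(1,2) by (simp add: GL_def invertible_mat_iff_det)
  moreover have "P * \<rho> (param_mat 1 N k e) = \<rho> (param_mat (-1) N k e) * P" if "e ^ n = 1" for k e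
    using P(3) param_mat_in_group[OF that, of N k] by (simp add: reflect_param_mat)
  ultimately show ?thesis by blast
qed

lemma conjugate_morphismsD:
  assumes "conjugate_morphisms v n \<phi> \<phi>'"
  obtains g where "g \<in> carrier (SO n)"
    "\<And>w. w \<in> carrier (weil_deligne_group v) \<Longrightarrow> \<phi> w \<in> carrier_mat n n \<Longrightarrow> g * \<phi> w = \<phi>' w * g"
proof -
  obtain g where g: "g \<in> carrier (SO n)"
    "\<And>w. w \<in> carrier (weil_deligne_group v) \<Longrightarrow> \<phi>' w = g * \<phi> w * transpose_mat g"
    using assms by (auto simp: conjugate_morphisms_def SO_inv)
  have "g * \<phi> w = \<phi>' w * g" if w: "w \<in> carrier (weil_deligne_group v)" and c: "\<phi> w \<in> carrier_mat n n" for w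
  proof -
    have t: "g \<in> carrier_mat n n" "transpose_mat g \<in> carrier_mat n n" "transpose_mat g * g = 1\<^sub>m n"
      using g(1) by (auto simp: SO_iff)
    have "\<phi>' w * g = g * \<phi> w * (transpose_mat g * g)"
      unfolding g(2)[OF w] by (rule assoc_mult_mat[OF mult_carrier_mat[OF t(1) c] t(2) t(1)])
    thus ?thesis unfolding t(3) using right_mult_one_mat[OF mult_carrier_mat[OF t(1) c]] by simp
  qed
  with g(1) show ?thesis by (rule that)
qed

section \<open>The parameters on the Weil-Deligne group\<close>

context local_field_char_0
begin

definition param :: "complex \<Rightarrow> nat \<Rightarrow> 'a wd \<Rightarrow> complex mat" where
  "param s N = (\<lambda>(\<sigma>, g). param_mat s N (deg4 \<sigma>) (tame_char \<sigma>))"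

lemma tame_char_nonzero: "\<sigma> \<in> carrier (weil_group v) \<Longrightarrow> tame_char \<sigma> \<noteq> 0"
  using tame_char_pow[OF weil_group_galois] by (metis power_0_left add_is_0 zero_neq_one)

lemma param_generic:
  assumes N: "N \<ge> 3" and s: "s * s = 1"
  shows "generic_morphism v (2 * N) (param s N)"
  unfolding param_def
\<comment> \<open>\<open>deg4\<close> and \<open>tame_char\<close> depend only on the images of
  \<open>zeta\<close> and \<open>yy\<close>; the order is \<open>n = q + 1\<close> in
  \<open>param_mat_finite_order\<close>.\<close>
proof (rule generic_of_finite_order[where S = "{zeta, yy}" and r = "2 * (2 * (q + 1))"])
  fix \<sigma> assume \<sigma>: "\<sigma> \<in> carrier (weil_group v)"
  note nz = tame_char_nonzero[OF \<sigma>]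
  show "param_mat s N (deg4 \<sigma>) (tame_char \<sigma>) \<in> carrier (SO (2 * N))"
    using N s nz by (intro param_mat_SO) auto
  show "semisimple_mat (param_mat s N (deg4 \<sigma>) (tame_char \<sigma>))"
    by (rule param_mat_semisimple[OF s nz])
  show "param_mat s N (deg4 (\<sigma> \<circ> \<tau>)) (tame_char (\<sigma> \<circ> \<tau>)) = param_mat s N (deg4 \<sigma>) (tame_char \<sigma>)"
    if "\<forall>x\<in>{zeta, yy}. \<tau> x = x" for \<tau>
    using that by (simp add: deg4_local tame_char_local)
  show "param_mat s N (deg4 (\<sigma> \<circ> \<tau>)) (tame_char (\<sigma> \<circ> \<tau>)) =
      param_mat s N (deg4 \<sigma>) (tame_char \<sigma>) * param_mat s N (deg4 \<tau>) (tame_char \<tau>)"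
    if "\<tau> \<in> carrier (weil_group v)" for \<tau>
    using deg4_comp[OF \<sigma> that] tame_char_comp[OF \<sigma> that]
    by (simp only: param_mat_mult[OF s] param_mat_mod4)
next
  show "param_mat s N (deg4 id) (tame_char id) = 1\<^sub>m (2 * N)"
    by (simp add: deg4_id tame_char_id param_mat_one)
  show "param_mat s N (deg4 (geometric_frobenius v)) (tame_char (geometric_frobenius v)) ^\<^sub>m (2 * (2 * (q + 1)))
      = 1\<^sub>m (2 * N)"
    using tame_char_pow[OF geometric_frobenius(1)] by (intro param_mat_finite_order[OF s]) auto
qed auto

lemma param_locally_conjugate:
  assumes N: "N \<ge> 3"
  shows "locally_conjugate v (2 * N) (param 1 N) (param (-1) N)"
  unfolding locally_conjugate_def
proof (intro allI impI)
  fix m \<rho> assume \<rho>: "algebraic_rep_SO (2 * N) m \<rho>"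
  obtain P where P: "P \<in> carrier (GL m)" "\<And>k e. e ^ (q + 1) = 1 \<Longrightarrow>
      P * \<rho> (param_mat 1 N k e) = \<rho> (param_mat (-1) N k e) * P"
    using param_mat_locally_conjugate[OF N _ \<rho>, of "q + 1"] by auto
  have "P * \<rho> (param 1 N w) = \<rho> (param (-1) N w) * P" if "w \<in> carrier (weil_deligne_group v)" for w
    using that P(2)[OF tame_char_pow[OF weil_group_galois]]
    by (auto simp: param_def weil_deligne_group_def DirProd_def)
  with P(1) show "\<exists>P\<in>carrier (GL m). \<forall>w\<in>carrier (weil_deligne_group v).
      P * \<rho> (param 1 N w) = \<rho> (param (-1) N w) * P" by blast
qed

text \<open>An inertia element of degree 0 with a tame value of square different from 1 and an
  element of degree 1 supply the two matrices that build the complex structure.\<close>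

lemma param_not_conjugate:
  assumes N: "N \<ge> 3"
  shows "\<not> conjugate_morphisms v (2 * N) (param 1 N) (param (-1) N)"
proof
  assume "conjugate_morphisms v (2 * N) (param 1 N) (param (-1) N)"
  then obtain g where g: "g \<in> carrier (SO (2 * N))"
    "\<And>w. w \<in> carrier (weil_deligne_group v) \<Longrightarrow> param 1 N w \<in> carrier_mat (2 * N) (2 * N) \<Longrightarrow>
      g * param 1 N w = param (-1) N w * g"
    by (rule conjugate_morphismsD) blast
  have gw: "g * param_mat 1 N (deg4 \<sigma>) (tame_char \<sigma>) = param_mat (-1) N (deg4 \<sigma>) (tame_char \<sigma>) * g"
    if "\<sigma> \<in> carrier (weil_group v)" for \<sigma>
    using g(2)[of "(\<sigma>, 1\<^sub>m 2)"] that
    by (simp add: param_def weil_deligne_group_def DirProd_def SL_def param_mat_carrier)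
  obtain \<tau> where \<tau>: "\<tau> \<in> inertia_group v" "deg4 \<tau> = 0" "tame_char \<tau> ^ 2 \<noteq> 1"
    by (rule exists_inertia_tame_char)
  obtain \<sigma> where \<sigma>: "\<sigma> \<in> carrier (weil_group v)" "deg4 \<sigma> = 1"
    by (rule exists_weil_deg_1)
  have "\<tau> \<in> carrier (weil_group v)" using \<tau>(1) by (rule inertia_in_weil)
  from param_mat_not_conjugate[OF N g(1) tame_char_nonzero[OF this] \<tau>(3) tame_char_nonzero[OF \<sigma>(1)]
      gw[OF this, unfolded \<tau>(2)] gw[OF \<sigma>(1), unfolded \<sigma>(2)]]
  show False .
qed

end

theorem corollary3p18:
  fixes v :: "'a::field_char_0 \<Rightarrow> real" and N :: nat
  assumes "nonarch_local_field v" and "odd (residue_char v)" and "N \<ge> 3"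
  shows "generically_WD_unacceptable v (2 * N) \<and>
    (\<exists>\<phi>1 \<phi>2. generic_morphism v (2 * N) \<phi>1 \<and> generic_morphism v (2 * N) \<phi>2 \<and>
       locally_conjugate v (2 * N) \<phi>1 \<phi>2 \<and> \<not> conjugate_morphisms v (2 * N) \<phi>1 \<phi>2)"
proof -
  interpret local_field_char_0 v using assms(1) by (simp add: local_field_char_0_def)
  have "generic_morphism v (2 * N) (param 1 N)" "generic_morphism v (2 * N) (param (-1) N)"
    using assms(3) by (simp_all add: param_generic)
  moreover note param_locally_conjugate[OF assms(3)] param_not_conjugate[OF assms(3)]
  ultimately show ?thesis unfolding generically_WD_acceptable_def by blast
qed

end
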